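(* Let $1<p<\infty$, $c<1$ and $m\in\mathbb{R}$ with $c-1<\frac{m+1}p<2$. Then $$D(B^d_{m,p})=\Big\{u\in D(B_{m,p,max}):\ y^{-2\theta}u\in L^p_m\ \text{for every } 0\le\theta\le1\ \text{such that } c-1+2\theta<\frac{m+1}p<2\Big\}.$$ Moreover: (i) $(1\wedge y)^{2-2\theta}D_{yy}u,\ (1\wedge y)^{1-2\theta}D_yu\in L^p_m$ for every $u\in D(B^d_{m,p})$ and every $0\le\theta\le1$ such that $c-1+2\theta<\frac{m+1}p<2$; (ii) $D_yu\in L^1(0,1)$ and $\lim_{y\to0}u(y)=0$ for every $u\in D(B^d_{m,p})$.
   Context: All spaces are on $\mathbb{R}_+=(0,\infty)$: $L^p_m=L^p((0,\infty);y^m\,dy)$; $L^1(0,1)$ is with respect to Lebesgue measure; $a\wedge b=\min\{a,b\}$. $B=D_{yy}+\frac cyD_y$ and $D(B_{m,p,max})=\{u\in L^p_m\cap W^{2,p}_{loc}(\mathbb{R}_+):Bu\in L^p_m\}$. $B^d_{m,p}$ is the generator of the bounded analytic semigroup $(e^{zB^d})_{\mathrm{Re}\,z>0}$ on $L^p_m$ given by $e^{zB^d}f(y)=\int_0^\infty p_{B^d}(z,y,\rho)f(\rho)\,d\rho$ with $$p_{B^d}(z,y,\rho)=\frac1{2z}\rho^c(y\rho)^{\frac{1-c}2}\exp\Big\{-\frac{y^2+\rho^2}{4z}\Big\}I_{\frac{1-c}2}\Big(\frac{y\rho}{2z}\Big),$$ $I_\nu$ being the modified Bessel function of the first kind. 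*)

theory Defs
  imports "HOL-Analysis.Analysis"
begin

text \<open>
  Functions on the half-line are represented by total functions \<open>real \<Rightarrow> complex\<close>, of which only the
  restriction to \<open>{0<..}\<close> matters. Function spaces are sets of such functions, with Borel measurable
  functions as representatives of the classes modulo null sets.
\<close>

definition meas_m :: "real \<Rightarrow> real measure" where
  "meas_m m = density (restrict_space lborel {0<..}) (\<lambda>y. ennreal (y powr m))"

definition Lpm :: "real \<Rightarrow> real \<Rightarrow> (real \<Rightarrow> complex) set" where
  "Lpm m p = {f \<in> borel_measurable (meas_m m). integrable (meas_m m) (\<lambda>y. norm (f y) powr p)}"

definition Lpm_norm :: "real \<Rightarrow> real \<Rightarrow> (real \<Rightarrow> complex) \<Rightarrow> real" where
  "Lpm_norm m p f = (LINT y|meas_m m. norm (f y) powr p) powr (1 / p)"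

definition Lp_loc :: "real \<Rightarrow> (real \<Rightarrow> complex) set" where
  "Lp_loc p = {f. set_borel_measurable lborel {0<..} f \<and>
     (\<forall>K. compact K \<and> K \<subseteq> {0<..} \<longrightarrow> set_integrable lborel K (\<lambda>y. norm (f y) powr p))}"

definition test_fun :: "(real \<Rightarrow> real) \<Rightarrow> bool" where
  "test_fun \<phi> \<longleftrightarrow> (\<forall>k x. ((deriv ^^ k) \<phi>) differentiable (at x)) \<and>
     (\<exists>K. compact K \<and> K \<subseteq> {0<..} \<and> (\<forall>x. x \<notin> K \<longrightarrow> \<phi> x = 0))"

definition has_weak_deriv :: "nat \<Rightarrow> (real \<Rightarrow> complex) \<Rightarrow> (real \<Rightarrow> complex) \<Rightarrow> bool" where
  "has_weak_deriv k u v \<longleftrightarrow> u \<in> Lp_loc 1 \<and> v \<in> Lp_loc 1 \<and>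
     (\<forall>\<phi>. test_fun \<phi> \<longrightarrow>
        (LINT y:{0<..}|lborel. (deriv ^^ k) \<phi> y *\<^sub>R u y) =
        (-1) ^ k * (LINT y:{0<..}|lborel. \<phi> y *\<^sub>R v y))"

text \<open>
  Weak derivatives are unique up to null sets only; \<open>weak_D\<close> selects a representative. It is used
  only for functions in \<open>W2p_loc\<close>, where the derivatives in question exist.
\<close>

definition weak_D :: "nat \<Rightarrow> (real \<Rightarrow> complex) \<Rightarrow> real \<Rightarrow> complex" where
  "weak_D k u = (SOME v. has_weak_deriv k u v)"

definition W2p_loc :: "real \<Rightarrow> (real \<Rightarrow> complex) set" where
  "W2p_loc p = {u \<in> Lp_loc p. \<forall>k\<in>{1, 2}. \<exists>v\<in>Lp_loc p. has_weak_deriv k u v}"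

definition opB :: "real \<Rightarrow> (real \<Rightarrow> complex) \<Rightarrow> real \<Rightarrow> complex" where
  "opB c u = (\<lambda>y. weak_D 2 u y + of_real (c / y) * weak_D 1 u y)"

definition dom_B_max :: "real \<Rightarrow> real \<Rightarrow> real \<Rightarrow> (real \<Rightarrow> complex) set" where
  "dom_B_max c m p = {u \<in> Lpm m p \<inter> W2p_loc p. opB c u \<in> Lpm m p}"

definition Bessel_I :: "real \<Rightarrow> complex \<Rightarrow> complex" where
  "Bessel_I \<nu> z = (z / 2) powr of_real \<nu> *
     (\<Sum>k. (z / 2) ^ (2 * k) * of_real (rGamma (\<nu> + real k + 1)) / fact k)"

definition heat_kernel :: "real \<Rightarrow> complex \<Rightarrow> real \<Rightarrow> real \<Rightarrow> complex" where
  "heat_kernel c z y \<rho> =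
     1 / (2 * z) * of_real (\<rho> powr c * (y * \<rho>) powr ((1 - c) / 2))
     * exp (- (of_real (y\<^sup>2 + \<rho>\<^sup>2) / (4 * z)))
     * Bessel_I ((1 - c) / 2) (of_real (y * \<rho>) / (2 * z))"

definition semigroup_Bd :: "real \<Rightarrow> complex \<Rightarrow> (real \<Rightarrow> complex) \<Rightarrow> real \<Rightarrow> complex" where
  "semigroup_Bd c z f = (\<lambda>y. LINT \<rho>:{0<..}|lborel. heat_kernel c z y \<rho> * f \<rho>)"

text \<open>
  Domain of the generator of a semigroup on \<open>Lpm m p\<close>: those \<open>u\<close> for which the difference quotients
  \<open>(T t u - u) / t\<close> converge in norm as \<open>t \<rightarrow> 0+\<close>. As \<open>Lpm_norm\<close> is meaningful on \<open>Lpm m p\<close> only, membership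
  has to be required along with convergence.
\<close>

definition generator_dom ::
    "real \<Rightarrow> real \<Rightarrow> (complex \<Rightarrow> (real \<Rightarrow> complex) \<Rightarrow> real \<Rightarrow> complex) \<Rightarrow> (real \<Rightarrow> complex) set" where
  "generator_dom m p T = {u \<in> Lpm m p. \<exists>v\<in>Lpm m p.
     (\<forall>\<^sub>F t in at_right (0::real). T (of_real t) u \<in> Lpm m p) \<and>
     ((\<lambda>t. Lpm_norm m p (\<lambda>y. (T (of_real t) u y - u y) / of_real t - v y)) \<longlongrightarrow> 0)
       (at_right (0::real))}"

definition dom_Bd :: "real \<Rightarrow> real \<Rightarrow> real \<Rightarrow> (real \<Rightarrow> complex) set" where
  "dom_Bd c m p = generator_dom m p (semigroup_Bd c)"

text \<open>The limit at \<open>0\<close> of a class modulo null sets is that of its continuous representative.\<close>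

definition limit_at_0 :: "(real \<Rightarrow> complex) \<Rightarrow> complex \<Rightarrow> bool" where
  "limit_at_0 u l \<longleftrightarrow> (\<exists>v. continuous_on {0<..} v \<and> (AE y in lborel. 0 < y \<longrightarrow> u y = v y) \<and>
     (v \<longlongrightarrow> l) (at_right 0))"

end

theory Submission
 imports Defs "HOL-Real_Asymp.Real_Asymp"
begin

text \<open>
 Let \<open>\<nu> = (1 - c) / 2 > 0\<close> and let \<open>T t\<close> be the semigroup at a real time \<open>t\<close>, with kernel \<open>k\<close>. The moments of \<open>k\<close> in the
 second variable are explicit series and satisfy \<open>\<integral> k t y r * r powr a dr \<le> C * y powr a\<close> for \<open>-2 < a \<le> 2 * \<nu>\<close>, uniformly
 in \<open>t\<close>. Since \<open>k\<close> is symmetric with respect to \<open>y powr c dy\<close>, Schur's test bounds \<open>T t\<close> on the weighted space, and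
 concentration of \<open>k\<close> at \<open>y\<close> yields strong continuity.

 The maximal domain consists of the solutions of \<open>(y powr c * U')' = y powr c * f\<close> with \<open>U\<close> and \<open>f\<close> in the space. Hardy's
 inequalities show that \<open>U'\<close> is integrable near \<open>0\<close>, that \<open>U\<close> has a limit there, and that the weighted estimates hold for
 \<open>U'\<close>, \<open>U''\<close> and, if the limit is \<open>0\<close>, for \<open>U\<close>. As there are exponents \<open>\<theta>\<close> with \<open>(m + 1) / p < 2 * \<theta>\<close>, the weighted
 condition in the theorem says just that the limit is \<open>0\<close>, and this condition also describes the domain of the generator:

 If the limit is \<open>0\<close>, Green's identity against the kernel gives \<open>T t U - T s U = \<integral>\<^sub>s\<^sup>t T \<tau> f d\<tau>\<close>, so that the difference
 quotients of \<open>U\<close> converge to \<open>f\<close>. Conversely, let \<open>u\<close> be mapped to \<open>v\<close> by the generator and let \<open>U\<close> solve the equation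
 for \<open>v\<close> with limit \<open>0\<close>. For \<open>\<eta>\<close> of compact support with \<open>\<integral> r * \<eta> r dr = 0\<close> the equation \<open>B \<psi> = \<eta>\<close> has a solution that
 vanishes at infinity and equals a multiple of \<open>r powr (1 - c)\<close> near \<open>0\<close>; pairing with \<open>\<psi>\<close> shows that \<open>u - U\<close> is
 orthogonal to every such \<open>\<eta>\<close>, hence a multiple of \<open>y powr (1 - c)\<close>, which has limit \<open>0\<close> as well.
\<close>

section \<open>Bessel functions and the kernel\<close>

text \<open>The derivatives of the kernel are controlled only for times bounded away from 0, so
  Green's identity is first integrated over \<open>[s, t]\<close> with \<open>0 < s\<close>, and
  \<open>s\<close> is removed afterwards by strong continuity. The limit of \<open>U\<close> matters
  in the boundary term at 0, where the flux of the kernel is merely bounded. The condition on \<eta>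
  comes from the homogeneous solutions 1 and \<open>r powr (1 - c)\<close>: with respect to the
  measure \<open>r powr c dr\<close>, the integral of \<open>r * \<eta> r\<close> is the pairing of
  \<eta> with the second one. A solution \<psi> that vanishes beyond the support of \<eta> equals
  \<open>A + k * r powr (1 - c)\<close> near 0, and \<open>A\<close> is a multiple of that integral.
  The condition therefore says that \<psi> has limit 0, and only multiples of
  \<open>r powr (1 - c)\<close> are orthogonal to every such \<eta>. The function \<psi> belongs to
  the dual space, whose exponent and weight satisfy the hypotheses with the same \<nu>; the
  inclusion already proved for the generator then applies to \<psi> there. The solution
  \<open>U\<close> is not known to lie in the space before it is compared with \<open>u\<close>,
  hence the compact supports.\<close>

text \<open>\<open>I\<^sub>\<nu> (2 * z) = z powr \<nu> * bessel_F \<nu> (z\<^sup>2)\<close>; unlike \<open>I\<^sub>\<nu>\<close>, the function \<open>bessel_F \<nu>\<close> is entire.\<close>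

definition bessel_coeff :: "real \<Rightarrow> nat \<Rightarrow> real" where
 "bessel_coeff \<nu> n = rGamma (\<nu> + real n + 1) / fact n"

definition bessel_F :: "real \<Rightarrow> real \<Rightarrow> real" where
 "bessel_F \<nu> z = (\<Sum>n. bessel_coeff \<nu> n * z ^ n)"

lemma rGamma_pos: "0 < x \<Longrightarrow> 0 < rGamma (x::real)"
 by (simp add: rGamma_inverse_Gamma)

lemma bessel_coeff_pos: "0 \<le> \<nu> \<Longrightarrow> 0 < bessel_coeff \<nu> n"
 by (auto simp: bessel_coeff_def intro!: divide_pos_pos rGamma_pos)

text \<open>Each application of the functional equation divides by \<nu> + n + 1, which is at least
  n + 1; together these factors exceed the factorial.\<close>

lemma rGamma_add_le:
 assumes "0 \<le> \<nu>"
 shows "rGamma (\<nu> + real n + 1) \<le> rGamma (\<nu> + 1) / fact n"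
proof (induction n)
 case (Suc n)
 have eq: "(\<nu> + real n + 1) * rGamma (\<nu> + real n + 1 + 1) = rGamma (\<nu> + real n + 1)"
  by (rule rGamma_plus1)
 have pos: "0 < rGamma (\<nu> + real n + 1 + 1)"
  using assms by (intro rGamma_pos) auto
 have "(real n + 1) * rGamma (\<nu> + real n + 1 + 1) \<le> (\<nu> + real n + 1) * rGamma (\<nu> + real n + 1 + 1)"
  using assms pos by (intro mult_right_mono) auto
 also have "\<dots> \<le> rGamma (\<nu> + 1) / fact n"
  using Suc eq by simp
 finally have "rGamma (\<nu> + real n + 1 + 1) \<le> rGamma (\<nu> + 1) / fact n / (real n + 1)"
  by (subst pos_le_divide_eq) (auto simp: mult.commute)
 moreover have "\<nu> + real (Suc n) + 1 = \<nu> + real n + 1 + 1" by simp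
 ultimately show ?case by (simp only:) (simp add: add.commute mult.commute)
qed auto

lemma bessel_coeff_le:
 assumes "0 \<le> \<nu>"
 shows "bessel_coeff \<nu> n \<le> rGamma (\<nu> + 1) / (fact n * fact n)"
 using rGamma_add_le[OF assms, of n] by (simp add: bessel_coeff_def field_simps)

lemma bessel_coeff_le':
 assumes "0 \<le> \<nu>"
 shows "bessel_coeff \<nu> n \<le> rGamma (\<nu> + 1) * inverse (fact n)"
proof -
 have "rGamma (\<nu> + 1) / (fact n * fact n) \<le> rGamma (\<nu> + 1) / (fact n * 1)"
  using assms rGamma_pos[of "\<nu> + 1"]
  by (intro divide_left_mono mult_left_mono) (auto simp: fact_ge_1)
 then show ?thesis using bessel_coeff_le[OF assms, of n] by (simp add: divide_inverse)
qed

lemma bessel_F_summable: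
 assumes "0 \<le> \<nu>"
 shows "summable (\<lambda>n. bessel_coeff \<nu> n * z ^ n)"
proof (rule summable_comparison_test')
 show "summable (\<lambda>n. rGamma (\<nu> + 1) * (inverse (fact n) * \<bar>z\<bar> ^ n))"
  by (intro summable_mult) (simp add: summable_exp)
 show "norm (bessel_coeff \<nu> n * z ^ n) \<le> rGamma (\<nu> + 1) * (inverse (fact n) * \<bar>z\<bar> ^ n)" if "0 \<le> n" for n
  using bessel_coeff_le'[OF assms, of n] bessel_coeff_pos[OF assms, of n]
  by (auto simp: abs_mult power_abs mult.assoc[symmetric] intro!: mult_right_mono)
qed

lemma bessel_coeff_diffs: "diffs (bessel_coeff \<nu>) n = bessel_coeff (\<nu> + 1) n"
proof -
 have "\<nu> + real (Suc n) + 1 = \<nu> + 1 + real n + 1" by simp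
 moreover have "fact (Suc n) = (real (Suc n)) * fact n" by simp
 ultimately show ?thesis
  unfolding diffs_def bessel_coeff_def by (simp only:) (simp del: of_nat_Suc)
qed

text \<open>By \<open>bessel_coeff_diffs\<close>, differentiating the power series term by term only
  raises the order by one. Derivatives of the kernel are therefore again combinations of kernels of
  the same shape.\<close>

lemma bessel_F_has_field_derivative [derivative_intros]:
 assumes "0 \<le> \<nu>" and "(g has_field_derivative g') (at x within S)"
 shows "((\<lambda>x. bessel_F \<nu> (g x)) has_field_derivative bessel_F (\<nu> + 1) (g x) * g') (at x within S)"
proof -
 have "((\<lambda>x. \<Sum>n. bessel_coeff \<nu> n * x ^ n) has_field_derivative
   (\<Sum>n. diffs (bessel_coeff \<nu>) n * z ^ n)) (at z)" for z
  by (rule termdiffs_strong_converges_everywhere) (rule bessel_F_summable[OF assms(1)])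
 then have "(bessel_F \<nu> has_field_derivative bessel_F (\<nu> + 1) z) (at z)" for z
  by (simp add: bessel_F_def[abs_def] bessel_coeff_diffs)
 from DERIV_chain2[OF this assms(2)] show ?thesis .
qed

text \<open>Comparison of coefficients reduces this to the functional equation of
  \<open>rGamma\<close>. Since differentiation raises the order, it is the equation z F'' + (\<nu> +
  1) F' = F, the form that Bessel's equation takes for the entire function.\<close>

lemma bessel_F_ode:
 assumes "0 \<le> \<nu>"
 shows "z * bessel_F (\<nu> + 2) z + (\<nu> + 1) * bessel_F (\<nu> + 1) z = bessel_F \<nu> z"
proof -
 have s0: "(\<lambda>n. bessel_coeff (\<nu> + 2) n * z ^ n) sums bessel_F (\<nu> + 2) z"
  and s1: "(\<lambda>n. bessel_coeff (\<nu> + 1) n * z ^ n) sums bessel_F (\<nu> + 1) z"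
  and s2: "(\<lambda>n. bessel_coeff \<nu> n * z ^ n) sums bessel_F \<nu> z"
  using assms unfolding bessel_F_def by (auto intro!: summable_sums bessel_F_summable)
 \<comment> \<open>Multiplication by z shifts the coefficients by one index; the new coefficient at
   index 0 is 0.\<close>
 let ?g = "\<lambda>n. if n = 0 then 0 else bessel_coeff (\<nu> + 2) (n - 1) * z ^ n"
 have "(\<lambda>n. ?g (Suc n)) sums (z * bessel_F (\<nu> + 2) z)"
  using sums_mult[OF s0, of z] by (simp add: mult_ac)
 then have "?g sums (z * bessel_F (\<nu> + 2) z)"
  by (subst (asm) sums_Suc_iff) simp
 from sums_add[OF this sums_mult[OF s1, of "\<nu> + 1"]]
 have "(\<lambda>n. ?g n + (\<nu> + 1) * (bessel_coeff (\<nu> + 1) n * z ^ n)) sums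
   (z * bessel_F (\<nu> + 2) z + (\<nu> + 1) * bessel_F (\<nu> + 1) z)" .
 also have "(\<lambda>n. ?g n + (\<nu> + 1) * (bessel_coeff (\<nu> + 1) n * z ^ n)) = (\<lambda>n. bessel_coeff \<nu> n * z ^ n)"
 proof
  fix n
  show "?g n + (\<nu> + 1) * (bessel_coeff (\<nu> + 1) n * z ^ n) = bessel_coeff \<nu> n * z ^ n"
  proof (cases n)
   case 0
   then show ?thesis using rGamma_plus1[of "\<nu> + 1"] by (simp add: bessel_coeff_def)
  next
   case (Suc k)
   define R where "R = rGamma (\<nu> + real k + 2 + 1)"
   have e: "\<nu> + 2 + real k + 1 = \<nu> + real k + 2 + 1" "\<nu> + 1 + real (Suc k) + 1 = \<nu> + real k + 2 + 1"
    "\<nu> + real (Suc k) + 1 = \<nu> + real k + 2" by auto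
   have r: "rGamma (\<nu> + real k + 2) = (\<nu> + real k + 2) * R"
    unfolding R_def by (rule rGamma_plus1[symmetric])
   have f: "fact (Suc k) = (real k + 1) * fact k" by simp
   have "bessel_coeff (\<nu> + 2) k + (\<nu> + 1) * bessel_coeff (\<nu> + 1) (Suc k) = bessel_coeff \<nu> (Suc k)"
    unfolding bessel_coeff_def e f r R_def[symmetric]
    by (simp add: divide_simps) (simp add: algebra_simps)
   from arg_cong[OF this, of "\<lambda>x. x * z ^ Suc k"] show ?thesis
    using Suc by (simp add: algebra_simps)
  qed
 qed
 finally show ?thesis using s2 sums_unique2 by blast
qed

lemma bessel_F_pos: "0 \<le> \<nu> \<Longrightarrow> 0 \<le> z \<Longrightarrow> 0 < bessel_F \<nu> z"
proof -
 assume a: "0 \<le> \<nu>" "0 \<le> z"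
 have "bessel_coeff \<nu> 0 = (\<Sum>n<1. bessel_coeff \<nu> n * z ^ n)" by simp
 also have "\<dots> \<le> bessel_F \<nu> z"
  unfolding bessel_F_def using a bessel_coeff_pos[OF a(1), THEN less_imp_le]
  by (intro sum_le_suminf bessel_F_summable) auto
 finally show ?thesis using bessel_coeff_pos[OF a(1), of 0] by linarith
qed

text \<open>After \<open>bessel_coeff_le\<close> the terms are the squares of
  \<open>z ^ n / fact n\<close>. Each square is the middle summand of the coefficient with index 2 n
  in the Cauchy product of exp z with itself. The rate 2 is the one that completes the square with
  the Gaussian factor of the kernel.\<close>

lemma bessel_F_square_le:
 assumes "0 \<le> \<nu>" "0 \<le> z"
 shows "bessel_F \<nu> (z\<^sup>2) \<le> rGamma (\<nu> + 1) * exp (2 * z)"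
proof -
 have "(\<lambda>n. z ^ n /\<^sub>R fact n) sums exp z" by (rule exp_converges)
 then have e: "(\<lambda>n. z ^ n / fact n) sums exp z" by (simp add: field_simps)
 have "summable (\<lambda>n. norm (z ^ n / fact n))" using assms e by (simp add: sums_iff)
 then have cp: "(\<lambda>k. \<Sum>i\<le>k. (z ^ i / fact i) * (z ^ (k - i) / fact (k - i))) sums (exp z * exp z)"
  using Cauchy_product_sums[of "\<lambda>n. z ^ n / fact n" "\<lambda>n. z ^ n / fact n"] e by (simp add: sums_iff)
 let ?c = "\<lambda>k. \<Sum>i\<le>k. (z ^ i / fact i) * (z ^ (k - i) / fact (k - i))"
 have sum: "(\<Sum>n<N. (z ^ n / fact n) * (z ^ n / fact n)) \<le> exp z * exp z" for N
 proof -
  have c0: "0 \<le> ?c k" for k using assms by (intro sum_nonneg) auto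
  have "(\<Sum>n<N. (z ^ n / fact n) * (z ^ n / fact n)) \<le> (\<Sum>n<N. ?c (2 * n))"
  proof (rule sum_mono)
   fix n
   have "(z ^ n / fact n) * (z ^ (2 * n - n) / fact (2 * n - n)) \<le> ?c (2 * n)"
    using assms by (intro member_le_sum) auto
   then show "(z ^ n / fact n) * (z ^ n / fact n) \<le> ?c (2 * n)" by (simp add: mult_2)
  qed
  also have "\<dots> = sum ?c ((\<lambda>n. 2 * n) ` {..<N})"
   by (subst sum.reindex) (auto simp: inj_on_def)
  also have "\<dots> \<le> exp z * exp z"
   using cp c0 by (intro sum_le_suminf[of ?c, THEN order_trans]) (auto simp: sums_iff)
  finally show ?thesis .
 qed
 have "bessel_F \<nu> (z\<^sup>2) \<le> rGamma (\<nu> + 1) * (exp z * exp z)"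
  unfolding bessel_F_def
 proof (rule suminf_le_const[OF bessel_F_summable[OF assms(1)]])
  fix N
  have "(\<Sum>n<N. bessel_coeff \<nu> n * (z\<^sup>2) ^ n) \<le> (\<Sum>n<N. rGamma (\<nu> + 1) * ((z ^ n / fact n) * (z ^ n / fact n)))"
  proof (rule sum_mono)
   fix n
   have "bessel_coeff \<nu> n * (z\<^sup>2) ^ n \<le> rGamma (\<nu> + 1) / (fact n * fact n) * (z\<^sup>2) ^ n"
    using bessel_coeff_le[OF assms(1), of n] by (intro mult_right_mono) auto
   also have "\<dots> = rGamma (\<nu> + 1) * ((z ^ n / fact n) * (z ^ n / fact n))"
    by (simp add: power_mult[symmetric] power_add[symmetric] mult_2)
   finally show "bessel_coeff \<nu> n * (z\<^sup>2) ^ n \<le> rGamma (\<nu> + 1) * ((z ^ n / fact n) * (z ^ n / fact n))" .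
  qed
  also have "\<dots> \<le> rGamma (\<nu> + 1) * (exp z * exp z)"
   unfolding sum_distrib_left[symmetric] using sum[of N] rGamma_pos[of "\<nu> + 1"] assms
   by (intro mult_left_mono) auto
  finally show "(\<Sum>n<N. bessel_coeff \<nu> n * (z\<^sup>2) ^ n) \<le> rGamma (\<nu> + 1) * (exp z * exp z)" .
 qed
 then show ?thesis by (simp add: exp_add[symmetric])
qed

lemma borel_measurable_bessel_F [measurable]: "bessel_F \<nu> \<in> borel_measurable borel"
 unfolding bessel_F_def[abs_def] by measurable

text \<open>With respect to \<open>r powr (1 + 2 * \<nu>) dr\<close> this is the heat kernel of the
  radial Laplacian in dimension 2 + 2 \<nu>. The powers of y and r that the Bessel function
  contributes are left out, so that it is smooth across 0 and symmetric.\<close>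

definition bkernel :: "real \<Rightarrow> real \<Rightarrow> real \<Rightarrow> real \<Rightarrow> real" where
 "bkernel \<nu> t y r = 2 * (4 * t) powr (-1 - \<nu>) * exp (- (y\<^sup>2 + r\<^sup>2) / (4 * t)) * bessel_F \<nu> ((y * r / (4 * t))\<^sup>2)"

lemma bkernel_pos: "0 \<le> \<nu> \<Longrightarrow> 0 < t \<Longrightarrow> 0 < bkernel \<nu> t y r"
 by (auto simp: bkernel_def intro!: mult_pos_pos bessel_F_pos)

lemma bkernel_sym: "bkernel \<nu> t y r = bkernel \<nu> t r y"
 by (simp add: bkernel_def add_ac mult_ac)

text \<open>Differentiating the Bessel factor raises its order but not the power of
  \<open>4 * t\<close> in front; the factor \<open>4 * t\<close> restores the balance, so that the
  derivatives are written through kernels of order \<nu> and \<nu> + 1.\<close>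

lemma bkernel_Suc:
 assumes "0 < t"
 shows "2 * (4 * t) powr (-1 - \<nu>) * exp (- (y\<^sup>2 + r\<^sup>2) / (4 * t)) * bessel_F (\<nu> + 1) ((y * r / (4 * t))\<^sup>2) =
  4 * t * bkernel (\<nu> + 1) t y r"
proof -
 have "(4 * t) powr (-1 - \<nu>) = (4 * t) * (4 * t) powr (-1 - (\<nu> + 1))"
  using assms by (simp add: powr_mult_base)
 then show ?thesis by (simp add: bkernel_def)
qed

lemma bkernel_deriv_r:
 assumes "0 \<le> \<nu>" "0 < t"
 shows "((\<lambda>r. bkernel \<nu> t y r) has_field_derivative
  r / (2 * t) * (y\<^sup>2 * bkernel (\<nu> + 1) t y r - bkernel \<nu> t y r)) (at r within S)"
proof -
 let ?K = "2 * (4 * t) powr (-1 - \<nu>)"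
 have q: "((\<lambda>r. (y * r / (4 * t))\<^sup>2) has_field_derivative 2 * (y * r / (4 * t)) * (y / (4 * t))) (at r within S)"
  using assms by (auto intro!: derivative_eq_intros simp: field_simps power2_eq_square)
 have e: "((\<lambda>r. exp (- (y\<^sup>2 + r\<^sup>2) / (4 * t))) has_field_derivative
   exp (- (y\<^sup>2 + r\<^sup>2) / (4 * t)) * (- (2 * r) / (4 * t))) (at r within S)"
  using assms by (auto intro!: derivative_eq_intros simp: field_simps)
 have "((\<lambda>r. bkernel \<nu> t y r) has_field_derivative
   ?K * exp (- (y\<^sup>2 + r\<^sup>2) / (4 * t)) * (- (2 * r) / (4 * t)) * bessel_F \<nu> ((y * r / (4 * t))\<^sup>2) +
   ?K * exp (- (y\<^sup>2 + r\<^sup>2) / (4 * t)) * bessel_F (\<nu> + 1) ((y * r / (4 * t))\<^sup>2) * (2 * (y * r / (4 * t)) * (y / (4 * t))))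
   (at r within S)"
  unfolding bkernel_def
  by (rule DERIV_cong[OF DERIV_mult[OF DERIV_cmult[OF e] bessel_F_has_field_derivative[OF assms(1) q]]]) (simp only: mult_ac)
 moreover have "?K * exp (- (y\<^sup>2 + r\<^sup>2) / (4 * t)) * (- (2 * r) / (4 * t)) * bessel_F \<nu> ((y * r / (4 * t))\<^sup>2)
   = - (r / (2 * t)) * bkernel \<nu> t y r"
  using assms by (simp add: bkernel_def field_simps)
 moreover have "?K * exp (- (y\<^sup>2 + r\<^sup>2) / (4 * t)) * bessel_F (\<nu> + 1) ((y * r / (4 * t))\<^sup>2) *
   (2 * (y * r / (4 * t)) * (y / (4 * t))) = r / (2 * t) * y\<^sup>2 * bkernel (\<nu> + 1) t y r"
  unfolding bkernel_Suc[OF assms(2)] using assms by (simp add: field_simps power2_eq_square)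
 ultimately show ?thesis by (simp add: algebra_simps)
qed

lemma bkernel_deriv_t:
 assumes "0 \<le> \<nu>" "0 < t"
 shows "((\<lambda>t. bkernel \<nu> t y r) has_field_derivative
  (- (1 + \<nu>) / t + (y\<^sup>2 + r\<^sup>2) / (4 * t\<^sup>2)) * bkernel \<nu> t y r
   - (y * r)\<^sup>2 / (2 * t\<^sup>2) * bkernel (\<nu> + 1) t y r) (at t within S)"
proof -
 let ?K = "2 * (4 * t) powr (-1 - \<nu>)"
 let ?e = "exp (- (y\<^sup>2 + r\<^sup>2) / (4 * t))"
 have p: "((\<lambda>t. (4 * t) powr (-1 - \<nu>)) has_field_derivative (-1 - \<nu>) / t * (4 * t) powr (-1 - \<nu>)) (at t within S)"
 proof (rule DERIV_cong[OF has_field_derivative_at_within[OF DERIV_fun_powr]])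
  show "((\<lambda>t. 4 * t) has_field_derivative 4) (at t)"
   by (rule DERIV_cmult_Id)
  show "0 < 4 * t" using assms by simp
  show "(-1 - \<nu>) * (4 * t) powr (-1 - \<nu> - of_nat 1) * 4 = (-1 - \<nu>) / t * (4 * t) powr (-1 - \<nu>)"
   using assms by (subst powr_diff) simp
 qed
 have e: "((\<lambda>t. exp (- (y\<^sup>2 + r\<^sup>2) / (4 * t))) has_field_derivative ?e * ((y\<^sup>2 + r\<^sup>2) / (4 * t\<^sup>2))) (at t within S)"
  using assms by (auto intro!: derivative_eq_intros simp: field_simps power2_eq_square)
 have q: "((\<lambda>t. (y * r / (4 * t))\<^sup>2) has_field_derivative - ((y * r)\<^sup>2 / (8 * t ^ 3))) (at t within S)"
  using assms by (auto intro!: derivative_eq_intros simp: field_simps power2_eq_square power3_eq_cube)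
 have "((\<lambda>t. bkernel \<nu> t y r) has_field_derivative
   2 * ((-1 - \<nu>) / t * (4 * t) powr (-1 - \<nu>)) * ?e * bessel_F \<nu> ((y * r / (4 * t))\<^sup>2) +
   ?K * (?e * ((y\<^sup>2 + r\<^sup>2) / (4 * t\<^sup>2))) * bessel_F \<nu> ((y * r / (4 * t))\<^sup>2) +
   ?K * ?e * bessel_F (\<nu> + 1) ((y * r / (4 * t))\<^sup>2) * (- ((y * r)\<^sup>2 / (8 * t ^ 3)))) (at t within S)"
  unfolding bkernel_def
  by (rule DERIV_cong[OF DERIV_mult[OF DERIV_mult[OF DERIV_cmult[OF p, of 2] e] bessel_F_has_field_derivative[OF assms(1) q]]])
   (simp only: distrib_right distrib_left mult_ac)
 moreover have "?K * ?e * bessel_F (\<nu> + 1) ((y * r / (4 * t))\<^sup>2) * (- ((y * r)\<^sup>2 / (8 * t ^ 3))) =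
   - ((y * r)\<^sup>2 / (2 * t\<^sup>2) * bkernel (\<nu> + 1) t y r)"
  unfolding bkernel_Suc[OF assms(2)] using assms by (simp add: field_simps power2_eq_square power3_eq_cube)
 ultimately show ?thesis by (simp add: bkernel_def algebra_simps)
qed

section \<open>Moments of the kernel\<close>

abbreviation nnint :: "(real \<Rightarrow> real) \<Rightarrow> ennreal" where
 "nnint f \<equiv> \<integral>\<^sup>+y\<in>{0<..}. ennreal (f y) \<partial>lborel"

abbreviation nnint_R :: "(real \<Rightarrow> real) \<Rightarrow> ennreal" where
 "nnint_R f \<equiv> \<integral>\<^sup>+y. ennreal (f y) \<partial>lborel"

text \<open>Substitution of u = r^2 / (4 t) in Euler's integral for the Gamma function.\<close>

lemma nn_integral_gaussian_moment:
 assumes "0 < x" "0 < t"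
 shows "nnint (\<lambda>r. 2 * r powr (2 * x - 1) * exp (- r\<^sup>2 / (4 * t))) =
  ennreal ((4 * t) powr x * Gamma x)"
proof -
 let ?f = "\<lambda>u::real. u powr (x - 1) / exp u"
 let ?g = "\<lambda>r::real. r\<^sup>2 / (4 * t)"
 have hi: "(?f has_integral Gamma x) {0<..}"
 proof -
  have "((\<lambda>u. if u \<in> {0<..} then ?f u else 0) has_integral Gamma x) {0..}"
   by (rule has_integral_spike[OF _ _ Gamma_integral_real[OF assms(1)], of "{0}"]) auto
  then show ?thesis by (subst (asm) has_integral_restrict) auto
 qed
 have ai: "?f absolutely_integrable_on {0<..}"
  using hi by (intro nonnegative_absolutely_integrable_1) auto
 have img: "?g ` {0<..} = {0<..}"
 proof safe
  fix u :: real assume "0 < u"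
  then have "u = ?g (sqrt (4 * t * u))" "0 < sqrt (4 * t * u)" using assms by auto
  then show "u \<in> ?g ` {0<..}" by blast
 qed (use assms in auto)
 have ms: "{0<..} \<in> sets (lebesgue :: real measure)" by simp
 have inj: "inj_on ?g {0<..}" using assms by (auto simp: inj_on_def power2_eq_iff)
 have der: "(?g has_field_derivative 2 * r / (4 * t)) (at r within {0<..})" for r
  using assms by (auto intro!: derivative_eq_intros)
 have "(\<lambda>r. \<bar>2 * r / (4 * t)\<bar> * ?f (?g r)) absolutely_integrable_on {0<..} \<and>
   integral {0<..} (\<lambda>r. \<bar>2 * r / (4 * t)\<bar> * ?f (?g r)) = Gamma x"
  using has_absolute_integral_change_of_variables_1'[OF ms der inj, of ?f "Gamma x"] ai integral_unique[OF hi]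
  unfolding img by blast
 then have "((\<lambda>r. \<bar>2 * r / (4 * t)\<bar> * ?f (?g r)) has_integral Gamma x) {0<..}"
  by (auto simp only: has_integral_iff intro!: set_lebesgue_integral_eq_integral(1))
 from has_integral_mult_right[OF this, of "(4 * t) powr x"]
 have "((\<lambda>r. (4 * t) powr x * (\<bar>2 * r / (4 * t)\<bar> * ?f (?g r))) has_integral ((4 * t) powr x * Gamma x)) {0<..}" .
 from nn_integral_has_integral_lebesgue[OF _ this]
 have "(nnint_R (\<lambda>r. indicator {0<..} r * ((4 * t) powr x * (\<bar>2 * r / (4 * t)\<bar> * ?f (?g r))))) =
   ennreal ((4 * t) powr x * Gamma x)"
  by (auto simp: assms)
 moreover have "(nnint_R (\<lambda>r. indicator {0<..} r * ((4 * t) powr x * (\<bar>2 * r / (4 * t)\<bar> * ?f (?g r)))))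
   = nnint (\<lambda>r. 2 * r powr (2 * x - 1) * exp (- r\<^sup>2 / (4 * t)))"
 proof (rule nn_integral_cong)
  fix r :: real
  show "ennreal (indicator {0<..} r * ((4 * t) powr x * (\<bar>2 * r / (4 * t)\<bar> * ?f (?g r)))) =
   ennreal (2 * r powr (2 * x - 1) * exp (- r\<^sup>2 / (4 * t))) * indicator {0<..} r"
  proof (cases "0 < r")
   case True
   have "r\<^sup>2 powr (x - 1) = (r powr 2) powr (x - 1)" using True by simp
   also have "\<dots> = r powr (2 * x - 2)" unfolding powr_powr by (simp add: algebra_simps)
   finally have "?g r powr (x - 1) = r powr (2 * x - 2) / (4 * t) powr (x - 1)"
    using True assms by (simp add: powr_divide)
   moreover have "(4 * t) powr x = (4 * t) * (4 * t) powr (x - 1)"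
    using assms by (simp add: powr_mult_base)
   moreover have "r powr (2 * x - 1) = r * r powr (2 * x - 2)"
    using True by (simp add: powr_mult_base)
   ultimately have "(4 * t) powr x * (\<bar>2 * r / (4 * t)\<bar> * ?f (?g r)) = 2 * r powr (2 * x - 1) * exp (- r\<^sup>2 / (4 * t))"
   proof -
    assume a: "?g r powr (x - 1) = r powr (2 * x - 2) / (4 * t) powr (x - 1)"
     and b: "(4 * t) powr x = (4 * t) * (4 * t) powr (x - 1)"
     and c: "r powr (2 * x - 1) = r * r powr (2 * x - 2)"
    have ex: "exp (- r\<^sup>2 / (4 * t)) = 1 / exp (?g r)"
     by (simp add: exp_minus inverse_eq_divide)
    have "\<bar>2 * r / (4 * t)\<bar> = 2 * r / (4 * t)" using True assms by simp
    moreover have "(4 * t) powr (x - 1) \<noteq> 0" using assms by simp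
    ultimately show ?thesis unfolding a b c ex using assms by simp
   qed
   then show ?thesis using True by simp
  qed simp
 qed
 ultimately show ?thesis by simp
qed

text \<open>This is the heat kernel at a real time for c = 1 - 2 \<nu>, as a density with respect to
  \<open>dr\<close> (see \<open>heat_kernel_of_real\<close>): all powers of y and r collect into the
  single factor in front.\<close>

definition dkernel :: "real \<Rightarrow> real \<Rightarrow> real \<Rightarrow> real \<Rightarrow> real" where
 "dkernel \<nu> t y r = y powr (2 * \<nu>) * r * bkernel \<nu> t y r"

lemma dkernel_pos:
 "0 \<le> \<nu> \<Longrightarrow> 0 < t \<Longrightarrow> 0 < y \<Longrightarrow> 0 < r \<Longrightarrow> 0 < dkernel \<nu> t y r"
 by (simp add: dkernel_def bkernel_pos)

lemma dkernel_measurable [measurable (raw)]: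
 assumes [measurable]: "f \<in> borel_measurable M" "g \<in> borel_measurable M" "h \<in> borel_measurable M"
 shows "(\<lambda>x. dkernel \<nu> (f x) (g x) (h x)) \<in> borel_measurable M"
 unfolding dkernel_def bkernel_def by measurable

text \<open>All terms of the Bessel series are positive, so that it may be integrated term by term,
  and each term is a Gaussian moment. The argument of Gamma is positive for every k because a
  exceeds -2.\<close>

lemma nn_integral_dkernel_powr:
 assumes \<nu>: "0 \<le> \<nu>" and a: "-2 < a" and t: "0 < t" and y: "0 < y"
 shows "nnint (\<lambda>r. dkernel \<nu> t y r * r powr a) =
  (\<Sum>k. ennreal (y powr (2 * \<nu>) * (4 * t) powr (a / 2 - \<nu>) * exp (- y\<^sup>2 / (4 * t)) *
    ((y\<^sup>2 / (4 * t)) ^ k * Gamma (real k + (1 + a / 2)) * bessel_coeff \<nu> k)))"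
proof -
 let ?M = "\<lambda>k. (4 * t) powr (real k + (1 + a / 2)) * Gamma (real k + (1 + a / 2))"
 let ?s = "y\<^sup>2 / (4 * t)"
 define A where "A k = y powr (2 * \<nu>) * (4 * t) powr (- 1 - \<nu> - real k) * exp (- ?s) * ?s ^ k * bessel_coeff \<nu> k" for k
 have A0: "0 \<le> A k" for k
  using bessel_coeff_pos[OF \<nu>, of k] t by (auto simp: A_def)
 let ?G = "\<lambda>k r. 2 * r powr (2 * (real k + (1 + a / 2)) - 1) * exp (- r\<^sup>2 / (4 * t))"
 have pw: "ennreal (dkernel \<nu> t y r * r powr a) = (\<Sum>k. ennreal (A k) * ennreal (?G k r))" if r: "0 < r" for r
 proof -
  have eq: "y powr (2 * \<nu>) * r * (2 * (4 * t) powr (-1 - \<nu>) * exp (- (y\<^sup>2 + r\<^sup>2) / (4 * t))) * r powr a *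
    (bessel_coeff \<nu> k * ((y * r / (4 * t))\<^sup>2) ^ k) = A k * ?G k r" for k
  proof -
   have 1: "((y * r / (4 * t))\<^sup>2) ^ k = ?s ^ k * (r powr (2 * real k) * (4 * t) powr (- real k))"
   proof -
    have "r powr (2 * real k) = r powr (real (2 * k))" by simp
    also have "\<dots> = r ^ (2 * k)" using r by (rule powr_realpow)
    finally have "r powr (2 * real k) = (r\<^sup>2) ^ k" by (simp add: power_mult)
    moreover have "(4 * t) powr (- real k) = 1 / (4 * t) ^ k"
     using t by (simp add: powr_minus_divide powr_realpow)
    moreover have "(y * r / (4 * t))\<^sup>2 = ?s * (r\<^sup>2 / (4 * t))"
     by (simp add: power2_eq_square)
    ultimately show ?thesis by (simp only: power_mult_distrib power_divide) simp
   qed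
   have 2: "exp (- (y\<^sup>2 + r\<^sup>2) / (4 * t)) = exp (- ?s) * exp (- r\<^sup>2 / (4 * t))"
    by (simp add: exp_add[symmetric] add_divide_distrib diff_divide_distrib)
   have 3: "(4 * t) powr (- 1 - \<nu> - real k) = (4 * t) powr (- 1 - \<nu>) * (4 * t) powr (- real k)"
    using t by (simp add: powr_add[symmetric])
   have 4: "r powr (2 * (real k + (1 + a / 2)) - 1) = r powr (2 * real k) * (r * r powr a)"
    using r by (simp add: powr_mult_base powr_add[symmetric] algebra_simps)
   show ?thesis unfolding A_def 1 2 3 4 by (simp only: mult_ac)
  qed
  have "(\<lambda>k. bessel_coeff \<nu> k * ((y * r / (4 * t))\<^sup>2) ^ k) sums bessel_F \<nu> ((y * r / (4 * t))\<^sup>2)"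
   unfolding bessel_F_def by (intro summable_sums bessel_F_summable \<nu>)
  from sums_mult[OF this, of "y powr (2 * \<nu>) * r * (2 * (4 * t) powr (-1 - \<nu>) * exp (- (y\<^sup>2 + r\<^sup>2) / (4 * t))) * r powr a"]
  have "(\<lambda>k. A k * ?G k r) sums (dkernel \<nu> t y r * r powr a)"
   unfolding eq by (simp add: dkernel_def bkernel_def mult_ac)
  then have "(\<Sum>k. ennreal (A k * ?G k r)) = ennreal (dkernel \<nu> t y r * r powr a)"
   using A0 by (intro suminf_ennreal_eq) auto
  then show ?thesis using A0 by (simp add: ennreal_mult)
 qed
 have "nnint (\<lambda>r. dkernel \<nu> t y r * r powr a) =
   (\<integral>\<^sup>+r. (\<Sum>k. ennreal (A k) * (ennreal (?G k r) * indicator {0<..} r)) \<partial>lborel)"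
  by (rule nn_integral_cong) (auto simp: pw indicator_def)
 also have "\<dots> = (\<Sum>k. \<integral>\<^sup>+r. ennreal (A k) * (ennreal (?G k r) * indicator {0<..} r) \<partial>lborel)"
  by (rule nn_integral_suminf) simp
 also have "\<dots> = (\<Sum>k. ennreal (A k) * ennreal (?M k))"
 proof (rule suminf_cong)
  fix k
  have g: "nnint (\<lambda>r. ?G k r) =
    ennreal (?M k)"
   using a t by (intro nn_integral_gaussian_moment) (auto intro: add_nonneg_pos)
  show "(\<integral>\<^sup>+r. ennreal (A k) * (ennreal (?G k r) * indicator {0<..} r) \<partial>lborel) =
    ennreal (A k) * ennreal (?M k)"
   unfolding g[symmetric] by (rule nn_integral_cmult) simp
 qed
 also have "\<dots> = (\<Sum>k. ennreal (y powr (2 * \<nu>) * (4 * t) powr (a / 2 - \<nu>) * exp (- y\<^sup>2 / (4 * t)) *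
    ((y\<^sup>2 / (4 * t)) ^ k * Gamma (real k + (1 + a / 2)) * bessel_coeff \<nu> k)))"
 proof (rule suminf_cong)
  fix k
  have "(4 * t) powr (a / 2 - \<nu>) = (4 * t) powr (- 1 - \<nu> - real k) * (4 * t) powr (real k + (1 + a / 2))"
   using t by (simp add: powr_add[symmetric])
  then show "ennreal (A k) * ennreal (?M k) =
    ennreal (y powr (2 * \<nu>) * (4 * t) powr (a / 2 - \<nu>) * exp (- y\<^sup>2 / (4 * t)) *
    ((y\<^sup>2 / (4 * t)) ^ k * Gamma (real k + (1 + a / 2)) * bessel_coeff \<nu> k))"
   using A0[of k] by (subst ennreal_mult'[symmetric]) (auto simp: A_def mult_ac)
 qed
 finally show ?thesis .
qed

text \<open>Euler's limit formula for Gamma at \<alpha> and at \<beta>: the quotient of the two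
  approximating sequences is, up to a constant and a factor that tends to 1, the quotient
  \<open>X\<close> of the two sides. Hence \<open>X\<close> tends to 1 and is bounded.\<close>

lemma Gamma_ratio_le:
 fixes \<alpha> \<beta> :: real
 assumes "0 < \<alpha>" "\<alpha> \<le> \<beta>"
 obtains C where "0 < C" "\<And>k. Gamma (real k + \<alpha>) * rGamma (real k + \<beta>) \<le> C * (real k + 1) powr - (\<beta> - \<alpha>)"
proof -
 define X where "X k = Gamma (real k + \<alpha>) * rGamma (real k + \<beta>) * (real k + 1) powr (\<beta> - \<alpha>)" for k
 have nn: "x \<notin> \<int>\<^sub>\<le>\<^sub>0" if "0 < x" for x :: real
  using that by (auto elim!: nonpos_Ints_cases)
 have "(\<lambda>n. Gamma_series \<beta> n / Gamma_series \<alpha> n) \<longlonglongrightarrow> Gamma \<beta> / Gamma \<alpha>"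
  using less_imp_neq[OF Gamma_real_pos[OF assms(1)]] by (intro tendsto_divide Gamma_series_LIMSEQ) metis
 \<comment> \<open>The approximating sequences contribute a power of n, while
   \<open>X (Suc n)\<close> contains the power of n + 2; this factor converts one into the
   other.\<close>
 moreover have "(\<lambda>n. ((real n + 2) / real n) powr (\<beta> - \<alpha>)) \<longlonglongrightarrow> 1"
  by real_asymp
 ultimately have "(\<lambda>n. Gamma_series \<beta> n / Gamma_series \<alpha> n * ((real n + 2) / real n) powr (\<beta> - \<alpha>))
   \<longlonglongrightarrow> Gamma \<beta> / Gamma \<alpha> * 1"
  by (rule tendsto_mult)
 moreover have "Gamma_series \<beta> n / Gamma_series \<alpha> n * ((real n + 2) / real n) powr (\<beta> - \<alpha>) =
    Gamma \<beta> / Gamma \<alpha> * X (Suc n)" if "1 \<le> n" for n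
 proof -
  have p: "pochhammer z (Suc n) = Gamma (real (Suc n) + z) / Gamma z" if "0 < z" for z :: real
   using pochhammer_Gamma[OF nn[OF that], of "Suc n"] by (simp add: add_ac)
  have e: "exp (z * ln (real n)) = real n powr z" for z :: real
   using that by (simp add: powr_def)
  have gs: "Gamma_series \<beta> n / Gamma_series \<alpha> n =
    (real n powr \<beta> / real n powr \<alpha>) * (pochhammer \<alpha> (Suc n) / pochhammer \<beta> (Suc n))"
   by (simp add: Gamma_series_def e)
  have "real n powr \<beta> = real n powr (\<beta> - \<alpha>) * real n powr \<alpha>"
   by (simp add: powr_add[symmetric])
  moreover have "((real n + 2) / real n) powr (\<beta> - \<alpha>) = (real (Suc n) + 1) powr (\<beta> - \<alpha>) / real n powr (\<beta> - \<alpha>)"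
   using that by (simp add: powr_divide add_ac)
  moreover have "Gamma \<alpha> > 0" "Gamma \<beta> > 0" "Gamma (real (Suc n) + \<alpha>) > 0" "Gamma (real (Suc n) + \<beta>) > 0"
   "real n powr \<alpha> > 0" "real n powr (\<beta> - \<alpha>) > 0"
   using assms that by (auto intro!: Gamma_real_pos add_nonneg_pos simp del: of_nat_Suc)
  ultimately show ?thesis
   unfolding gs p[OF assms(1)] p[OF less_le_trans[OF assms]] X_def rGamma_inverse_Gamma
   by (simp add: divide_simps mult.commute del: of_nat_Suc)
 qed
 ultimately have "(\<lambda>n. Gamma \<beta> / Gamma \<alpha> * X (Suc n)) \<longlonglongrightarrow> Gamma \<beta> / Gamma \<alpha>"
  by (subst (asm) tendsto_cong[OF eventually_sequentiallyI[of 1]]) auto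
 from tendsto_mult_left[OF this, of "Gamma \<alpha> / Gamma \<beta>"]
 have "(\<lambda>n. X (Suc n)) \<longlonglongrightarrow> 1"
  using Gamma_real_pos[of \<alpha>] Gamma_real_pos[of \<beta>] assms by (simp add: Gamma_eq_zero_iff nn)
 then have "X \<longlonglongrightarrow> 1" by (simp add: filterlim_sequentially_Suc)
 then have "Bseq X" by (auto intro: convergent_imp_Bseq convergentI)
 then obtain C where C: "0 < C" "\<And>k. norm (X k) \<le> C" by (auto elim: BseqE)
 show ?thesis
 proof (rule that[OF C(1)])
  fix k
  have "X k \<le> C" using C(2)[of k] by simp
  then have "X k * (real k + 1) powr - (\<beta> - \<alpha>) \<le> C * (real k + 1) powr - (\<beta> - \<alpha>)"
   by (intro mult_right_mono) auto
  moreover have "X k * (real k + 1) powr - (\<beta> - \<alpha>) = Gamma (real k + \<alpha>) * rGamma (real k + \<beta>)"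
   by (simp add: X_def powr_add[symmetric] mult.assoc)
  ultimately show "Gamma (real k + \<alpha>) * rGamma (real k + \<beta>) \<le> C * (real k + 1) powr - (\<beta> - \<alpha>)" by (simp only:)
 qed
qed

text \<open>The sum is the expectation of (s / (k + 1))^\<delta> for a Poisson variable k of mean s.
  With an integer n at least \<delta>, the power is at most 1 + (s / (k + 1))^n, and the second term
  is absorbed into the exponential series shifted by n at the cost of a factor
  \<open>fact n\<close>.\<close>

lemma poisson_negative_moment:
 assumes "0 \<le> \<delta>"
 obtains C :: real where "0 < C"
  "\<And>s. 0 < s \<Longrightarrow> (\<Sum>k. ennreal (exp (- s) * (s ^ k / fact k * (s powr \<delta> * (real k + 1) powr - \<delta>)))) \<le> ennreal C"
proof
 define n where "n = nat \<lceil>\<delta>\<rceil>"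
 have n: "\<delta> \<le> real n" using assms by (simp add: n_def)
 show "0 < (1 + fact n :: real)" by (simp add: add_pos_pos)
 fix s :: real assume s: "0 < s"
 have e: "(\<lambda>k. s ^ k / fact k) sums exp s"
  using exp_converges[of s] by (simp add: field_simps)
 let ?b = "\<lambda>k. s ^ k / fact k + fact n * (s ^ (k + n) / fact (k + n))"
 have pw: "s ^ k / fact k * (s powr \<delta> * (real k + 1) powr - \<delta>) \<le> ?b k" for k
 proof -
  let ?q = "s / (real k + 1)"
  have q: "0 < ?q" using s by simp
  have "s powr \<delta> * (real k + 1) powr - \<delta> = ?q powr \<delta>"
   using s by (simp add: powr_divide powr_minus_divide)
  also have "\<dots> \<le> 1 + ?q ^ n"
  proof (cases "?q \<le> 1")
   case True
   have "?q powr \<delta> \<le> 1 powr \<delta>" using True q assms by (intro powr_mono2) auto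
   then show ?thesis using q by simp (smt (verit) zero_le_power q)
  next
   case False
   have "?q powr \<delta> \<le> ?q powr (real n)" using False n by (intro powr_mono) auto
   then show ?thesis using q by (simp add: powr_realpow)
  qed
  finally have 1: "s ^ k / fact k * (s powr \<delta> * (real k + 1) powr - \<delta>) \<le> s ^ k / fact k * (1 + ?q ^ n)"
   using s by (intro mult_left_mono) auto
  have f: "fact (k + j) \<le> fact k * (real k + 1) ^ j * fact j" for j
  proof (induction j)
   case (Suc j)
   have "fact (k + Suc j) = (real k + real j + 1) * fact (k + j)" by (simp add: algebra_simps)
   also have "\<dots> \<le> ((real k + 1) * (real j + 1)) * (fact k * (real k + 1) ^ j * fact j)"
    by (intro mult_mono Suc) (auto simp: algebra_simps)
   finally show ?case by (simp add: algebra_simps)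
  qed simp
  have "s ^ k / fact k * ?q ^ n = s ^ (k + n) / (fact k * (real k + 1) ^ n)"
   by (simp add: power_add power_divide)
  also have "\<dots> \<le> s ^ (k + n) * (fact n / fact (k + n))"
  proof -
   have "1 / (fact k * (real k + 1) ^ n) \<le> fact n / fact (k + n)"
    using f[of n] by (simp add: divide_simps mult_ac)
   then have "s ^ (k + n) * (1 / (fact k * (real k + 1) ^ n)) \<le> s ^ (k + n) * (fact n / fact (k + n))"
    using s by (intro mult_left_mono) auto
   then show ?thesis by simp
  qed
  finally show ?thesis using 1 by (simp add: distrib_left mult_ac)
 qed
 have sb: "summable ?b"
  using e sums_split_initial_segment[OF e, of n]
  by (intro summable_add summable_mult) (auto simp: sums_iff)
 have "(\<Sum>k. ?b k) = exp s + fact n * (\<Sum>k. s ^ (k + n) / fact (k + n))"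
 proof -
  have "?b sums (exp s + fact n * (\<Sum>k. s ^ (k + n) / fact (k + n)))"
   using sums_split_initial_segment[OF e, of n] by (intro sums_add sums_mult e) (simp add: sums_iff)
  then show ?thesis by (simp add: sums_iff)
 qed
 also have "\<dots> \<le> exp s + fact n * exp s"
 proof -
  have "(\<Sum>k. s ^ (k + n) / fact (k + n)) = exp s - (\<Sum>k<n. s ^ k / fact k)"
   using sums_split_initial_segment[OF e, of n] by (simp add: sums_iff)
  also have "\<dots> \<le> exp s" using s by (auto intro!: sum_nonneg)
  finally show ?thesis by simp
 qed
 finally have le: "(\<Sum>k. ?b k) \<le> exp s * (1 + fact n)" by (simp add: algebra_simps)
 have "(\<Sum>k. ennreal (exp (- s) * (s ^ k / fact k * (s powr \<delta> * (real k + 1) powr - \<delta>)))) \<le>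
   (\<Sum>k. ennreal (exp (- s) * ?b k))"
  by (intro suminf_le ennreal_leI mult_left_mono pw) auto
 also have "\<dots> = ennreal (exp (- s) * (\<Sum>k. ?b k))"
  using s sb by (subst suminf_mult[symmetric]) (auto intro!: suminf_ennreal2 summable_mult)
 also have "\<dots> \<le> ennreal (exp (- s) * (exp s * (1 + fact n)))"
  using le by (intro ennreal_leI mult_left_mono) auto
 also have "exp (- s) * (exp s * (1 + fact n)) = (1 + fact n :: real)"
  by (simp add: mult.assoc[symmetric] exp_add[symmetric])
 finally show "(\<Sum>k. ennreal (exp (- s) * (s ^ k / fact k * (s powr \<delta> * (real k + 1) powr - \<delta>)))) \<le> ennreal (1 + fact n)" .
qed

text \<open>In the series of \<open>nn_integral_dkernel_powr\<close> the quotient of Gamma values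
  behaves like (k + 1)^(-\<delta>) with \<delta> = \<nu> - a / 2, so that the series is
  \<open>y powr a\<close> times a negative Poisson moment of mean y^2 / (4 t). The condition
  \<open>a \<le> 2 * \<nu>\<close> says that \<delta> is nonnegative; the bound of the moment is
  uniform in the mean and hence in t.\<close>

lemma dkernel_powr_le:
 assumes \<nu>: "0 \<le> \<nu>" and a: "-2 < a" "a \<le> 2 * \<nu>"
 obtains C where "0 < C" "\<And>t y. 0 < t \<Longrightarrow> 0 < y \<Longrightarrow>
  nnint (\<lambda>r. dkernel \<nu> t y r * r powr a) \<le> ennreal (C * y powr a)"
proof -
 define \<delta> where "\<delta> = \<nu> - a / 2"
 have \<delta>: "0 \<le> \<delta>" using a by (simp add: \<delta>_def)
 obtain C1 where C1: "0 < C1" "\<And>k. Gamma (real k + (1 + a / 2)) * rGamma (real k + (\<nu> + 1)) \<le> C1 * (real k + 1) powr - (\<nu> + 1 - (1 + a / 2))"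
  using Gamma_ratio_le[of "1 + a / 2" "\<nu> + 1"] a by auto
 obtain C2 where C2: "0 < C2"
  "\<And>s. 0 < s \<Longrightarrow> (\<Sum>k. ennreal (exp (- s) * (s ^ k / fact k * (s powr \<delta> * (real k + 1) powr - \<delta>)))) \<le> ennreal C2"
  using poisson_negative_moment[OF \<delta>] by blast
 show ?thesis
 proof (rule that[of "C1 * C2"])
  show "0 < C1 * C2" using C1 C2 by simp
  fix t y :: real assume t: "0 < t" and y: "0 < y"
  let ?s = "y\<^sup>2 / (4 * t)"
  let ?P = "\<lambda>k. exp (- ?s) * (?s ^ k / fact k * (?s powr \<delta> * (real k + 1) powr - \<delta>))"
  have s: "0 < ?s" using t y by simp
  have sc: "y powr (2 * \<nu>) * (4 * t) powr (a / 2 - \<nu>) = y powr a * ?s powr \<delta>"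
  proof -
   have "y\<^sup>2 powr \<delta> = (y powr 2) powr \<delta>" using y by simp
   also have "\<dots> = y powr (2 * \<delta>)" unfolding powr_powr by simp
   finally have "?s powr \<delta> = y powr (2 * \<delta>) / (4 * t) powr \<delta>"
    using t y by (simp add: powr_divide)
   moreover have "(4 * t) powr (a / 2 - \<nu>) = 1 / (4 * t) powr \<delta>"
    using t powr_minus_divide[of "4 * t" \<delta>] by (simp add: \<delta>_def)
   moreover have "y powr (2 * \<nu>) = y powr a * y powr (2 * \<delta>)"
    by (simp add: powr_add[symmetric] \<delta>_def algebra_simps)
   ultimately show ?thesis by simp
  qed
  have "nnint (\<lambda>r. dkernel \<nu> t y r * r powr a) =
   (\<Sum>k. ennreal (y powr a * ?s powr \<delta> * exp (- ?s) * (?s ^ k * Gamma (real k + (1 + a / 2)) * bessel_coeff \<nu> k)))"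
   unfolding nn_integral_dkernel_powr[OF \<nu> a(1) t y] sc by simp
  also have "\<dots> \<le> (\<Sum>k. ennreal (y powr a * C1) * ennreal (?P k))"
  proof (intro suminf_le)
   fix k
   have "Gamma (real k + (1 + a / 2)) * bessel_coeff \<nu> k \<le> C1 * (real k + 1) powr - \<delta> / fact k"
    using C1(2)[of k] by (simp add: bessel_coeff_def add_ac \<delta>_def divide_right_mono)
   then have "(y powr a * ?s powr \<delta> * exp (- ?s) * ?s ^ k) * (Gamma (real k + (1 + a / 2)) * bessel_coeff \<nu> k) \<le>
     (y powr a * ?s powr \<delta> * exp (- ?s) * ?s ^ k) * (C1 * (real k + 1) powr - \<delta> / fact k)"
    using t by (intro mult_left_mono) auto
   also have "\<dots> = (y powr a * C1) * (?P k)"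
    by simp
   finally show "ennreal (y powr a * ?s powr \<delta> * exp (- ?s) * (?s ^ k * Gamma (real k + (1 + a / 2)) * bessel_coeff \<nu> k))
    \<le> ennreal (y powr a * C1) * ennreal (?P k)"
    using C1(1) t by (subst ennreal_mult[symmetric]) (auto intro!: ennreal_leI simp: mult_ac)
  qed auto
  also have "\<dots> \<le> ennreal (y powr a * C1) * ennreal C2"
   using C2(2)[OF s] by (subst ennreal_suminf_cmult) (auto intro!: mult_left_mono)
  also have "\<dots> = ennreal (C1 * C2 * y powr a)"
   using C1 C2 by (subst ennreal_mult[symmetric]) (auto simp: mult_ac)
  finally show "nnint (\<lambda>r. dkernel \<nu> t y r * r powr a) \<le> ennreal (C1 * C2 * y powr a)" .
 qed
qed

lemma dkernel_swap:
 assumes "0 < y" "0 < r"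
 shows "dkernel \<nu> t y r = r powr (1 - 2 * \<nu>) * dkernel \<nu> t r y * y powr (2 * \<nu> - 1)"
proof -
 have "y powr (2 * \<nu>) = y * y powr (2 * \<nu> - 1)" "r powr (1 - 2 * \<nu>) * r powr (2 * \<nu>) = r"
  using assms by (simp_all add: powr_mult_base powr_add[symmetric])
 then show ?thesis
  unfolding dkernel_def bkernel_sym[of \<nu> t y r] by (simp add: algebra_simps)
qed

text \<open>The bound of \<open>dkernel_powr_le\<close> for the transposed kernel: by
  \<open>dkernel_swap\<close> the exponent b corresponds to b - 1 + 2 \<nu>, and the range of b is
  the range of a under this shift.\<close>

lemma dkernel_powr_le':
 assumes \<nu>: "0 \<le> \<nu>" and b: "- 1 - 2 * \<nu> < b" "b \<le> 1"
 obtains C where "0 < C" "\<And>t r. 0 < t \<Longrightarrow> 0 < r \<Longrightarrow>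
  nnint (\<lambda>y. dkernel \<nu> t y r * y powr b) \<le> ennreal (C * r powr b)"
proof -
 obtain C where C: "0 < C" "\<And>t y. 0 < t \<Longrightarrow> 0 < y \<Longrightarrow>
  nnint (\<lambda>r. dkernel \<nu> t y r * r powr (b - 1 + 2 * \<nu>)) \<le> ennreal (C * y powr (b - 1 + 2 * \<nu>))"
  using dkernel_powr_le[OF \<nu>, of "b - 1 + 2 * \<nu>"] b by auto
 show ?thesis
 proof (rule that[OF C(1)])
  fix t r :: real assume t: "0 < t" and r: "0 < r"
  have "nnint (\<lambda>y. dkernel \<nu> t y r * y powr b) =
   (\<integral>\<^sup>+y. ennreal (r powr (1 - 2 * \<nu>)) * (ennreal (dkernel \<nu> t r y * y powr (b - 1 + 2 * \<nu>)) * indicator {0<..} y) \<partial>lborel)"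
  proof (rule nn_integral_cong)
   fix y :: real
   show "ennreal (dkernel \<nu> t y r * y powr b) * indicator {0<..} y =
     ennreal (r powr (1 - 2 * \<nu>)) * (ennreal (dkernel \<nu> t r y * y powr (b - 1 + 2 * \<nu>)) * indicator {0<..} y)"
   proof (cases "0 < y")
    case True
    have "y powr (b - 1 + 2 * \<nu>) = y powr (2 * \<nu> - 1) * y powr b"
     by (simp add: powr_add[symmetric] algebra_simps)
    then show ?thesis
     using True dkernel_swap[OF True r, of \<nu> t]
     by (simp add: ennreal_mult'[symmetric] mult_ac)
   qed simp
  qed
  also have "\<dots> = ennreal (r powr (1 - 2 * \<nu>)) * nnint (\<lambda>y. dkernel \<nu> t r y * y powr (b - 1 + 2 * \<nu>))"
   by (rule nn_integral_cmult) simp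
  also have "\<dots> \<le> ennreal (r powr (1 - 2 * \<nu>)) * ennreal (C * r powr (b - 1 + 2 * \<nu>))"
   using C(2)[OF t r] by (intro mult_left_mono) auto
  also have "\<dots> = ennreal (C * r powr b)"
  proof -
   have "r powr (1 - 2 * \<nu>) * (C * r powr (b - 1 + 2 * \<nu>)) = C * (r powr (1 - 2 * \<nu>) * r powr (b - 1 + 2 * \<nu>))"
    by simp
   also have "\<dots> = C * r powr b" by (simp add: powr_add[symmetric])
   finally show ?thesis using C(1) by (subst ennreal_mult[symmetric]) auto
  qed
  finally show "nnint (\<lambda>y. dkernel \<nu> t y r * y powr b) \<le> ennreal (C * r powr b)" .
 qed
qed

section \<open>Exact moments of the kernel and its concentration as the time tends to 0\<close>

lemma poisson_moments:
 fixes s :: real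
 shows "(\<lambda>k. s ^ k / fact k) sums exp s"
  and "(\<lambda>k. s ^ k / fact k * (\<nu> + real k + 1)) sums (exp s * (s + \<nu> + 1))"
  and "(\<lambda>k. s ^ k / fact k * ((\<nu> + real k + 1) * (\<nu> + real k + 2))) sums
   (exp s * (s\<^sup>2 + 2 * (\<nu> + 2) * s + (\<nu> + 1) * (\<nu> + 2)))"
proof -
 show e: "(\<lambda>k. s ^ k / fact k) sums exp s"
  using exp_converges[of s] by (simp add: field_simps)
 have e1: "(\<lambda>k. s ^ k / fact k * real k) sums (s * exp s)"
 proof -
  have "(\<lambda>k. s ^ Suc k / fact (Suc k) * real (Suc k)) = (\<lambda>k. s * (s ^ k / fact k))"
   by (rule ext) (simp add: field_simps del: of_nat_Suc)
  then have "(\<lambda>k. s ^ Suc k / fact (Suc k) * real (Suc k)) sums (s * exp s)"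
   using sums_mult[OF e, of s] by simp
  then show ?thesis by (subst (asm) sums_Suc_iff) simp
 qed
 have e2: "(\<lambda>k. s ^ k / fact k * (real k * (real k - 1))) sums (s\<^sup>2 * exp s)"
 proof -
  have "(\<lambda>k. s ^ Suc k / fact (Suc k) * (real (Suc k) * (real (Suc k) - 1))) = (\<lambda>k. s * (s ^ k / fact k * real k))"
  proof
   fix k
   have "real (Suc k) - 1 = real k" by simp
   then show "s ^ Suc k / fact (Suc k) * (real (Suc k) * (real (Suc k) - 1)) = s * (s ^ k / fact k * real k)"
    by (simp only:) (simp del: of_nat_Suc)
  qed
  then have "(\<lambda>k. s ^ Suc k / fact (Suc k) * (real (Suc k) * (real (Suc k) - 1))) sums (s * (s * exp s))"
   using sums_mult[OF e1, of s] by simp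
  then show ?thesis by (subst (asm) sums_Suc_iff) (simp add: power2_eq_square mult_ac)
 qed
 have "(\<lambda>k. s ^ k / fact k * real k + (\<nu> + 1) * (s ^ k / fact k)) sums (s * exp s + (\<nu> + 1) * exp s)"
  by (intro sums_add sums_mult e e1)
 moreover have "(\<lambda>k. s ^ k / fact k * real k + (\<nu> + 1) * (s ^ k / fact k)) = (\<lambda>k. s ^ k / fact k * (\<nu> + real k + 1))"
 proof
  fix k
  have "q * x + (\<nu> + 1) * q = q * (\<nu> + x + 1)" for q x :: real by algebra
  then show "s ^ k / fact k * real k + (\<nu> + 1) * (s ^ k / fact k) = s ^ k / fact k * (\<nu> + real k + 1)" .
 qed
 ultimately show "(\<lambda>k. s ^ k / fact k * (\<nu> + real k + 1)) sums (exp s * (s + \<nu> + 1))"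
  by (simp add: algebra_simps)
 have "(\<lambda>k. s ^ k / fact k * (real k * (real k - 1)) + (2 * (\<nu> + 2)) * (s ^ k / fact k * real k)
    + ((\<nu> + 1) * (\<nu> + 2)) * (s ^ k / fact k)) sums
   (s\<^sup>2 * exp s + (2 * (\<nu> + 2)) * (s * exp s) + ((\<nu> + 1) * (\<nu> + 2)) * exp s)"
  by (intro sums_add sums_mult e e1 e2)
 moreover have "s ^ k / fact k * (real k * (real k - 1)) + (2 * (\<nu> + 2)) * (s ^ k / fact k * real k)
    + ((\<nu> + 1) * (\<nu> + 2)) * (s ^ k / fact k) = s ^ k / fact k * ((\<nu> + real k + 1) * (\<nu> + real k + 2))" for k
 proof -
  have "q * (x * (x - 1)) + (2 * (\<nu> + 2)) * (q * x) + ((\<nu> + 1) * (\<nu> + 2)) * q = q * ((\<nu> + x + 1) * (\<nu> + x + 2))" for q x :: real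
   by algebra
  then show ?thesis .
 qed
 ultimately show "(\<lambda>k. s ^ k / fact k * ((\<nu> + real k + 1) * (\<nu> + real k + 2))) sums
   (exp s * (s\<^sup>2 + 2 * (\<nu> + 2) * s + (\<nu> + 1) * (\<nu> + 2)))"
  by (simp add: algebra_simps)
qed

text \<open>At the exponents 2 \<nu> + 2 j the quotient of Gamma values is a polynomial
  \<open>P\<close> in k, namely a rising factorial with j factors, and the series for the moment is
  an expectation \<open>Q\<close> of \<open>P\<close> under the Poisson distribution. This is why
  \<open>poisson_moments\<close> is stated for rising factorials.\<close>

lemma dkernel_moment:
 assumes \<nu>: "0 \<le> \<nu>" and t: "0 < t" and y: "0 < y"
  and P: "\<And>k. Gamma (real k + (1 + (2 * \<nu> + 2 * real j) / 2)) * rGamma (\<nu> + real k + 1) = P k"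
  and Q: "(\<lambda>k. (y\<^sup>2 / (4 * t)) ^ k / fact k * P k) sums (exp (y\<^sup>2 / (4 * t)) * Q)"
  and P0: "\<And>k. 0 \<le> P k"
 shows "has_bochner_integral lborel (\<lambda>r. indicator {0<..} r * (dkernel \<nu> t y r * (r powr (2 * \<nu>) * r ^ (2 * j))))
   (y powr (2 * \<nu>) * ((4 * t) ^ j * Q))"
proof -
 let ?s = "y\<^sup>2 / (4 * t)"
 have Q0: "0 \<le> exp ?s * Q" using P0 t by (intro sums_le[OF _ sums_zero Q]) auto
 then have Q0': "0 \<le> Q" by (simp add: zero_le_mult_iff)
 define c where "c = y powr (2 * \<nu>) * (4 * t) ^ j * exp (- ?s)"
 have c: "0 \<le> c" using t by (simp add: c_def)
 have "(nnint_R (\<lambda>r. indicator {0<..} r * (dkernel \<nu> t y r * (r powr (2 * \<nu>) * r ^ (2 * j))))) =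
   nnint (\<lambda>r. dkernel \<nu> t y r * r powr (2 * \<nu> + 2 * real j))"
 proof (rule nn_integral_cong)
  fix r :: real
  have "r powr (2 * \<nu> + 2 * real j) = r powr (2 * \<nu>) * r ^ (2 * j)" if "0 < r"
   using that powr_realpow[of r "2 * j"] by (simp add: powr_add)
  then show "ennreal (indicator {0<..} r * (dkernel \<nu> t y r * (r powr (2 * \<nu>) * r ^ (2 * j)))) =
   ennreal (dkernel \<nu> t y r * r powr (2 * \<nu> + 2 * real j)) * indicator {0<..} r"
   by (cases "0 < r") auto
 qed
 also have "\<dots> = (\<Sum>k. ennreal (y powr (2 * \<nu>) * (4 * t) powr ((2 * \<nu> + 2 * real j) / 2 - \<nu>) * exp (- y\<^sup>2 / (4 * t)) *
    (?s ^ k * Gamma (real k + (1 + (2 * \<nu> + 2 * real j) / 2)) * bessel_coeff \<nu> k)))"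
  using \<nu> by (intro nn_integral_dkernel_powr t y) auto
 also have "\<dots> = (\<Sum>k. ennreal (c * (?s ^ k / fact k * P k)))"
 proof (rule suminf_cong)
  fix k
  have "(4 * t) powr ((2 * \<nu> + 2 * real j) / 2 - \<nu>) = (4 * t) ^ j"
   using t by (simp add: add_divide_distrib powr_realpow)
  then show "ennreal (y powr (2 * \<nu>) * (4 * t) powr ((2 * \<nu> + 2 * real j) / 2 - \<nu>) * exp (- y\<^sup>2 / (4 * t)) *
    (?s ^ k * Gamma (real k + (1 + (2 * \<nu> + 2 * real j) / 2)) * bessel_coeff \<nu> k)) = ennreal (c * (?s ^ k / fact k * P k))"
   unfolding P[symmetric] c_def bessel_coeff_def by (simp add: mult.assoc)
 qed
 also have "\<dots> = ennreal (c * (exp ?s * Q))"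
  using P0 c t by (intro suminf_ennreal_eq sums_mult Q) auto
 also have "c * (exp ?s * Q) = y powr (2 * \<nu>) * ((4 * t) ^ j * Q)"
 proof -
  have "exp (- ?s) * exp ?s = 1" by (simp add: exp_add[symmetric])
  then have "c * (exp ?s * Q) = y powr (2 * \<nu>) * (4 * t) ^ j * (exp (- ?s) * exp ?s) * Q"
   unfolding c_def by (simp only: mult_ac)
  then show ?thesis by (simp add: exp_add[symmetric])
 qed
 finally show ?thesis
  using \<nu> t y Q0' by (intro has_bochner_integral_nn_integral)
   (auto intro!: AE_I2 mult_nonneg_nonneg less_imp_le[OF dkernel_pos] simp: indicator_def)
qed

lemma Gamma_rGamma_plus:
 assumes "0 < (x::real)"
 shows "Gamma x * rGamma x = 1" "Gamma (x + 1) * rGamma x = x" "Gamma (x + 2) * rGamma x = x * (x + 1)"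
proof -
 have x: "x \<notin> \<int>\<^sub>\<le>\<^sub>0" "x + 1 \<notin> \<int>\<^sub>\<le>\<^sub>0"
  using assms by (auto elim!: nonpos_Ints_cases)
 show 1: "Gamma x * rGamma x = 1"
  using Gamma_real_pos[OF assms] by (simp add: rGamma_inverse_Gamma)
 show "Gamma (x + 1) * rGamma x = x"
  using 1 Gamma_plus1[OF x(1)] by simp
 have "x + 2 = x + 1 + 1" by simp
 then show "Gamma (x + 2) * rGamma x = x * (x + 1)"
  using 1 Gamma_plus1[OF x(1)] Gamma_plus1[OF x(2)] by (simp only:) simp
qed

text \<open>
 The kernel, divided by \<open>y powr (2 * \<nu>)\<close> and weighted by \<open>r powr (2 * \<nu>)\<close>, is a probability density
 in \<open>r\<close>, and these are the mean and the variance that Chebyshev's argument requires.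
\<close>

lemma dkernel_mass:
 assumes \<nu>: "0 \<le> \<nu>" and t: "0 < t" and y: "0 < y"
 shows "has_bochner_integral lborel (\<lambda>r. indicator {0<..} r * (dkernel \<nu> t y r * r powr (2 * \<nu>)))
   (y powr (2 * \<nu>))"
proof -
 have "has_bochner_integral lborel (\<lambda>r. indicator {0<..} r * (dkernel \<nu> t y r * (r powr (2 * \<nu>) * r ^ (2 * 0))))
   (y powr (2 * \<nu>) * ((4 * t) ^ 0 * 1))"
 proof (rule dkernel_moment[OF assms])
  fix k
  show "Gamma (real k + (1 + (2 * \<nu> + 2 * real 0) / 2)) * rGamma (\<nu> + real k + 1) = 1"
   using Gamma_rGamma_plus(1)[of "\<nu> + real k + 1"] \<nu> by (simp add: add_ac)
 qed (use poisson_moments(1) in auto)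
 then show ?thesis by simp
qed

lemma dkernel_variance:
 assumes \<nu>: "0 \<le> \<nu>" and t: "0 < t" and y: "0 < y"
 shows "has_bochner_integral lborel (\<lambda>r. indicator {0<..} r * (dkernel \<nu> t y r * (r powr (2 * \<nu>) * (r\<^sup>2 - y\<^sup>2)\<^sup>2)))
   (y powr (2 * \<nu>) * (8 * t * y\<^sup>2 + 16 * t\<^sup>2 * ((\<nu> + 1) * (\<nu> + 2))))"
proof -
 let ?s = "y\<^sup>2 / (4 * t)"
 have p: "0 < \<nu> + real k + 1" for k using \<nu> by simp
 have m0: "has_bochner_integral lborel (\<lambda>r. indicator {0<..} r * (dkernel \<nu> t y r * (r powr (2 * \<nu>) * r ^ (2 * 0))))
   (y powr (2 * \<nu>) * ((4 * t) ^ 0 * 1))"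
  using dkernel_mass[OF assms] by simp
 have m1: "has_bochner_integral lborel (\<lambda>r. indicator {0<..} r * (dkernel \<nu> t y r * (r powr (2 * \<nu>) * r ^ (2 * 1))))
   (y powr (2 * \<nu>) * ((4 * t) ^ 1 * (?s + \<nu> + 1)))"
 proof (rule dkernel_moment[OF assms _ poisson_moments(2)])
  fix k
  show "Gamma (real k + (1 + (2 * \<nu> + 2 * real 1) / 2)) * rGamma (\<nu> + real k + 1) = \<nu> + real k + 1"
   using Gamma_rGamma_plus(2)[OF p[of k]] by (simp add: add_divide_distrib add_ac)
 qed (use \<nu> in auto)
 have m2: "has_bochner_integral lborel (\<lambda>r. indicator {0<..} r * (dkernel \<nu> t y r * (r powr (2 * \<nu>) * r ^ (2 * 2))))
   (y powr (2 * \<nu>) * ((4 * t) ^ 2 * (?s\<^sup>2 + 2 * (\<nu> + 2) * ?s + (\<nu> + 1) * (\<nu> + 2))))"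
 proof (rule dkernel_moment[OF assms _ poisson_moments(3)])
  fix k
  show "Gamma (real k + (1 + (2 * \<nu> + 2 * real 2) / 2)) * rGamma (\<nu> + real k + 1) = (\<nu> + real k + 1) * (\<nu> + real k + 2)"
   using Gamma_rGamma_plus(3)[OF p[of k]] by (simp add: add_divide_distrib add_ac)
 qed (use \<nu> in auto)
 have "has_bochner_integral lborel (\<lambda>r. indicator {0<..} r * (dkernel \<nu> t y r * (r powr (2 * \<nu>) * r ^ (2 * 2)))
   - (2 * y\<^sup>2) * (indicator {0<..} r * (dkernel \<nu> t y r * (r powr (2 * \<nu>) * r ^ (2 * 1))))
   + y ^ 4 * (indicator {0<..} r * (dkernel \<nu> t y r * (r powr (2 * \<nu>) * r ^ (2 * 0)))))
  (y powr (2 * \<nu>) * ((4 * t) ^ 2 * (?s\<^sup>2 + 2 * (\<nu> + 2) * ?s + (\<nu> + 1) * (\<nu> + 2)))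
   - (2 * y\<^sup>2) * (y powr (2 * \<nu>) * ((4 * t) ^ 1 * (?s + \<nu> + 1)))
   + y ^ 4 * (y powr (2 * \<nu>) * ((4 * t) ^ 0 * 1)))"
  by (intro has_bochner_integral_add has_bochner_integral_diff has_bochner_integral_mult_right m0 m1 m2)
 moreover have "y powr (2 * \<nu>) * ((4 * t) ^ 2 * (?s\<^sup>2 + 2 * (\<nu> + 2) * ?s + (\<nu> + 1) * (\<nu> + 2)))
   - (2 * y\<^sup>2) * (y powr (2 * \<nu>) * ((4 * t) ^ 1 * (?s + \<nu> + 1)))
   + y ^ 4 * (y powr (2 * \<nu>) * ((4 * t) ^ 0 * 1))
   = y powr (2 * \<nu>) * (8 * t * y\<^sup>2 + 16 * t\<^sup>2 * ((\<nu> + 1) * (\<nu> + 2)))"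
 proof -
  define s where "s = ?s"
  have "y\<^sup>2 = 4 * t * s" using t by (simp add: s_def)
  moreover have "y ^ 4 = (y\<^sup>2)\<^sup>2" by simp
  moreover have "Y * ((4 * t)\<^sup>2 * (s\<^sup>2 + 2 * (\<nu> + 2) * s + (\<nu> + 1) * (\<nu> + 2)))
   - (2 * (4 * t * s)) * (Y * ((4 * t) * (s + \<nu> + 1))) + (4 * t * s)\<^sup>2 * (Y * (1 * 1))
   = Y * (8 * t * (4 * t * s) + 16 * t\<^sup>2 * ((\<nu> + 1) * (\<nu> + 2)))" for Y by algebra
  ultimately show ?thesis unfolding s_def[symmetric] by (simp only: power_one_right power_0)
 qed
 moreover have "indicator {0<..} r * (dkernel \<nu> t y r * (r powr (2 * \<nu>) * r ^ (2 * 2)))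
   - (2 * y\<^sup>2) * (indicator {0<..} r * (dkernel \<nu> t y r * (r powr (2 * \<nu>) * r ^ (2 * 1))))
   + y ^ 4 * (indicator {0<..} r * (dkernel \<nu> t y r * (r powr (2 * \<nu>) * r ^ (2 * 0))))
   = indicator {0<..} r * (dkernel \<nu> t y r * (r powr (2 * \<nu>) * (r\<^sup>2 - y\<^sup>2)\<^sup>2))" for r :: real
  by simp algebra
 ultimately show ?thesis by simp
qed

text \<open>Chebyshev's argument in the variable r^2, whose first two moments are explicit. The
  variance is of order t for fixed y, so that only the continuity of w at y and its boundedness
  matter.\<close>

lemma dkernel_concentration:
 fixes w :: "real \<Rightarrow> real"
 assumes \<nu>: "0 \<le> \<nu>" and y: "0 < y"
  and [measurable]: "w \<in> borel_measurable borel" and M: "\<And>r. \<bar>w r\<bar> \<le> M" and cont: "isCont w y"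
 shows "((\<lambda>t. LINT r|lborel. indicator {0<..} r * (dkernel \<nu> t y r * r powr (2 * \<nu>)) * w r)
   \<longlongrightarrow> y powr (2 * \<nu>) * w y) (at_right 0)"
proof -
 let ?Z = "\<lambda>t r. indicator {0<..} r * (dkernel \<nu> t y r * (r powr (2 * \<nu>) * (r\<^sup>2 - y\<^sup>2)\<^sup>2))"
 let ?V = "\<lambda>t. 8 * t * y\<^sup>2 + 16 * t\<^sup>2 * ((\<nu> + 1) * (\<nu> + 2))"
 let ?k = "\<lambda>t r. indicator {0<..} r * (dkernel \<nu> t y r * r powr (2 * \<nu>))"
 have k0: "0 \<le> ?k t r" if "0 < t" for t r
  using that \<nu> y less_imp_le[OF dkernel_pos] by (auto simp: indicator_def)
 have mass: "has_bochner_integral lborel (?k t) (y powr (2 * \<nu>))" if "0 < t" for t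
  using dkernel_mass[OF \<nu> that y] by simp
 have int: "integrable lborel (\<lambda>r. ?k t r * w r)" if "0 < t" for t
 proof (rule Bochner_Integration.integrable_bound)
  show "integrable lborel (\<lambda>r. ?k t r * M)"
   using mass[OF that] by (auto simp: has_bochner_integral_iff)
  show "AE r in lborel. norm (?k t r * w r) \<le> norm (?k t r * M)"
   using M k0[OF that] by (intro AE_I2) (auto simp: abs_mult intro!: mult_left_mono order_trans[OF M])
 qed measurable
 have est: "\<exists>K. \<forall>t>0. \<bar>(LINT r|lborel. ?k t r * w r) - y powr (2 * \<nu>) * w y\<bar> \<le>
   y powr (2 * \<nu>) * (e + K * (?V t))" if e: "0 < e" for e
 proof -
  obtain d where d: "0 < d" "\<And>r. \<bar>r - y\<bar> < d \<Longrightarrow> \<bar>w r - w y\<bar> < e"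
   using cont e unfolding continuous_at_eps_delta by (auto simp: dist_real_def)
  \<comment> \<open>For |r - y| at least d one has |r^2 - y^2| at least d y, and then the term with
    \<open>K\<close> is at least 2 M, which bounds any difference of values of w.\<close>
  define K where "K = 2 * M / (d * y)\<^sup>2"
  have M0: "0 \<le> M" using M[of 0] by linarith
  have pw: "\<bar>w r - w y\<bar> \<le> e + K * (r\<^sup>2 - y\<^sup>2)\<^sup>2" if r: "0 < r" for r
  proof (cases "\<bar>r - y\<bar> < d")
   case True
   then show ?thesis using d(2)[OF True] M0 by (simp add: K_def add_increasing2)
  next
   case False
   have "d * y \<le> \<bar>r - y\<bar> * (r + y)" using False r y d by (intro mult_mono) auto
   also have "\<dots> = \<bar>r\<^sup>2 - y\<^sup>2\<bar>" using r y by (simp add: square_diff_square_factored abs_mult power2_eq_square)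
   finally have "(d * y)\<^sup>2 \<le> (r\<^sup>2 - y\<^sup>2)\<^sup>2" using d y by (metis abs_le_square_iff abs_mult abs_of_pos)
   then have "2 * M * 1 \<le> 2 * M * ((r\<^sup>2 - y\<^sup>2)\<^sup>2 / (d * y)\<^sup>2)"
    using M0 d y by (intro mult_left_mono) (auto simp: divide_simps)
   moreover have "\<bar>w r - w y\<bar> \<le> 2 * M" using M[of r] M[of y] by linarith
   ultimately show ?thesis using e by (simp add: K_def)
  qed
  have "\<bar>(LINT r|lborel. ?k t r * w r) - y powr (2 * \<nu>) * w y\<bar> \<le>
   y powr (2 * \<nu>) * (e + K * (?V t))" if t: "0 < t" for t
  proof -
   note ms = mass[OF t]
   have msi: "integrable lborel (\<lambda>r. ?k t r * w y)" and mse: "(LINT r|lborel. ?k t r * w y) = y powr (2 * \<nu>) * w y"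
   proof -
    have "has_bochner_integral lborel (\<lambda>r. ?k t r * w y) (y powr (2 * \<nu>) * w y)"
     by (intro has_bochner_integral_mult_left ms)
    then show "integrable lborel (\<lambda>r. ?k t r * w y)" "(LINT r|lborel. ?k t r * w y) = y powr (2 * \<nu>) * w y"
     unfolding has_bochner_integral_iff by blast+
   qed
   have i1: "has_bochner_integral lborel (\<lambda>r. e * ?k t r + K * (?Z t r))
     (e * y powr (2 * \<nu>) + K * (y powr (2 * \<nu>) * (?V t)))"
    by (intro has_bochner_integral_add has_bochner_integral_mult_right ms dkernel_variance \<nu> t y)
   have eq: "(LINT r|lborel. ?k t r * w r) - y powr (2 * \<nu>) * w y = (LINT r|lborel. ?k t r * w r - ?k t r * w y)"
    by (simp only: Bochner_Integration.integral_diff[OF int[OF t] msi] mse)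
   have "\<bar>(LINT r|lborel. ?k t r * w r) - y powr (2 * \<nu>) * w y\<bar> \<le> (LINT r|lborel. \<bar>?k t r * w r - ?k t r * w y\<bar>)"
    unfolding eq by (rule integral_abs_bound)
   also have "\<dots> \<le> (LINT r|lborel. e * ?k t r + K * (?Z t r))"
   proof (rule integral_mono)
    show "integrable lborel (\<lambda>r. \<bar>?k t r * w r - ?k t r * w y\<bar>)"
     by (rule integrable_abs[OF Bochner_Integration.integrable_diff[OF int[OF t] msi]])
    show "integrable lborel (\<lambda>r. e * ?k t r + K * (?Z t r))"
     by (rule has_bochner_integral_iff[THEN iffD1, OF i1, THEN conjunct1])
    fix r :: real
    show "\<bar>?k t r * w r - ?k t r * w y\<bar> \<le> e * ?k t r + K * (?Z t r)"
    proof (cases "0 < r")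
     case True
     have "\<bar>?k t r * w r - ?k t r * w y\<bar> = ?k t r * \<bar>w r - w y\<bar>"
      unfolding right_diff_distrib[symmetric] abs_mult[of "?k t r"] abs_of_nonneg[OF k0[OF t, of r]] ..
     also have "\<dots> \<le> ?k t r * (e + K * (r\<^sup>2 - y\<^sup>2)\<^sup>2)"
      using k0[OF t, of r] pw[OF True] by (rule mult_left_mono[rotated])
     finally show ?thesis by (simp add: algebra_simps)
    qed simp
   qed
   also have "\<dots> = e * y powr (2 * \<nu>) + K * (y powr (2 * \<nu>) * (?V t))"
    by (rule has_bochner_integral_integral_eq[OF i1])
   finally show ?thesis by (simp only: distrib_left mult_ac)
  qed
  then show ?thesis by blast
 qed
 show ?thesis
 proof (rule tendstoI)
  fix \<epsilon> :: real assume \<epsilon>: "0 < \<epsilon>"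
  define e where "e = \<epsilon> / (2 * y powr (2 * \<nu>))"
  have "0 < e" using \<epsilon> y by (simp add: e_def)
  from est[OF this] obtain K where K: "\<And>t. 0 < t \<Longrightarrow> \<bar>(LINT r|lborel. ?k t r * w r) - y powr (2 * \<nu>) * w y\<bar> \<le>
   y powr (2 * \<nu>) * (e + K * (?V t))" by blast
  have "((\<lambda>t. y powr (2 * \<nu>) * (e + K * (?V t))) \<longlongrightarrow>
    y powr (2 * \<nu>) * (e + K * (8 * 0 * y\<^sup>2 + 16 * 0\<^sup>2 * ((\<nu> + 1) * (\<nu> + 2))))) (at_right 0)"
   by (intro tendsto_intros)
  moreover have "y powr (2 * \<nu>) * (e + K * (8 * 0 * y\<^sup>2 + 16 * 0\<^sup>2 * ((\<nu> + 1) * (\<nu> + 2)))) < \<epsilon>"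
   using \<epsilon> y by (simp add: e_def)
  ultimately have "\<forall>\<^sub>F t in at_right 0. y powr (2 * \<nu>) * (e + K * (?V t)) < \<epsilon>"
   by (rule order_tendstoD)
  moreover have "\<forall>\<^sub>F t in at_right (0::real). 0 < t" by (simp add: eventually_at_right_less)
  ultimately show "\<forall>\<^sub>F t in at_right 0. dist (LINT r|lborel. ?k t r * w r) (y powr (2 * \<nu>) * w y) < \<epsilon>"
   by eventually_elim (use K in \<open>force simp: dist_real_def\<close>)
 qed
qed

section \<open>Schur's test\<close>

text \<open>Young's inequality for the product of (x^p l^(1 - p))^(1/p) and l^(1 - 1/p), which is x.
  The free parameter l is chosen later so as to recover the sharp scaling of Hoelder's
  inequality.\<close>

lemma Young_scaled:
 assumes "1 < p" "0 \<le> x" "0 < (l::real)"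
 shows "x \<le> x powr p * l powr (1 - p) / p + l * (p - 1) / p"
proof (cases "x = 0")
 case True
 then show ?thesis using assms by simp
next
 case False
 have "(x powr p * l powr (1 - p)) powr (1 / p) * l powr (1 - 1 / p) \<le> (1 / p) * (x powr p * l powr (1 - p)) + (1 - 1 / p) * l"
  using assms False by (intro Youngs_inequality_0) auto
 moreover have "(x powr p * l powr (1 - p)) powr (1 / p) * l powr (1 - 1 / p) = x"
  using assms False by (simp add: powr_mult powr_powr powr_add[symmetric] diff_divide_distrib)
 moreover have "(1 - 1 / p) * l = l * (p - 1) / p" using assms by (simp add: field_simps)
 ultimately show ?thesis by (simp add: mult.commute)
qed

text \<open>\<open>Young_scaled\<close> is applied to the quotient g / h and integrated against the
  weight k h.\<close>

lemma nn_integral_Young: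
 assumes p: "1 < p" and l: "0 < l"
  and [measurable]: "k \<in> borel_measurable M" "g \<in> borel_measurable M" "h \<in> borel_measurable M"
  and k: "\<And>x. 0 \<le> k x" and g: "\<And>x. 0 \<le> g x" and h: "\<And>x. k x \<noteq> 0 \<Longrightarrow> 0 < h x"
 shows "(\<integral>\<^sup>+x. ennreal (k x * g x) \<partial>M) \<le>
  ennreal (l powr (1 - p) / p) * (\<integral>\<^sup>+x. ennreal (k x * (g x powr p * h x powr (1 - p))) \<partial>M) +
  ennreal (l * (p - 1) / p) * (\<integral>\<^sup>+x. ennreal (k x * h x) \<partial>M)"
proof -
 let ?K = "\<lambda>x. k x * (g x powr p * h x powr (1 - p))"
 have "(\<integral>\<^sup>+x. ennreal (k x * g x) \<partial>M) \<le> (\<integral>\<^sup>+x. ennreal (l powr (1 - p) / p) * ennreal (?K x) +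
   ennreal (l * (p - 1) / p) * ennreal (k x * h x) \<partial>M)"
 proof (rule nn_integral_mono)
  fix x
  show "ennreal (k x * g x) \<le> ennreal (l powr (1 - p) / p) * ennreal (?K x) +
   ennreal (l * (p - 1) / p) * ennreal (k x * h x)"
  proof (cases "k x = 0")
   case False
   then have h0: "0 < h x" by (rule h)
   have "g x / h x \<le> (g x / h x) powr p * l powr (1 - p) / p + l * (p - 1) / p"
    using p l g h0 by (intro Young_scaled) auto
   then have "k x * h x * (g x / h x) \<le> k x * h x * ((g x / h x) powr p * l powr (1 - p) / p + l * (p - 1) / p)"
    using k[of x] h0 by (intro mult_left_mono) auto
   moreover have "h x * (g x / h x) powr p = g x powr p * h x powr (1 - p)"
    using h0 g[of x] by (simp add: powr_divide powr_diff)
   moreover have "k x * h x * (g x / h x) = k x * g x" using h0 by simp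
   moreover have "k x * h x * ((g x / h x) powr p * l powr (1 - p) / p + l * (p - 1) / p) =
    l powr (1 - p) / p * (k x * (h x * (g x / h x) powr p)) + l * (p - 1) / p * (k x * h x)"
    by (simp add: algebra_simps add_divide_distrib diff_divide_distrib)
   ultimately have "k x * g x \<le> l powr (1 - p) / p * (?K x) + l * (p - 1) / p * (k x * h x)"
    by simp
   then have "ennreal (k x * g x) \<le> ennreal (l powr (1 - p) / p * (?K x) + l * (p - 1) / p * (k x * h x))"
    by (rule ennreal_leI)
   also have "\<dots> = ennreal (l powr (1 - p) / p * (?K x)) + ennreal (l * (p - 1) / p * (k x * h x))"
    using p l k[of x] h0 by (intro ennreal_plus) auto
   also have "\<dots> = ennreal (l powr (1 - p) / p) * ennreal (?K x) + ennreal (l * (p - 1) / p) * ennreal (k x * h x)"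
    using p l by (intro arg_cong2[of _ _ _ _ "(+)"] ennreal_mult') auto
   finally show ?thesis .
  qed simp
 qed
 also have "\<dots> = ennreal (l powr (1 - p) / p) * (\<integral>\<^sup>+x. ennreal (?K x) \<partial>M) +
  ennreal (l * (p - 1) / p) * (\<integral>\<^sup>+x. ennreal (k x * h x) \<partial>M)"
  by (simp add: nn_integral_add nn_integral_cmult)
 finally show ?thesis .
qed

text \<open>The choice l = T / H optimises \<open>nn_integral_Young\<close>. The number T is a
  finite lower bound for the integral of k g, so that the term T - T / p on the right can be
  subtracted even when this integral is infinite.\<close>

lemma nn_integral_Hoelder:
 assumes p: "1 < p" and H: "0 < H" and T: "0 \<le> T" "ennreal T \<le> (\<integral>\<^sup>+x. ennreal (k x * g x) \<partial>M)"
  and [measurable]: "k \<in> borel_measurable M" "g \<in> borel_measurable M" "h \<in> borel_measurable M"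
  and k: "\<And>x. 0 \<le> k x" and g: "\<And>x. 0 \<le> g x" and h: "\<And>x. k x \<noteq> 0 \<Longrightarrow> 0 < h x"
  and kh: "(\<integral>\<^sup>+x. ennreal (k x * h x) \<partial>M) \<le> ennreal H"
 shows "ennreal (T powr p) \<le> ennreal (H powr (p - 1)) * (\<integral>\<^sup>+x. ennreal (k x * (g x powr p * h x powr (1 - p))) \<partial>M)"
proof (cases "T = 0")
 case False
 then have T0: "0 < T" using T by simp
 let ?J = "\<integral>\<^sup>+x. ennreal (k x * (g x powr p * h x powr (1 - p))) \<partial>M"
 show ?thesis
 proof (cases "?J = \<infinity>")
  case True
  then show ?thesis using H by (simp add: ennreal_mult_top)
 next
  case False
  then obtain j where j: "?J = ennreal j" "0 \<le> j" by (cases ?J) auto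
  let ?l = "T / H"
  have l: "0 < ?l" using T0 H by simp
  have "ennreal T \<le> ennreal (?l powr (1 - p) / p) * ennreal j + ennreal (?l * (p - 1) / p) * ennreal H"
  proof -
   have "ennreal T \<le> ennreal (?l powr (1 - p) / p) * ?J + ennreal (?l * (p - 1) / p) * (\<integral>\<^sup>+x. ennreal (k x * h x) \<partial>M)"
    by (rule order_trans[OF T(2) nn_integral_Young[OF p l _ _ _ k g h]]) simp_all
   also have "\<dots> \<le> ennreal (?l powr (1 - p) / p) * ?J + ennreal (?l * (p - 1) / p) * ennreal H"
    by (intro add_left_mono mult_left_mono kh) simp
   finally show ?thesis unfolding j(1) .
  qed
  also have "\<dots> = ennreal (?l powr (1 - p) / p * j + ?l * (p - 1) / p * H)"
   using p H T0 j(2) by (subst (1 2) ennreal_mult'[symmetric]) (auto simp: ennreal_plus[symmetric] simp del: ennreal_plus)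
  finally have "T \<le> ?l powr (1 - p) / p * j + ?l * (p - 1) / p * H"
   using p H T0 j(2) by (subst (asm) ennreal_le_iff) auto
  also have "?l * (p - 1) / p * H = T - T / p" using H p by (simp add: field_simps)
  finally have "T / p \<le> ?l powr (1 - p) / p * j" by simp
  then have "T \<le> ?l powr (1 - p) * j" using p by (simp add: divide_simps split: if_splits)
  then have "T * ?l powr (p - 1) \<le> ?l powr (1 - p) * j * ?l powr (p - 1)"
   by (rule mult_right_mono) simp
  also have "\<dots> = (?l powr (1 - p) * ?l powr (p - 1)) * j" by (simp only: mult_ac)
  also have "\<dots> = j" using T0 H by (simp add: powr_add[symmetric])
  finally have "T * (T powr (p - 1) / H powr (p - 1)) \<le> j" using T0 H by (simp add: powr_divide)
  then have "T * T powr (p - 1) \<le> H powr (p - 1) * j" using H by (simp add: divide_simps mult.commute)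
  then have "T powr p \<le> H powr (p - 1) * j" using T0 by (simp add: powr_mult_base)
  then show ?thesis unfolding j(1) by (subst ennreal_mult'[symmetric]) (auto intro!: ennreal_leI)
 qed
qed simp

text \<open>Hoelder's inequality with the test function \<open>r powr a\<close> gives
  \<open>T y powr p\<close> at most (C1 y^a)^(p - 1) times the integral of k g^p r^(a (1 - p)).
  After multiplication by \<open>y powr m\<close> and exchange of the integrals, the integral in y
  carries the exponent m + a (p - 1), which is the one in the hypothesis on C2.\<close>

lemma schur_test:
 fixes k :: "real \<Rightarrow> real \<Rightarrow> real" and g T :: "real \<Rightarrow> real"
 assumes p: "1 < p" and C: "0 < C1" "0 \<le> C2"
  and k[measurable]: "case_prod k \<in> borel_measurable borel" and [measurable]: "g \<in> borel_measurable borel"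
  and k0: "\<And>y r. 0 < y \<Longrightarrow> 0 < r \<Longrightarrow> 0 \<le> k y r" and g0: "\<And>r. 0 < r \<Longrightarrow> 0 \<le> g r"
  and C1: "\<And>y. 0 < y \<Longrightarrow> nnint (\<lambda>r. k y r * r powr a) \<le> ennreal (C1 * y powr a)"
  and C2: "\<And>r. 0 < r \<Longrightarrow> nnint (\<lambda>y. k y r * y powr (m + a * (p - 1))) \<le> ennreal (C2 * r powr (m + a * (p - 1)))"
  and T0: "\<And>y. 0 < y \<Longrightarrow> 0 \<le> T y"
  and T: "\<And>y. 0 < y \<Longrightarrow> ennreal (T y) \<le> nnint (\<lambda>r. k y r * g r)"
 shows "nnint (\<lambda>y. y powr m * T y powr p) \<le>
   ennreal (C1 powr (p - 1) * C2) * nnint (\<lambda>r. r powr m * g r powr p)"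
proof -
 let ?Y = "\<lambda>y r. k y r * (g r powr p * r powr (a * (1 - p)))"
 let ?Z = "\<lambda>y r. k y r * (g r powr p * r powr (a * (1 - p)) * y powr (m + a * (p - 1)))"
 let ?I = "\<lambda>x::real. indicator {0<..} x :: real"
 have [measurable]: "(\<lambda>x. k (f x) (h x)) \<in> borel_measurable M" if "f \<in> borel_measurable M" "h \<in> borel_measurable M"
  for f h and M :: "'b measure"
  using measurable_compose[OF borel_measurable_Pair[OF that] k] by simp
 have I: "ennreal x * indicator {0<..} r = ennreal (?I r * x)" for x r :: real
  by (simp add: indicator_def)
 have step: "ennreal (y powr m * T y powr p) \<le>
   (\<integral>\<^sup>+r. ennreal (C1 powr (p - 1)) * ennreal (?I r * (?Z y r)) \<partial>lborel)"
  if y: "0 < y" for y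
 proof -
  have "ennreal (T y powr p) \<le> ennreal ((C1 * y powr a) powr (p - 1)) *
    (nnint_R (\<lambda>r. (?I r * k y r) * ((?I r * g r) powr p * (r powr a) powr (1 - p))))"
  proof (rule nn_integral_Hoelder[OF p])
   show "0 < C1 * y powr a" using C y by simp
   show "ennreal (T y) \<le> (nnint_R (\<lambda>r. (?I r * k y r) * (?I r * g r)))"
    using T[OF y] by (rule order_trans) (auto intro!: nn_integral_mono simp: indicator_def)
   show "(nnint_R (\<lambda>r. (?I r * k y r) * r powr a)) \<le> ennreal (C1 * y powr a)"
    using C1[OF y] by (rule order_trans[rotated]) (auto intro!: nn_integral_mono simp: indicator_def)
  qed (use T0[OF y] k0[OF y] g0 in \<open>auto simp: indicator_def\<close>)
  also have "\<dots> = ennreal (C1 powr (p - 1)) * (ennreal (y powr (a * (p - 1))) *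
    (nnint_R (\<lambda>r. ?I r * (?Y y r))))"
  proof -
   have "(C1 * y powr a) powr (p - 1) = C1 powr (p - 1) * y powr (a * (p - 1))"
    using C by (simp add: powr_mult powr_powr)
   moreover have "(nnint_R (\<lambda>r. (?I r * k y r) * ((?I r * g r) powr p * (r powr a) powr (1 - p)))) =
     (nnint_R (\<lambda>r. ?I r * (?Y y r)))"
    by (intro nn_integral_cong) (auto simp: indicator_def powr_powr)
   ultimately show ?thesis by (simp add: ennreal_mult mult.assoc)
  qed
  finally have "ennreal (y powr m) * ennreal (T y powr p) \<le> ennreal (y powr m) * \<dots>"
   by (rule mult_left_mono) simp
  also have "\<dots> = ennreal (C1 powr (p - 1)) * (ennreal (y powr (m + a * (p - 1))) *
    (nnint_R (\<lambda>r. ?I r * (?Y y r))))"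
   by (simp add: powr_add ennreal_mult mult_ac)
  also have "\<dots> = (\<integral>\<^sup>+r. ennreal (C1 powr (p - 1)) * (ennreal (y powr (m + a * (p - 1))) *
    ennreal (?I r * (?Y y r))) \<partial>lborel)"
   by (simp add: nn_integral_cmult)
  also have "\<dots> = (\<integral>\<^sup>+r. ennreal (C1 powr (p - 1)) * ennreal (?I r * (?Z y r)) \<partial>lborel)"
   by (simp add: ennreal_mult'[symmetric] mult_ac)
  finally show ?thesis by (simp add: ennreal_mult)
 qed
 have "nnint (\<lambda>y. y powr m * T y powr p) \<le>
   (\<integral>\<^sup>+y. (\<integral>\<^sup>+r. ennreal (C1 powr (p - 1)) * ennreal (?I y * (?I r * (?Z y r))) \<partial>lborel) \<partial>lborel)"
  using step by (intro nn_integral_mono) (auto simp: indicator_def)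
 also have "\<dots> = (\<integral>\<^sup>+r. (\<integral>\<^sup>+y. ennreal (C1 powr (p - 1)) * ennreal (?I y * (?I r * (?Z y r))) \<partial>lborel) \<partial>lborel)"
  by (rule lborel_pair.Fubini') simp
 also have "\<dots> \<le> (\<integral>\<^sup>+r. ennreal (C1 powr (p - 1) * C2) * (ennreal (r powr m * g r powr p) * indicator {0<..} r) \<partial>lborel)"
 proof (rule nn_integral_mono)
  fix r :: real
  show "(\<integral>\<^sup>+y. ennreal (C1 powr (p - 1)) * ennreal (?I y * (?I r * (?Z y r))) \<partial>lborel)
    \<le> ennreal (C1 powr (p - 1) * C2) * (ennreal (r powr m * g r powr p) * indicator {0<..} r)"
  proof (cases "0 < r")
   case True
   let ?c = "C1 powr (p - 1) * (g r powr p * r powr (a * (1 - p)))"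
   have "(\<integral>\<^sup>+y. ennreal (C1 powr (p - 1)) * ennreal (?I y * (?I r * (?Z y r))) \<partial>lborel)
    = (\<integral>\<^sup>+y. ennreal ?c * (ennreal (k y r * y powr (m + a * (p - 1))) * indicator {0<..} y) \<partial>lborel)"
   proof (rule nn_integral_cong)
    fix y :: real
    have "ennreal (C1 powr (p - 1)) * ennreal (?Z y r) =
      ennreal (C1 powr (p - 1) * (?Z y r))"
     by (rule ennreal_mult'[symmetric]) simp
    also have "\<dots> = ennreal (?c * (k y r * y powr (m + a * (p - 1))))"
     by (simp only: mult_ac)
    also have "\<dots> = ennreal ?c * ennreal (k y r * y powr (m + a * (p - 1)))"
     by (rule ennreal_mult') simp
    finally show "ennreal (C1 powr (p - 1)) * ennreal (?I y * (?I r * (?Z y r))) =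
      ennreal ?c * (ennreal (k y r * y powr (m + a * (p - 1))) * indicator {0<..} y)"
     using True by (simp add: indicator_def)
   qed
   also have "\<dots> = ennreal ?c * nnint (\<lambda>y. k y r * y powr (m + a * (p - 1)))"
    by (rule nn_integral_cmult) simp
   also have "\<dots> \<le> ennreal ?c * ennreal (C2 * r powr (m + a * (p - 1)))"
    by (intro mult_left_mono C2 True) auto
   also have "\<dots> = ennreal (C1 powr (p - 1) * C2 * (g r powr p * (r powr (a * (1 - p)) * r powr (m + a * (p - 1)))))"
    by (subst ennreal_mult'[symmetric]) (auto simp: mult_ac)
   also have "r powr (a * (1 - p)) * r powr (m + a * (p - 1)) = r powr m"
    by (simp add: powr_add[symmetric] algebra_simps)
   finally show ?thesis using True C by (simp add: ennreal_mult'[symmetric] mult_ac)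
  qed simp
 qed
 also have "\<dots> = ennreal (C1 powr (p - 1) * C2) * nnint (\<lambda>r. r powr m * g r powr p)"
  by (rule nn_integral_cmult) simp
 finally show ?thesis .
qed

section \<open>Weighted Lebesgue spaces\<close>

text \<open>The power \<open>p\<close> of the norm, with values in the extended reals; only a quasi-triangle inequality is needed.\<close>

definition power_norm :: "real \<Rightarrow> real \<Rightarrow> (real \<Rightarrow> complex) \<Rightarrow> ennreal" where
 "power_norm m p f = nnint (\<lambda>y. y powr m * norm (f y) powr p)"

abbreviation hl_measurable :: "(real \<Rightarrow> 'a::real_normed_vector) \<Rightarrow> bool" where
 "hl_measurable f \<equiv> set_borel_measurable lborel {0<..} f"

text \<open>Extension by zero turns measurability on the half-line into Borel measurability on the
  line, to which automated measurability proofs apply.\<close>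

definition ext0 :: "(real \<Rightarrow> 'a::zero) \<Rightarrow> real \<Rightarrow> 'a" where
 "ext0 f y = (if 0 < y then f y else 0)"

lemma hl_measurable_iff: "hl_measurable f \<longleftrightarrow> ext0 f \<in> borel_measurable borel"
proof -
 have "(\<lambda>x. indicat_real {0<..} x *\<^sub>R f x) = ext0 f" by (auto simp: ext0_def indicator_def)
 then show ?thesis by (simp add: set_borel_measurable_def)
qed

lemma hl_measurableI:
 fixes f :: "real \<Rightarrow> 'a::{second_countable_topology, real_normed_vector}"
 shows "f \<in> borel_measurable borel \<Longrightarrow> hl_measurable f"
 by (simp add: set_borel_measurable_def)

lemma hl_measurable_cong:
 "(\<And>y. 0 < y \<Longrightarrow> f y = g y) \<Longrightarrow> hl_measurable f \<longleftrightarrow> hl_measurable g"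
proof -
 assume "\<And>y. 0 < y \<Longrightarrow> f y = g y"
 then have "ext0 f = ext0 g" by (auto simp: ext0_def)
 then show ?thesis by (simp add: hl_measurable_iff)
qed

lemma hl_measurable_continuous:
 fixes f :: "real \<Rightarrow> 'a::euclidean_space"
 assumes "continuous_on {0<..} f" shows "hl_measurable f"
 using borel_measurable_continuous_on_indicator[OF _ assms] by (simp add: set_borel_measurable_def)

lemma hl_measurable_add:
 fixes f g :: "real \<Rightarrow> complex"
 assumes "hl_measurable f" "hl_measurable g"
 shows "hl_measurable (\<lambda>y. f y + g y)" "hl_measurable (\<lambda>y. f y - g y)"
  "hl_measurable (\<lambda>y. f y * g y)"
proof -
 note [measurable] = assms[unfolded hl_measurable_iff]
 have "ext0 (\<lambda>y. f y + g y) = (\<lambda>y. ext0 f y + ext0 g y)" "ext0 (\<lambda>y. f y - g y) = (\<lambda>y. ext0 f y - ext0 g y)"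
  "ext0 (\<lambda>y. f y * g y) = (\<lambda>y. ext0 f y * ext0 g y)"
  by (auto simp: ext0_def)
 then show "hl_measurable (\<lambda>y. f y + g y)" "hl_measurable (\<lambda>y. f y - g y)"
  "hl_measurable (\<lambda>y. f y * g y)"
  by (simp_all add: hl_measurable_iff)
qed

lemma hl_measurable_mult_left:
 fixes f g :: "real \<Rightarrow> complex"
 assumes "hl_measurable f" "g \<in> borel_measurable borel"
 shows "hl_measurable (\<lambda>y. g y * f y)"
 using hl_measurable_add(3)[OF hl_measurableI[OF assms(2)] assms(1)] .

lemma meas_m_measurable_iff: "f \<in> borel_measurable (meas_m m) \<longleftrightarrow> hl_measurable f"
 for f :: "real \<Rightarrow> 'a::real_normed_vector"
 unfolding meas_m_def
 by (simp add: borel_measurable_restrict_space_iff set_borel_measurable_def)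

lemma nn_integral_meas_m:
 assumes "hl_measurable (f :: real \<Rightarrow> real)" "\<And>y. 0 < y \<Longrightarrow> 0 \<le> f y"
 shows "(\<integral>\<^sup>+y. ennreal (f y) \<partial>meas_m m) = nnint (\<lambda>y. y powr m * f y)"
proof -
 have [measurable]: "f \<in> borel_measurable (restrict_space lborel {0<..})"
  using assms(1) by (simp add: borel_measurable_restrict_space_iff set_borel_measurable_def)
 have "(\<integral>\<^sup>+y. ennreal (f y) \<partial>meas_m m) = (\<integral>\<^sup>+y. ennreal (y powr m) * ennreal (f y) \<partial>restrict_space lborel {0<..})"
  unfolding meas_m_def by (subst nn_integral_density) (auto intro!: measurable_restrict_space1)
 also have "\<dots> = (\<integral>\<^sup>+y\<in>{0<..}. ennreal (y powr m) * ennreal (f y) \<partial>lborel)"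
  by (rule nn_integral_restrict_space) simp
 finally show ?thesis by (simp add: ennreal_mult'[symmetric])
qed

lemma hl_measurable_norm_powr:
 assumes "hl_measurable f" shows "hl_measurable (\<lambda>y. norm (f y) powr p)"
proof -
 note [measurable] = assms[unfolded hl_measurable_iff]
 have "ext0 (\<lambda>y. norm (f y) powr p) = (\<lambda>y. indicator {0<..} y * norm (ext0 f y) powr p)"
  by (auto simp: ext0_def indicator_def)
 then show ?thesis by (simp add: hl_measurable_iff)
qed

text \<open>The working form of membership: integrability with respect to the density measure
  becomes finiteness of a weighted integral over Lebesgue measure.\<close>

lemma Lpm_iff: "f \<in> Lpm m p \<longleftrightarrow> hl_measurable f \<and> power_norm m p f < \<infinity>"
proof (cases "hl_measurable f")
 case True
 note pm = hl_measurable_norm_powr[OF True, of p]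
 have "integrable (meas_m m) (\<lambda>y. norm (f y) powr p) \<longleftrightarrow> power_norm m p f < \<infinity>"
  unfolding integrable_iff_bounded power_norm_def
  using nn_integral_meas_m[OF pm] pm by (simp add: meas_m_measurable_iff)
 then show ?thesis using True by (simp add: Lpm_def meas_m_measurable_iff)
qed (simp add: Lpm_def meas_m_measurable_iff)

lemma Lpm_ext0: "f \<in> Lpm m p \<Longrightarrow> ext0 f \<in> borel_measurable borel"
 by (simp add: Lpm_iff hl_measurable_iff)

lemma Lpm_norm_eq:
 assumes "hl_measurable f" shows "Lpm_norm m p f = enn2real (power_norm m p f) powr (1 / p)"
proof -
 note pm = hl_measurable_norm_powr[OF assms, of p]
 have "(LINT y|meas_m m. norm (f y) powr p) = enn2real (power_norm m p f)"
  unfolding power_norm_def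
  using nn_integral_meas_m[OF pm] pm by (subst integral_eq_nn_integral) (simp_all add: meas_m_measurable_iff)
 then show ?thesis by (simp add: Lpm_norm_def)
qed

abbreviation eq_AE :: "(real \<Rightarrow> 'a) \<Rightarrow> (real \<Rightarrow> 'a) \<Rightarrow> bool" where
 "eq_AE f g \<equiv> AE y in lborel. 0 < y \<longrightarrow> f y = g y"

lemma power_norm_cong_AE:
 assumes "eq_AE f g"
 shows "power_norm m p f = power_norm m p g"
 unfolding power_norm_def using assms
 by (intro nn_integral_cong_AE) (auto elim!: eventually_mono simp: indicator_def)

lemma power_norm_cong:
 assumes "\<And>y. 0 < y \<Longrightarrow> f y = g y" shows "power_norm m p f = power_norm m p g"
 using assms by (intro power_norm_cong_AE) auto

lemma power_norm_mono_AE: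
 assumes "AE y in lborel. 0 < y \<longrightarrow> norm (f y) \<le> norm (g y)" "0 \<le> p"
 shows "power_norm m p f \<le> power_norm m p g"
 unfolding power_norm_def using assms
 by (intro nn_integral_mono_AE)
  (auto elim!: eventually_mono simp: indicator_def intro!: ennreal_leI mult_left_mono powr_mono2)

lemma power_norm_cmult: "power_norm m p (\<lambda>y. c * f y) = ennreal (norm c powr p) * power_norm m p f"
 if "hl_measurable f"
proof -
 note [measurable] = that[unfolded hl_measurable_iff]
 have "power_norm m p (\<lambda>y. c * f y) =
   (\<integral>\<^sup>+y. ennreal (norm c powr p) * (ennreal (y powr m * norm (ext0 f y) powr p) * indicator {0<..} y) \<partial>lborel)"
  unfolding power_norm_def
  by (rule nn_integral_cong)
   (auto simp: norm_mult powr_mult indicator_def ext0_def ennreal_mult'[symmetric] mult_ac)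
 also have "\<dots> = ennreal (norm c powr p) * (\<integral>\<^sup>+y. ennreal (y powr m * norm (ext0 f y) powr p) * indicator {0<..} y \<partial>lborel)"
  by (rule nn_integral_cmult) simp
 also have "(\<integral>\<^sup>+y. ennreal (y powr m * norm (ext0 f y) powr p) * indicator {0<..} y \<partial>lborel) = power_norm m p f"
  unfolding power_norm_def by (rule nn_integral_cong) (auto simp: ext0_def indicator_def)
 finally show ?thesis .
qed

lemma powr_add_le:
 fixes a b :: real
 assumes "0 \<le> a" "0 \<le> b" "0 \<le> p"
 shows "(a + b) powr p \<le> 2 powr p * (a powr p + b powr p)"
proof -
 have "(a + b) powr p \<le> (2 * max a b) powr p"
  using assms by (intro powr_mono2) auto
 also have "\<dots> = 2 powr p * max a b powr p" using assms by (simp add: powr_mult)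
 also have "\<dots> \<le> 2 powr p * (a powr p + b powr p)"
  using assms by (intro mult_left_mono) (auto simp: max_def)
 finally show ?thesis .
qed

lemma power_norm_add:
 assumes f: "hl_measurable f" and g: "hl_measurable g" and p: "0 \<le> p"
  and h: "\<And>y. 0 < y \<Longrightarrow> norm (h y) \<le> norm (f y) + norm (g y)"
 shows "power_norm m p h \<le> ennreal (2 powr p) * (power_norm m p f + power_norm m p g)"
proof -
 note [measurable] = f[unfolded hl_measurable_iff] g[unfolded hl_measurable_iff]
 have e: "power_norm m p f = (\<integral>\<^sup>+y. ennreal (y powr m * norm (ext0 f y) powr p) * indicator {0<..} y \<partial>lborel)" for f :: "real \<Rightarrow> complex"
  unfolding power_norm_def by (rule nn_integral_cong) (auto simp: ext0_def indicator_def)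
 have "power_norm m p h \<le> (\<integral>\<^sup>+y. ennreal (2 powr p) * (ennreal (y powr m * norm (ext0 f y) powr p) * indicator {0<..} y
   + ennreal (y powr m * norm (ext0 g y) powr p) * indicator {0<..} y) \<partial>lborel)"
  unfolding power_norm_def
 proof (rule nn_integral_mono)
  fix y :: real
  show "ennreal (y powr m * norm (h y) powr p) * indicator {0<..} y \<le> ennreal (2 powr p) *
    (ennreal (y powr m * norm (ext0 f y) powr p) * indicator {0<..} y + ennreal (y powr m * norm (ext0 g y) powr p) * indicator {0<..} y)"
  proof (cases "0 < y")
   case True
   have "norm (h y) powr p \<le> (norm (f y) + norm (g y)) powr p"
    using h[OF True] p by (intro powr_mono2) auto
   also have "\<dots> \<le> 2 powr p * (norm (f y) powr p + norm (g y) powr p)"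
    using p by (intro powr_add_le) auto
   finally have "y powr m * norm (h y) powr p \<le> y powr m * (2 powr p * (norm (f y) powr p + norm (g y) powr p))"
    by (rule mult_left_mono) simp
   then have "ennreal (y powr m * norm (h y) powr p) \<le> ennreal (2 powr p * (y powr m * norm (f y) powr p + y powr m * norm (g y) powr p))"
    by (intro ennreal_leI) (simp add: algebra_simps)
   also have "\<dots> = ennreal (2 powr p) * (ennreal (y powr m * norm (f y) powr p) + ennreal (y powr m * norm (g y) powr p))"
    by (subst ennreal_mult', simp, subst ennreal_plus) auto
   finally show ?thesis using True by (simp add: ext0_def)
  qed simp
 qed
 also have "\<dots> = ennreal (2 powr p) * (power_norm m p f + power_norm m p g)"
  unfolding e by (simp add: nn_integral_cmult nn_integral_add)
 finally show ?thesis .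
qed

lemma Lpm_add:
 assumes "f \<in> Lpm m p" "g \<in> Lpm m p" "0 \<le> p" shows "(\<lambda>y. f y + g y) \<in> Lpm m p"
proof -
 have "power_norm m p (\<lambda>y. f y + g y) \<le> ennreal (2 powr p) * (power_norm m p f + power_norm m p g)"
  using assms by (intro power_norm_add) (auto simp: Lpm_iff norm_triangle_ineq)
 also have "\<dots> < \<infinity>" using assms by (simp add: Lpm_iff ennreal_mult_less_top)
 finally show ?thesis using assms by (simp add: Lpm_iff hl_measurable_add)
qed

lemma Lpm_cmult:
 assumes "f \<in> Lpm m p" shows "(\<lambda>y. c * f y) \<in> Lpm m p"
 using assms by (auto simp: Lpm_iff power_norm_cmult ennreal_mult_less_top intro!: hl_measurable_mult_left)

lemma Lpm_diff:
 assumes "f \<in> Lpm m p" "g \<in> Lpm m p" "0 \<le> p" shows "(\<lambda>y. f y - g y) \<in> Lpm m p"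
 using Lpm_add[OF assms(1) Lpm_cmult[OF assms(2), of "-1"] assms(3)] by simp

lemma Lpm_cong_AE:
 assumes "f \<in> Lpm m p" "hl_measurable g" "eq_AE f g"
 shows "g \<in> Lpm m p"
 using assms power_norm_cong_AE[OF assms(3)] by (simp add: Lpm_iff)

lemma Lpm_bound:
 assumes "f \<in> Lpm m p" "hl_measurable g" "AE y in lborel. 0 < y \<longrightarrow> norm (g y) \<le> norm (f y)" "0 \<le> p"
 shows "g \<in> Lpm m p"
 using assms power_norm_mono_AE[OF assms(3,4)] by (auto simp: Lpm_iff intro: le_less_trans)

text \<open>Membership has to hold eventually: a Bochner integral that does not exist is 0 by
  convention, so that outside the space \<open>Lpm_norm\<close> would vanish where
  \<open>power_norm\<close> is infinite.\<close>

lemma Lpm_norm_tendsto_iff: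
 assumes p: "0 < p" and ev: "\<forall>\<^sub>F t in F. f t \<in> Lpm m p"
 shows "((\<lambda>t. Lpm_norm m p (f t)) \<longlongrightarrow> 0) F \<longleftrightarrow> ((\<lambda>t. power_norm m p (f t)) \<longlongrightarrow> 0) F"
proof
 assume "((\<lambda>t. Lpm_norm m p (f t)) \<longlongrightarrow> 0) F"
 then have "((\<lambda>t. ennreal (Lpm_norm m p (f t) powr p)) \<longlongrightarrow> ennreal 0) F"
  using p by (intro tendsto_ennrealI tendsto_zero_powrI[where b = p]) (auto simp: Lpm_norm_def)
 moreover have "\<forall>\<^sub>F t in F. ennreal (Lpm_norm m p (f t) powr p) = power_norm m p (f t)"
  using ev by eventually_elim (use p in \<open>auto simp: Lpm_iff Lpm_norm_eq powr_powr\<close>)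
 ultimately show "((\<lambda>t. power_norm m p (f t)) \<longlongrightarrow> 0) F"
  by (simp add: tendsto_cong)
next
 assume "((\<lambda>t. power_norm m p (f t)) \<longlongrightarrow> 0) F"
 then have "((\<lambda>t. enn2real (power_norm m p (f t))) \<longlongrightarrow> 0) F"
  by (intro tendsto_enn2real) auto
 then have "((\<lambda>t. enn2real (power_norm m p (f t)) powr (1 / p)) \<longlongrightarrow> 0) F"
  using p by (intro tendsto_zero_powrI[where b = "1 / p"]) auto
 moreover have "\<forall>\<^sub>F t in F. enn2real (power_norm m p (f t)) powr (1 / p) = Lpm_norm m p (f t)"
  using ev by eventually_elim (auto simp: Lpm_iff Lpm_norm_eq)
 ultimately show "((\<lambda>t. Lpm_norm m p (f t)) \<longlongrightarrow> 0) F"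
  by (simp add: tendsto_cong)
qed

lemma power_norm_dominated_convergence:
 fixes F :: "nat \<Rightarrow> real \<Rightarrow> complex"
 assumes F: "\<And>i. hl_measurable (F i)" and G: "G \<in> Lpm m p" and p: "0 < p"
  and lim: "AE y in lborel. 0 < y \<longrightarrow> (\<lambda>i. F i y) \<longlonglongrightarrow> 0"
  and bound: "\<And>i y. 0 < y \<Longrightarrow> norm (F i y) \<le> norm (G y)"
 shows "(\<lambda>i. power_norm m p (F i)) \<longlonglongrightarrow> 0"
proof -
 note [measurable] = F[unfolded hl_measurable_iff] Lpm_ext0[OF G]
 have e: "power_norm m p f = (nnint_R (\<lambda>y. y powr m * norm (ext0 f y) powr p))" for f :: "real \<Rightarrow> complex"
  unfolding power_norm_def by (rule nn_integral_cong) (auto simp: ext0_def indicator_def)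
 have "(\<lambda>i. \<integral>\<^sup>+y. ennreal (y powr m * norm (ext0 (F i) y) powr p) \<partial>lborel) \<longlonglongrightarrow> (\<integral>\<^sup>+y. 0 \<partial>(lborel :: real measure))"
 proof (rule nn_integral_dominated_convergence[where w = "\<lambda>y. ennreal (y powr m * norm (ext0 G y) powr p)"])
  show "AE y in lborel. ennreal (y powr m * norm (ext0 (F j) y) powr p) \<le> ennreal (y powr m * norm (ext0 G y) powr p)" for j
   using p bound by (intro AE_I2 ennreal_leI mult_left_mono powr_mono2) (auto simp: ext0_def)
  show "(nnint_R (\<lambda>y. y powr m * norm (ext0 G y) powr p)) < \<infinity>"
   using G unfolding e[symmetric] by (simp add: Lpm_iff)
  show "AE y in lborel. (\<lambda>i. ennreal (y powr m * norm (ext0 (F i) y) powr p)) \<longlonglongrightarrow> 0"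
   using lim
  proof eventually_elim
   case (elim y)
   have "(\<lambda>i. norm (ext0 (F i) y)) \<longlonglongrightarrow> 0"
    using elim by (cases "0 < y") (auto simp: ext0_def tendsto_norm_zero)
   then have "(\<lambda>i. ennreal (y powr m * norm (ext0 (F i) y) powr p)) \<longlonglongrightarrow> ennreal (y powr m * 0)"
    using p by (intro tendsto_ennrealI tendsto_mult tendsto_const tendsto_zero_powrI[where b = p]) auto
   then show ?case by simp
  qed
 qed simp_all
 then show ?thesis unfolding e by simp
qed

lemma tendsto_at_right_0_sequentially:
 fixes f :: "real \<Rightarrow> 'a::topological_space"
 shows "(f \<longlongrightarrow> l) (at_right 0) \<longleftrightarrow> (\<forall>X. (\<forall>i. 0 < X i) \<longrightarrow> X \<longlonglongrightarrow> 0 \<longrightarrow> (\<lambda>i. f (X i)) \<longlonglongrightarrow> l)"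
 unfolding tendsto_at_iff_sequentially by (auto simp: o_def)

lemma nn_integral_powr_finite:
 assumes "-1 < a" "0 < b"
 shows "nnint (\<lambda>y. y powr a * exp (- b * y)) < \<infinity>"
proof -
 have "(\<lambda>t. complex_of_real t powr (complex_of_real (a + 1) - 1) / of_real (exp (b * t))) absolutely_integrable_on {0<..}"
  using assms by (intro absolutely_integrable_Gamma_integral) auto
 then have "set_integrable lebesgue {0<..} (\<lambda>t. norm (complex_of_real t powr (complex_of_real (a + 1) - 1) / of_real (exp (b * t))))"
  by (rule set_integrable_norm)
 then have "set_integrable lebesgue {0<..} (\<lambda>y. y powr a * exp (- b * y))"
  by (rule set_integrable_cong[THEN iffD1, rotated -1])
   (auto simp: norm_mult norm_inverse norm_powr_real_powr exp_minus divide_inverse)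
 then have "set_integrable lborel {0<..} (\<lambda>y. y powr a * exp (- b * y))"
  unfolding set_integrable_def by (subst (asm) integrable_completion) auto
 then have "(nnint_R (\<lambda>y. norm (indicator {0<..} y *\<^sub>R (y powr a * exp (- b * y))))) < \<infinity>"
  unfolding set_integrable_def integrable_iff_bounded by simp
 then show ?thesis
  by (rule le_less_trans[rotated]) (auto intro!: nn_integral_mono simp: indicator_def)
qed

lemma nn_integral_powr_finite_0:
 assumes "-1 < a" "0 < b"
 shows "(\<integral>\<^sup>+y\<in>{0<..<b}. ennreal (y powr a) \<partial>lborel) < \<infinity>"
proof -
 have "(\<integral>\<^sup>+y\<in>{0<..<b}. ennreal (y powr a) \<partial>lborel) \<le> (\<integral>\<^sup>+y. ennreal (exp b) * (ennreal (y powr a * exp (- 1 * y)) * indicator {0<..} y) \<partial>lborel)"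
 proof (rule nn_integral_mono)
  fix y :: real
  have "y powr a * 1 \<le> y powr a * (exp b * exp (- y))" if "y < b"
   using that by (intro mult_left_mono) (auto simp: exp_add[symmetric])
  then show "ennreal (y powr a) * indicator {0<..<b} y \<le> ennreal (exp b) * (ennreal (y powr a * exp (- 1 * y)) * indicator {0<..} y)"
   by (auto simp: indicator_def ennreal_mult'[symmetric] mult_ac intro!: ennreal_leI)
 qed
 also have "\<dots> = ennreal (exp b) * nnint (\<lambda>y. y powr a * exp (- 1 * y))"
  by (rule nn_integral_cmult) simp
 also have "\<dots> < \<infinity>" using nn_integral_powr_finite[OF assms(1), of 1] by (simp add: ennreal_mult_less_top)
 finally show ?thesis .
qed

section \<open>The semigroup\<close>

definition dirichlet_semigroup :: "real \<Rightarrow> real \<Rightarrow> (real \<Rightarrow> complex) \<Rightarrow> real \<Rightarrow> complex" where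
 "dirichlet_semigroup \<nu> t f y = (LINT r|lborel. of_real (indicator {0<..} r * dkernel \<nu> t y r) * f r)"

lemma Bessel_I_of_real:
 assumes "0 \<le> \<nu>" "0 \<le> x"
 shows "Bessel_I \<nu> (of_real x) = of_real ((x / 2) powr \<nu> * bessel_F \<nu> ((x / 2)\<^sup>2))"
proof -
 have "(of_real x / 2) powr of_real \<nu> = complex_of_real ((x / 2) powr \<nu>)"
  using assms powr_of_real[of "x / 2" \<nu>] by simp
 moreover have "(\<Sum>k. (complex_of_real x / 2) ^ (2 * k) * of_real (rGamma (\<nu> + real k + 1)) / fact k) =
   of_real (bessel_F \<nu> ((x / 2)\<^sup>2))"
 proof -
  have "(\<Sum>k. (complex_of_real x / 2) ^ (2 * k) * of_real (rGamma (\<nu> + real k + 1)) / fact k) =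
    (\<Sum>k. complex_of_real (bessel_coeff \<nu> k * ((x / 2)\<^sup>2) ^ k))"
   unfolding power_mult by (rule suminf_cong) (simp add: bessel_coeff_def mult.commute)
  also have "\<dots> = of_real (bessel_F \<nu> ((x / 2)\<^sup>2))"
   unfolding bessel_F_def by (rule suminf_of_real[symmetric]) (rule bessel_F_summable[OF assms(1)])
  finally show ?thesis .
 qed
 ultimately show ?thesis by (simp add: Bessel_I_def)
qed

text \<open>The leading power of the Bessel function multiplies \<open>(y * r) powr \<nu>\<close>
  and \<open>r powr (1 - 2 * \<nu>)\<close>; the powers of r combine to r and those of y to
  \<open>y powr (2 * \<nu>)\<close>.\<close>

lemma heat_kernel_of_real:
 assumes \<nu>: "0 \<le> \<nu>" and t: "0 < t" and y: "0 < y" and r: "0 < r"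
 shows "heat_kernel (1 - 2 * \<nu>) (of_real t) y r = of_real (dkernel \<nu> t y r)"
proof -
 let ?H = "(y * r / (4 * t)) powr \<nu> * bessel_F \<nu> ((y * r / (4 * t))\<^sup>2)"
 let ?x = "y * r / (2 * t)"
 have "Bessel_I \<nu> (of_real ?x) = of_real ((?x / 2) powr \<nu> * bessel_F \<nu> ((?x / 2)\<^sup>2))"
  using t y r by (intro Bessel_I_of_real \<nu>) auto
 then have B: "Bessel_I \<nu> (of_real (y * r) / (2 * of_real t)) =
   of_real ?H"
  by simp
 have E: "exp (- (of_real (y\<^sup>2 + r\<^sup>2) / (4 * complex_of_real t))) = of_real (exp (- (y\<^sup>2 + r\<^sup>2) / (4 * t)))"
 proof -
  have "exp (- (of_real (y\<^sup>2 + r\<^sup>2) / (4 * complex_of_real t))) = of_real (exp (- ((y\<^sup>2 + r\<^sup>2) / (4 * t))))"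
   by (simp flip: exp_of_real)
  then show ?thesis by (simp only: minus_divide_left[of "y\<^sup>2 + r\<^sup>2" "4 * t"])
 qed
 have c: "(1 - (1 - 2 * \<nu>)) / 2 = \<nu>" by simp
 have K: "1 / (2 * t) * (r powr (1 - 2 * \<nu>) * (y * r) powr \<nu>) * (y * r / (4 * t)) powr \<nu> =
   y powr (2 * \<nu>) * r * (2 * (4 * t) powr (-1 - \<nu>))"
 proof -
  have "(y * r / (4 * t)) powr \<nu> = y powr \<nu> * r powr \<nu> * (4 * t) powr (- \<nu>)"
   using t y r by (simp add: powr_mult powr_divide powr_minus_divide)
  moreover have "(y * r) powr \<nu> = y powr \<nu> * r powr \<nu>" using y r by (simp add: powr_mult)
  moreover have "y powr (2 * \<nu>) = y powr \<nu> * y powr \<nu>" by (simp add: powr_add[symmetric])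
  moreover have "r powr (1 - 2 * \<nu>) * (r powr \<nu> * r powr \<nu>) = r"
   using r by (simp add: powr_add[symmetric])
  moreover have "(4 * t) powr (-1 - \<nu>) = (4 * t) powr (- \<nu>) / (4 * t)"
  proof -
   have "(4 * t) powr (- \<nu>) = (4 * t) * (4 * t) powr (-1 - \<nu>)" using t by (simp add: powr_mult_base)
   then show ?thesis using t by simp
  qed
  ultimately show ?thesis by (simp add: mult_ac)
 qed
 have mv: "a * e * (b * f) = (a * b) * e * f" for a b e f :: real by simp
 have "1 / (2 * t) * (r powr (1 - 2 * \<nu>) * (y * r) powr \<nu>) * exp (- (y\<^sup>2 + r\<^sup>2) / (4 * t)) *
   ?H =
   y powr (2 * \<nu>) * r * (2 * (4 * t) powr (-1 - \<nu>)) * exp (- (y\<^sup>2 + r\<^sup>2) / (4 * t)) * bessel_F \<nu> ((y * r / (4 * t))\<^sup>2)"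
  unfolding mv K ..
 then have "1 / (2 * t) * (r powr (1 - 2 * \<nu>) * (y * r) powr \<nu>) * exp (- (y\<^sup>2 + r\<^sup>2) / (4 * t)) *
   ?H = dkernel \<nu> t y r"
  unfolding dkernel_def bkernel_def by (simp only: mult.assoc)
 then have "of_real (dkernel \<nu> t y r) = complex_of_real (1 / (2 * t) * (r powr (1 - 2 * \<nu>) * (y * r) powr \<nu>) *
   exp (- (y\<^sup>2 + r\<^sup>2) / (4 * t)) * ?H)"
  by simp
 then show ?thesis
  unfolding heat_kernel_def c B E by (simp only: of_real_mult of_real_divide of_real_1 of_real_numeral)
qed

lemma semigroup_Bd_of_real:
 assumes "0 \<le> \<nu>" "0 < t" "0 < y"
 shows "semigroup_Bd (1 - 2 * \<nu>) (of_real t) f y = dirichlet_semigroup \<nu> t f y"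
 unfolding semigroup_Bd_def dirichlet_semigroup_def set_lebesgue_integral_def
 by (rule Bochner_Integration.integral_cong) (auto simp: heat_kernel_of_real[OF assms] indicator_def)

text \<open>Completing the square bounds the kernel by a Gaussian in r - y of width at most that for
  time t, and the square of r - y - 4 t shows that this Gaussian is at most exp (- 2 r + 2 y + 4 t).
  The rate 2 leaves one factor exp (- r) after polynomial factors in r have been absorbed.\<close>

lemma bkernel_exp_bound:
 assumes \<nu>: "0 \<le> \<nu>" and s: "0 < s" and y: "0 < y"
 obtains C where "0 < C" "\<And>\<tau> r. s \<le> \<tau> \<Longrightarrow> \<tau> \<le> t \<Longrightarrow> 0 < r \<Longrightarrow> bkernel \<nu> \<tau> y r \<le> C * exp (- (2 * r))"
proof
 let ?C = "2 * (4 * s) powr (-1 - \<nu>) * rGamma (\<nu> + 1) * exp (2 * y + 4 * t)"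
 have G: "0 < rGamma (\<nu> + 1)" using \<nu> by (intro rGamma_pos) auto
 then show "0 < ?C" using s by simp
 fix \<tau> r :: real assume \<tau>: "s \<le> \<tau>" "\<tau> \<le> t" and r: "0 < r"
 have \<tau>0: "0 < \<tau>" using \<tau> s by simp
 have F: "bessel_F \<nu> ((y * r / (4 * \<tau>))\<^sup>2) \<le> rGamma (\<nu> + 1) * exp (2 * (y * r / (4 * \<tau>)))"
  using y r \<tau>0 by (intro bessel_F_square_le \<nu>) auto
 have "- (y\<^sup>2 + r\<^sup>2) / (4 * \<tau>) + 2 * (y * r / (4 * \<tau>)) = - ((r - y)\<^sup>2 / (4 * \<tau>))"
  using \<tau>0 by (simp add: field_simps power2_eq_square)
 also have "\<dots> \<le> - ((r - y)\<^sup>2 / (4 * t))"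
  using \<tau> \<tau>0 by (intro le_imp_neg_le divide_left_mono) auto
 also have "\<dots> \<le> - (2 * r) + (2 * y + 4 * t)"
 proof -
  have "0 \<le> (r - y - 4 * t)\<^sup>2 / (4 * t)" using \<tau> \<tau>0 by simp
  also have "\<dots> = (r - y)\<^sup>2 / (4 * t) - 2 * (r - y) + 4 * t"
   using \<tau> \<tau>0 by (simp add: field_simps power2_eq_square)
  finally show ?thesis by simp
 qed
 finally have e: "- (y\<^sup>2 + r\<^sup>2) / (4 * \<tau>) + 2 * (y * r / (4 * \<tau>)) \<le> - (2 * r) + (2 * y + 4 * t)" .
 have "bkernel \<nu> \<tau> y r \<le> 2 * (4 * s) powr (-1 - \<nu>) * exp (- (y\<^sup>2 + r\<^sup>2) / (4 * \<tau>)) * (rGamma (\<nu> + 1) * exp (2 * (y * r / (4 * \<tau>))))"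
  unfolding bkernel_def using F \<tau> s \<nu> G less_imp_le[OF bessel_F_pos[OF \<nu>]]
  by (intro mult_mono powr_mono2') auto
 also have "\<dots> = 2 * (4 * s) powr (-1 - \<nu>) * rGamma (\<nu> + 1) * exp (- (y\<^sup>2 + r\<^sup>2) / (4 * \<tau>) + 2 * (y * r / (4 * \<tau>)))"
  unfolding exp_add by (simp only: mult_ac)
 also have "\<dots> \<le> 2 * (4 * s) powr (-1 - \<nu>) * rGamma (\<nu> + 1) * exp (- (2 * r) + (2 * y + 4 * t))"
  using e G by (intro mult_left_mono) auto
 also have "\<dots> = ?C * exp (- (2 * r))" unfolding exp_add by (simp only: mult_ac)
 finally show "bkernel \<nu> \<tau> y r \<le> ?C * exp (- (2 * r))" .
qed

lemma ennreal_tendsto_0I: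
 fixes f :: "'a \<Rightarrow> ennreal"
 assumes "\<And>e::real. 0 < e \<Longrightarrow> \<forall>\<^sub>F x in F. f x \<le> ennreal e"
 shows "(f \<longlongrightarrow> 0) F"
proof (rule order_tendstoI)
 fix a :: ennreal assume "0 < a"
 then obtain b where b: "0 < b" "b < a" using dense by blast
 then obtain e where e: "b = ennreal e" "0 < e"
  by (cases b) (auto simp: ennreal_less_zero_iff)
 from assms[OF e(2)] show "\<forall>\<^sub>F x in F. f x < a"
  by eventually_elim (use b e in auto)
qed simp

lemma ennreal_tendsto_0D:
 fixes f :: "'a \<Rightarrow> ennreal"
 assumes "(f \<longlongrightarrow> 0) F" "0 < (e::real)"
 shows "\<forall>\<^sub>F x in F. f x \<le> ennreal e"
 using order_tendstoD(2)[OF assms(1), of "ennreal e"] assms(2) by (auto elim: eventually_mono)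

lemma nn_integral_powr_finite_inf:
 assumes "q < -1" "0 < b"
 shows "(\<integral>\<^sup>+y\<in>{b..}. ennreal (y powr q) \<partial>lborel) < \<infinity>"
proof -
 have "(nnint_R (\<lambda>y. indicator {b..} y * y powr q)) = ennreal (- (b powr (q + 1)) / (q + 1))"
  by (rule nn_integral_has_integral_lebesgue[OF _ has_integral_powr_to_inf]) (use assms in auto)
 moreover have "(nnint_R (\<lambda>y. indicator {b..} y * y powr q)) = (\<integral>\<^sup>+y\<in>{b..}. ennreal (y powr q) \<partial>lborel)"
  by (rule nn_integral_cong) (auto simp: indicator_def)
 ultimately show ?thesis by simp
qed

text \<open>With c = 1 - 2 \<nu> these are the hypotheses of the theorem. The parameters are kept
  free because the same facts are used again for other weights, namely
  \<open>near_zero_weight \<theta>\<close> near the origin, and for the dual exponent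
  \<open>q\<close> with weight \<open>m_dual\<close>.\<close>

locale bessel_Lp =
 fixes p \<nu> m :: real
 assumes p: "1 < p" and \<nu>: "0 < \<nu>" and m_lower: "- 2 * \<nu> < (m + 1) / p" and m_upper: "(m + 1) / p < 2"
begin

lemma m_bounds: "- (2 * \<nu> * p) < m + 1" "m + 1 < 2 * p" "0 < p" "0 \<le> p" "0 \<le> \<nu>"
 using m_lower m_upper p \<nu> by (auto simp: field_simps)

abbreviation "T \<equiv> dirichlet_semigroup \<nu>"
abbreviation "N \<equiv> power_norm m p"
abbreviation "L \<equiv> Lpm m p"

text \<open>The weight \<open>r * exp (- r)\<close> is the common majorant of the kernel in its
  second variable. That functions of the space are integrable against it uses the upper bound m + 1
  < 2 p only near 0; at infinity the exponential suffices.\<close>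

lemma weighted_integral_finite:
 assumes "f \<in> L"
 shows "nnint (\<lambda>r. r * exp (- r) * norm (f r)) < \<infinity>"
proof -
 have f: "hl_measurable f" "N f < \<infinity>" using assms by (auto simp: Lpm_iff)
 note [measurable] = f(1)[unfolded hl_measurable_iff]
 let ?k = "\<lambda>r::real. indicator {0<..} r :: real"
 let ?g = "\<lambda>r. ?k r * (r * exp (- r) * norm (ext0 f r))"
 \<comment> \<open>The exponents are those for which \<open>?g\<close> to the power p times
   \<open>?h\<close> to the power 1 - p is the integrand of the norm. This function is integrable
   near 0 since (p - m) / (p - 1) exceeds -1, that is, m + 1 < 2 p.\<close>
 let ?h = "\<lambda>r. r powr ((p - m) / (p - 1)) * exp (- (p / (p - 1)) * r)"
 have "(nnint_R (\<lambda>r. ?k r * ?g r)) \<le>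
  ennreal (1 powr (1 - p) / p) * (nnint_R (\<lambda>r. ?k r * (?g r powr p * ?h r powr (1 - p)))) +
  ennreal (1 * (p - 1) / p) * (nnint_R (\<lambda>r. ?k r * ?h r))"
  by (rule nn_integral_Young[OF p]) (auto simp: indicator_def)
 moreover have "(nnint_R (\<lambda>r. ?k r * (?g r powr p * ?h r powr (1 - p)))) = N f"
  unfolding power_norm_def
 proof (rule nn_integral_cong)
  fix r :: real
  show "ennreal (?k r * (?g r powr p * ?h r powr (1 - p))) = ennreal (r powr m * norm (f r) powr p) * indicator {0<..} r"
  proof (cases "0 < r")
   case True
   have 1: "(r * exp (- r) * norm (f r)) powr p = r powr p * exp (- (p * r)) * norm (f r) powr p"
    using True by (simp add: powr_mult exp_powr_real mult.commute)
   have "?h r powr (1 - p) = r powr ((p - m) / (p - 1) * (1 - p)) * exp (- (p / (p - 1)) * r * (1 - p))"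
    using True by (simp add: powr_mult powr_powr exp_powr_real)
   also have "(p - m) / (p - 1) * (1 - p) = m - p" using p by (simp add: field_simps)
   also have "- (p / (p - 1)) * r * (1 - p) = p * r" using p by (simp add: field_simps)
   finally have 2: "?h r powr (1 - p) = r powr (m - p) * exp (p * r)" .
   have "r powr p * r powr (m - p) = r powr m" by (simp add: powr_add[symmetric])
   moreover have "exp (- (p * r)) * exp (p * r) = 1" by (simp add: exp_add[symmetric])
   ultimately have "(r powr p * exp (- (p * r)) * norm (f r) powr p) * (r powr (m - p) * exp (p * r)) = r powr m * norm (f r) powr p"
    by (metis (no_types, opaque_lifting) mult.assoc mult.commute mult.right_neutral)
   then show ?thesis using True 1 2 by (simp add: ext0_def)
  qed simp
 qed
 moreover have "(nnint_R (\<lambda>r. ?k r * ?h r)) < \<infinity>"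
 proof -
  have "nnint (\<lambda>r. ?h r) < \<infinity>"
   using p m_bounds by (intro nn_integral_powr_finite) (auto simp: field_simps)
  moreover have "(nnint_R (\<lambda>r. ?k r * ?h r)) = nnint (\<lambda>r. ?h r)"
   by (intro nn_integral_cong) (auto simp: indicator_def)
  ultimately show ?thesis by simp
 qed
 moreover have "(nnint_R (\<lambda>r. ?k r * ?g r)) = nnint (\<lambda>r. r * exp (- r) * norm (f r))"
  by (intro nn_integral_cong) (auto simp: indicator_def ext0_def)
 ultimately show ?thesis using f(2)
  by (auto simp: ennreal_mult_less_top intro: le_less_trans)
qed

lemma weighted_integrable:
 assumes "f \<in> L"
 shows "integrable lborel (\<lambda>r. indicator {0<..} r * (r * exp (- r) * norm (f r)))"
proof -
 note [measurable] = Lpm_ext0[OF assms]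
 have eq: "(\<lambda>r. indicator {0<..} r * (r * exp (- r) * norm (f r))) = (\<lambda>r. indicator {0<..} r * (r * exp (- r) * norm (ext0 f r)))"
  by (auto simp: ext0_def indicator_def)
 have "(nnint_R (\<lambda>r. norm (indicator {0<..} r * (r * exp (- r) * norm (f r))))) =
   nnint (\<lambda>r. r * exp (- r) * norm (f r))"
  by (intro nn_integral_cong) (auto simp: indicator_def)
 then show ?thesis
  using weighted_integral_finite[OF assms] by (intro integrableI_bounded) (simp_all add: eq)
qed

lemma dkernel_bound:
 assumes "0 < t" "0 < y"
 obtains C where "0 < C" "\<And>r. 0 < r \<Longrightarrow> dkernel \<nu> t y r \<le> C * (r * exp (- r))"
proof -
 obtain C where C: "0 < C" "\<And>\<tau> r. t \<le> \<tau> \<Longrightarrow> \<tau> \<le> t \<Longrightarrow> 0 < r \<Longrightarrow> bkernel \<nu> \<tau> y r \<le> C * exp (- (2 * r))"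
  using bkernel_exp_bound[OF m_bounds(5) assms, of t] by blast
 show ?thesis
 proof (rule that[of "y powr (2 * \<nu>) * C"])
  show "0 < y powr (2 * \<nu>) * C" using C assms by simp
  fix r :: real assume r: "0 < r"
  have "bkernel \<nu> t y r \<le> C * exp (- r)"
   using C(2)[of t r] r C(1) by (auto intro: order_trans mult_left_mono)
  then have "y powr (2 * \<nu>) * r * bkernel \<nu> t y r \<le> y powr (2 * \<nu>) * r * (C * exp (- r))"
   using r by (intro mult_left_mono) auto
  then show "dkernel \<nu> t y r \<le> y powr (2 * \<nu>) * C * (r * exp (- r))"
   by (simp add: dkernel_def mult_ac)
 qed
qed

lemma T_integrable:
 assumes f: "f \<in> L" and t: "0 < t" and y: "0 < y"
 shows "integrable lborel (\<lambda>r. of_real (indicator {0<..} r * dkernel \<nu> t y r) * f r)"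
proof -
 note [measurable] = Lpm_ext0[OF f]
 have eq: "(\<lambda>r. of_real (indicator {0<..} r * dkernel \<nu> t y r) * f r) =
   (\<lambda>r. of_real (indicator {0<..} r * dkernel \<nu> t y r) * ext0 f r)"
  by (auto simp: ext0_def indicator_def)
 obtain C where C: "0 < C" "\<And>r. 0 < r \<Longrightarrow> dkernel \<nu> t y r \<le> C * (r * exp (- r))"
  using dkernel_bound[OF t y] by blast
 show ?thesis
 proof (rule Bochner_Integration.integrable_bound)
  show "integrable lborel (\<lambda>r. C * (indicator {0<..} r * (r * exp (- r) * norm (f r))))"
   by (intro integrable_mult_right weighted_integrable f)
  show "AE r in lborel. norm (of_real (indicator {0<..} r * dkernel \<nu> t y r) * f r) \<le>
    norm (C * (indicator {0<..} r * (r * exp (- r) * norm (f r))))"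
  proof (rule AE_I2)
   fix r :: real
   show "norm (of_real (indicator {0<..} r * dkernel \<nu> t y r) * f r) \<le>
    norm (C * (indicator {0<..} r * (r * exp (- r) * norm (f r))))"
   proof (cases "0 < r")
    case True
    have "dkernel \<nu> t y r * norm (f r) \<le> C * (r * exp (- r)) * norm (f r)"
     using C(2)[OF True] by (intro mult_right_mono) auto
    then show ?thesis
     using True C(1) less_imp_le[OF dkernel_pos[OF m_bounds(5) t y True]]
     by (simp add: norm_mult mult.assoc)
   qed simp
  qed
 qed (unfold eq, measurable)
qed

text \<open>Joint measurability in time and space is what allows time averages of the semigroup to
  be handled by Fubini's theorem.\<close>

lemma T_measurable2:
 assumes "hl_measurable f"
 shows "(\<lambda>(t, y). T t f y) \<in> borel_measurable borel"
proof -
 note [measurable] = assms[unfolded hl_measurable_iff]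
 have eq: "T t f y = (LINT r|lborel. of_real (indicator {0<..} r * dkernel \<nu> t y r) * ext0 f r)" for t y
  unfolding dirichlet_semigroup_def
  by (rule Bochner_Integration.integral_cong) (auto simp: ext0_def indicator_def)
 have "(\<lambda>z. LINT r|lborel. of_real (indicator {0<..} r * dkernel \<nu> (fst z) (snd z) r) * ext0 f r)
   \<in> borel_measurable (borel \<Otimes>\<^sub>M borel)"
  by (rule lborel.borel_measurable_lebesgue_integral) simp
 then show ?thesis by (simp add: eq case_prod_beta' borel_prod)
qed

lemma T_measurable [measurable (raw)]:
 assumes "hl_measurable f" "g \<in> borel_measurable M" "h \<in> borel_measurable M"
 shows "(\<lambda>x. T (g x) f (h x)) \<in> borel_measurable M"
 using measurable_compose[OF borel_measurable_Pair[OF assms(2,3)] T_measurable2[OF assms(1)]] by simp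

lemma T_cong_AE:
 assumes "eq_AE f g" "hl_measurable f" "hl_measurable g"
 shows "T t f y = T t g y"
proof -
 note [measurable] = assms(2,3)[unfolded hl_measurable_iff]
 have eq: "T t f y = (LINT r|lborel. of_real (indicator {0<..} r * dkernel \<nu> t y r) * ext0 f r)" for f
  unfolding dirichlet_semigroup_def
  by (rule Bochner_Integration.integral_cong) (auto simp: ext0_def indicator_def)
 show ?thesis unfolding eq
 proof (rule integral_cong_AE)
  show "AE r in lborel. of_real (indicator {0<..} r * dkernel \<nu> t y r) * ext0 f r =
    of_real (indicator {0<..} r * dkernel \<nu> t y r) * ext0 g r"
   using assms(1) by eventually_elim (auto simp: ext0_def)
 qed measurable
qed

lemma T_add:
 assumes "f \<in> L" "g \<in> L" "0 < t" "0 < y"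
 shows "T t (\<lambda>y. f y + g y) y = T t f y + T t g y"
 unfolding dirichlet_semigroup_def distrib_left
 by (rule Bochner_Integration.integral_add[OF T_integrable T_integrable]) (use assms in auto)

lemma T_cmult: "T t (\<lambda>y. c * f y) y = c * T t f y"
proof -
 have "T t (\<lambda>y. c * f y) y = (LINT r|lborel. c * (of_real (indicator {0<..} r * dkernel \<nu> t y r) * f r))"
  unfolding dirichlet_semigroup_def by (simp add: mult_ac)
 then show ?thesis by (simp add: dirichlet_semigroup_def)
qed

lemma T_diff:
 assumes "f \<in> L" "g \<in> L" "0 < t" "0 < y"
 shows "T t (\<lambda>y. f y - g y) y = T t f y - T t g y"
 using T_add[OF assms(1) Lpm_cmult[OF assms(2), of "-1"] assms(3,4)] T_cmult[of t "-1" g y] by simp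

lemma T_norm_le:
 assumes "f \<in> L" "0 < t" "0 < y"
 shows "ennreal (norm (T t f y)) \<le> nnint (\<lambda>r. dkernel \<nu> t y r * norm (f r))"
proof -
 have "ennreal (norm (T t f y)) \<le> (\<integral>\<^sup>+r. norm (of_real (indicator {0<..} r * dkernel \<nu> t y r) * f r) \<partial>lborel)"
  unfolding dirichlet_semigroup_def by (rule integral_norm_bound_ennreal[OF T_integrable[OF assms]])
 also have "\<dots> = nnint (\<lambda>r. dkernel \<nu> t y r * norm (f r))"
  using less_imp_le[OF dkernel_pos[OF m_bounds(5) assms(2,3)]]
  by (intro nn_integral_cong) (auto simp: indicator_def norm_mult)
 finally show ?thesis .
qed

text \<open>Schur's test with a single power; the constant does not depend on t because the moment
  bounds do not.\<close>

lemma T_bounded: "\<exists>C\<ge>0. \<forall>t f. 0 < t \<longrightarrow> f \<in> L \<longrightarrow> N (T t f) \<le> ennreal C * N f"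
proof -
 \<comment> \<open>The largest exponent permitted by the two upper bounds
   \<open>a \<le> 2 * \<nu>\<close> and \<open>m + a * (p - 1) \<le> 1\<close>. The two lower bounds
   then follow from the hypotheses on (m + 1) / p.\<close>
 define a where "a = min (2 * \<nu>) ((1 - m) / (p - 1))"
 have a: "-2 < a" "a \<le> 2 * \<nu>" "- 1 - 2 * \<nu> < m + a * (p - 1)" "m + a * (p - 1) \<le> 1"
 proof -
  let ?q = "(1 - m) / (p - 1)"
  have q: "?q * (p - 1) = 1 - m" "-2 < ?q" using p m_bounds by (auto simp: pos_less_divide_eq)
  show "-2 < a" "a \<le> 2 * \<nu>" using q \<nu> by (auto simp: a_def)
  have "a * (p - 1) \<le> ?q * (p - 1)" using p by (intro mult_right_mono) (auto simp: a_def)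
  then show "m + a * (p - 1) \<le> 1" using q by simp
  show "- 1 - 2 * \<nu> < m + a * (p - 1)"
  proof (cases "a = 2 * \<nu>")
   case True
   then show ?thesis using m_bounds by (simp add: algebra_simps)
  next
   case False
   then have "a = ?q" by (auto simp: a_def min_def split: if_splits)
   then show ?thesis using q \<nu> by simp
  qed
 qed
 obtain C1 where C1: "0 < C1" "\<And>t y. 0 < t \<Longrightarrow> 0 < y \<Longrightarrow>
  nnint (\<lambda>r. dkernel \<nu> t y r * r powr a) \<le> ennreal (C1 * y powr a)"
  using dkernel_powr_le[OF m_bounds(5) a(1,2)] by blast
 obtain C2 where C2: "0 < C2" "\<And>t r. 0 < t \<Longrightarrow> 0 < r \<Longrightarrow>
  nnint (\<lambda>y. dkernel \<nu> t y r * y powr (m + a * (p - 1))) \<le> ennreal (C2 * r powr (m + a * (p - 1)))"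
  using dkernel_powr_le'[OF m_bounds(5) a(3,4)] by blast
 have "N (T t f) \<le> ennreal (C1 powr (p - 1) * C2) * N f" if t: "0 < t" and f: "f \<in> L" for t f
 proof -
  note [measurable] = Lpm_ext0[OF f]
  have e: "N f = nnint (\<lambda>y. y powr m * norm (ext0 f y) powr p)"
   unfolding power_norm_def by (rule nn_integral_cong) (auto simp: ext0_def indicator_def)
  have [measurable]: "case_prod (dkernel \<nu> t) \<in> borel_measurable borel"
   unfolding borel_prod[symmetric] by measurable
  show ?thesis unfolding e
   unfolding power_norm_def
  proof (rule schur_test[OF p, where k = "dkernel \<nu> t"])
   show "ennreal (norm (T t f y)) \<le> nnint (\<lambda>r. dkernel \<nu> t y r * norm (ext0 f r))" if "0 < y" for y
    using T_norm_le[OF f t that]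
    by (rule order_trans) (auto intro!: nn_integral_mono simp: ext0_def indicator_def)
  qed (use C1 C2 t less_imp_le[OF dkernel_pos[OF m_bounds(5)]] in auto)
 qed
 then show ?thesis using C1(1) C2(1) by (intro exI[of _ "C1 powr (p - 1) * C2"]) auto
qed

lemma T_hl_measurable: "hl_measurable f \<Longrightarrow> hl_measurable (T t f)"
 by (intro hl_measurableI) measurable

lemma T_in_L: "f \<in> L \<Longrightarrow> 0 < t \<Longrightarrow> T t f \<in> L"
proof -
 assume f: "f \<in> L" and t: "0 < t"
 obtain C where "0 \<le> C" "N (T t f) \<le> ennreal C * N f" using T_bounded f t by blast
 then have "N (T t f) < \<infinity>" using f by (auto simp: Lpm_iff ennreal_mult_less_top intro: le_less_trans)
 then show ?thesis using f by (auto simp: Lpm_iff intro: T_hl_measurable)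
qed

section \<open>Strong continuity at time 0: intervals, Borel sets, simple functions, the whole
  space\<close>

definition SC :: "(real \<Rightarrow> complex) \<Rightarrow> bool" where
 "SC f \<longleftrightarrow> ((\<lambda>t. N (\<lambda>y. T t f y - f y)) \<longlongrightarrow> 0) (at_right 0)"

lemma SC_cong:
 assumes "\<And>y. 0 < y \<Longrightarrow> f y = g y"
 shows "SC f \<longleftrightarrow> SC g"
proof -
 have "T t f y = T t g y" for t y
  unfolding dirichlet_semigroup_def
  by (rule Bochner_Integration.integral_cong) (auto simp: assms indicator_def)
 then have "N (\<lambda>y. T t f y - f y) = N (\<lambda>y. T t g y - g y)" for t
  using assms by (intro power_norm_cong) auto
 then show ?thesis by (simp add: SC_def)
qed

lemma T_minus_id_measurable:
 "hl_measurable f \<Longrightarrow> hl_measurable (\<lambda>y. T t f y - f y)"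
 by (intro hl_measurable_add T_hl_measurable)

lemma SC_add:
 assumes f: "f \<in> L" "SC f" and g: "g \<in> L" "SC g"
 shows "SC (\<lambda>y. f y + g y)"
proof -
 let ?B = "\<lambda>t. N (\<lambda>y. T t f y - f y) + N (\<lambda>y. T t g y - g y)"
 have "((\<lambda>t. ennreal (2 powr p) * (?B t)) \<longlongrightarrow> ennreal (2 powr p) * (0 + 0)) (at_right 0)"
  using f(2) g(2) unfolding SC_def by (intro tendsto_intros) auto
 then have lim: "((\<lambda>t. ennreal (2 powr p) * (?B t)) \<longlongrightarrow> 0) (at_right 0)" by simp
 show ?thesis unfolding SC_def
 proof (rule tendsto_sandwich[OF _ _ tendsto_const lim])
  show "\<forall>\<^sub>F t in at_right 0. N (\<lambda>y. T t (\<lambda>y. f y + g y) y - (f y + g y)) \<le>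
    ennreal (2 powr p) * (?B t)"
   unfolding eventually_at_right_field
  proof (intro exI[of _ 1] conjI allI impI)
   fix t :: real assume t: "0 < t"
   show "N (\<lambda>y. T t (\<lambda>y. f y + g y) y - (f y + g y)) \<le> ennreal (2 powr p) * (?B t)"
   proof (rule power_norm_add)
    fix y :: real assume "0 < y"
    then show "norm (T t (\<lambda>y. f y + g y) y - (f y + g y)) \<le> norm (T t f y - f y) + norm (T t g y - g y)"
     using norm_triangle_ineq[of "T t f y - f y" "T t g y - g y"] T_add[OF f(1) g(1) t]
     by (simp add: algebra_simps)
   qed (use f g m_bounds in \<open>auto simp: Lpm_iff intro!: T_minus_id_measurable\<close>)
  qed simp
 qed simp
qed

lemma SC_cmult:
 assumes f: "f \<in> L" "SC f"
 shows "SC (\<lambda>y. c * f y)"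
proof -
 have "N (\<lambda>y. T t (\<lambda>y. c * f y) y - c * f y) = ennreal (norm c powr p) * N (\<lambda>y. T t f y - f y)" for t
  unfolding T_cmult right_diff_distrib[symmetric]
  using f by (intro power_norm_cmult T_minus_id_measurable) (auto simp: Lpm_iff)
 moreover have "((\<lambda>t. ennreal (norm c powr p) * N (\<lambda>y. T t f y - f y)) \<longlongrightarrow> ennreal (norm c powr p) * 0) (at_right 0)"
  using f unfolding SC_def by (intro tendsto_intros) auto
 ultimately show ?thesis by (simp add: SC_def)
qed

text \<open>The uniform bound on the semigroup makes the set of functions with strong continuity
  closed.\<close>

lemma SC_limit:
 fixes F :: "nat \<Rightarrow> real \<Rightarrow> complex"
 assumes f: "f \<in> L" and F: "\<And>i. F i \<in> L" "\<And>i. SC (F i)"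
  and lim: "(\<lambda>i. N (\<lambda>y. F i y - f y)) \<longlonglongrightarrow> 0"
 shows "SC f"
 unfolding SC_def
proof (rule ennreal_tendsto_0I)
 fix e :: real assume e: "0 < e"
 obtain C where C: "0 \<le> C" "\<And>t f. 0 < t \<Longrightarrow> f \<in> L \<Longrightarrow> N (T t f) \<le> ennreal C * N f"
  using T_bounded by blast
 \<comment> \<open>\<open>A\<close> and \<open>B\<close> are the total factors with which the
   approximation error and the error of strong continuity enter after two uses of the quasi-triangle
   inequality.\<close>
 define A where "A = 2 powr p * C + 2 powr p * 2 powr p"
 have A: "0 < A" using C(1) by (simp add: A_def add_nonneg_pos)
 define B :: real where "B = 2 powr p * 2 powr p"
 have B: "0 < B" by (simp add: B_def)
 have "\<forall>\<^sub>F i in sequentially. N (\<lambda>y. F i y - f y) \<le> ennreal (e / (2 * A))"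
  using A e by (intro ennreal_tendsto_0D lim) auto
 then obtain i where i: "N (\<lambda>y. F i y - f y) \<le> ennreal (e / (2 * A))"
  by (auto simp: eventually_sequentially)
 have "\<forall>\<^sub>F t in at_right 0. N (\<lambda>y. T t (F i) y - F i y) \<le> ennreal (e / (2 * B))"
  using B e F(2)[of i] unfolding SC_def by (intro ennreal_tendsto_0D) auto
 moreover have "\<forall>\<^sub>F t in at_right (0::real). 0 < t" by (simp add: eventually_at_right_less)
 ultimately show "\<forall>\<^sub>F t in at_right 0. N (\<lambda>y. T t f y - f y) \<le> ennreal e"
 proof eventually_elim
  case (elim t)
  define d where "d = (\<lambda>y. f y - F i y)"
  have d: "d \<in> L" unfolding d_def using f F m_bounds by (intro Lpm_diff) auto
  have Nd: "N d = N (\<lambda>y. F i y - f y)"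
   unfolding power_norm_def d_def by (simp add: norm_minus_commute)
  have 1: "N (\<lambda>y. (T t (F i) y - F i y) - d y) \<le> ennreal (2 powr p) * (N (\<lambda>y. T t (F i) y - F i y) + N d)"
   using F(1)[of i] d m_bounds
   by (intro power_norm_add T_minus_id_measurable) (auto simp: Lpm_iff norm_triangle_ineq4)
  have "N (\<lambda>y. T t f y - f y) \<le> ennreal (2 powr p) * (N (T t d) + N (\<lambda>y. (T t (F i) y - F i y) - d y))"
  proof (rule power_norm_add)
   fix y :: real assume y: "0 < y"
   have "T t d y = T t f y - T t (F i) y"
    unfolding d_def using f F elim y by (intro T_diff) auto
   then have "T t f y - f y = T t d y + ((T t (F i) y - F i y) - d y)" by (simp add: d_def)
   then show "norm (T t f y - f y) \<le> norm (T t d y) + norm ((T t (F i) y - F i y) - d y)"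
    by (metis norm_triangle_ineq)
  qed (use d F(1)[of i] m_bounds in \<open>auto simp: Lpm_iff intro!: T_minus_id_measurable T_hl_measurable hl_measurable_add(2)\<close>)
  also have "\<dots> \<le> ennreal (2 powr p) * (ennreal C * N d + ennreal (2 powr p) * (N (\<lambda>y. T t (F i) y - F i y) + N d))"
   using C(2)[OF elim(2) d] 1 by (intro mult_left_mono add_mono) auto
  also have "\<dots> \<le> ennreal (2 powr p) * (ennreal C * ennreal (e / (2 * A)) + ennreal (2 powr p) * (ennreal (e / (2 * B)) + ennreal (e / (2 * A))))"
   using i elim(1) unfolding Nd by (intro mult_left_mono add_mono) auto
  also have "\<dots> = ennreal (2 powr p * (C * (e / (2 * A)) + 2 powr p * (e / (2 * B) + e / (2 * A))))"
  proof -
   have "0 \<le> e / (2 * A)" "0 \<le> e / (2 * B)" using A B e by auto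
   then show ?thesis using C(1)
    by (simp only: ennreal_mult ennreal_plus mult_nonneg_nonneg add_nonneg_nonneg powr_ge_zero)
  qed
  also have "2 powr p * (C * (e / (2 * A)) + 2 powr p * (e / (2 * B) + e / (2 * A))) = A * (e / (2 * A)) + B * (e / (2 * B))"
   unfolding A_def B_def by (simp only: distrib_left distrib_right mult_ac add_ac)
  also have "\<dots> = e" using A B by simp
  finally show ?case .
 qed
qed


text \<open>\<open>barrier\<close> dominates \<open>T t f\<close> for bounded \<open>f\<close> of compact support.\<close>

definition barrier :: "real \<Rightarrow> real \<Rightarrow> real" where
 "barrier a y = (if y < 1 then y powr (2 * \<nu>) else y powr a)"

lemma barrier_in_L:
 assumes "m + a * p < -1"
 shows "(\<lambda>y. of_real (K * barrier a y)) \<in> L"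
proof -
 have [measurable]: "barrier a \<in> borel_measurable borel" unfolding barrier_def[abs_def] by measurable
 have 1: "(\<integral>\<^sup>+y\<in>{0<..<1}. ennreal (y powr (m + 2 * \<nu> * p)) \<partial>lborel) < \<infinity>"
  using m_bounds by (intro nn_integral_powr_finite_0) auto
 have 2: "(\<integral>\<^sup>+y\<in>{1..}. ennreal (y powr (m + a * p)) \<partial>lborel) < \<infinity>"
  using assms by (intro nn_integral_powr_finite_inf) auto
 have "N (\<lambda>y. of_real (barrier a y)) \<le> (\<integral>\<^sup>+y. ennreal (y powr (m + 2 * \<nu> * p)) * indicator {0<..<1} y
   + ennreal (y powr (m + a * p)) * indicator {1..} y \<partial>lborel)"
  unfolding power_norm_def
  by (rule nn_integral_mono) (auto simp: barrier_def indicator_def powr_powr powr_add)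
 also have "\<dots> = (\<integral>\<^sup>+y\<in>{0<..<1}. ennreal (y powr (m + 2 * \<nu> * p)) \<partial>lborel) + (\<integral>\<^sup>+y\<in>{1..}. ennreal (y powr (m + a * p)) \<partial>lborel)"
  by (rule nn_integral_add) auto
 also have "\<dots> < \<infinity>" using 1 2 by simp
 finally have "(\<lambda>y. of_real (barrier a y)) \<in> L"
  by (auto simp: Lpm_iff intro!: hl_measurableI)
 from Lpm_cmult[OF this, of "of_real K"] show ?thesis by simp
qed

text \<open>A power is monotone, so that its minimum on the interval is attained at one of the
  endpoints; the sum over both endpoints covers either sign of q.\<close>

lemma compact_support_powr_le:
 fixes r :: real
 assumes "0 < \<alpha>" "\<alpha> \<le> r" "r \<le> \<beta>"
 shows "1 \<le> (\<alpha> powr (- q) + \<beta> powr (- q)) * r powr q"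
proof (cases "0 \<le> q")
 case True
 have "\<alpha> powr q \<le> r powr q" using assms True by (intro powr_mono2) auto
 then have "\<alpha> powr (- q) * \<alpha> powr q \<le> (\<alpha> powr (- q) + \<beta> powr (- q)) * r powr q"
  by (intro mult_mono) auto
 then show ?thesis using assms by (simp add: powr_add[symmetric])
next
 case False
 have "\<beta> powr q \<le> r powr q" using assms False by (intro powr_mono2') auto
 then have "\<beta> powr (- q) * \<beta> powr q \<le> (\<alpha> powr (- q) + \<beta> powr (- q)) * r powr q"
  by (intro mult_mono) auto
 then show ?thesis using assms by (simp add: powr_add[symmetric])
qed

lemma compact_support_in_L:
 assumes "hl_measurable f" and "0 < \<alpha>"
  and supp: "\<And>r. 0 < r \<Longrightarrow> norm (f r) \<le> K * indicator {\<alpha>..\<beta>} r" and K: "0 \<le> K"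
 shows "f \<in> L"
proof -
 \<comment> \<open>With this exponent \<open>m + a * p\<close> is -2, which makes the barrier
   integrable at infinity.\<close>
 define a where "a = - (m + 2) / p"
 let ?c = "(\<alpha> powr (- 2 * \<nu>) + \<beta> powr (- 2 * \<nu>)) + (\<alpha> powr (- a) + \<beta> powr (- a))"
 have a: "m + a * p < -1" using p by (simp add: a_def)
 show ?thesis
 proof (rule Lpm_bound[OF barrier_in_L[OF a, of "K * ?c"] assms(1)])
  show "AE y in lborel. 0 < y \<longrightarrow> norm (f y) \<le>
    norm (complex_of_real (K * ?c * barrier a y))"
  proof (intro AE_I2 impI)
   fix y :: real assume y: "0 < y"
   have "norm (f y) \<le> K * ?c * barrier a y"
   proof (cases "y \<in> {\<alpha>..\<beta>}")
    case True
    have "1 \<le> ?c * barrier a y"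
     using compact_support_powr_le[of \<alpha> y \<beta> "2 * \<nu>"] compact_support_powr_le[of \<alpha> y \<beta> a] True assms(2)
     by (auto simp: barrier_def distrib_right intro: add_increasing add_increasing2)
    then have "K * 1 \<le> K * (?c * barrier a y)"
     using K by (rule mult_left_mono)
    then show ?thesis using supp[OF y] True by (simp add: mult.assoc)
   next
    case False
    then show ?thesis using supp[OF y] K by (simp add: barrier_def mult_nonneg_nonneg add_nonneg_nonneg)
   qed
   then show "norm (f y) \<le> norm (complex_of_real (K * ?c * barrier a y))"
    by (simp only: norm_of_real)
  qed
 qed (use m_bounds in auto)
qed

text \<open>A bounded function of compact support is dominated by a multiple of any power. The
  moment bound for the exponent 2 \<nu> controls the image near 0 and that for a smaller exponent
  controls it at infinity, both uniformly in t; this supplies the majorant for dominated convergence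
  in time.\<close>

lemma T_compact_support_bound:
 assumes f: "hl_measurable f" and \<alpha>: "0 < \<alpha>"
  and supp: "\<And>r. 0 < r \<Longrightarrow> norm (f r) \<le> K * indicator {\<alpha>..\<beta>} r" and K: "0 \<le> K"
 obtains G where "G \<in> L" "\<And>t y. 0 < t \<Longrightarrow> 0 < y \<Longrightarrow> norm (T t f y) \<le> norm (G y)"
proof -
 have fL: "f \<in> L" by (rule compact_support_in_L[OF assms])
 \<comment> \<open>The midpoint of -2 and - (m + 1) / p: above -2 for the moment bound, below - (m +
   1) / p for integrability at infinity. The gap is open since (m + 1) / p < 2.\<close>
 define a where "a = (- 2 - (m + 1) / p) / 2"
 have a: "-2 < a" "a \<le> 2 * \<nu>" "m + a * p < -1"
 proof -
  show "-2 < a" "a \<le> 2 * \<nu>" using m_lower m_upper \<nu> by (auto simp: a_def)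
  have "a < - ((m + 1) / p)" 
  proof -
   have "(- 2 - q) / 2 < - q" if "q < 2" for q :: real using that by simp
   then show ?thesis unfolding a_def using m_upper by blast
  qed
  then have "a * p < - ((m + 1) / p) * p" using p by (intro mult_strict_right_mono) auto
  then show "m + a * p < -1" using p by simp
 qed
 have bd: "\<exists>C\<ge>0. \<forall>t y. 0 < t \<longrightarrow> 0 < y \<longrightarrow> norm (T t f y) \<le> C * y powr q" if q: "-2 < q" "q \<le> 2 * \<nu>" for q
 proof -
  obtain C where C: "0 < C" "\<And>t y. 0 < t \<Longrightarrow> 0 < y \<Longrightarrow>
   nnint (\<lambda>r. dkernel \<nu> t y r * r powr q) \<le> ennreal (C * y powr q)"
   using dkernel_powr_le[OF m_bounds(5) q] by blast
  define c where "c = K * (\<alpha> powr (- q) + \<beta> powr (- q))"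
  have c: "0 \<le> c" using K by (simp add: c_def)
  have "norm (T t f y) \<le> c * C * y powr q" if t: "0 < t" and y: "0 < y" for t y
  proof -
   have "ennreal (norm (T t f y)) \<le> nnint (\<lambda>r. dkernel \<nu> t y r * norm (f r))"
    by (rule T_norm_le[OF fL t y])
   also have "\<dots> \<le> (\<integral>\<^sup>+r. ennreal c * (ennreal (dkernel \<nu> t y r * r powr q) * indicator {0<..} r) \<partial>lborel)"
   proof (rule nn_integral_mono)
    fix r :: real
    show "ennreal (dkernel \<nu> t y r * norm (f r)) * indicator {0<..} r \<le>
     ennreal c * (ennreal (dkernel \<nu> t y r * r powr q) * indicator {0<..} r)"
    proof (cases "0 < r")
     case True
     have "norm (f r) \<le> c * r powr q"
     proof (cases "r \<in> {\<alpha>..\<beta>}")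
      case True
      have "K * 1 \<le> K * ((\<alpha> powr (- q) + \<beta> powr (- q)) * r powr q)"
       using compact_support_powr_le[of \<alpha> r \<beta> q] True \<alpha> K by (intro mult_left_mono) auto
      then show ?thesis using supp[OF \<open>0 < r\<close>] True by (simp add: c_def mult.assoc)
     next
      case False
      then show ?thesis using supp[OF \<open>0 < r\<close>] c by simp
     qed
     then have "dkernel \<nu> t y r * norm (f r) \<le> dkernel \<nu> t y r * (c * r powr q)"
      using dkernel_pos[OF m_bounds(5) t y True] by (intro mult_left_mono) auto
     then have "ennreal (dkernel \<nu> t y r * norm (f r)) \<le> ennreal (c * (dkernel \<nu> t y r * r powr q))"
      by (intro ennreal_leI) (simp add: mult_ac)
     also have "\<dots> = ennreal c * ennreal (dkernel \<nu> t y r * r powr q)"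
      by (rule ennreal_mult'[OF c])
     finally show ?thesis using True by simp
    qed simp
   qed
   also have "\<dots> = ennreal c * nnint (\<lambda>r. dkernel \<nu> t y r * r powr q)"
    by (rule nn_integral_cmult) simp
   also have "\<dots> \<le> ennreal c * ennreal (C * y powr q)"
    by (intro mult_left_mono C(2) t y) simp
   also have "\<dots> = ennreal (c * C * y powr q)"
    using c by (simp add: ennreal_mult'[symmetric] mult.assoc)
   finally show ?thesis using c C(1) by (subst (asm) ennreal_le_iff) auto
  qed
  then show ?thesis using c C(1) by (intro exI[of _ "c * C"]) auto
 qed
 obtain C1 where C1: "0 \<le> C1" "\<And>t y. 0 < t \<Longrightarrow> 0 < y \<Longrightarrow> norm (T t f y) \<le> C1 * y powr (2 * \<nu>)"
  using bd[of "2 * \<nu>"] \<nu> by auto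
 obtain C2 where C2: "0 \<le> C2" "\<And>t y. 0 < t \<Longrightarrow> 0 < y \<Longrightarrow> norm (T t f y) \<le> C2 * y powr a"
  using bd[OF a(1,2)] by auto
 show ?thesis
 proof (rule that[OF barrier_in_L[OF a(3), of "C1 + C2"]])
  fix t y :: real assume t: "0 < t" and y: "0 < y"
  have "norm (T t f y) \<le> (C1 + C2) * barrier a y"
   using C1(2)[OF t y] C2(2)[OF t y] C1(1) C2(1)
   by (auto simp: barrier_def distrib_right intro: order_trans add_increasing add_increasing2)
  then show "norm (T t f y) \<le> norm (complex_of_real ((C1 + C2) * barrier a y))"
   by (simp only: norm_of_real)
 qed
qed

text \<open>Pointwise convergence away from the two endpoints comes from the concentration of the
  kernel, and \<open>T_compact_support_bound\<close> dominates uniformly in t.\<close>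

lemma SC_interval:
 assumes a: "0 < a"
 shows "SC (\<lambda>y. of_real (indicator {a<..<b} y))"
proof -
 let ?f = "\<lambda>y. complex_of_real (indicator {a<..<b} y)"
 have fm: "hl_measurable ?f" by (intro hl_measurableI) measurable
 have supp: "norm (?f r) \<le> 1 * indicator {a..b} r" for r by (auto simp: indicator_def)
 have fL: "?f \<in> L" by (rule compact_support_in_L[OF fm a supp]) auto
 obtain G where G: "G \<in> L" "\<And>t y. 0 < t \<Longrightarrow> 0 < y \<Longrightarrow> norm (T t ?f y) \<le> norm (G y)"
  using T_compact_support_bound[OF fm a supp] by auto
 have H: "(\<lambda>y. of_real (norm (G y)) + of_real (norm (?f y))) \<in> L"
 proof (rule Lpm_add)
  have n: "(\<lambda>y. complex_of_real (norm (g y))) \<in> L" if g: "g \<in> L" for g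
  proof (rule Lpm_bound[OF g])
   note [measurable] = Lpm_ext0[OF g]
   have "ext0 (\<lambda>y. complex_of_real (norm (g y))) = (\<lambda>y. complex_of_real (norm (ext0 g y)))"
    by (auto simp: ext0_def)
   then show "hl_measurable (\<lambda>y. complex_of_real (norm (g y)))" by (simp add: hl_measurable_iff)
  qed (use m_bounds in auto)
  show "(\<lambda>y. complex_of_real (norm (G y))) \<in> L" by (rule n[OF G(1)])
  show "(\<lambda>y. complex_of_real (norm (?f y))) \<in> L" by (rule n[OF fL])
 qed (use m_bounds in auto)
 have lim: "((\<lambda>t. T t ?f y) \<longlongrightarrow> ?f y) (at_right 0)" if y: "0 < y" "y \<noteq> a" "y \<noteq> b" for y
 proof -
  \<comment> \<open>The concentration result is stated for the kernel weighted by
    \<open>r powr (2 * \<nu>)\<close>; dividing the indicator by this power keeps it bounded since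
    its support stays away from 0.\<close>
  define w where "w = (\<lambda>r. indicator {a<..<b} r * r powr (- 2 * \<nu>) :: real)"
  have "((\<lambda>t. LINT r|lborel. indicator {0<..} r * (dkernel \<nu> t y r * r powr (2 * \<nu>)) * w r)
   \<longlongrightarrow> y powr (2 * \<nu>) * w y) (at_right 0)"
  proof (rule dkernel_concentration[OF m_bounds(5) y(1)])
   show "w \<in> borel_measurable borel" unfolding w_def by measurable
   show "\<bar>w r\<bar> \<le> a powr (- 2 * \<nu>)" for r
    using a \<nu> by (auto simp: w_def indicator_def intro!: powr_mono2')
   show "isCont w y"
   proof (cases "a < y \<and> y < b")
    case True
    have ev: "\<forall>\<^sub>F r in nhds y. r \<in> {a<..<b}" using True by (intro eventually_nhds_in_open) auto
    have "isCont (\<lambda>r. r powr (- 2 * \<nu>)) y" using y by (intro continuous_intros) auto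
    moreover have "isCont w y \<longleftrightarrow> isCont (\<lambda>r. r powr (- 2 * \<nu>)) y"
     by (rule isCont_cong) (use ev in \<open>auto elim!: eventually_mono simp: w_def\<close>)
    ultimately show ?thesis by simp
   next
    case False
    have ev: "\<forall>\<^sub>F r in nhds y. r \<in> - {a..b}" using False y by (intro eventually_nhds_in_open) auto
    have "isCont w y \<longleftrightarrow> isCont (\<lambda>r. 0::real) y"
     by (rule isCont_cong) (use ev in \<open>auto elim!: eventually_mono simp: w_def indicator_def\<close>)
    then show ?thesis by simp
   qed
  qed
  moreover have "y powr (2 * \<nu>) * w y = indicator {a<..<b} y"
   using y by (simp add: w_def powr_add[symmetric])
  moreover have "(\<lambda>t. LINT r|lborel. indicator {0<..} r * (dkernel \<nu> t y r * r powr (2 * \<nu>)) * w r) =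
    (\<lambda>t. LINT r|lborel. indicator {0<..} r * dkernel \<nu> t y r * indicator {a<..<b} r)"
  proof (intro ext Bochner_Integration.integral_cong refl)
   fix t r :: real
   have "r powr (2 * \<nu>) * r powr (- 2 * \<nu>) = 1" if "0 < r"
    using that by (simp add: powr_add[symmetric])
   then show "indicator {0<..} r * (dkernel \<nu> t y r * r powr (2 * \<nu>)) * w r =
     indicator {0<..} r * dkernel \<nu> t y r * indicator {a<..<b} r"
    by (cases "0 < r") (auto simp: w_def)
  qed
  ultimately have "((\<lambda>t. complex_of_real (LINT r|lborel. indicator {0<..} r * dkernel \<nu> t y r * indicator {a<..<b} r))
    \<longlongrightarrow> ?f y) (at_right 0)" by (intro tendsto_of_real) simp
  then show ?thesis by (simp add: dirichlet_semigroup_def flip: integral_complex_of_real)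
 qed
 show ?thesis
  unfolding SC_def tendsto_at_right_0_sequentially
 proof (intro allI impI)
  fix X :: "nat \<Rightarrow> real" assume X: "\<forall>i. 0 < X i" "X \<longlonglongrightarrow> 0"
  show "(\<lambda>i. N (\<lambda>y. T (X i) ?f y - ?f y)) \<longlonglongrightarrow> 0"
  proof (rule power_norm_dominated_convergence[OF _ H m_bounds(3)])
   show "hl_measurable (\<lambda>y. T (X i) ?f y - ?f y)" for i
    by (intro T_minus_id_measurable fm)
   have "AE y in lborel. y \<noteq> a \<and> y \<noteq> b" by (intro AE_conjI AE_lborel_singleton)
   then show "AE y in lborel. 0 < y \<longrightarrow> (\<lambda>i. T (X i) ?f y - ?f y) \<longlonglongrightarrow> 0"
   proof eventually_elim
    case (elim y)
    show ?case
    proof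
     assume "0 < y"
     from lim[OF this] elim have "(\<lambda>i. T (X i) ?f y) \<longlonglongrightarrow> ?f y"
      unfolding tendsto_at_right_0_sequentially using X by auto
     then show "(\<lambda>i. T (X i) ?f y - ?f y) \<longlonglongrightarrow> 0"
      by (rule LIM_zero)
    qed
   qed
   fix i and y :: real assume y: "0 < y"
   have "norm (T (X i) ?f y - ?f y) \<le> norm (G y) + norm (?f y)"
    using norm_triangle_ineq4[of "T (X i) ?f y" "?f y"] G(2)[of "X i" y] X y by (meson add_right_mono order_trans)
   also have "\<dots> = norm (complex_of_real (norm (G y)) + of_real (norm (?f y)))"
    by (simp flip: of_real_add)
   finally show "norm (T (X i) ?f y - ?f y) \<le> norm (complex_of_real (norm (G y)) + of_real (norm (?f y)))" .
  qed
 qed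
qed

lemma SC_zero: "SC (\<lambda>_. 0)"
 using SC_interval[of 1 0] by simp

lemma indicator_in_L:
 assumes "A \<in> sets borel" "0 < \<alpha>"
 shows "(\<lambda>y. of_real (indicator (A \<inter> {\<alpha><..<\<beta>}) y)) \<in> L"
 using assms by (intro compact_support_in_L[where \<alpha> = \<alpha> and \<beta> = \<beta> and K = 1])
  (auto simp: indicator_def intro!: hl_measurableI borel_measurable_of_real borel_measurable_indicator)

text \<open>A Dynkin argument over the open intervals, which are stable under intersection. Cutting
  with a fixed bounded interval away from 0 keeps every indicator in the space, so that complements
  are differences and countable unions are limits in norm.\<close>

lemma SC_borel:
 assumes A: "A \<in> sets borel" and \<alpha>: "0 < \<alpha>"
 shows "SC (\<lambda>y. of_real (indicator (A \<inter> {\<alpha><..<\<beta>}) y))"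
proof -
 let ?G = "range (\<lambda>(a, b). {a<..<b :: real})"
 have bor: "sets borel = sigma_sets UNIV ?G"
  unfolding borel_eq_box[where 'a = real] box_real by (rule sets_measure_of) auto
 have "A \<in> sigma_sets UNIV ?G" using A bor by simp
 then show ?thesis
 proof (rule sigma_sets_induct_disjoint[rotated 2])
  show "Int_stable ?G" by (auto simp: Int_stable_def)
  show "?G \<subseteq> Pow UNIV" by simp
  show "SC (\<lambda>y. of_real (indicator (A \<inter> {\<alpha><..<\<beta>}) y))" if "A \<in> ?G" for A
  proof -
   from that obtain a b where "A = {a<..<b}" by auto
   then have "A \<inter> {\<alpha><..<\<beta>} = {max a \<alpha><..<min b \<beta>}" by auto
   then show ?thesis using SC_interval[of "max a \<alpha>" "min b \<beta>"] \<alpha> by simp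
  qed
  show "SC (\<lambda>y. of_real (indicator ({} \<inter> {\<alpha><..<\<beta>}) y))" using SC_zero by simp
  show "SC (\<lambda>y. of_real (indicator ((UNIV - A) \<inter> {\<alpha><..<\<beta>}) y))"
   if A: "A \<in> sigma_sets UNIV ?G" and SC: "SC (\<lambda>y. of_real (indicator (A \<inter> {\<alpha><..<\<beta>}) y))" for A
  proof -
   have Ab: "A \<in> sets borel" using A bor by simp
   have "SC (\<lambda>y. of_real (indicator (UNIV \<inter> {\<alpha><..<\<beta>}) y) + (-1) * of_real (indicator (A \<inter> {\<alpha><..<\<beta>}) y))"
   proof (intro SC_add SC_cmult Lpm_cmult)
    show "SC (\<lambda>y. of_real (indicator (UNIV \<inter> {\<alpha><..<\<beta>}) y))" using SC_interval[OF \<alpha>] by simp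
   qed (use indicator_in_L[OF Ab \<alpha>] indicator_in_L[of UNIV \<alpha>] \<alpha> SC in auto)
   moreover have "(\<lambda>y. of_real (indicator (UNIV \<inter> {\<alpha><..<\<beta>}) y) + (-1) * of_real (indicator (A \<inter> {\<alpha><..<\<beta>}) y)) =
     (\<lambda>y. complex_of_real (indicator ((UNIV - A) \<inter> {\<alpha><..<\<beta>}) y))"
    by (auto simp: indicator_def)
   ultimately show ?thesis by simp
  qed
  show "SC (\<lambda>y. of_real (indicator ((\<Union>i. A i) \<inter> {\<alpha><..<\<beta>}) y))"
   if disj: "disjoint_family A" and A: "range A \<subseteq> sigma_sets UNIV ?G"
    and SC: "\<And>i. SC (\<lambda>y. of_real (indicator (A i \<inter> {\<alpha><..<\<beta>}) y))" for A :: "nat \<Rightarrow> real set"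
  proof -
   have Ab: "A i \<in> sets borel" for i using A bor by auto
   define F where "F n y = complex_of_real (indicator ((\<Union>i<n. A i) \<inter> {\<alpha><..<\<beta>}) y)" for n y
   have Fin: "(\<Union>i<n. A i) \<in> sets borel" for n using Ab by (intro sets.finite_UN) auto
   have FL: "F n \<in> L" for n
    unfolding F_def by (rule indicator_in_L[OF Fin \<alpha>])
   have FSC: "SC (F n)" for n
   proof (induction n)
    case 0
    then show ?case using SC_zero by (simp add: F_def[abs_def])
   next
    case (Suc n)
    have "SC (\<lambda>y. F n y + of_real (indicator (A n \<inter> {\<alpha><..<\<beta>}) y))"
     by (intro SC_add FL Suc indicator_in_L Ab \<alpha> SC)
    moreover have "(\<lambda>y. F n y + of_real (indicator (A n \<inter> {\<alpha><..<\<beta>}) y)) = F (Suc n)"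
    proof
     fix y
     have "\<not> (y \<in> (\<Union>i<n. A i) \<and> y \<in> A n)"
      using disj by (auto simp: disjoint_family_on_def) (metis IntI empty_iff less_irrefl UNIV_I)
     then show "F n y + of_real (indicator (A n \<inter> {\<alpha><..<\<beta>}) y) = F (Suc n) y"
      by (auto simp: F_def indicator_def less_Suc_eq)
    qed
    ultimately show ?case by simp
   qed
   have U: "(\<Union>i. A i) \<in> sets borel" using Ab by auto
   show ?thesis
   proof (rule SC_limit[OF indicator_in_L[OF U \<alpha>] FL FSC])
    show "(\<lambda>i. N (\<lambda>y. F i y - of_real (indicator ((\<Union>i. A i) \<inter> {\<alpha><..<\<beta>}) y))) \<longlonglongrightarrow> 0"
    proof (rule power_norm_dominated_convergence[OF _ indicator_in_L[OF U \<alpha>, of \<beta>] m_bounds(3)])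
     show "hl_measurable (\<lambda>y. F i y - of_real (indicator ((\<Union>i. A i) \<inter> {\<alpha><..<\<beta>}) y))" for i
      using FL[of i] indicator_in_L[OF U \<alpha>] by (intro hl_measurable_add) (auto simp: Lpm_iff)
     show "AE y in lborel. 0 < y \<longrightarrow> (\<lambda>i. F i y - of_real (indicator ((\<Union>i. A i) \<inter> {\<alpha><..<\<beta>}) y)) \<longlonglongrightarrow> 0"
     proof (intro AE_I2 impI)
      fix y :: real
      show "(\<lambda>i. F i y - of_real (indicator ((\<Union>i. A i) \<inter> {\<alpha><..<\<beta>}) y)) \<longlonglongrightarrow> 0"
      proof (cases "y \<in> (\<Union>i. A i)")
       case True
       then obtain n where n: "y \<in> A n" by auto
       have "\<forall>\<^sub>F i in sequentially. F i y - of_real (indicator ((\<Union>i. A i) \<inter> {\<alpha><..<\<beta>}) y) = 0"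
        using eventually_gt_at_top[of n]
        by eventually_elim (use n in \<open>auto simp: F_def indicator_def\<close>)
       then show ?thesis by (rule tendsto_eventually)
      next
       case False
       then show ?thesis by (simp add: F_def)
      qed
     qed
     show "norm (F i y - of_real (indicator ((\<Union>i. A i) \<inter> {\<alpha><..<\<beta>}) y)) \<le>
       norm (complex_of_real (indicator ((\<Union>i. A i) \<inter> {\<alpha><..<\<beta>}) y))" for i y
      by (auto simp: F_def indicator_def)
    qed
   qed
  qed
 qed
qed

text \<open>The cut of \<open>SC_borel\<close> is removed by exhausting the half-line with the
  intervals from 1 / (n + 1) to n + 1.\<close>

lemma SC_indicator:
 assumes A: "A \<in> sets borel" and L: "(\<lambda>y. of_real (indicator A y)) \<in> L"
 shows "SC (\<lambda>y. of_real (indicator A y))"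
proof -
 define F where "F n y = complex_of_real (indicator (A \<inter> {inverse (real (Suc n))<..<real (Suc n)}) y)" for n y
 have FL: "F n \<in> L" for n unfolding F_def by (rule indicator_in_L[OF A]) simp
 show ?thesis
 proof (rule SC_limit[OF L FL])
  show "SC (F n)" for n unfolding F_def by (rule SC_borel[OF A]) simp
  show "(\<lambda>i. N (\<lambda>y. F i y - of_real (indicator A y))) \<longlonglongrightarrow> 0"
  proof (rule power_norm_dominated_convergence[OF _ L m_bounds(3)])
   show "hl_measurable (\<lambda>y. F i y - of_real (indicator A y))" for i
    using FL[of i] L by (intro hl_measurable_add) (auto simp: Lpm_iff)
   show "norm (F i y - of_real (indicator A y)) \<le> norm (complex_of_real (indicator A y))" for i y
    by (auto simp: F_def indicator_def)
   show "AE y in lborel. 0 < y \<longrightarrow> (\<lambda>i. F i y - of_real (indicator A y)) \<longlonglongrightarrow> 0"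
   proof (intro AE_I2 impI)
    fix y :: real assume y: "0 < y"
    have "(\<lambda>n. inverse (real (Suc n))) \<longlonglongrightarrow> 0" by (rule LIMSEQ_inverse_real_of_nat)
    then have 1: "\<forall>\<^sub>F n in sequentially. inverse (real (Suc n)) < y" using y by (rule order_tendstoD)
    have "filterlim (\<lambda>n. real (Suc n)) at_top sequentially"
     by (rule filterlim_compose[OF filterlim_real_sequentially filterlim_Suc])
    then have 2: "\<forall>\<^sub>F n in sequentially. y < real (Suc n)" by (simp only: filterlim_at_top_dense)
    have "\<forall>\<^sub>F n in sequentially. F n y - of_real (indicator A y) = 0"
     using 1 2 by eventually_elim (auto simp: F_def indicator_def)
    then show "(\<lambda>i. F i y - of_real (indicator A y)) \<longlonglongrightarrow> 0" by (rule tendsto_eventually)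
   qed
  qed
 qed
qed

text \<open>On the level set of a nonzero value the function has constant modulus, so that the
  indicator of that set lies in the space. The level set of 0 may have infinite measure but
  contributes the zero function.\<close>

lemma SC_simple:
 fixes s :: "real \<Rightarrow> complex"
 assumes s: "simple_function borel s" and sL: "s \<in> L"
 shows "SC s"
proof -
 let ?S = "\<lambda>v y. v * complex_of_real (indicator (s -` {v}) y)"
 have ms: "s -` {v} \<in> sets borel" for v using simple_functionD(2)[OF s, of "{v}"] by simp
 have part: "?S v \<in> L \<and> SC (?S v)" for v
 proof (cases "v = 0")
  case True
  then show ?thesis using SC_zero by (simp add: Lpm_iff power_norm_def set_borel_measurable_def)
 next
  case False
  have "(\<lambda>y. complex_of_real (indicator (s -` {v}) y)) \<in> L"
  proof (rule Lpm_bound[OF Lpm_cmult[OF sL, of "inverse v"]])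
   show "hl_measurable (\<lambda>y. complex_of_real (indicator (s -` {v}) y))"
    using ms by (intro hl_measurableI borel_measurable_of_real borel_measurable_indicator) auto
  qed (use False m_bounds in \<open>auto simp: indicator_def\<close>)
  then show ?thesis using SC_indicator[OF ms] by (intro conjI Lpm_cmult SC_cmult) auto
 qed
 have fin: "finite (range s)" using simple_functionD(1)[OF s] by simp
 have "(\<lambda>y. \<Sum>v\<in>V. ?S v y) \<in> L \<and> SC (\<lambda>y. \<Sum>v\<in>V. ?S v y)" if "finite V" for V
  using that
 proof induction
  case empty
  then show ?case using SC_zero by (simp add: Lpm_iff power_norm_def set_borel_measurable_def)
 next
  case (insert v V)
  then show ?case using part[of v] m_bounds by (auto intro!: SC_add Lpm_add)
 qed
 from this[OF fin] have "SC (\<lambda>y. \<Sum>v\<in>range s. ?S v y)" by simp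
 moreover have "(\<lambda>y. \<Sum>v\<in>range s. ?S v y) = s"
 proof
  fix y
  have "(\<Sum>v\<in>range s. ?S v y) = (\<Sum>v\<in>range s. if v = s y then v else 0)"
   by (intro sum.cong) (auto simp: indicator_def)
  also have "\<dots> = s y" using fin by (simp add: sum.delta)
  finally show "(\<Sum>v\<in>range s. ?S v y) = s y" .
 qed
 ultimately show ?thesis by simp
qed

text \<open>Simple functions that converge pointwise and are bounded by twice the modulus of f
  converge to f in norm.\<close>

theorem strongly_continuous:
 assumes f: "f \<in> L"
 shows "SC f"
proof -
 have fm: "ext0 f \<in> borel_measurable borel" using f by (simp add: Lpm_iff hl_measurable_iff)
 obtain s where s: "\<And>i. simple_function borel (s i)" "\<And>x. (\<lambda>i. s i x) \<longlonglongrightarrow> ext0 f x"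
  "\<And>i x. dist (s i x) 0 \<le> 2 * dist (ext0 f x) 0"
  using borel_measurable_implies_sequence_metric[OF fm, of 0] by auto
 have eL: "ext0 f \<in> L"
  by (rule Lpm_cong_AE[OF f]) (use fm in \<open>auto simp: ext0_def intro: hl_measurableI\<close>)
 have sm: "hl_measurable (s i)" for i
  by (intro hl_measurableI borel_measurable_simple_function s)
 have sL: "s i \<in> L" for i
  by (rule Lpm_bound[OF Lpm_cmult[OF eL, of 2] sm]) (use s(3) m_bounds in \<open>auto simp: norm_mult\<close>)
 have "SC (ext0 f)"
 proof (rule SC_limit[OF eL sL])
  show "SC (s i)" for i by (rule SC_simple[OF s(1) sL])
  show "(\<lambda>i. N (\<lambda>y. s i y - ext0 f y)) \<longlonglongrightarrow> 0"
  proof (rule power_norm_dominated_convergence[OF _ Lpm_cmult[OF eL, of 3] m_bounds(3)])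
   show "hl_measurable (\<lambda>y. s i y - ext0 f y)" for i
    using sm eL by (intro hl_measurable_add) (auto simp: Lpm_iff)
   show "AE y in lborel. 0 < y \<longrightarrow> (\<lambda>i. s i y - ext0 f y) \<longlonglongrightarrow> 0"
    using s(2) by (auto simp: LIM_zero_iff intro!: AE_I2)
   show "norm (s i y - ext0 f y) \<le> norm (3 * ext0 f y)" for i y
    using norm_triangle_ineq4[of "s i y" "ext0 f y"] s(3)[of i y] by (simp add: norm_mult)
  qed
 qed
 then show ?thesis by (subst SC_cong[of _ "ext0 f"]) (auto simp: ext0_def)
qed

end

section \<open>Primitives and the Bessel equation\<close>

text \<open>Local absolute continuity on the open half-line, expressed by integrals because the
  density is merely locally integrable. The function G is fixed at every point, so that boundary
  values make sense, while the density matters only up to null sets.\<close>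

definition primitive :: "(real \<Rightarrow> complex) \<Rightarrow> (real \<Rightarrow> complex) \<Rightarrow> bool" where
 "primitive G g \<longleftrightarrow> (\<forall>a b. 0 < a \<longrightarrow> a \<le> b \<longrightarrow>
   set_integrable lborel {a..b} g \<and> (LINT x:{a..b}|lborel. g x) = G b - G a)"

lemma primitiveD:
 assumes "primitive G g" "0 < a" "a \<le> b"
 shows "set_integrable lborel {a..b} g" "(LINT x:{a..b}|lborel. g x) = G b - G a"
 using assms by (auto simp: primitive_def)

lemma primitive_integral:
 assumes "primitive G g" "0 < a" "a \<le> b"
 shows "g integrable_on {a..b}" "integral {a..b} g = G b - G a"
 using primitiveD[OF assms] set_borel_integral_eq_integral[OF primitiveD(1)[OF assms]] by auto

lemma primitive_isCont:
 assumes G: "primitive G g" and x: "0 < x"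
 shows "isCont G x"
proof -
 have "continuous_on {x / 2..x + 1} (\<lambda>u. G (x / 2) + integral {x / 2..u} g)"
  using x by (intro continuous_intros indefinite_integral_continuous_1 primitive_integral[OF G]) auto
 moreover have "G (x / 2) + integral {x / 2..u} g = G u" if "u \<in> {x / 2..x + 1}" for u
  using primitive_integral(2)[OF G, of "x / 2" u] x that by simp
 ultimately have "continuous_on {x / 2..x + 1} G" by (rule continuous_on_eq)
 then show ?thesis using x by (intro continuous_on_interior[of "{x / 2..x + 1}"]) auto
qed

lemma primitive_continuous_on: "primitive G g \<Longrightarrow> continuous_on {0<..} G"
 by (auto intro!: continuous_at_imp_continuous_on primitive_isCont)

lemma primitive_measurable: "primitive G g \<Longrightarrow> hl_measurable G"
 by (intro hl_measurable_continuous primitive_continuous_on)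

lemma hl_measurable_of_intervals:
 fixes g :: "real \<Rightarrow> complex"
 assumes "\<And>a b. 0 < a \<Longrightarrow> a \<le> b \<Longrightarrow> set_integrable lborel {a..b} g"
 shows "hl_measurable g"
proof -
 have m: "(\<lambda>x. indicator {inverse (real (Suc n))..real (Suc n)} x *\<^sub>R g x) \<in> borel_measurable borel" for n
 proof -
  have "inverse (real (Suc n)) \<le> 1" by (simp add: inverse_le_1_iff)
  also have "1 \<le> real (Suc n)" by simp
  finally have "set_integrable lborel {inverse (real (Suc n))..real (Suc n)} g" by (intro assms) auto
  then show ?thesis by (simp add: set_integrable_def integrable_iff_bounded)
 qed
 have "(\<lambda>n. indicator {inverse (real (Suc n))..real (Suc n)} x *\<^sub>R g x) \<longlonglongrightarrow> indicator {0<..} x *\<^sub>R g x" for x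
 proof (cases "0 < x")
  case True
  have "(\<lambda>n. inverse (real (Suc n))) \<longlonglongrightarrow> 0" by (rule LIMSEQ_inverse_real_of_nat)
  then have 1: "\<forall>\<^sub>F n in sequentially. inverse (real (Suc n)) < x" using True by (rule order_tendstoD)
  have "filterlim (\<lambda>n. real (Suc n)) at_top sequentially"
   by (rule filterlim_compose[OF filterlim_real_sequentially filterlim_Suc])
  then have 2: "\<forall>\<^sub>F n in sequentially. x < real (Suc n)" by (simp only: filterlim_at_top_dense)
  have "\<forall>\<^sub>F n in sequentially. indicator {inverse (real (Suc n))..real (Suc n)} x *\<^sub>R g x = indicator {0<..} x *\<^sub>R g x"
   using 1 2 by eventually_elim (use True in \<open>auto simp: indicator_def\<close>)
  then show ?thesis by (rule tendsto_eventually)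
 next
  case False
  have "\<not> inverse (real (Suc n)) \<le> x" for n
   using False by (metis inverse_positive_iff_positive less_le_trans of_nat_0_less_iff zero_less_Suc)
  then show ?thesis using False by (simp add: indicator_def)
 qed
 then have "(\<lambda>x. indicator {0<..} x *\<^sub>R g x) \<in> borel_measurable borel"
  by (intro borel_measurable_LIMSEQ_metric[OF m])
 then show ?thesis by (simp add: set_borel_measurable_def)
qed

lemma primitive_density_measurable: "primitive G g \<Longrightarrow> hl_measurable g"
 by (rule hl_measurable_of_intervals) (rule primitiveD)

lemma primitive_of_derivative:
 assumes der: "\<And>y. 0 < y \<Longrightarrow> (G has_vector_derivative g y) (at y)" and cont: "continuous_on {0<..} g"
 shows "primitive G g"
 unfolding primitive_def
proof (intro allI impI conjI)
 fix a b :: real assume ab: "0 < a" "a \<le> b"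
 have c: "continuous_on {a..b} g" using ab by (intro continuous_on_subset[OF cont]) auto
 then show "set_integrable lborel {a..b} g" by (rule borel_integrable_atLeastAtMost')
 show "(LINT x:{a..b}|lborel. g x) = G b - G a"
  unfolding set_lebesgue_integral_def using ab c
  by (intro integral_FTC_atLeastAtMost) (auto intro!: has_vector_derivative_at_within der)
qed

lemma primitive_has_derivative:
 assumes G: "primitive G g" and cont: "continuous_on {0<..} g" and x: "0 < x"
 shows "(G has_vector_derivative g x) (at x)"
proof -
 have "((\<lambda>u. integral {x / 2..u} g) has_vector_derivative g x) (at x within {x / 2..x + 1})"
  using x by (intro integral_has_vector_derivative continuous_on_subset[OF cont]) auto
 then have "((\<lambda>u. G (x / 2) + integral {x / 2..u} g) has_vector_derivative g x) (at x within {x / 2..x + 1})"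
  by (auto intro: derivative_eq_intros)
 then have "(G has_vector_derivative g x) (at x within {x / 2..x + 1})"
  by (rule has_vector_derivative_transform[rotated 2])
   (use primitive_integral(2)[OF G, of "x / 2"] x in auto)
 then show ?thesis using x at_within_interior[of x "{x / 2..x + 1}"] by simp
qed

lemma primitive_cong:
 assumes "primitive G g" "\<And>y. 0 < y \<Longrightarrow> G y = G' y" "\<And>y. 0 < y \<Longrightarrow> g y = g' y"
 shows "primitive G' g'"
proof -
 have "set_integrable lborel {a..b} g' \<longleftrightarrow> set_integrable lborel {a..b} g"
  "(LINT x:{a..b}|lborel. g' x) = (LINT x:{a..b}|lborel. g x)" if "0 < a" for a b
  using assms(3) that by (intro set_integrable_cong set_lebesgue_integral_cong; auto)+
 then show ?thesis using assms(1,2) by (auto simp: primitive_def)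
qed

lemma primitive_cong_AE:
 assumes G: "primitive G g" and m: "hl_measurable g'" and ae: "AE y in lborel. 0 < y \<longrightarrow> g y = g' y"
 shows "primitive G g'"
 unfolding primitive_def
proof (intro allI impI)
 fix a b :: real assume ab: "0 < a" "a \<le> b"
 note mm = m[unfolded hl_measurable_iff]
 have "(\<lambda>x. indicator {a..b} x *\<^sub>R g' x) = (\<lambda>x. indicator {a..b} x *\<^sub>R ext0 g' x)"
  using ab by (auto simp: indicator_def ext0_def)
 then have [measurable]: "(\<lambda>x. indicator {a..b} x *\<^sub>R g' x) \<in> borel_measurable borel" using mm by simp
 have [measurable]: "(\<lambda>x. indicator {a..b} x *\<^sub>R g x) \<in> borel_measurable borel"
  using primitiveD(1)[OF G ab] by (simp add: set_integrable_def integrable_iff_bounded)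
 have ae': "AE x in lborel. indicator {a..b} x *\<^sub>R g x = indicator {a..b} x *\<^sub>R g' x"
  using ae by eventually_elim (use ab in \<open>auto simp: indicator_def\<close>)
 have "set_integrable lborel {a..b} g'"
  unfolding set_integrable_def
  by (rule integrable_cong_AE_imp[OF primitiveD(1)[OF G ab, unfolded set_integrable_def]]) (use ae' in \<open>auto elim: eventually_mono\<close>)
 moreover have "(LINT x:{a..b}|lborel. g' x) = (LINT x:{a..b}|lborel. g x)"
  unfolding set_lebesgue_integral_def by (rule integral_cong_AE) (use ae' in \<open>auto elim: eventually_mono\<close>)
 ultimately show "set_integrable lborel {a..b} g' \<and> (LINT x:{a..b}|lborel. g' x) = G b - G a"
  using primitiveD(2)[OF G ab] by simp
qed

lemma primitive_diff:
 assumes "primitive F f" "primitive G g"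
 shows "primitive (\<lambda>y. F y - G y) (\<lambda>y. f y - g y)"
 unfolding primitive_def
 using primitiveD[OF assms(1)] primitiveD[OF assms(2)] by (auto simp: set_integral_diff)

lemma primitive_add:
 assumes "primitive F f" "primitive G g"
 shows "primitive (\<lambda>y. F y + G y) (\<lambda>y. f y + g y)"
 unfolding primitive_def
 using primitiveD[OF assms(1)] primitiveD[OF assms(2)] by (auto simp: set_integral_add)

lemma primitive_add_const: "primitive F f \<Longrightarrow> primitive (\<lambda>y. F y + k) f"
 by (simp add: primitive_def)

lemma primitive_exists:
 assumes "\<And>a b. 0 < a \<Longrightarrow> a \<le> b \<Longrightarrow> set_integrable lborel {a..b} g"
 obtains G where "primitive G g"
proof
 define I where "I a b = (LINT x:{a..b}|lborel. g x)" for a b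
 define G where "G y = (if 1 \<le> y then I 1 y else - I y 1)" for y
 have split: "I a c = I a b + I b c" if "0 < a" "a \<le> b" "b \<le> c" for a b c
  using that set_borel_integral_eq_integral(2)[OF assms] set_borel_integral_eq_integral(1)[OF assms]
   Henstock_Kurzweil_Integration.integral_combine[of a b c g]
  unfolding I_def by simp
 show "primitive G g"
  unfolding primitive_def
 proof (intro allI impI conjI assms)
  fix a b :: real assume ab: "0 < a" "a \<le> b"
  have "I a b = G b - G a"
   unfolding G_def using split[of 1 a b] split[of a 1 b] split[of a b 1] ab by auto
  then show "(LINT x:{a..b}|lborel. g x) = G b - G a" by (simp add: I_def)
 qed auto
qed

text \<open>
 Both factors are merely absolutely continuous, so the product rule is obtained from Fubini's theorem on
 the triangle \<open>a \<le> r \<le> x \<le> b\<close> rather than from the fundamental theorem of calculus.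
\<close>

lemma primitive_mult:
 assumes F: "primitive F f" and G: "primitive G g"
 shows "primitive (\<lambda>y. F y * G y) (\<lambda>y. F y * g y + f y * G y)"
 unfolding primitive_def
proof (intro allI impI)
 fix a b :: real assume ab: "0 < a" "a \<le> b"
 define f1 where "f1 x = indicator {a..b} x *\<^sub>R f x" for x
 define g1 where "g1 x = indicator {a..b} x *\<^sub>R g x" for x
 have f1: "integrable lborel f1" and g1: "integrable lborel g1"
  using primitiveD(1)[OF F ab] primitiveD(1)[OF G ab] by (simp_all add: f1_def[abs_def] g1_def[abs_def] set_integrable_def)
 note [measurable] = f1[THEN borel_measurable_integrable] g1[THEN borel_measurable_integrable]
 have int_prod: "integrable (lborel \<Otimes>\<^sub>M lborel) (\<lambda>(x, r). f1 x * g1 r)"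
 proof (rule lborel_pair.Fubini_integrable)
  show "integrable lborel (\<lambda>x. LINT y|lborel. norm (case (x, y) of (x, r) \<Rightarrow> f1 x * g1 r))"
   using f1 by (simp add: norm_mult integrable_norm)
  show "AE x in lborel. integrable lborel (\<lambda>y. case (x, y) of (x, r) \<Rightarrow> f1 x * g1 r)"
   using g1 by simp
 qed measurable
 define h where "h x r = (if r \<le> x then f1 x * g1 r else 0)" for x r
 have int_h: "integrable (lborel \<Otimes>\<^sub>M lborel) (\<lambda>(x, r). h x r)"
 proof (rule Bochner_Integration.integrable_bound[OF int_prod])
  show "(\<lambda>(x, r). h x r) \<in> borel_measurable (lborel \<Otimes>\<^sub>M lborel)" unfolding h_def by measurable
  show "AE x in lborel \<Otimes>\<^sub>M lborel. norm (case x of (x, r) \<Rightarrow> h x r) \<le> norm (case x of (x, r) \<Rightarrow> f1 x * g1 r)"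
   by (auto simp: h_def)
 qed
 have 1: "(LINT r|lborel. h x r) = f1 x * (G x - G a)" for x
 proof (cases "x \<in> {a..b}")
  case True
  have "(LINT r|lborel. h x r) = (LINT r|lborel. f1 x * (indicator {a..x} r *\<^sub>R g r))"
   using True by (intro Bochner_Integration.integral_cong) (auto simp: h_def g1_def indicator_def)
  also have "\<dots> = f1 x * (LINT r:{a..x}|lborel. g r)"
   unfolding set_lebesgue_integral_def by (rule integral_mult_right_zero)
  finally show ?thesis using primitiveD(2)[OF G ab(1), of x] True by simp
 next
  case False
  then have "f1 x = 0" by (simp add: f1_def)
  then show ?thesis by (simp add: h_def cong: if_cong)
 qed
 have 2: "(LINT x|lborel. h x r) = g1 r * (F b - F r)" for r
 proof (cases "r \<in> {a..b}")
  case True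
  have "(LINT x|lborel. h x r) = (LINT x|lborel. g1 r * (indicator {r..b} x *\<^sub>R f x))"
   using True by (intro Bochner_Integration.integral_cong) (auto simp: h_def f1_def indicator_def)
  also have "\<dots> = g1 r * (LINT x:{r..b}|lborel. f x)"
   unfolding set_lebesgue_integral_def by (rule integral_mult_right_zero)
  finally show ?thesis using primitiveD(2)[OF F, of r b] True ab by simp
 next
  case False
  then have "g1 r = 0" by (simp add: g1_def)
  then show ?thesis by (simp add: h_def cong: if_cong)
 qed
 have eq: "(LINT x|lborel. f1 x * (G x - G a)) = (LINT r|lborel. g1 r * (F b - F r))"
  using lborel_pair.Fubini_integral[OF int_h] by (simp add: 1 2)
 have i1: "integrable lborel (\<lambda>x. f1 x * (G x - G a))"
  using lborel_pair.integrable_fst'[OF int_h] by (simp add: 1)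
 have i2: "integrable lborel (\<lambda>r. g1 r * (F b - F r))"
  using lborel_pair.integrable_snd[OF int_h] by (simp add: 2)
 have I1: "integrable lborel (\<lambda>x. f1 x * G x)"
  using Bochner_Integration.integrable_add[OF i1 integrable_mult_left[OF f1, of "G a"]] by (simp add: algebra_simps)
 have I2: "integrable lborel (\<lambda>x. g1 x * F x)"
  using Bochner_Integration.integrable_diff[OF integrable_mult_left[OF g1, of "F b"] i2] by (simp add: algebra_simps)
 have e1: "(LINT x|lborel. f1 x * (G x - G a)) = (LINT x|lborel. f1 x * G x) - (F b - F a) * G a"
 proof -
  have "(LINT x|lborel. f1 x * (G x - G a)) = (LINT x|lborel. f1 x * G x) - (LINT x|lborel. f1 x * G a)"
   unfolding right_diff_distrib using I1 f1 by (intro Bochner_Integration.integral_diff) auto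
  also have "(LINT x|lborel. f1 x * G a) = (LINT x|lborel. f1 x) * G a" by (rule integral_mult_left_zero)
  also have "(LINT x|lborel. f1 x) = F b - F a"
   using primitiveD(2)[OF F ab] by (simp add: f1_def set_lebesgue_integral_def)
  finally show ?thesis .
 qed
 have e2: "(LINT x|lborel. g1 x * (F b - F x)) = (G b - G a) * F b - (LINT x|lborel. g1 x * F x)"
 proof -
  have "(LINT x|lborel. g1 x * (F b - F x)) = (LINT x|lborel. g1 x * F b) - (LINT x|lborel. g1 x * F x)"
   unfolding right_diff_distrib using I2 g1 by (intro Bochner_Integration.integral_diff) auto
  also have "(LINT x|lborel. g1 x * F b) = (LINT x|lborel. g1 x) * F b" by (rule integral_mult_left_zero)
  also have "(LINT x|lborel. g1 x) = G b - G a"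
   using primitiveD(2)[OF G ab] by (simp add: g1_def set_lebesgue_integral_def)
  finally show ?thesis .
 qed
 have E: "(LINT x|lborel. g1 x * F x) + (LINT x|lborel. f1 x * G x) = F b * G b - F a * G a"
  using eq unfolding e1 e2 by algebra
 have form: "(\<lambda>x. indicator {a..b} x *\<^sub>R (F x * g x + f x * G x)) = (\<lambda>x. g1 x * F x + f1 x * G x)"
  by (auto simp: f1_def g1_def indicator_def)
 have "set_integrable lborel {a..b} (\<lambda>x. F x * g x + f x * G x)"
  unfolding set_integrable_def form using I1 I2 by simp
 moreover have "(LINT x:{a..b}|lborel. F x * g x + f x * G x) = F b * G b - F a * G a"
  unfolding set_lebesgue_integral_def form
  unfolding Bochner_Integration.integral_add[OF I2 I1] by (rule E)
 ultimately show "set_integrable lborel {a..b} (\<lambda>y. F y * g y + f y * G y) \<and>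
   (LINT y:{a..b}|lborel. F y * g y + f y * G y) = F b * G b - F a * G a" by blast
qed

section \<open>Solutions of the Bessel equation and Green's identity\<close>

lemma primitive_powr: "primitive (\<lambda>y. of_real (y powr c)) (\<lambda>y. of_real (c * y powr (c - 1)))"
proof (rule primitive_of_derivative)
 fix y :: real assume "0 < y"
 then have "((\<lambda>y. y powr c) has_real_derivative c * y powr (c - 1)) (at y)"
  by (auto intro!: derivative_eq_intros simp: powr_diff)
 then have "((\<lambda>y. y powr c) has_vector_derivative c * y powr (c - 1)) (at y)"
  by (simp add: has_real_derivative_iff_has_vector_derivative)
 then show "((\<lambda>y. complex_of_real (y powr c)) has_vector_derivative of_real (c * y powr (c - 1))) (at y)"
  by (rule bounded_linear.has_vector_derivative[OF bounded_linear_of_real])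
qed (auto intro!: continuous_intros)

text \<open>The derivative is an argument of its own: it is continuous, and boundary terms evaluate
  it at points. The divergence form is the one to which Green's identity and Hardy's inequalities
  apply; \<open>bessel_solution_iff\<close> recovers the second derivative.\<close>

definition bessel_solution :: "real \<Rightarrow> (real \<Rightarrow> complex) \<Rightarrow> (real \<Rightarrow> complex) \<Rightarrow> (real \<Rightarrow> complex) \<Rightarrow> bool" where
 "bessel_solution c U U1 f \<longleftrightarrow> primitive U U1 \<and>
   primitive (\<lambda>y. of_real (y powr c) * U1 y) (\<lambda>y. of_real (y powr c) * f y)"

lemma bessel_solution_continuous:
 assumes "bessel_solution c U U1 f"
 shows "continuous_on {0<..} U" "continuous_on {0<..} U1"
  and "0 < y \<Longrightarrow> (U has_vector_derivative U1 y) (at y)"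
proof -
 have P: "primitive U U1" "primitive (\<lambda>y. of_real (y powr c) * U1 y) (\<lambda>y. of_real (y powr c) * f y)"
  using assms by (auto simp: bessel_solution_def)
 show "continuous_on {0<..} U" by (rule primitive_continuous_on[OF P(1)])
 have "continuous_on {0<..} (\<lambda>y. of_real (y powr (- c)) * (of_real (y powr c) * U1 y))"
  by (intro continuous_intros primitive_continuous_on[OF P(2)]) auto
 moreover have "of_real (y powr (- c)) * (of_real (y powr c) * U1 y) = U1 y" if "y \<in> {0<..}" for y
 proof -
  have "y powr (- c) * y powr c = 1" using that by (simp add: powr_add[symmetric])
  then show ?thesis by (metis mult.assoc mult_1 of_real_1 of_real_mult)
 qed
 ultimately show c: "continuous_on {0<..} U1" by (rule continuous_on_eq)
 show "0 < y \<Longrightarrow> (U has_vector_derivative U1 y) (at y)"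
  by (rule primitive_has_derivative[OF P(1) c])
qed

lemma bessel_solution_measurable:
 assumes "bessel_solution c U U1 f"
 shows "hl_measurable U" "hl_measurable U1" "hl_measurable f"
proof -
 show "hl_measurable U" "hl_measurable U1"
  by (intro hl_measurable_continuous bessel_solution_continuous[OF assms])+
 have "hl_measurable (\<lambda>y. of_real (y powr c) * f y)"
  using assms by (auto simp: bessel_solution_def intro: primitive_density_measurable)
 then have "hl_measurable (\<lambda>y. of_real (y powr (- c)) * (of_real (y powr c) * f y))"
  by (rule hl_measurable_mult_left) measurable
 moreover have "of_real (y powr (- c)) * (of_real (y powr c) * f y) = f y" if "0 < y" for y
 proof -
  have "y powr (- c) * y powr c = 1" using that by (simp add: powr_add[symmetric])
  then show ?thesis by (metis mult.assoc mult_1 of_real_1 of_real_mult)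
 qed
 ultimately show "hl_measurable f" by (subst (asm) hl_measurable_cong[of _ f]) auto
qed

text \<open>In the difference of the two product rules the terms with both first derivatives cancel,
  and the boundary term is the Wronskian weighted by \<open>y powr c\<close>.\<close>

lemma Green_identity:
 assumes U: "bessel_solution c U U1 f" and V: "bessel_solution c V V1 g"
 shows "primitive (\<lambda>y. of_real (y powr c) * (V y * U1 y - U y * V1 y)) (\<lambda>y. of_real (y powr c) * (V y * f y - U y * g y))"
proof -
 have "primitive (\<lambda>y. V y * (of_real (y powr c) * U1 y)) (\<lambda>y. V y * (of_real (y powr c) * f y) + V1 y * (of_real (y powr c) * U1 y))"
  "primitive (\<lambda>y. U y * (of_real (y powr c) * V1 y)) (\<lambda>y. U y * (of_real (y powr c) * g y) + U1 y * (of_real (y powr c) * V1 y))"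
  using U V by (auto simp: bessel_solution_def intro!: primitive_mult)
 from primitive_diff[OF this] show ?thesis
  by (rule primitive_cong) (auto simp: algebra_simps)
qed

text \<open>The product rule with the factor \<open>y powr (- c)\<close> leads from the divergence
  form to U'' = f - (c / y) U', and with the factor \<open>y powr c\<close> back.\<close>

lemma bessel_solution_iff:
 "bessel_solution c U U1 f \<longleftrightarrow> primitive U U1 \<and> primitive U1 (\<lambda>y. f y - of_real (c / y) * U1 y)"
proof
 assume s: "bessel_solution c U U1 f"
 then have P: "primitive U U1" "primitive (\<lambda>y. of_real (y powr c) * U1 y) (\<lambda>y. of_real (y powr c) * f y)"
  by (auto simp: bessel_solution_def)
 have "primitive U1 (\<lambda>y. f y - of_real (c / y) * U1 y)"
 proof (rule primitive_cong[OF primitive_mult[OF primitive_powr[of "- c"] P(2)]])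
  fix y :: real assume y: "0 < y"
  have "y powr (- c - 1) * y powr c = 1 / y"
   using y by (simp add: powr_add[symmetric] powr_minus_divide)
  then have 1: "y powr (- c) * y powr c = 1" "- c * y powr (- c - 1) * y powr c = - (c / y)"
   using y by (simp_all add: powr_add[symmetric] mult.assoc)
  have "of_real (y powr (- c)) * (of_real (y powr c) * z) = z" for z :: complex
   using 1(1) by (metis mult.assoc mult_1 of_real_1 of_real_mult)
  moreover have "of_real (- c * y powr (- c - 1)) * (of_real (y powr c) * z) = - (of_real (c / y) * z)" for z :: complex
   using 1(2) by (metis mult.assoc mult_minus_left of_real_minus of_real_mult)
  ultimately show "of_real (y powr (- c)) * (of_real (y powr c) * U1 y) = U1 y"
   "of_real (y powr (- c)) * (of_real (y powr c) * f y) + of_real (- c * y powr (- c - 1)) * (of_real (y powr c) * U1 y) =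
    f y - of_real (c / y) * U1 y"
   by simp_all
 qed
 then show "primitive U U1 \<and> primitive U1 (\<lambda>y. f y - of_real (c / y) * U1 y)" using P(1) by simp
next
 assume a: "primitive U U1 \<and> primitive U1 (\<lambda>y. f y - of_real (c / y) * U1 y)"
 have "primitive (\<lambda>y. of_real (y powr c) * U1 y) (\<lambda>y. of_real (y powr c) * f y)"
 proof (rule primitive_cong[OF primitive_mult[OF primitive_powr[of c] conjunct2[OF a]]])
  fix y :: real assume y: "0 < y"
  have "c * y powr (c - 1) = y powr c * (c / y)" using y by (simp add: powr_diff)
  then have "complex_of_real (c * y powr (c - 1)) = of_real (y powr c) * of_real (c / y)" by (metis of_real_mult)
  then show "of_real (y powr c) * (f y - of_real (c / y) * U1 y) + of_real (c * y powr (c - 1)) * U1 y = of_real (y powr c) * f y"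
   by (simp only: algebra_simps)
 qed simp
 then show "bessel_solution c U U1 f" using a by (simp add: bessel_solution_def)
qed

lemma power_norm_weight:
 "power_norm (m + q * p) p g = power_norm m p (\<lambda>y. of_real (y powr q) * g y)"
 unfolding power_norm_def
 by (rule nn_integral_cong) (auto simp: indicator_def norm_mult powr_mult powr_powr powr_add mult_ac)

lemma Lpm_weight_iff:
 assumes "hl_measurable g"
 shows "g \<in> Lpm (m + q * p) p \<longleftrightarrow> (\<lambda>y. of_real (y powr q) * g y) \<in> Lpm m p"
proof -
 have "hl_measurable (\<lambda>y. of_real (y powr q) * g y)"
  by (rule hl_measurable_mult_left[OF assms]) measurable
 then show ?thesis using assms by (simp add: Lpm_iff power_norm_weight)
qed

section \<open>Estimates for solutions\<close>

text \<open>Schur's test for the kernel y^(- q - 1) r^q on r \<ge> y. The integral in r converges at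
  infinity for q + a + 1 < 0 and that in y converges at 0 for \<mu> + a (p - 1) > q.\<close>

lemma Hardy_outer:
 assumes p: "1 < p" and \<mu>: "(q + 1) * p < \<mu> + 1"
 obtains C where "0 \<le> C" "\<And>g T. g \<in> borel_measurable borel \<Longrightarrow> (\<And>r. 0 < r \<Longrightarrow> 0 \<le> g r) \<Longrightarrow> (\<And>y. 0 < y \<Longrightarrow> 0 \<le> T y) \<Longrightarrow>
  (\<And>y. 0 < y \<Longrightarrow> ennreal (T y) \<le> (\<integral>\<^sup>+r\<in>{y..}. ennreal (y powr (- q - 1) * r powr q * g r) \<partial>lborel)) \<Longrightarrow>
  nnint (\<lambda>y. y powr \<mu> * T y powr p) \<le> ennreal C * nnint (\<lambda>r. r powr \<mu> * g r powr p)"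
proof -
 \<comment> \<open>The midpoint of the interval of exponents allowed by the two conditions of
   convergence; the interval is nonempty exactly when (q + 1) p < \<mu> + 1.\<close>
 define a where "a = ((q - \<mu>) / (p - 1) + - (q + 1)) / 2"
 define b where "b = \<mu> + a * (p - 1)"
 define k where "k y r = (if y \<le> r then y powr (- q - 1) * r powr q else 0)" for y r :: real
 have "(q - \<mu>) / (p - 1) < - (q + 1)"
  by (subst pos_divide_less_eq) (use p \<mu> in \<open>auto simp: algebra_simps\<close>)
 moreover have "u < (u + v) / 2" "(u + v) / 2 < v" if "u < v" for u v :: real using that by auto
 ultimately have a: "a < - (q + 1)" "(q - \<mu>) / (p - 1) < a" unfolding a_def by blast+
 have b: "q < b" using a(2) p by (simp add: b_def pos_divide_less_eq)
 have [measurable]: "case_prod k \<in> borel_measurable borel"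
  unfolding k_def[abs_def] borel_prod[symmetric] by measurable
 show ?thesis
 proof (rule that[of "(1 / (- (q + a + 1))) powr (p - 1) * (1 / (b - q))"])
  show "0 \<le> (1 / (- (q + a + 1))) powr (p - 1) * (1 / (b - q))" using b by simp
  fix g T :: "real \<Rightarrow> real"
  assume g[measurable]: "g \<in> borel_measurable borel" and g0: "\<And>r. 0 < r \<Longrightarrow> 0 \<le> g r" and T0: "\<And>y. 0 < y \<Longrightarrow> 0 \<le> T y"
   and T: "\<And>y. 0 < y \<Longrightarrow> ennreal (T y) \<le> (\<integral>\<^sup>+r\<in>{y..}. ennreal (y powr (- q - 1) * r powr q * g r) \<partial>lborel)"
  show "nnint (\<lambda>y. y powr \<mu> * T y powr p) \<le>
    ennreal ((1 / (- (q + a + 1))) powr (p - 1) * (1 / (b - q))) * nnint (\<lambda>r. r powr \<mu> * g r powr p)"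
  proof (rule schur_test[OF p, where k = k and a = a])
   show "0 < 1 / (- (q + a + 1))" using a by simp
   show "0 \<le> 1 / (b - q)" using b by simp
   show "case_prod k \<in> borel_measurable borel" by measurable
   show "0 \<le> k y r" for y r by (simp add: k_def)
   show "nnint (\<lambda>r. k y r * r powr a) \<le> ennreal (1 / (- (q + a + 1)) * y powr a)" if y: "0 < y" for y
   proof -
    have "nnint (\<lambda>r. k y r * r powr a) =
      (\<integral>\<^sup>+r. ennreal (y powr (- q - 1)) * ennreal (indicator {y..} r * r powr (q + a)) \<partial>lborel)"
     using y by (intro nn_integral_cong) (auto simp: k_def indicator_def powr_add ennreal_mult'[symmetric] mult_ac)
    also have "\<dots> = ennreal (y powr (- q - 1)) * (nnint_R (\<lambda>r. indicator {y..} r * r powr (q + a)))"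
     by (rule nn_integral_cmult) simp
    also have "(nnint_R (\<lambda>r. indicator {y..} r * r powr (q + a))) = ennreal (- (y powr (q + a + 1)) / (q + a + 1))"
     by (rule nn_integral_has_integral_lebesgue[OF _ has_integral_powr_to_inf]) (use a y in auto)
    also have "ennreal (y powr (- q - 1)) * ennreal (- (y powr (q + a + 1)) / (q + a + 1)) =
      ennreal (y powr (- q - 1) * (- (y powr (q + a + 1)) / (q + a + 1)))"
     by (rule ennreal_mult'[symmetric]) simp
    also have "y powr (- q - 1) * (- (y powr (q + a + 1)) / (q + a + 1)) = - (y powr (- q - 1) * y powr (q + a + 1)) / (q + a + 1)"
     by simp
    also have "y powr (- q - 1) * y powr (q + a + 1) = y powr a" by (simp add: powr_add[symmetric])
    also have "- (y powr a) / (q + a + 1) = 1 / (- (q + a + 1)) * y powr a"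
     by (metis divide_inverse minus_divide_divide minus_minus mult.commute mult.left_neutral)
    finally show ?thesis by simp
   qed
   show "nnint (\<lambda>y. k y r * y powr (\<mu> + a * (p - 1))) \<le> ennreal (1 / (b - q) * r powr (\<mu> + a * (p - 1)))" if r: "0 < r" for r
   proof -
    have "nnint (\<lambda>y. k y r * y powr (\<mu> + a * (p - 1))) \<le>
      (\<integral>\<^sup>+y. ennreal (r powr q) * ennreal (indicator {0..r} y * y powr (b - q - 1)) \<partial>lborel)"
    proof (rule nn_integral_mono)
     fix y :: real
     have "y powr (- q - 1) * y powr b = y powr (b - q - 1)" by (simp add: powr_add[symmetric] algebra_simps)
     then show "ennreal (k y r * y powr (\<mu> + a * (p - 1))) * indicator {0<..} y \<le> ennreal (r powr q) * ennreal (indicator {0..r} y * y powr (b - q - 1))"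
      by (auto simp: k_def indicator_def b_def[symmetric] ennreal_mult'[symmetric] mult_ac)
    qed
    also have "\<dots> = ennreal (r powr q) * (nnint_R (\<lambda>y. indicator {0..r} y * y powr (b - q - 1)))"
     by (rule nn_integral_cmult) simp
    also have "(nnint_R (\<lambda>y. indicator {0..r} y * y powr (b - q - 1))) = ennreal (r powr (b - q - 1 + 1) / (b - q - 1 + 1))"
     by (rule nn_integral_has_integral_lebesgue[OF _ has_integral_powr_from_0]) (use b r in auto)
    also have "ennreal (r powr q) * ennreal (r powr (b - q - 1 + 1) / (b - q - 1 + 1)) = ennreal (r powr q * (r powr (b - q - 1 + 1) / (b - q - 1 + 1)))"
     by (rule ennreal_mult'[symmetric]) simp
    also have "r powr q * (r powr (b - q - 1 + 1) / (b - q - 1 + 1)) = 1 / (b - q) * (r powr q * r powr (b - q))" by simp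
    also have "r powr q * r powr (b - q) = r powr b" by (simp add: powr_add[symmetric])
    finally show ?thesis by (simp add: b_def)
   qed
   show "ennreal (T y) \<le> nnint (\<lambda>r. k y r * g r)" if y: "0 < y" for y
    by (rule order_trans[OF T[OF y]], intro nn_integral_mono) (use y in \<open>auto simp: k_def indicator_def\<close>)
  qed (use g0 T0 g in auto)
 qed
qed

text \<open>Schur's test for the kernel y^(-2) r on r \<le> y. The integral in r converges at 0 for
  a > -2 and that in y converges at infinity for \<mu> + a (p - 1) < 1.\<close>

lemma Hardy_inner:
 assumes p: "1 < p" and \<mu>: "\<mu> + 1 < 2 * p"
 obtains C where "0 \<le> C" "\<And>g T. g \<in> borel_measurable borel \<Longrightarrow> (\<And>r. 0 < r \<Longrightarrow> 0 \<le> g r) \<Longrightarrow> (\<And>y. 0 < y \<Longrightarrow> 0 \<le> T y) \<Longrightarrow>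
  (\<And>y. 0 < y \<Longrightarrow> ennreal (T y) \<le> (\<integral>\<^sup>+r\<in>{0<..y}. ennreal (y powr (- 2) * r * g r) \<partial>lborel)) \<Longrightarrow>
  nnint (\<lambda>y. y powr \<mu> * T y powr p) \<le> ennreal C * nnint (\<lambda>r. r powr \<mu> * g r powr p)"
proof -
 \<comment> \<open>Again the midpoint of the allowed interval, which is nonempty exactly when \<mu>
   + 1 < 2 p.\<close>
 define a where "a = (- 2 + (1 - \<mu>) / (p - 1)) / 2"
 define b where "b = \<mu> + a * (p - 1)"
 define k where "k y r = (if r \<le> y then y powr (- 2) * r else 0)" for y r :: real
 have "- 2 < (1 - \<mu>) / (p - 1)"
  by (subst pos_less_divide_eq) (use p \<mu> in \<open>auto simp: algebra_simps\<close>)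
 moreover have "u < (u + v) / 2" "(u + v) / 2 < v" if "u < v" for u v :: real using that by auto
 ultimately have a: "- 2 < a" "a < (1 - \<mu>) / (p - 1)" unfolding a_def by blast+
 have b: "b < 1" using a(2) p by (simp add: b_def pos_less_divide_eq)
 have [measurable]: "case_prod k \<in> borel_measurable borel"
  unfolding k_def[abs_def] borel_prod[symmetric] by measurable
 show ?thesis
 proof (rule that[of "(1 / (a + 2)) powr (p - 1) * (1 / (1 - b))"])
  show "0 \<le> (1 / (a + 2)) powr (p - 1) * (1 / (1 - b))" using b by simp
  fix g T :: "real \<Rightarrow> real"
  assume g[measurable]: "g \<in> borel_measurable borel" and g0: "\<And>r. 0 < r \<Longrightarrow> 0 \<le> g r" and T0: "\<And>y. 0 < y \<Longrightarrow> 0 \<le> T y"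
   and T: "\<And>y. 0 < y \<Longrightarrow> ennreal (T y) \<le> (\<integral>\<^sup>+r\<in>{0<..y}. ennreal (y powr (- 2) * r * g r) \<partial>lborel)"
  show "nnint (\<lambda>y. y powr \<mu> * T y powr p) \<le>
    ennreal ((1 / (a + 2)) powr (p - 1) * (1 / (1 - b))) * nnint (\<lambda>r. r powr \<mu> * g r powr p)"
  proof (rule schur_test[OF p, where k = k and a = a])
   show "0 < 1 / (a + 2)" using a by simp
   show "0 \<le> 1 / (1 - b)" using b by simp
   show "case_prod k \<in> borel_measurable borel" by measurable
   show "0 \<le> k y r" if "0 < r" for y r using that by (simp add: k_def)
   show "nnint (\<lambda>r. k y r * r powr a) \<le> ennreal (1 / (a + 2) * y powr a)" if y: "0 < y" for y
   proof -
    have "nnint (\<lambda>r. k y r * r powr a) \<le>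
      (\<integral>\<^sup>+r. ennreal (y powr (- 2)) * ennreal (indicator {0..y} r * r powr (a + 1)) \<partial>lborel)"
    proof (rule nn_integral_mono)
     fix r :: real
     have "r * r powr a = r powr (a + 1)" if "0 < r" using that by (simp add: powr_mult_base add.commute)
     then show "ennreal (k y r * r powr a) * indicator {0<..} r \<le> ennreal (y powr (- 2)) * ennreal (indicator {0..y} r * r powr (a + 1))"
      by (auto simp: k_def indicator_def ennreal_mult'[symmetric] mult.assoc)
    qed
    also have "\<dots> = ennreal (y powr (- 2)) * (nnint_R (\<lambda>r. indicator {0..y} r * r powr (a + 1)))"
     by (rule nn_integral_cmult) simp
    also have "(nnint_R (\<lambda>r. indicator {0..y} r * r powr (a + 1))) = ennreal (y powr (a + 1 + 1) / (a + 1 + 1))"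
     by (rule nn_integral_has_integral_lebesgue[OF _ has_integral_powr_from_0]) (use a y in auto)
    also have "ennreal (y powr (- 2)) * ennreal (y powr (a + 1 + 1) / (a + 1 + 1)) = ennreal (y powr (- 2) * (y powr (a + 1 + 1) / (a + 1 + 1)))"
     by (rule ennreal_mult'[symmetric]) simp
    also have "y powr (- 2) * (y powr (a + 1 + 1) / (a + 1 + 1)) = 1 / (a + 2) * (y powr (- 2) * y powr (a + 2))" by (simp add: add.commute)
    also have "y powr (- 2) * y powr (a + 2) = y powr a" unfolding powr_add[symmetric] by simp
    finally show ?thesis by simp
   qed
   show "nnint (\<lambda>y. k y r * y powr (\<mu> + a * (p - 1))) \<le> ennreal (1 / (1 - b) * r powr (\<mu> + a * (p - 1)))" if r: "0 < r" for r
   proof -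
    have "nnint (\<lambda>y. k y r * y powr (\<mu> + a * (p - 1))) \<le>
      (\<integral>\<^sup>+y. ennreal r * ennreal (indicator {r..} y * y powr (b - 2)) \<partial>lborel)"
    proof (rule nn_integral_mono)
     fix y :: real
     have "y powr (- 2) * y powr b = y powr (b - 2)" unfolding powr_add[symmetric] by simp
     then show "ennreal (k y r * y powr (\<mu> + a * (p - 1))) * indicator {0<..} y \<le> ennreal r * ennreal (indicator {r..} y * y powr (b - 2))"
      using r by (auto simp: k_def indicator_def b_def[symmetric] ennreal_mult'[symmetric] mult_ac)
    qed
    also have "\<dots> = ennreal r * (nnint_R (\<lambda>y. indicator {r..} y * y powr (b - 2)))"
     by (rule nn_integral_cmult) simp
    also have "(nnint_R (\<lambda>y. indicator {r..} y * y powr (b - 2))) = ennreal (- (r powr (b - 2 + 1)) / (b - 2 + 1))"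
     by (rule nn_integral_has_integral_lebesgue[OF _ has_integral_powr_to_inf]) (use b r in auto)
    also have "ennreal r * ennreal (- (r powr (b - 2 + 1)) / (b - 2 + 1)) = ennreal (r * (- (r powr (b - 2 + 1)) / (b - 2 + 1)))"
     using r by (intro ennreal_mult'[symmetric]) simp
    also have "r * (- (r powr (b - 2 + 1)) / (b - 2 + 1)) = (r * r powr (b - 1)) * (- 1 / (b - 1))" by simp
    also have "r * r powr (b - 1) = r powr b" using r by (simp add: powr_mult_base)
    also have "- 1 / (b - 1) = 1 / (1 - b)" by (metis minus_diff_eq minus_divide_left minus_divide_right)
    finally show ?thesis by (simp add: b_def)
   qed
   show "ennreal (T y) \<le> nnint (\<lambda>r. k y r * g r)" if y: "0 < y" for y
    by (rule order_trans[OF T[OF y]], intro nn_integral_mono) (use y in \<open>auto simp: k_def indicator_def\<close>)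
  qed (use g0 T0 g in auto)
 qed
qed

section \<open>Behaviour of solutions near 0\<close>

context bessel_Lp
begin

definition admissible :: "real \<Rightarrow> bool" where
 "admissible \<theta> \<longleftrightarrow> 0 \<le> \<theta> \<and> \<theta> \<le> 1 \<and> - 2 * \<nu> + 2 * \<theta> < (m + 1) / p"

text \<open>For such \<theta> the function \<open>y powr (- 2 * \<theta>)\<close> is not in the
  space near 0, so that the weighted condition excludes a nonzero limit. It is also the range in
  which both Hardy inequalities hold for the weight
  \<open>near_zero_weight \<theta>\<close>.\<close>

definition critical :: "real \<Rightarrow> bool" where
 "critical \<theta> \<longleftrightarrow> admissible \<theta> \<and> (m + 1) / p < 2 * \<theta>"

lemma admissible_0: "admissible 0"
 using m_lower by (simp add: admissible_def)

lemma critical_exists: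
 assumes "admissible \<theta>"
 obtains \<theta>' where "\<theta> \<le> \<theta>'" "critical \<theta>'"
proof (cases "(m + 1) / p < 2 * \<theta>")
 case True
 then show ?thesis using assms that by (auto simp: critical_def)
next
 case False
 define M where "M = (m + 1) / p"
 \<comment> \<open>Twice a critical exponent lies strictly between (m + 1) / p and this minimum, up
   to the admissible bound 2; \<theta>' is half the midpoint. An exponent that is not critical lies
   below (m + 1) / (2 p), hence below \<theta>'.\<close>
 define w where "w = min 2 (M + 2 * \<nu>)"
 define \<theta>' where "\<theta>' = (M + w) / 4"
 have "2 * \<theta> \<le> M" "0 \<le> \<theta>" "M < 2" "0 < \<nu>"
  using False assms m_upper \<nu> by (auto simp: M_def admissible_def)
 moreover from this have "M < w" "w \<le> 2" "w \<le> M + 2 * \<nu>" by (auto simp: w_def)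
 moreover have "4 * \<theta>' = M + w" by (simp add: \<theta>'_def)
 ultimately have "\<theta> \<le> \<theta>'" "0 \<le> \<theta>'" "\<theta>' \<le> 1" "- 2 * \<nu> + 2 * \<theta>' < M" "M < 2 * \<theta>'"
  by linarith+
 then show ?thesis using that[of \<theta>'] by (auto simp: critical_def admissible_def M_def)
qed

text \<open>Membership of g for this weight means that \<open>y powr (2 - 2 * \<theta>) * g\<close>
  lies in the original space; 2 - 2 \<theta> is the power that accompanies the second
  derivative.\<close>

abbreviation "near_zero_weight \<theta> \<equiv> m + (2 - 2 * \<theta>) * p"

lemma near_zero_weight_bounds:
 assumes "critical \<theta>"
 shows "(2 - 2 * \<nu>) * p < near_zero_weight \<theta> + 1" "near_zero_weight \<theta> + 1 < 2 * p"
proof -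
 have "(- 2 * \<nu> + 2 * \<theta>) * p < m + 1" "m + 1 < (2 * \<theta>) * p"
  using assms p by (auto simp: critical_def admissible_def pos_less_divide_eq pos_divide_less_eq)
 then show "(2 - 2 * \<nu>) * p < near_zero_weight \<theta> + 1" "near_zero_weight \<theta> + 1 < 2 * p"
  by (auto simp: algebra_simps)
qed

text \<open>The new weight shifts (m + 1) / p by 2 - 2 \<theta>, and the result stays below 2
  because \<theta> is critical. All facts of the locale thus apply to functions near 0 in the new
  weight, in particular \<open>weighted_integrable\<close>.\<close>

lemma near_zero_bessel_Lp: "critical \<theta> \<Longrightarrow> bessel_Lp p \<nu> (near_zero_weight \<theta>)"
proof
 assume c: "critical \<theta>"
 show "1 < p" "0 < \<nu>" by (rule p \<nu>)+
 have "(m + (2 - 2 * \<theta>) * p + 1) / p = (m + 1) / p + (2 - 2 * \<theta>)"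
  using p by (simp add: field_simps)
 then show "- 2 * \<nu> < (m + (2 - 2 * \<theta>) * p + 1) / p" "(m + (2 - 2 * \<theta>) * p + 1) / p < 2"
  using c by (auto simp: critical_def admissible_def)
qed

lemma restrict_near_zero:
 assumes \<theta>: "critical \<theta>" and f: "f \<in> L"
 shows "(\<lambda>y. of_real (indicator {0<..<1} y) * f y) \<in> Lpm (near_zero_weight \<theta>) p"
proof -
 have hm: "hl_measurable f" using f by (simp add: Lpm_iff)
 have m': "hl_measurable (\<lambda>y. of_real (indicator {0<..<1} y) * f y)"
  by (rule hl_measurable_mult_left[OF hm]) measurable
 show ?thesis
  unfolding Lpm_weight_iff[OF m']
 proof (rule Lpm_bound[OF f])
  show "hl_measurable (\<lambda>y. of_real (y powr (2 - 2 * \<theta>)) * (of_real (indicator {0<..<1} y) * f y))"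
   by (rule hl_measurable_mult_left[OF m']) measurable
  have "y powr (2 - 2 * \<theta>) * norm (f y) \<le> 1 * norm (f y)" if "0 < y" "y < 1" for y
   using that \<theta> powr_le_one_le[of y] by (intro mult_right_mono powr_le1) (auto simp: critical_def admissible_def)
  then show "AE y in lborel. 0 < y \<longrightarrow> norm (of_real (y powr (2 - 2 * \<theta>)) * (of_real (indicator {0<..<1} y) * f y)) \<le> norm (f y)"
   by (auto simp: norm_mult indicator_def intro!: AE_I2)
 qed (use p in auto)
qed

context
 fixes U U1 f :: "real \<Rightarrow> complex"
 assumes sol: "bessel_solution (1 - 2 * \<nu>) U U1 f" and fL: "f \<in> L"
begin

lemma sol_primitive:
 "primitive U U1" "primitive (\<lambda>y. of_real (y powr (1 - 2 * \<nu>)) * U1 y) (\<lambda>y. of_real (y powr (1 - 2 * \<nu>)) * f y)"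
 using sol by (auto simp: bessel_solution_def)

text \<open>Integrating the divergence form from y to 1 expresses U1 y minus the homogeneous part
  y^(-c) U1 1 by an integral of r^c f over [y, 1], to which \<open>Hardy_outer\<close> with q = c
  applies. The homogeneous part divided by y is y^(2 \<nu> - 2), which the lower bound of
  \<open>near_zero_weight_bounds\<close> puts in the space near 0.\<close>

lemma near_zero_U1:
 assumes \<theta>: "critical \<theta>"
 shows "(\<lambda>y. of_real (indicator {0<..<1} y / y) * U1 y) \<in> Lpm (near_zero_weight \<theta>) p"
proof -
 let ?c = "1 - 2 * \<nu>"
 let ?\<mu> = "near_zero_weight \<theta>"
 let ?J = "\<lambda>y. LINT r:{y..1}|lborel. of_real (r powr ?c) * f r"
 note bd = near_zero_weight_bounds[OF \<theta>]
 note Um = bessel_solution_measurable(2)[OF sol]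
 note [measurable] = Lpm_ext0[OF fL]
 define D where "D y = U1 y - of_real (y powr (- ?c)) * U1 1" for y
 have Dm: "hl_measurable D"
  unfolding D_def by (intro hl_measurable_add Um hl_measurableI) measurable
 define g where "g r = indicator {0<..<1} r * norm (ext0 f r)" for r :: real
 define T where "T y = indicator {0<..<1} y / y * norm (D y)" for y
 obtain C where C: "0 \<le> C" "\<And>g T. g \<in> borel_measurable borel \<Longrightarrow> (\<And>r. 0 < r \<Longrightarrow> 0 \<le> g r) \<Longrightarrow> (\<And>y. 0 < y \<Longrightarrow> 0 \<le> T y) \<Longrightarrow>
  (\<And>y. 0 < y \<Longrightarrow> ennreal (T y) \<le> (\<integral>\<^sup>+r\<in>{y..}. ennreal (y powr (- ?c - 1) * r powr ?c * g r) \<partial>lborel)) \<Longrightarrow>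
  nnint (\<lambda>y. y powr ?\<mu> * T y powr p) \<le> ennreal C * nnint (\<lambda>r. r powr ?\<mu> * g r powr p)"
  by (rule Hardy_outer[OF p, of ?c ?\<mu>]) (use bd in \<open>auto simp: algebra_simps\<close>)
 have "nnint (\<lambda>y. y powr ?\<mu> * T y powr p) \<le> ennreal C * nnint (\<lambda>r. r powr ?\<mu> * g r powr p)"
 proof (rule C(2))
  show "g \<in> borel_measurable borel" unfolding g_def by measurable
  show "0 \<le> g r" for r by (simp add: g_def)
  show "0 \<le> T y" if "0 < y" for y using that by (simp add: T_def)
  show "ennreal (T y) \<le> (\<integral>\<^sup>+r\<in>{y..}. ennreal (y powr (- ?c - 1) * r powr ?c * g r) \<partial>lborel)" if y: "0 < y" for y
  proof (cases "y < 1")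
   case True
   have "(?J y) = U1 1 - of_real (y powr ?c) * U1 y"
    using primitiveD(2)[OF sol_primitive(2) y, of 1] True by simp
   moreover have "of_real (y powr (- ?c)) * (of_real (y powr ?c) * U1 y) = U1 y"
   proof -
    have "y powr (- ?c) * y powr ?c = 1" using y by (simp add: powr_add[symmetric])
    then show ?thesis by (metis mult.assoc mult_1 of_real_1 of_real_mult)
   qed
   ultimately have Deq: "D y = - (of_real (y powr (- ?c)) * (?J y))"
    by (simp add: D_def right_diff_distrib)
   have "ennreal (norm (?J y)) \<le>
     (\<integral>\<^sup>+r. norm (indicator {y..1} r *\<^sub>R (of_real (r powr ?c) * f r)) \<partial>lborel)"
    unfolding set_lebesgue_integral_def
    using primitiveD(1)[OF sol_primitive(2) y, of 1] True
    by (intro integral_norm_bound_ennreal) (simp add: set_integrable_def)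
   also have "\<dots> = (\<integral>\<^sup>+r\<in>{y..}. ennreal (r powr ?c * g r) \<partial>lborel)"
   proof (rule nn_integral_cong_AE)
    have "AE r in lborel. r \<noteq> (1::real)" by (rule AE_lborel_singleton)
    then show "AE r in lborel. ennreal (norm (indicator {y..1} r *\<^sub>R (of_real (r powr ?c) * f r))) = ennreal (r powr ?c * g r) * indicator {y..} r"
     by eventually_elim (use y in \<open>auto simp: g_def ext0_def indicator_def norm_mult\<close>)
   qed
   finally have le: "ennreal (norm (?J y)) \<le> (\<integral>\<^sup>+r\<in>{y..}. ennreal (r powr ?c * g r) \<partial>lborel)" .
   have "y powr (- ?c - 1) = y powr (- ?c) / y" using y by (simp add: powr_diff power2_eq_square)
   then have "T y = y powr (- ?c - 1) * norm (?J y)"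
    unfolding T_def Deq using y True by (simp add: norm_mult)
   then have "ennreal (T y) = ennreal (y powr (- ?c - 1)) * ennreal (norm (?J y))"
    by (simp add: ennreal_mult')
   also have "\<dots> \<le> ennreal (y powr (- ?c - 1)) * (\<integral>\<^sup>+r\<in>{y..}. ennreal (r powr ?c * g r) \<partial>lborel)"
    by (intro mult_left_mono le) simp
   also have "\<dots> = (\<integral>\<^sup>+r. ennreal (y powr (- ?c - 1)) * (ennreal (r powr ?c * g r) * indicator {y..} r) \<partial>lborel)"
    by (rule nn_integral_cmult[symmetric]) (simp add: g_def)
   also have "\<dots> = (\<integral>\<^sup>+r\<in>{y..}. ennreal (y powr (- ?c - 1) * r powr ?c * g r) \<partial>lborel)"
    by (intro nn_integral_cong) (simp add: ennreal_mult' mult.assoc)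
   finally show ?thesis .
  qed (simp add: T_def)
 qed
 also have "nnint (\<lambda>r. r powr ?\<mu> * g r powr p) = power_norm ?\<mu> p (\<lambda>y. of_real (indicator {0<..<1} y) * f y)"
  unfolding power_norm_def by (intro nn_integral_cong) (auto simp: g_def ext0_def indicator_def)
 also have "nnint (\<lambda>y. y powr ?\<mu> * T y powr p) = power_norm ?\<mu> p (\<lambda>y. of_real (indicator {0<..<1} y / y) * D y)"
  unfolding power_norm_def by (intro nn_integral_cong) (auto simp: T_def indicator_def norm_mult norm_divide)
 finally have "power_norm ?\<mu> p (\<lambda>y. of_real (indicator {0<..<1} y / y) * D y) < \<infinity>"
  using restrict_near_zero[OF \<theta> fL] by (auto simp: Lpm_iff ennreal_mult_less_top intro: le_less_trans)
 moreover have "hl_measurable (\<lambda>y. of_real (indicator {0<..<1} y / y) * D y)"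
  by (rule hl_measurable_mult_left[OF Dm]) measurable
 ultimately have 1: "(\<lambda>y. of_real (indicator {0<..<1} y / y) * D y) \<in> Lpm ?\<mu> p" by (simp add: Lpm_iff)
 have 2: "(\<lambda>y. of_real (indicator {0<..<1} y / y * y powr (- ?c))) \<in> Lpm ?\<mu> p"
 proof -
  have "power_norm ?\<mu> p (\<lambda>y. of_real (indicator {0<..<1} y / y * y powr (- ?c))) =
    (\<integral>\<^sup>+y\<in>{0<..<1}. ennreal (y powr (?\<mu> - (2 - 2 * \<nu>) * p)) \<partial>lborel)"
   unfolding power_norm_def
  proof (rule nn_integral_cong)
   fix y :: real
   have "y powr ?\<mu> * (y powr (- ?c) / y) powr p = y powr (?\<mu> - (2 - 2 * \<nu>) * p)" if "0 < y"
   proof -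
    have "y powr (- ?c) / y = y powr (- (2 - 2 * \<nu>))" using that powr_diff[of y "- ?c" 1] by simp
    then show ?thesis by (simp add: powr_powr powr_add[symmetric] del: minus_diff_eq)
   qed
   then show "ennreal (y powr ?\<mu> * norm (complex_of_real (indicator {0<..<1} y / y * y powr (- ?c))) powr p) * indicator {0<..} y =
     ennreal (y powr (?\<mu> - (2 - 2 * \<nu>) * p)) * indicator {0<..<1} y"
    by (simp only: norm_of_real) (auto simp: indicator_def)
  qed
  also have "\<dots> < \<infinity>" using bd by (intro nn_integral_powr_finite_0) auto
  finally show ?thesis by (auto simp: Lpm_iff intro!: hl_measurableI)
 qed
 have "(\<lambda>y. of_real (indicator {0<..<1} y / y) * D y + U1 1 * of_real (indicator {0<..<1} y / y * y powr (- ?c))) \<in> Lpm ?\<mu> p"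
  using 1 2 p by (intro Lpm_add Lpm_cmult) auto
 moreover have "(\<lambda>y. of_real (indicator {0<..<1} y / y) * D y + U1 1 * of_real (indicator {0<..<1} y / y * y powr (- ?c))) =
   (\<lambda>y. of_real (indicator {0<..<1} y / y) * U1 y)"
  by (rule ext) (simp add: D_def algebra_simps)
 ultimately show ?thesis by simp
qed

text \<open>The quotient U1 / y lies in a space of the locale, where \<open>r * exp (- r)\<close> is
  an integrable weight; its factor r cancels the denominator.\<close>

lemma U1_integrable_near_zero: "integrable lborel (\<lambda>y. indicator {0<..<1} y *\<^sub>R U1 y)"
proof -
 obtain \<theta> where \<theta>: "critical \<theta>" using critical_exists[OF admissible_0] by blast
 interpret B: bessel_Lp p \<nu> "near_zero_weight \<theta>" by (rule near_zero_bessel_Lp[OF \<theta>])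
 note i = B.weighted_integrable[OF near_zero_U1[OF \<theta>]]
 show ?thesis
 proof (rule Bochner_Integration.integrable_bound[OF integrable_mult_right[OF i, of "exp 1"]])
  have "(\<lambda>y. indicator {0<..<1} y *\<^sub>R U1 y) = (\<lambda>y. indicator {0<..<1} y *\<^sub>R ext0 U1 y)"
   by (auto simp: indicator_def ext0_def)
  then show "(\<lambda>y. indicator {0<..<1} y *\<^sub>R U1 y) \<in> borel_measurable lborel"
   using bessel_solution_measurable(2)[OF sol] by (simp add: hl_measurable_iff)
  have "norm (U1 y) \<le> exp 1 * (y * exp (- y) * (norm (U1 y) / y))" if "0 < y" "y < 1" for y
  proof -
   have "1 * norm (U1 y) \<le> exp (1 - y) * norm (U1 y)" using that by (intro mult_right_mono) auto
   also have "\<dots> = exp 1 * (y * exp (- y) * (norm (U1 y) / y))" using that by (simp add: exp_diff exp_minus field_simps)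
   finally show ?thesis by simp
  qed
  then show "AE y in lborel. norm (indicator {0<..<1} y *\<^sub>R U1 y) \<le>
    norm (exp 1 * (indicator {0<..} y * (y * exp (- y) * norm (of_real (indicator {0<..<1} y / y) * U1 y))))"
   by (intro AE_I2) (auto simp: indicator_def norm_mult norm_divide)
 qed
qed

end

end

text \<open>An integrable function need not tend to 0, yet it cannot stay above e on a half-line.
  This is enough to dispose of boundary terms at infinity along a sequence.\<close>

lemma integrable_small_values:
 fixes \<phi> :: "real \<Rightarrow> real"
 assumes "integrable lborel \<phi>" "0 < e"
 obtains b where "R \<le> b" "\<phi> b < e"
proof -
 have "\<exists>b\<ge>R. \<phi> b < e"
 proof (rule ccontr)
  assume "\<not> ?thesis"
  then have *: "\<And>b. R \<le> b \<Longrightarrow> e \<le> \<phi> b" by force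
  define I where "I = (LINT x|lborel. \<bar>\<phi> x\<bar>)"
  obtain n where n: "I / e < real n" using reals_Archimedean2 by blast
  have "(\<integral>\<^sup>+x. ennreal e * indicator {R..R + real n} x \<partial>lborel) \<le> (\<integral>\<^sup>+x. ennreal \<bar>\<phi> x\<bar> \<partial>lborel)"
   by (rule nn_integral_mono) (use * in \<open>force simp: indicator_def intro!: ennreal_leI\<close>)
  also have "\<dots> = ennreal I"
   unfolding I_def using assms(1) by (intro nn_integral_eq_integral) auto
  also have "(\<integral>\<^sup>+x. ennreal e * indicator {R..R + real n} x \<partial>lborel) = ennreal (e * real n)"
   using assms(2) by (simp add: nn_integral_cmult_indicator ennreal_mult')
  finally have "e * real n \<le> I" unfolding I_def by (subst (asm) ennreal_le_iff) auto
  then show False using n assms(2) by (simp add: pos_divide_less_eq mult.commute)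
 qed
 then show ?thesis using that by blast
qed

context bessel_Lp
begin

context
 fixes U U1 f :: "real \<Rightarrow> complex"
 assumes sol: "bessel_solution (1 - 2 * \<nu>) U U1 f" and fL: "f \<in> L"
begin

private lemma prim:
 "primitive U U1" "primitive (\<lambda>y. of_real (y powr (1 - 2 * \<nu>)) * U1 y) (\<lambda>y. of_real (y powr (1 - 2 * \<nu>)) * f y)"
 using sol by (auto simp: bessel_solution_def)

text \<open>Integrability of the derivative near 0 yields the limit. The bound of U - l by an
  integral of the derivative is the form in which \<open>Hardy_inner\<close> takes its
  input.\<close>

lemma solution_limit:
 obtains l where "(U \<longlongrightarrow> l) (at_right 0)"
  "\<And>y. 0 < y \<Longrightarrow> y < 1 \<Longrightarrow> ennreal (norm (U y - l)) \<le> (\<integral>\<^sup>+r\<in>{0<..y}. ennreal (norm (U1 r)) \<partial>lborel)"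
proof -
 define u where "u r = indicator {0<..<1} r *\<^sub>R U1 r" for r :: real
 have u: "integrable lborel u" unfolding u_def by (rule U1_integrable_near_zero[OF sol fL])
 note [measurable] = u[THEN borel_measurable_integrable]
 define J where "J y = (LINT r|lborel. indicator {0<..y} r *\<^sub>R u r)" for y :: real
 have Ji: "integrable lborel (\<lambda>r. indicator {0<..y} r *\<^sub>R u r)" for y
  by (rule integrable_mult_indicator[OF _ u]) simp
 have inc: "J z - J y = U z - U y" if "0 < y" "y \<le> z" "z < 1" for y z
 proof -
  have "J z - J y = (LINT r|lborel. indicator {0<..z} r *\<^sub>R u r - indicator {0<..y} r *\<^sub>R u r)"
   unfolding J_def by (rule Bochner_Integration.integral_diff[symmetric, OF Ji Ji])
  also have "\<dots> = (LINT r|lborel. indicator {y..z} r *\<^sub>R U1 r)"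
  proof (rule integral_cong_AE)
   show "(\<lambda>r. indicator {y..z} r *\<^sub>R U1 r) \<in> borel_measurable lborel"
    using primitiveD(1)[OF prim(1) that(1,2)] by (simp add: set_integrable_def)
   have "AE r in lborel. r \<noteq> y" by (rule AE_lborel_singleton)
   then show "AE r in lborel. indicator {0<..z} r *\<^sub>R u r - indicator {0<..y} r *\<^sub>R u r = indicator {y..z} r *\<^sub>R U1 r"
    by eventually_elim (use that in \<open>auto simp: u_def indicator_def\<close>)
  qed measurable
  also have "\<dots> = U z - U y"
   using primitiveD(2)[OF prim(1) that(1,2)] by (simp add: set_lebesgue_integral_def)
  finally show ?thesis .
 qed
 define l where "l = U (1/2) - J (1/2)"
 have l: "U y - l = J y" if "0 < y" "y < 1" for y
  using inc[of y "1/2"] inc[of "1/2" y] that by (cases "y \<le> 1/2") (auto simp: l_def algebra_simps)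
 have Jlim: "(J \<longlongrightarrow> 0) (at_right 0)"
  unfolding tendsto_at_right_0_sequentially
 proof (intro allI impI)
  fix X :: "nat \<Rightarrow> real" assume X: "\<forall>i. 0 < X i" "X \<longlonglongrightarrow> 0"
  have "(\<lambda>i. J (X i)) \<longlonglongrightarrow> (LINT r|(lborel :: real measure). 0)"
   unfolding J_def
  proof (rule integral_dominated_convergence[OF _ _ integrable_norm[OF u]])
   show "AE r in lborel. (\<lambda>i. indicator {0<..X i} r *\<^sub>R u r) \<longlonglongrightarrow> 0"
   proof (rule AE_I2)
    fix r :: real
    show "(\<lambda>i. indicator {0<..X i} r *\<^sub>R u r) \<longlonglongrightarrow> 0"
    proof (cases "0 < r")
     case True
     have "\<forall>\<^sub>F i in sequentially. X i < r" using X(2) True by (rule order_tendstoD)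
     then have "\<forall>\<^sub>F i in sequentially. indicator {0<..X i} r *\<^sub>R u r = 0"
      by eventually_elim simp
     then show ?thesis by (rule tendsto_eventually)
    qed simp
   qed
   show "AE r in lborel. norm (indicator {0<..X i} r *\<^sub>R u r) \<le> norm (u r)" for i
    by (auto simp: indicator_def)
  qed (use u in auto)
  then show "(\<lambda>i. J (X i)) \<longlonglongrightarrow> 0" by simp
 qed
 show ?thesis
 proof (rule that[of l])
  have "((\<lambda>y. J y + l) \<longlongrightarrow> 0 + l) (at_right 0)" by (intro tendsto_intros Jlim)
  moreover have "\<forall>\<^sub>F y in at_right 0. J y + l = U y"
   unfolding eventually_at_right_field by (intro exI[of _ 1]) (auto simp: l[symmetric])
  ultimately show "(U \<longlongrightarrow> l) (at_right 0)" by (simp add: tendsto_cong)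
  fix y :: real assume y: "0 < y" "y < 1"
  have "ennreal (norm (U y - l)) \<le> (\<integral>\<^sup>+r. norm (indicator {0<..y} r *\<^sub>R u r) \<partial>lborel)"
   unfolding l[OF y] J_def by (rule integral_norm_bound_ennreal[OF Ji])
  also have "\<dots> \<le> (\<integral>\<^sup>+r\<in>{0<..y}. ennreal (norm (U1 r)) \<partial>lborel)"
   by (rule nn_integral_mono) (auto simp: u_def indicator_def)
  finally show "ennreal (norm (U y - l)) \<le> (\<integral>\<^sup>+r\<in>{0<..y}. ennreal (norm (U1 r)) \<partial>lborel)" .
 qed
qed

text \<open>\<open>Hardy_inner\<close> with g the modulus of U1 / y: the quotient of U - l by y^2 is
  dominated by y^(-2) times the integral of r g over (0, y].\<close>

lemma near_zero_U:
 assumes \<theta>: "critical \<theta>" and lim: "(U \<longlongrightarrow> l) (at_right 0)"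
 shows "(\<lambda>y. of_real (indicator {0<..<1} y / y\<^sup>2) * (U y - l)) \<in> Lpm (near_zero_weight \<theta>) p"
proof -
 let ?V = "(\<lambda>y. of_real (indicator {0<..<1} y / y\<^sup>2) * (U y - l))"
 let ?\<mu> = "near_zero_weight \<theta>"
 let ?W = "\<lambda>y. of_real (indicator {0<..<1} y / y) * U1 y"
 obtain l' where l': "(U \<longlongrightarrow> l') (at_right 0)"
  "\<And>y. 0 < y \<Longrightarrow> y < 1 \<Longrightarrow> ennreal (norm (U y - l')) \<le> (\<integral>\<^sup>+r\<in>{0<..y}. ennreal (norm (U1 r)) \<partial>lborel)"
  using solution_limit by blast
 have "l' = l" by (rule tendsto_unique[OF _ l'(1) lim]) simp
 note bd = l'(2)[unfolded this]
 note W = near_zero_U1[OF sol fL \<theta>]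
 note [measurable] = Lpm_ext0[OF W]
 have [measurable]: "ext0 U1 \<in> borel_measurable borel"
  using bessel_solution_measurable(2)[OF sol] by (simp add: hl_measurable_iff)
 define g where "g r = norm (ext0 ?W r)" for r
 define T where "T y = indicator {0<..<1} y / y\<^sup>2 * norm (U y - l)" for y
 obtain C where C: "0 \<le> C" "\<And>g T. g \<in> borel_measurable borel \<Longrightarrow> (\<And>r. 0 < r \<Longrightarrow> 0 \<le> g r) \<Longrightarrow> (\<And>y. 0 < y \<Longrightarrow> 0 \<le> T y) \<Longrightarrow>
  (\<And>y. 0 < y \<Longrightarrow> ennreal (T y) \<le> (\<integral>\<^sup>+r\<in>{0<..y}. ennreal (y powr (- 2) * r * g r) \<partial>lborel)) \<Longrightarrow>
  nnint (\<lambda>y. y powr ?\<mu> * T y powr p) \<le> ennreal C * nnint (\<lambda>r. r powr ?\<mu> * g r powr p)"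
  by (rule Hardy_inner[OF p near_zero_weight_bounds(2)[OF \<theta>]]) blast
 have "nnint (\<lambda>y. y powr ?\<mu> * T y powr p) \<le> ennreal C * nnint (\<lambda>r. r powr ?\<mu> * g r powr p)"
 proof (rule C(2))
  show "g \<in> borel_measurable borel" unfolding g_def by measurable
  show "0 \<le> g r" "0 \<le> T y" for r y by (simp_all add: g_def T_def)
  show "ennreal (T y) \<le> (\<integral>\<^sup>+r\<in>{0<..y}. ennreal (y powr (- 2) * r * g r) \<partial>lborel)" if y: "0 < y" for y
  proof (cases "y < 1")
   case True
   have "T y = y powr (- 2) * norm (U y - l)" using True y by (simp add: T_def powr_minus_divide)
   then have "ennreal (T y) = ennreal (y powr (- 2)) * ennreal (norm (U y - l))" by (simp add: ennreal_mult')
   also have "\<dots> \<le> ennreal (y powr (- 2)) * (\<integral>\<^sup>+r\<in>{0<..y}. ennreal (norm (U1 r)) \<partial>lborel)"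
    by (intro mult_left_mono bd y True) simp
   also have "(\<integral>\<^sup>+r\<in>{0<..y}. ennreal (norm (U1 r)) \<partial>lborel) = (\<integral>\<^sup>+r\<in>{0<..y}. ennreal (norm (ext0 U1 r)) \<partial>lborel)"
    by (intro nn_integral_cong) (auto simp: ext0_def indicator_def)
   also have "ennreal (y powr (- 2)) * \<dots> = (\<integral>\<^sup>+r. ennreal (y powr (- 2)) * (ennreal (norm (ext0 U1 r)) * indicator {0<..y} r) \<partial>lborel)"
    by (rule nn_integral_cmult[symmetric]) simp
   also have "\<dots> = (\<integral>\<^sup>+r\<in>{0<..y}. ennreal (y powr (- 2) * r * g r) \<partial>lborel)"
    by (intro nn_integral_cong)
     (use True in \<open>auto simp: ennreal_mult'[symmetric] g_def ext0_def indicator_def norm_mult norm_divide\<close>)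
   finally show ?thesis .
  qed (simp add: T_def)
 qed
 also have "nnint (\<lambda>r. r powr ?\<mu> * g r powr p) = power_norm ?\<mu> p ?W"
  unfolding power_norm_def by (intro nn_integral_cong) (auto simp: g_def ext0_def indicator_def)
 also have "nnint (\<lambda>y. y powr ?\<mu> * T y powr p) = power_norm ?\<mu> p ?V"
  unfolding power_norm_def by (intro nn_integral_cong) (auto simp: T_def indicator_def norm_mult norm_divide norm_power)
 finally have "power_norm ?\<mu> p ?V < \<infinity>"
  using W by (auto simp: Lpm_iff ennreal_mult_less_top intro: le_less_trans)
 moreover have "hl_measurable ?V"
  by (rule hl_measurable_mult_left, intro hl_measurable_add bessel_solution_measurable[OF sol] hl_measurableI) measurable
 ultimately show ?thesis by (simp add: Lpm_iff)
qed

text \<open>Integration of the divergence form over [y, 1] writes y U1 y as y^(2 \<nu>) times a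
  constant minus the integral of r^c f. Moving the factor y^(2 \<nu>) under the integral makes
  dominated convergence applicable.\<close>

lemma solution_derivative_limit: "((\<lambda>y. of_real y * U1 y) \<longlongrightarrow> 0) (at_right 0)"
 unfolding tendsto_at_right_0_sequentially
proof (intro allI impI)
 fix X :: "nat \<Rightarrow> real" assume X: "\<forall>i. 0 < X i" "X \<longlonglongrightarrow> 0"
 let ?c = "1 - 2 * \<nu>"
 note [measurable] = Lpm_ext0[OF fL]
 define w where "w r = exp 1 * (indicator {0<..} r * (r * exp (- r) * norm (ext0 f r)))" for r :: real
 \<comment> \<open>Since r^c is r / r^(2 \<nu>), the weight under the integral becomes r (X i /
   r)^(2 \<nu>); the quotient is at most 1 on the interval and tends to 0 for fixed r.\<close>
 define h where "h i r = indicator {X i..1} r * (X i / r) powr (2 * \<nu>) * (r * norm (ext0 f r))" for i r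
 have w: "integrable lborel w"
 proof -
  have "w = (\<lambda>r. exp 1 * (indicator {0<..} r * (r * exp (- r) * norm (f r))))"
   by (auto simp: w_def ext0_def indicator_def)
  then show ?thesis using weighted_integrable[OF fL] by simp
 qed
 have hw: "norm (h i r) \<le> w r" for i r
 proof (cases "r \<in> {X i..1}")
  case True
  have r: "0 < r" using True X(1) by (auto intro: less_le_trans)
  have "(X i / r) powr (2 * \<nu>) \<le> 1" using True r less_imp_le[OF X(1)[rule_format, of i]] \<nu> by (intro powr_le1) auto
  also have "1 \<le> exp (1 - r)" using True by simp
  finally have "(X i / r) powr (2 * \<nu>) * (r * norm (f r)) \<le> exp (1 - r) * (r * norm (f r))"
   by (rule mult_right_mono) (use r in simp)
  also have "\<dots> = exp 1 * (r * exp (- r) * norm (f r))" by (simp add: exp_diff exp_minus field_simps)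
  finally show ?thesis using True r by (simp add: h_def w_def ext0_def abs_mult)
 next
  case False
  then have "h i r = 0" by (simp add: h_def)
  moreover have "0 \<le> w r" by (simp add: w_def indicator_def)
  ultimately show ?thesis by simp
 qed
 have "(\<lambda>i. LINT r|lborel. h i r) \<longlonglongrightarrow> (LINT r|(lborel :: real measure). 0)"
 proof (rule integral_dominated_convergence[OF _ _ w])
  show "AE r in lborel. (\<lambda>i. h i r) \<longlonglongrightarrow> 0"
  proof (rule AE_I2)
   fix r :: real
   show "(\<lambda>i. h i r) \<longlonglongrightarrow> 0"
   proof (cases "0 < r")
    case True
    have "(\<lambda>i. (X i / r) powr (2 * \<nu>) * (r * norm (ext0 f r))) \<longlonglongrightarrow> 0 * (r * norm (ext0 f r))"
    proof (intro tendsto_mult tendsto_const tendsto_zero_powrI[where b = "2 * \<nu>"])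
     have "(\<lambda>i. X i / r) \<longlonglongrightarrow> 0 / r" using X(2) True by (intro tendsto_divide tendsto_const) auto
     then show "(\<lambda>i. X i / r) \<longlonglongrightarrow> 0" by simp
     show "\<forall>\<^sub>F i in sequentially. 0 \<le> X i / r" using X(1) True by (auto simp: less_imp_le)
    qed (use \<nu> in auto)
    then have l: "(\<lambda>i. (X i / r) powr (2 * \<nu>) * (r * norm (ext0 f r))) \<longlonglongrightarrow> 0" by simp
    show ?thesis
     by (rule Lim_null_comparison[OF _ l]) (use True in \<open>auto simp: h_def indicator_def\<close>)
   next
    case False
    then have "h i r = 0" for i using X(1)[rule_format, of i] by (auto simp: h_def indicator_def)
    then show ?thesis by simp
   qed
  qed
  show "AE r in lborel. norm (h i r) \<le> w r" for i using hw by auto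
 qed (auto simp: h_def)
 then have hlim: "(\<lambda>i. LINT r|lborel. h i r) \<longlonglongrightarrow> 0" by simp
 have "(\<lambda>i. X i powr (2 * \<nu>) * norm (U1 1) + (LINT r|lborel. h i r)) \<longlonglongrightarrow> 0 * norm (U1 1) + 0"
  using X \<nu> by (intro tendsto_intros hlim tendsto_zero_powrI[where b = "2 * \<nu>"]) (auto simp: less_imp_le)
 then have lim: "(\<lambda>i. X i powr (2 * \<nu>) * norm (U1 1) + (LINT r|lborel. h i r)) \<longlonglongrightarrow> 0" by simp
 have est: "norm (of_real (X i) * U1 (X i)) \<le> X i powr (2 * \<nu>) * norm (U1 1) + (LINT r|lborel. h i r)" if i: "X i < 1" for i
 proof -
  let ?x = "X i"
  let ?H = "\<lambda>r. indicator {?x..1} r *\<^sub>R (of_real (r powr ?c) * f r)"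
  let ?J = "(LINT r:{?x..1}|lborel. of_real (r powr ?c) * f r)"
  have x: "0 < ?x" "?x \<le> 1" using X(1) i by auto
  have "?J = U1 1 - of_real (?x powr ?c) * U1 ?x"
   using primitiveD(2)[OF prim(2) x] by simp
  then have "of_real (?x powr ?c) * U1 ?x = U1 1 - ?J" by simp
  moreover have "of_real ?x * U1 ?x = of_real (?x powr (2 * \<nu>)) * (of_real (?x powr ?c) * U1 ?x)"
  proof -
   have "?x powr (2 * \<nu>) * ?x powr ?c = ?x" using x by (simp add: powr_add[symmetric])
   then show ?thesis by (metis mult.assoc of_real_mult)
  qed
  ultimately have "norm (of_real ?x * U1 ?x) = ?x powr (2 * \<nu>) * norm (U1 1 - ?J)"
   by (simp add: norm_mult)
  also have "\<dots> \<le> ?x powr (2 * \<nu>) * (norm (U1 1) + norm ?J)"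
   by (intro mult_left_mono norm_triangle_ineq4) auto
  also have "\<dots> = ?x powr (2 * \<nu>) * norm (U1 1) + ?x powr (2 * \<nu>) * norm ?J"
   by (simp add: distrib_left)
  also have "?x powr (2 * \<nu>) * norm ?J \<le> (LINT r|lborel. h i r)"
  proof -
   have "norm ?J \<le> (LINT r|lborel. norm (?H r))"
    unfolding set_lebesgue_integral_def by (rule integral_norm_bound)
   then have "?x powr (2 * \<nu>) * norm ?J \<le>
     ?x powr (2 * \<nu>) * (LINT r|lborel. norm (?H r))"
    by (rule mult_left_mono) simp
   also have "\<dots> = (LINT r|lborel. ?x powr (2 * \<nu>) * norm (?H r))"
    by (rule integral_mult_right_zero[symmetric])
   also have "\<dots> = (LINT r|lborel. h i r)"
   proof (rule Bochner_Integration.integral_cong[OF refl])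
    fix r :: real
    show "?x powr (2 * \<nu>) * norm (?H r) = h i r"
    proof (cases "r \<in> {?x..1}")
     case True
     have r: "0 < r" using True x by auto
     have "r powr ?c = r / r powr (2 * \<nu>)" using r by (simp add: powr_diff)
     then show ?thesis using True r x by (simp add: h_def ext0_def norm_mult norm_divide powr_divide)
    qed (simp add: h_def)
   qed
   finally show ?thesis .
  qed
  finally show ?thesis by simp
 qed
 show "(\<lambda>i. of_real (X i) * U1 (X i)) \<longlonglongrightarrow> 0"
 proof (rule Lim_null_comparison[OF _ lim])
  have "\<forall>\<^sub>F i in sequentially. X i < 1" using X(2) by (rule order_tendstoD) simp
  then show "\<forall>\<^sub>F i in sequentially. norm (of_real (X i) * U1 (X i)) \<le> X i powr (2 * \<nu>) * norm (U1 1) + (LINT r|lborel. h i r)"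
   by eventually_elim (rule est)
 qed
qed

end

end

section \<open>Behaviour of solutions away from 0: the derivative on the half-line beyond 1\<close>

lemma Lpm_bound2:
 assumes "f \<in> Lpm m p" "g \<in> Lpm m p" "hl_measurable h" "0 \<le> p"
  and "\<And>y. 0 < y \<Longrightarrow> norm (h y) \<le> norm (f y) + norm (g y)"
 shows "h \<in> Lpm m p"
proof -
 have "power_norm m p h \<le> ennreal (2 powr p) * (power_norm m p f + power_norm m p g)"
  using assms by (intro power_norm_add) (auto simp: Lpm_iff)
 also have "\<dots> < \<infinity>" using assms by (simp add: Lpm_iff ennreal_mult_less_top)
 finally show ?thesis using assms by (simp add: Lpm_iff)
qed

lemma powr_half_one_bounds:
 fixes x :: real
 assumes "1 / 2 \<le> x" "x \<le> 1"
 shows "2 powr (- \<bar>c\<bar>) \<le> x powr c" "x powr c \<le> 2 powr \<bar>c\<bar>"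
proof -
 have h: "(1 / 2) powr c = 2 powr (- c)" by (simp add: powr_divide powr_minus_divide)
 have "2 powr (- \<bar>c\<bar>) \<le> x powr c \<and> x powr c \<le> 2 powr \<bar>c\<bar>"
 proof (cases "0 \<le> c")
  case True
  have "(1 / 2) powr c \<le> x powr c" using assms True by (intro powr_mono2) auto
  moreover have "x powr c \<le> 1" using assms True by (intro powr_le1) auto
  moreover have "1 \<le> 2 powr \<bar>c\<bar>" by (rule ge_one_powr_ge_zero) auto
  ultimately show ?thesis using True h by simp
 next
  case False
  have "x powr c \<le> (1 / 2) powr c" using assms False by (intro powr_mono2') auto
  moreover have "1 powr c \<le> x powr c" using assms False by (intro powr_mono2') auto
  moreover have "2 powr (- \<bar>c\<bar>) \<le> 2 powr (0::real)" by (intro powr_mono) auto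
  ultimately show ?thesis using False h by simp
 qed
 then show "2 powr (- \<bar>c\<bar>) \<le> x powr c" "x powr c \<le> 2 powr \<bar>c\<bar>" by auto
qed

lemma powr_ratio_le:
 fixes x y :: real
 assumes "0 < x" "x \<le> y" "y \<le> 2 * x"
 shows "x powr m \<le> 2 powr \<bar>m\<bar> * y powr m"
proof -
 have "(x / y) powr m \<le> 2 powr \<bar>m\<bar>" using assms by (intro powr_half_one_bounds) (auto simp: field_simps)
 then have "x powr m / y powr m \<le> 2 powr \<bar>m\<bar>" using assms by (simp add: powr_divide)
 then show ?thesis using assms by (simp add: pos_divide_le_eq)
qed

text \<open>For y \<ge> 1 the points y and y + 1 differ at most by a factor 2, so that the weights
  there are comparable.\<close>

lemma Lpm_shift:
 assumes "U \<in> Lpm m p"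
 shows "(\<lambda>y. of_real (indicator {1..} y) * U (y + 1)) \<in> Lpm m p"
proof -
 let ?V = "(\<lambda>y. of_real (indicator {1..} y) * U (y + 1))"
 note [measurable] = Lpm_ext0[OF assms]
 have eq: "indicator {1..} y * U (y + 1) = indicator {1..} y * ext0 U (1 + 1 * y)" for y :: real
  by (auto simp: ext0_def indicator_def add.commute)
 let ?\<phi> = "\<lambda>x. ennreal (x powr m * norm (ext0 U x) powr p) * indicator {0<..} x"
 have "power_norm m p ?V \<le> (\<integral>\<^sup>+y. ennreal (2 powr \<bar>m\<bar>) * ?\<phi> (1 + 1 * y) \<partial>lborel)"
  unfolding power_norm_def
 proof (rule nn_integral_mono)
  fix y :: real
  show "ennreal (y powr m * norm (of_real (indicator {1..} y) * U (y + 1)) powr p) * indicator {0<..} y \<le> ennreal (2 powr \<bar>m\<bar>) * ?\<phi> (1 + 1 * y)"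
  proof (cases "1 \<le> y")
   case True
   have "y powr m * norm (U (y + 1)) powr p \<le> (2 powr \<bar>m\<bar> * (y + 1) powr m) * norm (U (y + 1)) powr p"
    using True by (intro mult_right_mono powr_ratio_le) auto
   then have "ennreal (y powr m * norm (U (y + 1)) powr p) \<le> ennreal (2 powr \<bar>m\<bar> * ((y + 1) powr m * norm (U (y + 1)) powr p))"
    by (intro ennreal_leI) (simp add: mult.assoc)
   also have "\<dots> = ennreal (2 powr \<bar>m\<bar>) * ennreal ((y + 1) powr m * norm (U (y + 1)) powr p)"
    by (rule ennreal_mult') simp
   finally show ?thesis using True by (simp add: ext0_def add.commute)
  qed simp
 qed
 also have "\<dots> = ennreal (2 powr \<bar>m\<bar>) * (\<integral>\<^sup>+y. ?\<phi> (1 + 1 * y) \<partial>lborel)"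
  by (rule nn_integral_cmult) simp
 also have "(\<integral>\<^sup>+y. ?\<phi> (1 + 1 * y) \<partial>lborel) = (\<integral>\<^sup>+x. ?\<phi> x \<partial>lborel)"
  by (subst nn_integral_real_affine[of ?\<phi> 1 1]) simp_all
 also have "\<dots> = power_norm m p U"
  unfolding power_norm_def by (intro nn_integral_cong) (auto simp: ext0_def indicator_def)
 also have "ennreal (2 powr \<bar>m\<bar>) * power_norm m p U < \<infinity>"
  using assms by (simp add: Lpm_iff ennreal_mult_less_top)
 finally have "power_norm m p ?V < \<infinity>" .
 moreover have "hl_measurable ?V"
 proof (rule hl_measurableI)
  have "?V = (\<lambda>y. complex_of_real (indicator {1..} y) * ext0 U (1 + 1 * y))"
   by (auto simp: ext0_def indicator_def add.commute)
  then show "?V \<in> borel_measurable borel" by simp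
 qed
 ultimately show ?thesis by (simp add: Lpm_iff)
qed

text \<open>Schur's test with a = 0 for the indicator of y \<le> r \<le> y + 1: the integral in r is
  1, and the weights at y and r are comparable, which gives the factor
  \<open>2 powr \<bar>m\<bar>\<close>.\<close>

lemma Lpm_local_average:
 assumes p: "1 < p" and f: "f \<in> Lpm m p"
  and int: "\<And>y. 0 < y \<Longrightarrow> set_integrable lborel {y..y + 1} f"
  and F: "\<And>y. 1 \<le> y \<Longrightarrow> 0 \<le> F y" "\<And>y. 1 \<le> y \<Longrightarrow> F y \<le> (LINT r:{y..y + 1}|lborel. norm (f r))"
 shows "power_norm m p (\<lambda>y. of_real (indicator {1..} y * F y)) < \<infinity>"
proof -
 note [measurable] = Lpm_ext0[OF f]
 define k where "k y r = (if 1 \<le> y \<and> y \<le> r \<and> r \<le> y + 1 then 1 else 0 :: real)" for y r :: real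
 have [measurable]: "case_prod k \<in> borel_measurable borel"
  unfolding k_def[abs_def] borel_prod[symmetric] by measurable
 have "nnint (\<lambda>y. y powr m * (indicator {1..} y * F y) powr p) \<le>
   ennreal (1 powr (p - 1) * 2 powr \<bar>m\<bar>) * nnint (\<lambda>r. r powr m * norm (ext0 f r) powr p)"
 proof (rule schur_test[OF p, where k = k and a = 0])
  show "case_prod k \<in> borel_measurable borel" by measurable
  show "nnint (\<lambda>r. k y r * r powr 0) \<le> ennreal (1 * y powr 0)" if "0 < y" for y
  proof -
   have "nnint (\<lambda>r. k y r * r powr 0) \<le> (\<integral>\<^sup>+r. indicator {y..y + 1} r \<partial>lborel)"
    by (rule nn_integral_mono) (auto simp: k_def indicator_def)
   then show ?thesis using that by simp
  qed
  show "nnint (\<lambda>y. k y r * y powr (m + 0 * (p - 1))) \<le> ennreal (2 powr \<bar>m\<bar> * r powr (m + 0 * (p - 1)))" if r: "0 < r" for r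
  proof -
   have "nnint (\<lambda>y. k y r * y powr (m + 0 * (p - 1))) \<le>
     (\<integral>\<^sup>+y. ennreal (2 powr \<bar>m\<bar> * r powr m) * indicator {r - 1..r} y \<partial>lborel)"
    by (rule nn_integral_mono) (auto simp: k_def indicator_def intro!: ennreal_leI powr_ratio_le)
   also have "\<dots> = ennreal (2 powr \<bar>m\<bar> * r powr m)" by (simp add: nn_integral_cmult_indicator)
   finally show ?thesis by simp
  qed
  show "ennreal (indicator {1..} y * F y) \<le> nnint (\<lambda>r. k y r * norm (ext0 f r))" if y: "0 < y" for y
  proof (cases "1 \<le> y")
   case True
   have "integrable lborel (\<lambda>r. norm (indicator {y..y + 1} r *\<^sub>R f r))"
    using int[OF y] by (intro integrable_norm) (simp add: set_integrable_def)
   then have i: "integrable lborel (\<lambda>r. indicator {y..y + 1} r *\<^sub>R norm (f r))" by simp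
   have "ennreal (F y) \<le> ennreal (LINT r:{y..y + 1}|lborel. norm (f r))" by (intro ennreal_leI F True)
   also have "\<dots> = (nnint_R (\<lambda>r. indicator {y..y + 1} r *\<^sub>R norm (f r)))"
    unfolding set_lebesgue_integral_def by (rule nn_integral_eq_integral[symmetric, OF i]) simp
   also have "\<dots> \<le> nnint (\<lambda>r. k y r * norm (ext0 f r))"
    by (rule nn_integral_mono) (use True in \<open>auto simp: k_def ext0_def indicator_def\<close>)
   finally show ?thesis using True by simp
  qed simp
 qed (use F in \<open>auto simp: k_def indicator_def\<close>)
 also have "nnint (\<lambda>r. r powr m * norm (ext0 f r) powr p) = power_norm m p f"
  unfolding power_norm_def by (intro nn_integral_cong) (auto simp: ext0_def indicator_def)
 also have "nnint (\<lambda>y. y powr m * (indicator {1..} y * F y) powr p) = power_norm m p (\<lambda>y. of_real (indicator {1..} y * F y))"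
  unfolding power_norm_def using F(1) by (intro nn_integral_cong) (auto simp: indicator_def)
 finally show ?thesis using f by (auto simp: Lpm_iff ennreal_mult_less_top intro: le_less_trans)
qed

text \<open>A Taylor formula with integral remainder adapted to the divergence form. The combination
  Q s^c U1 + U has density Q s^c f, and at y + 1 its first term vanishes, so that U1 y is expressed
  by U y, U (y + 1) and an average of f.\<close>

lemma bessel_solution_derivative_bound:
 assumes sol: "bessel_solution (1 - 2 * \<nu>) U U1 f" and \<nu>: "0 < \<nu>" and y: "1 \<le> y"
  and int: "set_integrable lborel {y..y + 1} f"
 defines "\<kappa> \<equiv> 2 powr \<bar>1 - 2 * \<nu>\<bar>"
 shows "norm (U1 y) \<le> \<kappa> * (norm (U (y + 1)) + norm (U y) + \<kappa> * (LINT r:{y..y + 1}|lborel. norm (f r)))"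
proof -
 let ?c = "1 - 2 * \<nu>"
 \<comment> \<open>The primitive of - s^(-c) that vanishes at y + 1; with it the derivative of U
   cancels in the product rule. It replaces the factor y + 1 - s of the ordinary Taylor
   formula.\<close>
 define Q where "Q s = ((y + 1) powr (2 * \<nu>) - s powr (2 * \<nu>)) / (2 * \<nu>)" for s :: real
 let ?H = "\<lambda>s. indicator {y..y + 1} s *\<^sub>R (of_real (Q s * s powr ?c) * f s)"
 let ?J = "(LINT s:{y..y + 1}|lborel. of_real (Q s * s powr ?c) * f s)"
 have prim: "primitive U U1" "primitive (\<lambda>y. of_real (y powr ?c) * U1 y) (\<lambda>y. of_real (y powr ?c) * f y)"
  using sol by (auto simp: bessel_solution_def)
 have Qder: "(Q has_real_derivative - (s powr (- ?c))) (at s)" if "0 < s" for s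
  unfolding Q_def using that \<nu> by (auto intro!: derivative_eq_intros)
 have Qb: "0 \<le> Q s * s powr ?c" "Q s * s powr ?c \<le> \<kappa> * (y + 1 - s)" "(y + 1 - s) / \<kappa> \<le> Q s * s powr ?c"
  if s: "y \<le> s" "s \<le> y + 1" for s
 proof -
  have \<kappa>: "0 < \<kappa>" by (simp add: \<kappa>_def)
  have "0 \<le> Q s * s powr ?c \<and> Q s * s powr ?c \<le> \<kappa> * (y + 1 - s) \<and> (y + 1 - s) / \<kappa> \<le> Q s * s powr ?c"
  proof (cases "s = y + 1")
   case True
   then show ?thesis by (simp add: Q_def)
  next
   case False
   then have "s < y + 1" using s by simp
   then obtain \<xi> where \<xi>: "s < \<xi>" "\<xi> < y + 1" "Q (y + 1) - Q s = (y + 1 - s) * (- (\<xi> powr (- ?c)))"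
    using MVT2[of s "y + 1" Q "\<lambda>s. - (s powr (- ?c))"] Qder s y by force
   moreover have "Q (y + 1) = 0" by (simp add: Q_def)
   moreover have "\<xi> powr (- ?c) = 1 / \<xi> powr ?c" by (rule powr_minus_divide)
   ultimately have "Q s = (y + 1 - s) * (1 / \<xi> powr ?c)" by (simp only:)
   moreover have "(s / \<xi>) powr ?c = s powr ?c / \<xi> powr ?c" by (rule powr_divide)
   ultimately have eq: "Q s * s powr ?c = (y + 1 - s) * (s / \<xi>) powr ?c" by simp
   \<comment> \<open>Because y \<ge> 1, the quotient of two points of [y, y + 1] with the smaller
     one on top is at least 1 / 2; hence Q s^c is comparable to y + 1 - s with constants that do not
     depend on y.\<close>
   have r: "1 / 2 \<le> s / \<xi>" "s / \<xi> \<le> 1" using \<xi> s y by (auto simp: field_simps)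
   have "2 powr - \<bar>?c\<bar> = 1 / \<kappa>" by (simp add: \<kappa>_def powr_minus_divide)
   then have h: "1 / \<kappa> \<le> (s / \<xi>) powr ?c" "(s / \<xi>) powr ?c \<le> \<kappa>"
    using powr_half_one_bounds[OF r, of ?c] by (auto simp: \<kappa>_def)
   have "(y + 1 - s) * (1 / \<kappa>) \<le> (y + 1 - s) * (s / \<xi>) powr ?c" "(y + 1 - s) * (s / \<xi>) powr ?c \<le> (y + 1 - s) * \<kappa>"
    using s by (intro mult_left_mono[OF h(1)] mult_left_mono[OF h(2)]; simp)+
   then show ?thesis unfolding eq using s by (simp add: mult.commute)
  qed
  then show "0 \<le> Q s * s powr ?c" "Q s * s powr ?c \<le> \<kappa> * (y + 1 - s)" "(y + 1 - s) / \<kappa> \<le> Q s * s powr ?c" by auto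
 qed
 have Qp: "primitive (\<lambda>s. of_real (Q s)) (\<lambda>s. of_real (- (s powr (- ?c))))"
 proof (rule primitive_of_derivative)
  show "((\<lambda>s. complex_of_real (Q s)) has_vector_derivative of_real (- (s powr (- ?c)))) (at s)" if "0 < s" for s
   by (rule bounded_linear.has_vector_derivative[OF bounded_linear_of_real])
    (use Qder[OF that] in \<open>simp add: has_real_derivative_iff_has_vector_derivative\<close>)
 qed (auto intro!: continuous_intros)
 have P: "primitive (\<lambda>s. of_real (Q s) * (of_real (s powr ?c) * U1 s) + U s) (\<lambda>s. of_real (Q s * s powr ?c) * f s)"
 proof (rule primitive_cong[OF primitive_add[OF primitive_mult[OF Qp prim(2)] prim(1)]])
  fix s :: real assume s: "0 < s"
  have "s powr (- ?c) * s powr ?c = 1" using s by (simp add: powr_add[symmetric])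
  then have "of_real (- (s powr (- ?c))) * (of_real (s powr ?c) * z) = - z" for z :: complex
   by (metis mult.assoc mult_1 mult_minus_left of_real_1 of_real_minus of_real_mult)
  then show "of_real (Q s) * (of_real (s powr ?c) * f s) + of_real (- (s powr (- ?c))) * (of_real (s powr ?c) * U1 s) + U1 s =
    of_real (Q s * s powr ?c) * f s" by simp
 qed simp
 have \<kappa>: "0 < \<kappa>" by (simp add: \<kappa>_def)
 have "Q (y + 1) = 0" by (simp add: Q_def)
 then have eq: "of_real (Q y * y powr ?c) * U1 y = U (y + 1) - U y - ?J"
  using primitiveD(2)[OF P, of y "y + 1"] y by (simp add: algebra_simps)
 have "norm ?J \<le> (LINT s:{y..y + 1}|lborel. \<kappa> * norm (f s))"
 proof -
  have "norm ?J \<le> (LINT s|lborel. norm (?H s))"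
   unfolding set_lebesgue_integral_def by (rule integral_norm_bound)
  also have "\<dots> \<le> (LINT s:{y..y + 1}|lborel. \<kappa> * norm (f s))"
   unfolding set_lebesgue_integral_def
  proof (rule integral_mono)
   show "integrable lborel (\<lambda>s. norm (?H s))"
    using primitiveD(1)[OF P, of y "y + 1"] y by (intro integrable_norm) (simp add: set_integrable_def)
   have "integrable lborel (\<lambda>r. \<kappa> * norm (indicator {y..y + 1} r *\<^sub>R f r))"
    using int by (intro integrable_mult_right integrable_norm) (simp add: set_integrable_def)
   then show "integrable lborel (\<lambda>s. indicator {y..y + 1} s *\<^sub>R (\<kappa> * norm (f s)))" by (simp add: mult_ac)
   fix s :: real
   show "norm (?H s) \<le> indicator {y..y + 1} s *\<^sub>R (\<kappa> * norm (f s))"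
   proof (cases "s \<in> {y..y + 1}")
    case True
    have "\<kappa> * (y + 1 - s) \<le> \<kappa> * 1" using True \<kappa> by (intro mult_left_mono) auto
    then have "\<bar>Q s * s powr ?c\<bar> \<le> \<kappa>" using Qb[of s] True by auto
    then have "\<bar>Q s * s powr ?c\<bar> * norm (f s) \<le> \<kappa> * norm (f s)" by (rule mult_right_mono) simp
    then show ?thesis using True by (simp add: norm_mult abs_mult mult.assoc)
   qed simp
  qed
  finally show ?thesis .
 qed
 also have "(LINT s:{y..y + 1}|lborel. \<kappa> * norm (f s)) = \<kappa> * (LINT s:{y..y + 1}|lborel. norm (f s))" by simp
 finally have I: "norm ?J \<le> \<kappa> * (LINT s:{y..y + 1}|lborel. norm (f s))" .
 have "1 / \<kappa> * norm (U1 y) \<le> (Q y * y powr ?c) * norm (U1 y)"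
  using Qb(3)[of y] by (intro mult_right_mono) auto
 also have "\<dots> = norm (of_real (Q y * y powr ?c) * U1 y)"
  unfolding norm_mult norm_of_real using Qb(1)[of y] by simp
 also have "\<dots> \<le> norm (U (y + 1)) + norm (U y) + \<kappa> * (LINT s:{y..y + 1}|lborel. norm (f s))"
  unfolding eq
  using norm_triangle_ineq4[of "U (y + 1) - U y" "LINT s:{y..y + 1}|lborel. of_real (Q s * s powr ?c) * f s"]
   norm_triangle_ineq4[of "U (y + 1)" "U y"] I by linarith
 finally show ?thesis using \<kappa> by (simp add: field_simps)
qed

section \<open>Weighted estimates on the whole half-line and the vanishing of the limit\<close>

context bessel_Lp
begin

context
 fixes U U1 f :: "real \<Rightarrow> complex"
 assumes sol: "bessel_solution (1 - 2 * \<nu>) U U1 f" and fL: "f \<in> L" and UL: "U \<in> L"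
begin

lemma solution_interval_integrable:
 assumes "0 < a" "a \<le> b" shows "set_integrable lborel {a..b} f"
proof -
 have "primitive U1 (\<lambda>y. f y - of_real ((1 - 2 * \<nu>) / y) * U1 y)"
  using sol by (simp add: bessel_solution_iff)
 then have "set_integrable lborel {a..b} (\<lambda>y. f y - of_real ((1 - 2 * \<nu>) / y) * U1 y)"
  by (rule primitiveD[OF _ assms])
 moreover have "set_integrable lborel {a..b} (\<lambda>y. of_real ((1 - 2 * \<nu>) / y) * U1 y)"
  using assms by (intro borel_integrable_atLeastAtMost' continuous_intros
    continuous_on_subset[OF bessel_solution_continuous(2)[OF sol]]) auto
 ultimately have "set_integrable lborel {a..b} (\<lambda>y. (f y - of_real ((1 - 2 * \<nu>) / y) * U1 y) + of_real ((1 - 2 * \<nu>) / y) * U1 y)"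
  by (rule set_integral_add)
 then show ?thesis by simp
qed

text \<open>\<open>bessel_solution_derivative_bound\<close> dominates the derivative by a shift of
  U, by U itself and by the local averages of f, each of which is in the space.\<close>

lemma U1_at_infinity: "(\<lambda>y. of_real (indicator {1..} y) * U1 y) \<in> L"
proof -
 let ?V = "(\<lambda>y. complex_of_real (norm (of_real (indicator {1..} y) * U (y + 1)) + norm (of_real (indicator {1..} y) * U y)))"
 note [measurable] = Lpm_ext0[OF fL]
 define \<kappa> where "\<kappa> = 2 powr \<bar>1 - 2 * \<nu>\<bar>"
 have \<kappa>: "0 < \<kappa>" by (simp add: \<kappa>_def)
 \<comment> \<open>The average is written as an integral over the whole line of a function
   measurable in y and r together, which makes it measurable in y.\<close>
 define F where "F y = (LINT r|lborel. (if y \<le> r \<and> r \<le> y + 1 then norm (ext0 f r) else 0))" for y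
 have Fm: "F \<in> borel_measurable borel"
  unfolding F_def by (rule lborel.borel_measurable_lebesgue_integral) simp
 have Feq: "F y = (LINT r:{y..y + 1}|lborel. norm (f r))" if "1 \<le> y" for y
  unfolding F_def set_lebesgue_integral_def
  by (rule Bochner_Integration.integral_cong) (use that in \<open>auto simp: ext0_def indicator_def\<close>)
 have F0: "0 \<le> F y" for y unfolding F_def by (rule Bochner_Integration.integral_nonneg) auto
 have 3: "(\<lambda>y. complex_of_real (indicator {1..} y * F y)) \<in> L"
 proof -
  have "N (\<lambda>y. of_real (indicator {1..} y * F y)) < \<infinity>"
   by (intro Lpm_local_average[OF p fL] solution_interval_integrable F0 eq_refl[OF Feq]) auto
  then show ?thesis using Fm by (auto simp: Lpm_iff intro!: hl_measurableI)
 qed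
 have 1: "(\<lambda>y. of_real (indicator {1..} y) * U (y + 1)) \<in> L" by (rule Lpm_shift[OF UL])
 have Um: "hl_measurable U" and U1m: "hl_measurable U1"
  using bessel_solution_measurable[OF sol] by auto
 have 2: "(\<lambda>y. of_real (indicator {1..} y) * U y) \<in> L"
  by (rule Lpm_bound[OF UL hl_measurable_mult_left[OF Um]]) (auto simp: indicator_def m_bounds)
 have G: "?V \<in> L"
 proof (rule Lpm_bound2[OF 1 2])
  note [measurable] = Lpm_ext0[OF 1] Lpm_ext0[OF 2]
  have "ext0 ?V =
   (\<lambda>y. complex_of_real (norm (ext0 (\<lambda>y. of_real (indicator {1..} y) * U (y + 1)) y) + norm (ext0 (\<lambda>y. of_real (indicator {1..} y) * U y) y)))"
   by (auto simp: ext0_def)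
  then show "hl_measurable ?V"
   by (simp add: hl_measurable_iff)
 qed (auto simp: m_bounds simp del: of_real_add)
 show ?thesis
 proof (rule Lpm_bound2[OF Lpm_cmult[OF G, of "of_real \<kappa>"] Lpm_cmult[OF 3, of "of_real (\<kappa> * \<kappa>)"]])
  show "hl_measurable (\<lambda>y. of_real (indicator {1..} y) * U1 y)"
   by (rule hl_measurable_mult_left[OF U1m]) measurable
  fix y :: real
  show "norm (of_real (indicator {1..} y) * U1 y) \<le>
   norm (of_real \<kappa> * complex_of_real (norm (of_real (indicator {1..} y) * U (y + 1)) + norm (of_real (indicator {1..} y) * U y))) +
   norm (complex_of_real (\<kappa> * \<kappa>) * of_real (indicator {1..} y * F y))"
  proof (cases "1 \<le> y")
   case True
   have "norm (U1 y) \<le> \<kappa> * (norm (U (y + 1)) + norm (U y) + \<kappa> * F y)"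
    unfolding Feq[OF True] \<kappa>_def using True by (intro bessel_solution_derivative_bound[OF sol \<nu>] solution_interval_integrable) auto
   also have "\<dots> = \<kappa> * (norm (U (y + 1)) + norm (U y)) + \<kappa> * \<kappa> * F y" by (simp add: algebra_simps)
   finally show ?thesis
    using True \<kappa> F0[of y] by (simp only: norm_mult norm_of_real indicator_simps) (simp add: abs_mult)
  qed simp
 qed (auto simp: m_bounds)
qed

text \<open>Below 1 the weights for \<theta> are dominated by those for a larger critical exponent,
  to which Hardy's inequalities apply; beyond 1 the unweighted bounds suffice. The second derivative
  is f minus a multiple of U1 / y, and its weight carries one more power of y than that of
  U1.\<close>

lemma solution_weighted:
 assumes \<theta>: "admissible \<theta>"
 shows "(\<lambda>y. of_real (min 1 y powr (1 - 2 * \<theta>)) * U1 y) \<in> L"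
  and "(\<lambda>y. of_real (min 1 y powr (2 - 2 * \<theta>)) * (f y - of_real ((1 - 2 * \<nu>) / y) * U1 y)) \<in> L"
  and "(U \<longlongrightarrow> 0) (at_right 0) \<Longrightarrow> (\<lambda>y. of_real (y powr (- 2 * \<theta>)) * U y) \<in> L"
proof -
 let ?U2 = "\<lambda>y. f y - of_real ((1 - 2 * \<nu>) / y) * U1 y"
 \<comment> \<open>An admissible exponent may lie below the range of Hardy's inequalities. Since
   y^(- 2 \<theta>) is at most y^(- 2 \<theta>') on (0, 1), a critical exponent above it
   suffices.\<close>
 obtain \<theta>' where \<theta>': "\<theta> \<le> \<theta>'" "critical \<theta>'" using critical_exists[OF \<theta>] .
 have Um: "hl_measurable U" and U1m: "hl_measurable U1" and fm: "hl_measurable f"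
  using bessel_solution_measurable[OF sol] by auto
 have mono: "y powr (q - 2 * \<theta>) \<le> y powr (q - 2 * \<theta>')" if "0 < y" "y < 1" for q y
  using that \<theta>'(1) by (intro powr_mono') auto
 have \<theta>1: "0 \<le> \<theta>" "\<theta> \<le> 1" using \<theta> by (auto simp: admissible_def)
 define W where "W y = of_real (y powr (2 - 2 * \<theta>')) * (of_real (indicator {0<..<1} y / y) * U1 y)" for y
 define S where "S y = W y + of_real (indicator {1..} y) * U1 y" for y
 have WL: "W \<in> L"
 proof -
  have "hl_measurable (\<lambda>y. of_real (indicator {0<..<1} y / y) * U1 y)"
   by (rule hl_measurable_mult_left[OF U1m]) measurable
  from Lpm_weight_iff[OF this, THEN iffD1, OF near_zero_U1[OF sol fL \<theta>'(2)]]
  show ?thesis by (simp add: W_def[abs_def])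
 qed
 have SL: "S \<in> L" unfolding S_def[abs_def] by (rule Lpm_add[OF WL U1_at_infinity m_bounds(4)])
 have S0: "norm (S y) = y powr (1 - 2 * \<theta>') * norm (U1 y)" if "0 < y" "y < 1" for y
 proof -
  have "y powr (2 - 2 * \<theta>') = y * y powr (1 - 2 * \<theta>')" using that by (simp add: powr_mult_base)
  then show ?thesis using that by (simp add: S_def W_def norm_mult norm_divide)
 qed
 have S1: "norm (S y) = norm (U1 y)" if "1 \<le> y" for y
  using that by (simp add: S_def W_def)
 show "(\<lambda>y. of_real (min 1 y powr (1 - 2 * \<theta>)) * U1 y) \<in> L"
 proof (rule Lpm_bound[OF SL])
  show "hl_measurable (\<lambda>y. of_real (min 1 y powr (1 - 2 * \<theta>)) * U1 y)"
   by (rule hl_measurable_mult_left[OF U1m]) measurable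
  show "AE y in lborel. 0 < y \<longrightarrow> norm (of_real (min 1 y powr (1 - 2 * \<theta>)) * U1 y) \<le> norm (S y)"
  proof (intro AE_I2 impI)
   fix y :: real assume y: "0 < y"
   show "norm (of_real (min 1 y powr (1 - 2 * \<theta>)) * U1 y) \<le> norm (S y)"
   proof (cases "y < 1")
    case True
    then show ?thesis using mono[OF y True, of 1] y by (simp add: S0 norm_mult mult_right_mono)
   qed (simp add: S1 norm_mult)
  qed
 qed (rule m_bounds)
 show "(\<lambda>y. of_real (min 1 y powr (2 - 2 * \<theta>)) * (?U2 y)) \<in> L"
 proof (rule Lpm_bound2[OF fL Lpm_cmult[OF SL, of "of_real (1 - 2 * \<nu>)"]])
  have "hl_measurable (\<lambda>y. f y - of_real ((1 - 2 * \<nu>) / y) * U1 y)"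
   by (intro hl_measurable_add fm hl_measurable_mult_left U1m) measurable
  then show "hl_measurable (\<lambda>y. of_real (min 1 y powr (2 - 2 * \<theta>)) * (?U2 y))"
   by (rule hl_measurable_mult_left) measurable
  fix y :: real assume y: "0 < y"
  let ?w = "min 1 y powr (2 - 2 * \<theta>)"
  have w: "?w \<le> 1" using y \<theta>1 by (intro powr_le1) auto
  have "norm (of_real ?w * (?U2 y)) \<le> ?w * (norm (f y) + \<bar>1 - 2 * \<nu>\<bar> / y * norm (U1 y))"
   unfolding norm_mult norm_of_real
   using norm_triangle_ineq4[of "f y" "of_real ((1 - 2 * \<nu>) / y) * U1 y"] y
   by (intro mult_mono) (auto simp: norm_mult norm_divide simp flip: of_real_diff of_real_mult)
  also have "\<dots> = ?w * norm (f y) + \<bar>1 - 2 * \<nu>\<bar> * (?w / y * norm (U1 y))" by (simp add: algebra_simps)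
  also have "\<dots> \<le> norm (f y) + \<bar>1 - 2 * \<nu>\<bar> * norm (S y)"
  proof (intro add_mono mult_left_mono)
   show "?w * norm (f y) \<le> norm (f y)" using w by (simp add: mult_left_le_one_le)
   show "?w / y * norm (U1 y) \<le> norm (S y)"
   proof (cases "y < 1")
    case True
    have "y powr (2 - 2 * \<theta>) = y * y powr (1 - 2 * \<theta>)" using y by (simp add: powr_mult_base)
    then have "?w / y = y powr (1 - 2 * \<theta>)" using True y by simp
    then show ?thesis using mono[OF y True, of 1] S0[OF y True] by (simp add: mult_right_mono)
   next
    case False
    then have "?w / y \<le> 1" by simp
    then have "?w / y * norm (U1 y) \<le> 1 * norm (U1 y)" by (rule mult_right_mono) simp
    then show ?thesis using False S1[of y] by simp
   qed
  qed auto
  also have "\<dots> = norm (f y) + norm (of_real (1 - 2 * \<nu>) * S y)" by (simp only: norm_mult norm_of_real)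
  finally show "norm (of_real ?w * (?U2 y)) \<le> norm (f y) + norm (of_real (1 - 2 * \<nu>) * S y)" .
 qed (rule m_bounds)
 assume lim: "(U \<longlongrightarrow> 0) (at_right 0)"
 define Z where "Z y = of_real (y powr (2 - 2 * \<theta>')) * (of_real (indicator {0<..<1} y / y\<^sup>2) * (U y - 0))" for y
 have ZL: "Z \<in> L"
 proof -
  have "hl_measurable (\<lambda>y. of_real (indicator {0<..<1} y / y\<^sup>2) * (U y - 0))"
   unfolding diff_zero by (rule hl_measurable_mult_left[OF Um]) measurable
  from Lpm_weight_iff[OF this, THEN iffD1, OF near_zero_U[OF sol fL \<theta>'(2) lim]]
  show ?thesis by (simp add: Z_def[abs_def])
 qed
 show "(\<lambda>y. of_real (y powr (- 2 * \<theta>)) * U y) \<in> L"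
 proof (rule Lpm_bound2[OF ZL UL])
  show "hl_measurable (\<lambda>y. of_real (y powr (- 2 * \<theta>)) * U y)"
   by (rule hl_measurable_mult_left[OF Um]) measurable
  fix y :: real assume y: "0 < y"
  show "norm (of_real (y powr (- 2 * \<theta>)) * U y) \<le> norm (Z y) + norm (U y)"
  proof (cases "y < 1")
   case True
   have "y powr (2 - 2 * \<theta>') = y powr 2 * y powr (0 - 2 * \<theta>')" unfolding powr_add[symmetric] by simp
   then have "norm (Z y) = y powr (0 - 2 * \<theta>') * norm (U y)"
    using True y by (simp add: Z_def norm_mult norm_divide norm_power)
   then show ?thesis using mono[OF y True, of 0] by (simp add: norm_mult mult_right_mono add_increasing2)
  next
   case False
   have "y powr (- 2 * \<theta>) \<le> y powr 0" using False \<theta>1 by (intro powr_mono) auto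
   then have "y powr (- 2 * \<theta>) * norm (U y) \<le> 1 * norm (U y)" using y by (intro mult_right_mono) auto
   then show ?thesis by (simp add: norm_mult add_increasing)
  qed
 qed (rule m_bounds)
qed

text \<open>If the limit were nonzero, the integrand of the weighted norm would be at least K / y
  near 0, because \<theta> critical means m - 2 \<theta> p < -1, and the integral would diverge
  logarithmically.\<close>

lemma limit_zero_of_weighted:
 assumes \<theta>: "critical \<theta>" and w: "(\<lambda>y. of_real (y powr (- 2 * \<theta>)) * U y) \<in> L" and lim: "(U \<longlongrightarrow> l) (at_right 0)"
 shows "l = 0"
proof (rule ccontr)
 let ?V = "(\<lambda>y. of_real (y powr (- 2 * \<theta>)) * U y)"
 assume l: "l \<noteq> 0"
 have "((\<lambda>y. norm (U y)) \<longlongrightarrow> norm l) (at_right 0)" by (intro tendsto_norm lim)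
 then have "\<forall>\<^sub>F y in at_right 0. norm l / 2 < norm (U y)" using l by (intro order_tendstoD(1)) auto
 then obtain d where d: "0 < d" "\<And>y. 0 < y \<Longrightarrow> y < d \<Longrightarrow> norm l / 2 < norm (U y)"
  unfolding eventually_at_right_field by blast
 define e where "e = min d 1 / 2"
 have e: "0 < e" "e < d" "e < 1" using d by (auto simp: e_def)
 define K where "K = (norm l / 2) powr p"
 have K: "0 < K" using l by (simp add: K_def)
 have q: "m - 2 * \<theta> * p \<le> -1" using \<theta> p by (auto simp: critical_def pos_divide_less_eq)
 have ge: "ennreal (K * real n) \<le> N ?V" for n
 proof -
  \<comment> \<open>The integral of 1 / y over the interval from e exp (- n) to e is exactly
    n.\<close>
  define a where "a = e * exp (- real n)"
  have a: "0 < a" "a \<le> e" using e by (auto simp: a_def mult_le_cancel_left2)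
  have "(\<integral>\<^sup>+y. ennreal (1 / y) * indicator {a..e} y \<partial>lborel) = ennreal (ln e - ln a)"
   using a by (intro nn_integral_FTC_Icc) (auto intro!: derivative_eq_intros simp: field_simps)
  also have "ln e - ln a = real n" using e by (simp add: a_def ln_mult)
  finally have "ennreal (K * real n) = ennreal K * (\<integral>\<^sup>+y. ennreal (1 / y) * indicator {a..e} y \<partial>lborel)"
   using K by (simp add: ennreal_mult')
  also have "\<dots> = (\<integral>\<^sup>+y. ennreal K * (ennreal (1 / y) * indicator {a..e} y) \<partial>lborel)"
   by (rule nn_integral_cmult[symmetric]) simp
  also have "\<dots> \<le> N ?V"
   unfolding power_norm_def
  proof (rule nn_integral_mono)
   fix y :: real
   show "ennreal K * (ennreal (1 / y) * indicator {a..e} y) \<le>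
     ennreal (y powr m * norm (of_real (y powr (- 2 * \<theta>)) * U y) powr p) * indicator {0<..} y"
   proof (cases "y \<in> {a..e}")
    case True
    then have y: "0 < y" "y < 1" "y < d" using a e by auto
    have "1 / y = y powr (-1)" using y by (simp add: powr_minus_divide)
    also have "\<dots> \<le> y powr (m - 2 * \<theta> * p)" using q y by (intro powr_mono') auto
    finally have 1: "1 / y \<le> y powr (m - 2 * \<theta> * p)" .
    have 2: "K \<le> norm (U y) powr p" unfolding K_def using d(2)[OF y(1,3)] p by (intro powr_mono2) auto
    have "K * (1 / y) \<le> norm (U y) powr p * y powr (m - 2 * \<theta> * p)"
     using 1 2 K y by (intro mult_mono) auto
    also have "\<dots> = y powr m * norm (of_real (y powr (- 2 * \<theta>)) * U y) powr p"
     using y by (simp add: norm_mult norm_divide powr_divide powr_mult powr_powr powr_diff powr_minus_divide)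
    finally show ?thesis using True y K by (simp add: ennreal_mult'[symmetric] ennreal_leI)
   qed simp
  qed
  finally show ?thesis .
 qed
 obtain x where x: "N ?V = ennreal x" "0 \<le> x"
  using w by (cases "N ?V") (auto simp: Lpm_iff)
 obtain n where "x / K < real n" using reals_Archimedean2 by blast
 moreover have "K * real n \<le> x" using ge[of n] x by (simp add: ennreal_le_iff)
 ultimately show False using K by (simp add: pos_divide_less_eq mult.commute)
qed

end

end

section \<open>The generator on solutions vanishing at zero\<close>

text \<open>\<open>bessel_F_ode\<close> at z = (y r / (4 \<tau>))^2, multiplied by the Gaussian
  factor; every unit of the order contributes a factor 4 \<tau>.\<close>

lemma bkernel_ode:
 assumes \<nu>: "0 \<le> \<nu>" and \<tau>: "0 < \<tau>"
 shows "bkernel \<nu> \<tau> y r = y\<^sup>2 * r\<^sup>2 * bkernel (\<nu> + 2) \<tau> y r + 4 * \<tau> * (\<nu> + 1) * bkernel (\<nu> + 1) \<tau> y r"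
proof -
 let ?z = "(y * r / (4 * \<tau>))\<^sup>2"
 let ?e = "exp (- (y\<^sup>2 + r\<^sup>2) / (4 * \<tau>))"
 let ?K = "\<lambda>\<nu>. 2 * (4 * \<tau>) powr (-1 - \<nu>)"
 have 1: "?K \<nu> * ?e * bessel_F (\<nu> + 1) ?z = 4 * \<tau> * bkernel (\<nu> + 1) \<tau> y r"
  by (rule bkernel_Suc[OF \<tau>])
 have 2: "?K (\<nu> + 1) * ?e * bessel_F (\<nu> + 2) ?z = 4 * \<tau> * bkernel (\<nu> + 2) \<tau> y r"
  using bkernel_Suc[OF \<tau>, of "\<nu> + 1"] by (simp add: add.assoc)
 have K: "?K \<nu> = 4 * \<tau> * ?K (\<nu> + 1)"
  using \<tau> powr_mult_base[of "4 * \<tau>" "-1 - (\<nu> + 1)"] by simp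
 have z: "?z * (16 * \<tau>\<^sup>2) = y\<^sup>2 * r\<^sup>2" using \<tau> by (simp add: power_divide power_mult_distrib)
 have "bkernel \<nu> \<tau> y r = ?K \<nu> * ?e * (?z * bessel_F (\<nu> + 2) ?z + (\<nu> + 1) * bessel_F (\<nu> + 1) ?z)"
  unfolding bessel_F_ode[OF \<nu>] bkernel_def by simp
 also have "\<dots> = ?z * (4 * \<tau> * (?K (\<nu> + 1) * ?e * bessel_F (\<nu> + 2) ?z)) + (\<nu> + 1) * (?K \<nu> * ?e * bessel_F (\<nu> + 1) ?z)"
  unfolding K by (simp only: distrib_left mult_ac)
 also have "\<dots> = (?z * (16 * \<tau>\<^sup>2)) * bkernel (\<nu> + 2) \<tau> y r + (\<nu> + 1) * (4 * \<tau> * bkernel (\<nu> + 1) \<tau> y r)"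
  unfolding 1 2 by (simp add: power2_eq_square)
 finally show ?thesis unfolding z by simp
qed

text \<open>\<open>kernel_flux\<close> is \<open>r powr c * d/dr (r powr (- c) * k)\<close> for the kernel \<open>k\<close>, where \<open>c = 1 - 2 * \<nu>\<close>.\<close>

definition kernel_flux :: "real \<Rightarrow> real \<Rightarrow> real \<Rightarrow> real \<Rightarrow> real" where
 "kernel_flux \<nu> \<tau> y r = y powr (2 * \<nu>) * (2 * \<nu> * bkernel \<nu> \<tau> y r
   + r * (r / (2 * \<tau>) * (y\<^sup>2 * bkernel (\<nu> + 1) \<tau> y r - bkernel \<nu> \<tau> y r)))"

definition kernel_dt :: "real \<Rightarrow> real \<Rightarrow> real \<Rightarrow> real \<Rightarrow> real" where
 "kernel_dt \<nu> \<tau> y r = y powr (2 * \<nu>) * r * ((- (1 + \<nu>) / \<tau> + (y\<^sup>2 + r\<^sup>2) / (4 * \<tau>\<^sup>2)) * bkernel \<nu> \<tau> y r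
   - (y * r)\<^sup>2 / (2 * \<tau>\<^sup>2) * bkernel (\<nu> + 1) \<tau> y r)"

lemma dkernel_deriv_t:
 assumes "0 \<le> \<nu>" "0 < \<tau>"
 shows "((\<lambda>\<tau>. dkernel \<nu> \<tau> y r) has_real_derivative kernel_dt \<nu> \<tau> y r) (at \<tau> within S)"
 unfolding dkernel_def kernel_dt_def
 by (rule DERIV_cmult[OF bkernel_deriv_t[OF assms]])

text \<open>Together with \<open>dkernel_deriv_t\<close> this is the adjoint heat equation; the last step is the Bessel equation.\<close>

lemma kernel_flux_deriv:
 assumes \<nu>: "0 \<le> \<nu>" and \<tau>: "0 < \<tau>"
 shows "((\<lambda>r. kernel_flux \<nu> \<tau> y r) has_real_derivative kernel_dt \<nu> \<tau> y r) (at r)"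
proof -
 let ?h0 = "bkernel \<nu> \<tau> y r"
 let ?h1 = "bkernel (\<nu> + 1) \<tau> y r"
 let ?h2 = "bkernel (\<nu> + 2) \<tau> y r"
 have d0: "((\<lambda>r. bkernel \<nu> \<tau> y r) has_real_derivative r / (2 * \<tau>) * (y\<^sup>2 * ?h1 - ?h0)) (at r)"
  by (rule bkernel_deriv_r[OF \<nu> \<tau>])
 have d1: "((\<lambda>r. bkernel (\<nu> + 1) \<tau> y r) has_real_derivative r / (2 * \<tau>) * (y\<^sup>2 * ?h2 - ?h1)) (at r)"
  using bkernel_deriv_r[of "\<nu> + 1" \<tau> y r UNIV] \<nu> \<tau> by (simp add: add.assoc)
 define D where "D = 2 * \<nu> * (r / (2 * \<tau>) * (y\<^sup>2 * ?h1 - ?h0))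
   + (2 * r / (2 * \<tau>) * (y\<^sup>2 * ?h1 - ?h0)
    + r\<^sup>2 / (2 * \<tau>) * (y\<^sup>2 * (r / (2 * \<tau>) * (y\<^sup>2 * ?h2 - ?h1)) - r / (2 * \<tau>) * (y\<^sup>2 * ?h1 - ?h0)))"
 have q: "((\<lambda>r. r\<^sup>2 / (2 * \<tau>)) has_real_derivative 2 * r / (2 * \<tau>)) (at r)"
  using \<tau> by (auto intro!: derivative_eq_intros)
 have "((\<lambda>r. y powr (2 * \<nu>) * (2 * \<nu> * bkernel \<nu> \<tau> y r
   + r\<^sup>2 / (2 * \<tau>) * (y\<^sup>2 * bkernel (\<nu> + 1) \<tau> y r - bkernel \<nu> \<tau> y r))) has_real_derivative
   y powr (2 * \<nu>) * D) (at r)"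
  by (rule DERIV_cong[OF DERIV_cmult[OF DERIV_add[OF DERIV_cmult[OF d0, of "2 * \<nu>"]
   DERIV_mult[OF q DERIV_diff[OF DERIV_cmult[OF d1, of "y\<^sup>2"] d0]]]]])
   (simp add: D_def algebra_simps)
 moreover have "D = r * ((- (1 + \<nu>) / \<tau> + (y\<^sup>2 + r\<^sup>2) / (4 * \<tau>\<^sup>2)) * ?h0 - (y * r)\<^sup>2 / (2 * \<tau>\<^sup>2) * ?h1)"
 proof -
  have "4 * \<tau>\<^sup>2 * (2 * \<nu> * (r * (1 / (2 * \<tau>)) * (y\<^sup>2 * h1 - h0))
   + (2 * r * (1 / (2 * \<tau>)) * (y\<^sup>2 * h1 - h0)
    + r\<^sup>2 * (1 / (2 * \<tau>)) * (y\<^sup>2 * (r * (1 / (2 * \<tau>)) * (y\<^sup>2 * h2 - h1)) - r * (1 / (2 * \<tau>)) * (y\<^sup>2 * h1 - h0))))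
   = 4 * \<tau> * \<nu> * r * (y\<^sup>2 * h1 - h0) + 4 * \<tau> * r * (y\<^sup>2 * h1 - h0) + r ^ 3 * (y ^ 4 * h2 - 2 * y\<^sup>2 * h1 + h0)" for h0 h1 h2
   using \<tau> by (simp add: field_simps) algebra
  then have "4 * \<tau>\<^sup>2 * D = 4 * \<tau> * \<nu> * r * (y\<^sup>2 * ?h1 - ?h0) + 4 * \<tau> * r * (y\<^sup>2 * ?h1 - ?h0) + r ^ 3 * (y ^ 4 * ?h2 - 2 * y\<^sup>2 * ?h1 + ?h0)"
   unfolding D_def by simp
  also have "\<dots> = r * ((- 4 * \<tau> * (1 + \<nu>) + (y\<^sup>2 + r\<^sup>2)) * ?h0 - 2 * (y * r)\<^sup>2 * ?h1)"
   using bkernel_ode[OF \<nu> \<tau>, of y r] by algebra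
  also have "\<dots> = 4 * \<tau>\<^sup>2 * (r * ((- (1 + \<nu>) / \<tau> + (y\<^sup>2 + r\<^sup>2) / (4 * \<tau>\<^sup>2)) * ?h0 - (y * r)\<^sup>2 / (2 * \<tau>\<^sup>2) * ?h1))"
  proof -
   have "4 * \<tau>\<^sup>2 * (- (1 + \<nu>) / \<tau> + (y\<^sup>2 + r\<^sup>2) / (4 * \<tau>\<^sup>2)) = - 4 * \<tau> * (1 + \<nu>) + (y\<^sup>2 + r\<^sup>2)"
    using \<tau> by (simp add: field_simps power2_eq_square)
   moreover have "4 * \<tau>\<^sup>2 * ((y * r)\<^sup>2 / (2 * \<tau>\<^sup>2)) = 2 * (y * r)\<^sup>2" using \<tau> by simp
   ultimately show ?thesis by algebra
  qed
  finally show ?thesis using \<tau> by simp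
 qed
 moreover have "(\<lambda>r. kernel_flux \<nu> \<tau> y r) = (\<lambda>r. y powr (2 * \<nu>) * (2 * \<nu> * bkernel \<nu> \<tau> y r
   + r\<^sup>2 / (2 * \<tau>) * (y\<^sup>2 * bkernel (\<nu> + 1) \<tau> y r - bkernel \<nu> \<tau> y r)))"
  by (rule ext) (simp add: kernel_flux_def power2_eq_square)
 ultimately show ?thesis by (simp add: kernel_dt_def mult.assoc)
qed

text \<open>The function differentiated is \<open>r powr (- c)\<close> times the kernel for c = 1 -
  2 \<nu>, that is, the density of the semigroup with respect to \<open>r powr c dr\<close>. It
  takes the place of the second solution in Green's identity.\<close>

lemma kernel_potential_deriv:
 assumes \<nu>: "0 \<le> \<nu>" and \<tau>: "0 < \<tau>" and r: "0 < r"
 shows "((\<lambda>r. y powr (2 * \<nu>) * r powr (2 * \<nu>) * bkernel \<nu> \<tau> y r) has_real_derivative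
   r powr (2 * \<nu> - 1) * kernel_flux \<nu> \<tau> y r) (at r)"
proof -
 have "((\<lambda>r. r powr (2 * \<nu>)) has_real_derivative 2 * \<nu> * r powr (2 * \<nu> - 1)) (at r)"
  using r DERIV_fun_powr[OF DERIV_ident, of r "2 * \<nu>"] by simp
 from DERIV_mult[OF DERIV_cmult[OF this, of "y powr (2 * \<nu>)"] bkernel_deriv_r[OF \<nu> \<tau>, of y r UNIV]]
 have "((\<lambda>r. y powr (2 * \<nu>) * r powr (2 * \<nu>) * bkernel \<nu> \<tau> y r) has_real_derivative
   y powr (2 * \<nu>) * (2 * \<nu> * r powr (2 * \<nu> - 1)) * bkernel \<nu> \<tau> y r +
   r / (2 * \<tau>) * (y\<^sup>2 * bkernel (\<nu> + 1) \<tau> y r - bkernel \<nu> \<tau> y r) * (y powr (2 * \<nu>) * r powr (2 * \<nu>))) (at r)" .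
 moreover have "r powr (2 * \<nu>) = r powr (2 * \<nu> - 1) * r" using r by (simp add: powr_diff)
 ultimately show ?thesis by (simp add: kernel_flux_def algebra_simps)
qed

lemma continuous_on_bkernel:
 assumes "0 \<le> \<nu>" "0 < \<tau>" shows "continuous_on S (\<lambda>r. bkernel \<nu> \<tau> y r)"
 by (auto intro!: continuous_at_imp_continuous_on DERIV_isCont[OF bkernel_deriv_r[OF assms]])

lemma one_plus_square_le_exp: "0 \<le> (r::real) \<Longrightarrow> 1 + r\<^sup>2 \<le> 2 * exp r"
 using exp_lower_Taylor_quadratic[of r] by simp

text \<open>Every quantity is a polynomial in r times kernels bounded by exp (- 2 r); the factor 1 +
  r^2 is absorbed by one exp r. The kernel and its time derivative keep a factor r at 0, while the
  flux is only bounded there. The constants are uniform for times in [s, t] with s positive.\<close>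

lemma kernel_bounds:
 assumes \<nu>: "0 \<le> \<nu>" and s: "0 < s" and y: "0 < y"
 obtains C where "0 < C" "\<And>\<tau> r. s \<le> \<tau> \<Longrightarrow> \<tau> \<le> t \<Longrightarrow> 0 < r \<Longrightarrow>
  \<bar>dkernel \<nu> \<tau> y r\<bar> \<le> C * (r * exp (- r)) \<and> \<bar>kernel_flux \<nu> \<tau> y r\<bar> \<le> C * exp (- r) \<and> \<bar>kernel_dt \<nu> \<tau> y r\<bar> \<le> C * (r * exp (- r))"
proof -
 obtain A where A: "0 < A" "\<And>\<tau> r. s \<le> \<tau> \<Longrightarrow> \<tau> \<le> t \<Longrightarrow> 0 < r \<Longrightarrow> bkernel \<nu> \<tau> y r \<le> A * exp (- (2 * r))"
  using bkernel_exp_bound[OF \<nu> s y, of t] by blast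
 obtain B where B: "0 < B" "\<And>\<tau> r. s \<le> \<tau> \<Longrightarrow> \<tau> \<le> t \<Longrightarrow> 0 < r \<Longrightarrow> bkernel (\<nu> + 1) \<tau> y r \<le> B * exp (- (2 * r))"
  using bkernel_exp_bound[OF _ s y, of "\<nu> + 1" t] \<nu> by auto
 define Y where "Y = y powr (2 * \<nu>)"
 define C1 where "C1 = Y * A"
 define C2 where "C2 = Y * (2 * \<nu> * A + 1 / (2 * s) * (y\<^sup>2 * B + A))"
 define C3 where "C3 = Y * (((1 + \<nu>) / s + (y\<^sup>2 + 1) / (4 * s\<^sup>2)) * A + y\<^sup>2 / (2 * s\<^sup>2) * B)"
 let ?\<alpha> = "((1 + \<nu>) / s + (y\<^sup>2 + 1) / (4 * s\<^sup>2)) * A + y\<^sup>2 / (2 * s\<^sup>2) * B"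
 define C where "C = 2 * (C1 + C2 + C3)"
 have Y: "0 < Y" using y by (simp add: Y_def)
 have C0: "0 < C1" "0 \<le> C2" "0 \<le> C3" using A B Y s y \<nu> by (auto simp: C1_def C2_def C3_def)
 show ?thesis
 proof (rule that[of C])
  show "0 < C" using C0 by (simp add: C_def)
  fix \<tau> r :: real assume \<tau>: "s \<le> \<tau>" "\<tau> \<le> t" and r: "0 < r"
  let ?h0 = "bkernel \<nu> \<tau> y r" and ?h1 = "bkernel (\<nu> + 1) \<tau> y r"
  let ?e = "exp (- (2 * r))"
  let ?D = "r / (2 * \<tau>) * (y\<^sup>2 * ?h1 - ?h0)"
  let ?g = "(1 + r\<^sup>2) * ?e"
  have \<tau>0: "0 < \<tau>" using \<tau> s by simp
  have h: "0 \<le> ?h0" "0 \<le> ?h1" "?h0 \<le> A * ?e" "?h1 \<le> B * ?e"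
   using bkernel_pos[OF \<nu> \<tau>0, of y r] bkernel_pos[of "\<nu> + 1" \<tau> y r] \<nu> \<tau>0 A(2)[OF \<tau> r] B(2)[OF \<tau> r] by auto
  have g: "?g \<le> 2 * exp (- r)" "?e \<le> ?g" "r\<^sup>2 * ?e \<le> ?g" "0 \<le> ?g"
  proof -
   have "?g \<le> 2 * exp r * ?e" using one_plus_square_le_exp[of r] r by (intro mult_right_mono) auto
   also have "\<dots> = 2 * exp (- r)" by (simp add: mult.assoc exp_add[symmetric])
   finally show "?g \<le> 2 * exp (- r)" .
  qed (auto simp: algebra_simps)
  have g0: "x * ?g \<le> 2 * x * exp (- r)" if "0 \<le> x" for x
   using mult_left_mono[OF g(1) that] by simp
  have inv: "1 / \<tau> \<le> 1 / s" "1 / \<tau>\<^sup>2 \<le> 1 / s\<^sup>2"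
   using \<tau> s by (auto intro!: divide_left_mono power_mono)
  have 1: "\<bar>dkernel \<nu> \<tau> y r\<bar> \<le> C1 * (r * ?g)"
  proof -
   have "?h0 \<le> A * ?g" by (rule order_trans[OF h(3) mult_left_mono[OF g(2)]]) (use A in simp)
   then have "Y * r * ?h0 \<le> Y * r * (A * ?g)" using Y r by (intro mult_left_mono) auto
   moreover have "dkernel \<nu> \<tau> y r = Y * r * ?h0" by (simp only: dkernel_def Y_def)
   moreover have "0 \<le> Y * r * ?h0" using Y r h(1) by simp
   moreover have "C1 * (r * ?g) = Y * r * (A * ?g)" by (simp add: C1_def)
   ultimately show ?thesis by linarith
  qed
  have 2: "\<bar>kernel_flux \<nu> \<tau> y r\<bar> \<le> C2 * ?g"
  proof -
   have "\<bar>2 * \<nu> * ?h0 + r * ?D\<bar> \<le> 2 * \<nu> * ?h0 + \<bar>r * ?D\<bar>"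
    using \<nu> h by (intro order_trans[OF abs_triangle_ineq]) auto
   also have "\<bar>r * ?D\<bar> = r\<^sup>2 * (1 / \<tau>) / 2 * \<bar>y\<^sup>2 * ?h1 - ?h0\<bar>"
    using r \<tau>0 by (simp add: abs_mult power2_eq_square)
   also have "r\<^sup>2 * (1 / \<tau>) / 2 * \<bar>y\<^sup>2 * ?h1 - ?h0\<bar> \<le> r\<^sup>2 * (1 / s) / 2 * (y\<^sup>2 * (B * ?e) + A * ?e)"
   proof (intro mult_mono divide_right_mono mult_left_mono inv)
    have "\<bar>y\<^sup>2 * ?h1 - ?h0\<bar> \<le> \<bar>y\<^sup>2 * ?h1\<bar> + \<bar>?h0\<bar>" by (rule abs_triangle_ineq4)
    also have "\<dots> = y\<^sup>2 * ?h1 + ?h0" using h by simp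
    also have "\<dots> \<le> y\<^sup>2 * (B * ?e) + A * ?e" using h by (intro add_mono mult_left_mono) auto
    finally show "\<bar>y\<^sup>2 * ?h1 - ?h0\<bar> \<le> y\<^sup>2 * (B * ?e) + A * ?e" .
   qed (use s \<tau>0 in auto)
   also have "\<dots> = 1 / (2 * s) * (y\<^sup>2 * B + A) * (r\<^sup>2 * ?e)" by (simp add: field_simps)
   also have "\<dots> \<le> 1 / (2 * s) * (y\<^sup>2 * B + A) * ?g"
    using s A B by (intro mult_left_mono g) auto
   also have "2 * \<nu> * ?h0 \<le> 2 * \<nu> * A * ?g"
    using mult_left_mono[OF order_trans[OF h(3) mult_left_mono[OF g(2), of A]], of "2 * \<nu>"] A(1) \<nu> by (simp add: mult.assoc)
   finally have "\<bar>2 * \<nu> * ?h0 + r * ?D\<bar> \<le> (2 * \<nu> * A + 1 / (2 * s) * (y\<^sup>2 * B + A)) * ?g"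
    by (simp add: distrib_right)
   then have "Y * \<bar>2 * \<nu> * ?h0 + r * ?D\<bar> \<le> Y * ((2 * \<nu> * A + 1 / (2 * s) * (y\<^sup>2 * B + A)) * ?g)"
    using Y by (intro mult_left_mono) auto
   then show ?thesis using Y unfolding kernel_flux_def Y_def[symmetric] C2_def abs_mult[of Y] by (simp only: abs_of_pos mult.assoc)
  qed
  have 3: "\<bar>kernel_dt \<nu> \<tau> y r\<bar> \<le> C3 * (r * ?g)"
  proof -
   let ?a = "- (1 + \<nu>) / \<tau> + (y\<^sup>2 + r\<^sup>2) / (4 * \<tau>\<^sup>2)"
   have "\<bar>?a\<bar> \<le> (1 + \<nu>) * (1 / \<tau>) + (y\<^sup>2 + r\<^sup>2) / 4 * (1 / \<tau>\<^sup>2)"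
    using \<nu> \<tau>0 by (intro order_trans[OF abs_triangle_ineq]) (auto simp: abs_divide add_nonneg_nonneg add.commute)
   also have "\<dots> \<le> (1 + \<nu>) * (1 / s) + (y\<^sup>2 + r\<^sup>2) / 4 * (1 / s\<^sup>2)"
    using \<nu> by (intro add_mono mult_left_mono inv) auto
   finally have a: "\<bar>?a\<bar> \<le> (1 + \<nu>) * (1 / s) + (y\<^sup>2 + r\<^sup>2) / 4 * (1 / s\<^sup>2)" .
   have "\<bar>?a * ?h0\<bar> \<le> ((1 + \<nu>) * (1 / s) + (y\<^sup>2 + r\<^sup>2) / 4 * (1 / s\<^sup>2)) * (A * ?e)"
    unfolding abs_mult using a h \<nu> by (intro mult_mono) auto
   also have "\<dots> = (1 + \<nu>) / s * A * ?e + y\<^sup>2 / (4 * s\<^sup>2) * A * ?e + 1 / (4 * s\<^sup>2) * A * (r\<^sup>2 * ?e)"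
    by (simp add: algebra_simps add_divide_distrib)
   also have "\<dots> \<le> (1 + \<nu>) / s * A * ?g + y\<^sup>2 / (4 * s\<^sup>2) * A * ?g + 1 / (4 * s\<^sup>2) * A * ?g"
    using \<nu> s A(1) by (intro add_mono mult_left_mono g) auto
   also have "\<dots> = ((1 + \<nu>) / s + (y\<^sup>2 + 1) / (4 * s\<^sup>2)) * A * ?g"
    by (simp add: distrib_right add_divide_distrib)
   finally have b1: "\<bar>?a * ?h0\<bar> \<le> ((1 + \<nu>) / s + (y\<^sup>2 + 1) / (4 * s\<^sup>2)) * A * ?g" .
   have "\<bar>(y * r)\<^sup>2 / (2 * \<tau>\<^sup>2) * ?h1\<bar> = (y\<^sup>2 * r\<^sup>2) / 2 * (1 / \<tau>\<^sup>2) * ?h1"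
    using h by (simp add: abs_mult power_mult_distrib)
   also have "\<dots> \<le> (y\<^sup>2 * r\<^sup>2) / 2 * (1 / s\<^sup>2) * (B * ?e)"
    using h inv by (intro mult_mono mult_left_mono) auto
   also have "\<dots> = y\<^sup>2 / (2 * s\<^sup>2) * B * (r\<^sup>2 * ?e)" by simp
   also have "\<dots> \<le> y\<^sup>2 / (2 * s\<^sup>2) * B * ?g" using B(1) by (intro mult_left_mono g) auto
   finally have b2: "\<bar>(y * r)\<^sup>2 / (2 * \<tau>\<^sup>2) * ?h1\<bar> \<le> y\<^sup>2 / (2 * s\<^sup>2) * B * ?g" .
   have "\<bar>?a * ?h0 - (y * r)\<^sup>2 / (2 * \<tau>\<^sup>2) * ?h1\<bar> \<le> ?\<alpha> * ?g"
    unfolding distrib_right[of _ _ ?g] by (rule order_trans[OF abs_triangle_ineq4 add_mono[OF b1 b2]])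
   then have "(Y * r) * \<bar>?a * ?h0 - (y * r)\<^sup>2 / (2 * \<tau>\<^sup>2) * ?h1\<bar> \<le> (Y * r) * (?\<alpha> * ?g)"
    using Y r by (intro mult_left_mono) auto
   moreover have "\<bar>kernel_dt \<nu> \<tau> y r\<bar> = (Y * r) * \<bar>?a * ?h0 - (y * r)\<^sup>2 / (2 * \<tau>\<^sup>2) * ?h1\<bar>"
    unfolding kernel_dt_def Y_def[symmetric] abs_mult[of "Y * r"] using Y r by simp
   ultimately show ?thesis unfolding C3_def by (simp only: mult_ac)
  qed
  have le: "x * ?g \<le> C * exp (- r)" if "0 \<le> x" "x \<le> C1 + C2 + C3" for x
  proof -
   have "2 * x * exp (- r) \<le> C * exp (- r)" using that by (intro mult_right_mono) (auto simp: C_def)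
   then show ?thesis by (rule order_trans[OF g0[OF that(1)]])
  qed
  have le': "x * (r * ?g) \<le> C * (r * exp (- r))" if "0 \<le> x" "x \<le> C1 + C2 + C3" for x
   using mult_left_mono[OF le[OF that], of r] r by (simp add: mult_ac)
  show "\<bar>dkernel \<nu> \<tau> y r\<bar> \<le> C * (r * exp (- r)) \<and> \<bar>kernel_flux \<nu> \<tau> y r\<bar> \<le> C * exp (- r) \<and> \<bar>kernel_dt \<nu> \<tau> y r\<bar> \<le> C * (r * exp (- r))"
   using order_trans[OF 1 le'] order_trans[OF 2 le] order_trans[OF 3 le'] C0 by auto
 qed
qed

section \<open>Green's identity against the kernel and convergence of the difference
  quotients\<close>

context bessel_Lp
begin

lemma kernel_bound_integrable:
 assumes g: "g \<in> L" and m[measurable]: "\<phi> \<in> borel_measurable borel"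
  and bound: "\<And>r. 0 < r \<Longrightarrow> \<bar>\<phi> r\<bar> \<le> C * (r * exp (- r))"
 shows "integrable lborel (\<lambda>r. of_real (indicator {0<..} r * \<phi> r) * g r)"
proof (rule Bochner_Integration.integrable_bound[OF integrable_mult_right[OF weighted_integrable[OF g], of C]])
 note [measurable] = Lpm_ext0[OF g]
 have "(\<lambda>r. of_real (indicator {0<..} r * \<phi> r) * g r) = (\<lambda>r. of_real (indicator {0<..} r * \<phi> r) * ext0 g r)"
  by (auto simp: ext0_def indicator_def)
 then show "(\<lambda>r. of_real (indicator {0<..} r * \<phi> r) * g r) \<in> borel_measurable lborel" by simp
 show "AE r in lborel. norm (of_real (indicator {0<..} r * \<phi> r) * g r) \<le> norm (C * (indicator {0<..} r * (r * exp (- r) * norm (g r))))"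
 proof (rule AE_I2)
  fix r :: real
  show "norm (of_real (indicator {0<..} r * \<phi> r) * g r) \<le> norm (C * (indicator {0<..} r * (r * exp (- r) * norm (g r))))"
  proof (cases "0 < r")
   case True
   have "\<bar>\<phi> r\<bar> * norm (g r) \<le> C * (r * exp (- r)) * norm (g r)"
    using bound[OF True] by (rule mult_right_mono) simp
   also have "\<dots> = C * (r * exp (- r) * norm (g r))" by (simp only: mult.assoc)
   finally have "\<bar>\<phi> r\<bar> * norm (g r) \<le> \<bar>C * (r * exp (- r) * norm (g r))\<bar>" by linarith
   then show ?thesis using True by (simp add: norm_mult)
  qed simp
 qed
qed

context
 fixes U U1 f :: "real \<Rightarrow> complex"
 assumes sol: "bessel_solution (1 - 2 * \<nu>) U U1 f" and fL: "f \<in> L" and UL: "U \<in> L"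
  and U0: "(U \<longlongrightarrow> 0) (at_right 0)"
begin

lemma kernel_dt_measurable [measurable (raw)]:
 assumes [measurable]: "a \<in> borel_measurable M" "b \<in> borel_measurable M" "d \<in> borel_measurable M"
 shows "(\<lambda>x. kernel_dt \<nu> (a x) (b x) (d x)) \<in> borel_measurable M"
 unfolding kernel_dt_def bkernel_def by measurable

text \<open>The difference of the product rules for the weighted potential times r^c U1 and for the
  flux times U; the terms with flux and U1 cancel.\<close>

lemma kernel_Green_primitive:
 assumes \<tau>: "0 < \<tau>"
 shows "primitive (\<lambda>r. of_real (dkernel \<nu> \<tau> y r) * U1 r - of_real (kernel_flux \<nu> \<tau> y r) * U r)
  (\<lambda>r. of_real (dkernel \<nu> \<tau> y r) * f r - of_real (kernel_dt \<nu> \<tau> y r) * U r)"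
proof -
 let ?P = "\<lambda>r. y powr (2 * \<nu>) * r powr (2 * \<nu>) * bkernel \<nu> \<tau> y r"
 let ?F = "\<lambda>r. r powr (2 * \<nu> - 1) * kernel_flux \<nu> \<tau> y r"
 note \<nu>0 = m_bounds(5)
 have cP: "continuous_on S (\<lambda>r. kernel_flux \<nu> \<tau> y r)" for S
  by (auto intro!: continuous_at_imp_continuous_on DERIV_isCont[OF kernel_flux_deriv[OF \<nu>0 \<tau>]])
 have cK: "continuous_on S (\<lambda>r. kernel_dt \<nu> \<tau> y r)" for S
  unfolding kernel_dt_def using \<tau> \<nu>0 by (intro continuous_intros continuous_on_bkernel) auto
 have V: "primitive (\<lambda>r. of_real (?P r))
   (\<lambda>r. of_real (?F r))"
 proof (rule primitive_of_derivative)
  fix r :: real assume "0 < r"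
  from kernel_potential_deriv[OF \<nu>0 \<tau> this, of y]
  show "((\<lambda>r. complex_of_real (?P r)) has_vector_derivative
    of_real (?F r)) (at r)"
   unfolding has_real_derivative_iff_has_vector_derivative by (rule bounded_linear.has_vector_derivative[OF bounded_linear_of_real])
 qed (auto intro!: continuous_intros cP)
 have P: "primitive (\<lambda>r. of_real (kernel_flux \<nu> \<tau> y r)) (\<lambda>r. of_real (kernel_dt \<nu> \<tau> y r))"
 proof (rule primitive_of_derivative)
  fix r :: real
  from kernel_flux_deriv[OF \<nu>0 \<tau>, of y r]
  show "((\<lambda>r. complex_of_real (kernel_flux \<nu> \<tau> y r)) has_vector_derivative of_real (kernel_dt \<nu> \<tau> y r)) (at r)"
   unfolding has_real_derivative_iff_has_vector_derivative by (rule bounded_linear.has_vector_derivative[OF bounded_linear_of_real])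
 qed (auto intro!: continuous_intros cK)
 have prim: "primitive U U1" "primitive (\<lambda>y. of_real (y powr (1 - 2 * \<nu>)) * U1 y) (\<lambda>y. of_real (y powr (1 - 2 * \<nu>)) * f y)"
  using sol by (auto simp: bessel_solution_def)
 show ?thesis
 proof (rule primitive_cong[OF primitive_diff[OF primitive_mult[OF V prim(2)] primitive_mult[OF P prim(1)]]])
  fix r :: real assume r: "0 < r"
  have 1: "r powr (2 * \<nu>) * r powr (1 - 2 * \<nu>) = r" using r by (simp add: powr_add[symmetric])
  have 2: "r powr (2 * \<nu> - 1) * r powr (1 - 2 * \<nu>) = 1" using r by (simp add: powr_add[symmetric])
  have V: "of_real (?P r) * (of_real (r powr (1 - 2 * \<nu>)) * z) =
    of_real (dkernel \<nu> \<tau> y r) * z" for z :: complex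
  proof -
   have "y powr (2 * \<nu>) * r powr (2 * \<nu>) * bkernel \<nu> \<tau> y r * r powr (1 - 2 * \<nu>) =
     y powr (2 * \<nu>) * (r powr (2 * \<nu>) * r powr (1 - 2 * \<nu>)) * bkernel \<nu> \<tau> y r" by (simp only: mult_ac)
   then have "y powr (2 * \<nu>) * r powr (2 * \<nu>) * bkernel \<nu> \<tau> y r * r powr (1 - 2 * \<nu>) = dkernel \<nu> \<tau> y r"
    unfolding 1 dkernel_def .
   then show ?thesis by (metis mult.assoc of_real_mult)
  qed
  have F: "of_real (?F r) * (of_real (r powr (1 - 2 * \<nu>)) * z) =
    of_real (kernel_flux \<nu> \<tau> y r) * z" for z :: complex
  proof -
   have "r powr (2 * \<nu> - 1) * kernel_flux \<nu> \<tau> y r * r powr (1 - 2 * \<nu>) =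
     (r powr (2 * \<nu> - 1) * r powr (1 - 2 * \<nu>)) * kernel_flux \<nu> \<tau> y r" by (simp only: mult_ac)
   then have "r powr (2 * \<nu> - 1) * kernel_flux \<nu> \<tau> y r * r powr (1 - 2 * \<nu>) = kernel_flux \<nu> \<tau> y r" unfolding 2 by simp
   then show ?thesis by (metis mult.assoc of_real_mult)
  qed
  show "of_real (?P r) * (of_real (r powr (1 - 2 * \<nu>)) * U1 r) -
    of_real (kernel_flux \<nu> \<tau> y r) * U r =
    of_real (dkernel \<nu> \<tau> y r) * U1 r - of_real (kernel_flux \<nu> \<tau> y r) * U r"
   unfolding V ..
  show "of_real (?P r) * (of_real (r powr (1 - 2 * \<nu>)) * f r) +
    of_real (?F r) * (of_real (r powr (1 - 2 * \<nu>)) * U1 r) -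
    (of_real (kernel_flux \<nu> \<tau> y r) * U1 r + of_real (kernel_dt \<nu> \<tau> y r) * U r) =
    of_real (dkernel \<nu> \<tau> y r) * f r - of_real (kernel_dt \<nu> \<tau> y r) * U r"
   unfolding V F by simp
 qed
qed

text \<open>Green's identity on [a n, b n]; both boundary terms tend to 0. At 0 the kernel is O(r)
  and r U1 tends to 0, while the flux is merely bounded, so that the limit 0 of U is essential. At
  infinity the points b n are chosen where the boundary terms are small.\<close>

lemma T_eq_kernel_dt:
 assumes \<tau>: "0 < \<tau>" and y: "0 < y"
 shows "T \<tau> f y = (LINT r|lborel. of_real (indicator {0<..} r * kernel_dt \<nu> \<tau> y r) * U r)"
proof -
 obtain C where C: "0 < C" "\<And>\<sigma> r. \<tau> \<le> \<sigma> \<Longrightarrow> \<sigma> \<le> \<tau> \<Longrightarrow> 0 < r \<Longrightarrow>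
  \<bar>dkernel \<nu> \<sigma> y r\<bar> \<le> C * (r * exp (- r)) \<and> \<bar>kernel_flux \<nu> \<sigma> y r\<bar> \<le> C * exp (- r) \<and> \<bar>kernel_dt \<nu> \<sigma> y r\<bar> \<le> C * (r * exp (- r))"
  using kernel_bounds[OF m_bounds(5) \<tau> y, of \<tau>] by blast
 note bd = C(2)[OF order_refl order_refl]
 define \<phi> where "\<phi> r = of_real (indicator {0<..} r * dkernel \<nu> \<tau> y r) * f r - of_real (indicator {0<..} r * kernel_dt \<nu> \<tau> y r) * U r" for r
 define B where "B r = of_real (dkernel \<nu> \<tau> y r) * U1 r - of_real (kernel_flux \<nu> \<tau> y r) * U r" for r
 have i1: "integrable lborel (\<lambda>r. of_real (indicator {0<..} r * dkernel \<nu> \<tau> y r) * f r)"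
  by (rule T_integrable[OF fL \<tau> y])
 have i2: "integrable lborel (\<lambda>r. of_real (indicator {0<..} r * kernel_dt \<nu> \<tau> y r) * U r)"
  by (rule kernel_bound_integrable[OF UL]) (use bd in auto)
 have i: "integrable lborel \<phi>" unfolding \<phi>_def by (rule Bochner_Integration.integrable_diff[OF i1 i2])
 note [measurable] = i[THEN borel_measurable_integrable]
 have Beq: "(LINT r|lborel. indicator {a..b} r *\<^sub>R \<phi> r) = B b - B a" if "0 < a" "a \<le> b" for a b
 proof -
  have "(LINT r|lborel. indicator {a..b} r *\<^sub>R \<phi> r) = (LINT r:{a..b}|lborel. of_real (dkernel \<nu> \<tau> y r) * f r - of_real (kernel_dt \<nu> \<tau> y r) * U r)"
   unfolding set_lebesgue_integral_def
   by (rule Bochner_Integration.integral_cong) (use that in \<open>auto simp: \<phi>_def indicator_def\<close>)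
  also have "\<dots> = B b - B a" unfolding B_def by (rule primitiveD(2)[OF kernel_Green_primitive[OF \<tau>] that])
  finally show ?thesis .
 qed
 define a where "a n = inverse (real (Suc n))" for n
 have a: "0 < a n" "a n \<le> 1" for n by (simp_all add: a_def inverse_le_1_iff)
 have alim: "a \<longlonglongrightarrow> 0" unfolding a_def by (rule LIMSEQ_inverse_real_of_nat)
 \<comment> \<open>Up to the constant \<open>C\<close> this dominates the boundary term at points
   beyond 1; it is integrable, hence small at arbitrarily distant points.\<close>
 define \<psi> where "\<psi> r = indicator {0<..} r * (r * exp (- r) * norm (of_real (indicator {1..} r) * U1 r)) + indicator {0<..} r * (r * exp (- r) * norm (U r))" for r :: real
 have \<psi>: "integrable lborel \<psi>"
  unfolding \<psi>_def by (intro Bochner_Integration.integrable_add weighted_integrable UL U1_at_infinity[OF sol fL UL])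
 have "\<exists>b. real n + 1 \<le> b \<and> \<psi> b < a n" for n
  using integrable_small_values[OF \<psi> a(1)[of n], of "real n + 1"] by blast
 then obtain b where b: "\<And>n. real n + 1 \<le> b n" "\<And>n. \<psi> (b n) < a n" by metis
 have blim: "(\<lambda>n. B (b n)) \<longlonglongrightarrow> 0"
 proof (rule Lim_null_comparison)
  show "(\<lambda>n. C * a n) \<longlonglongrightarrow> 0" using tendsto_mult_left[OF alim, of C] by simp
  show "\<forall>\<^sub>F n in sequentially. norm (B (b n)) \<le> C * a n"
  proof (intro always_eventually allI)
   fix n
   have bn: "1 \<le> b n" "0 < b n" using b(1)[of n] by linarith+
   let ?r = "b n"
   have k: "\<bar>dkernel \<nu> \<tau> y ?r\<bar> \<le> C * (?r * exp (- ?r))" "\<bar>kernel_flux \<nu> \<tau> y ?r\<bar> \<le> C * (?r * exp (- ?r))"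
   proof -
    show "\<bar>dkernel \<nu> \<tau> y ?r\<bar> \<le> C * (?r * exp (- ?r))" using bd[OF bn(2)] by blast
    have "C * (1 * exp (- ?r)) \<le> C * (?r * exp (- ?r))" using C(1) bn by (intro mult_left_mono mult_right_mono) auto
    then show "\<bar>kernel_flux \<nu> \<tau> y ?r\<bar> \<le> C * (?r * exp (- ?r))" using bd[OF bn(2)] by simp
   qed
   have "norm (B ?r) \<le> \<bar>dkernel \<nu> \<tau> y ?r\<bar> * norm (U1 ?r) + \<bar>kernel_flux \<nu> \<tau> y ?r\<bar> * norm (U ?r)"
    unfolding B_def by (rule order_trans[OF norm_triangle_ineq4]) (simp add: norm_mult)
   also have "\<dots> \<le> C * (?r * exp (- ?r)) * norm (U1 ?r) + C * (?r * exp (- ?r)) * norm (U ?r)"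
    by (intro add_mono mult_right_mono k) auto
   also have "\<dots> = C * \<psi> ?r" using bn by (simp add: \<psi>_def algebra_simps)
   also have "\<dots> \<le> C * a n" using C(1) b(2)[of n] by (intro mult_left_mono) auto
   finally show "norm (B (b n)) \<le> C * a n" .
  qed
 qed
 have Alim: "(\<lambda>n. B (a n)) \<longlonglongrightarrow> 0"
 proof (rule Lim_null_comparison)
  have l1: "(\<lambda>n. of_real (a n) * U1 (a n)) \<longlonglongrightarrow> 0"
   using solution_derivative_limit[OF sol fL] a(1) alim unfolding tendsto_at_right_0_sequentially by blast
  have l2: "(\<lambda>n. U (a n)) \<longlonglongrightarrow> 0"
   using U0 a(1) alim unfolding tendsto_at_right_0_sequentially by blast
  have "(\<lambda>n. C * (norm (of_real (a n) * U1 (a n)) + norm (U (a n)))) \<longlonglongrightarrow> C * (0 + 0)"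
   by (intro tendsto_intros tendsto_norm_zero l1 l2)
  then show "(\<lambda>n. C * (norm (of_real (a n) * U1 (a n)) + norm (U (a n)))) \<longlonglongrightarrow> 0" by simp
  show "\<forall>\<^sub>F n in sequentially. norm (B (a n)) \<le> C * (norm (of_real (a n) * U1 (a n)) + norm (U (a n)))"
  proof (intro always_eventually allI)
   fix n
   let ?r = "a n"
   have e: "exp (- ?r) \<le> 1" using a(1)[of n] by simp
   have k1: "\<bar>dkernel \<nu> \<tau> y ?r\<bar> \<le> C * ?r"
   proof -
    have "C * (?r * exp (- ?r)) \<le> C * (?r * 1)" using C(1) a(1)[of n] by (intro mult_left_mono e) auto
    then show ?thesis using bd[OF a(1)[of n]] by linarith
   qed
   have k2: "\<bar>kernel_flux \<nu> \<tau> y ?r\<bar> \<le> C"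
   proof -
    have "C * exp (- ?r) \<le> C * 1" using C(1) by (intro mult_left_mono e) auto
    then show ?thesis using bd[OF a(1)[of n]] by linarith
   qed
   have "norm (B ?r) \<le> \<bar>dkernel \<nu> \<tau> y ?r\<bar> * norm (U1 ?r) + \<bar>kernel_flux \<nu> \<tau> y ?r\<bar> * norm (U ?r)"
    unfolding B_def by (rule order_trans[OF norm_triangle_ineq4]) (simp add: norm_mult)
   also have "\<dots> \<le> C * ?r * norm (U1 ?r) + C * norm (U ?r)"
    by (intro add_mono mult_right_mono k1 k2) auto
   also have "\<dots> = C * (norm (of_real ?r * U1 ?r) + norm (U ?r))" using a(1)[of n] by (simp add: norm_mult distrib_left)
   finally show "norm (B (a n)) \<le> C * (norm (of_real (a n) * U1 (a n)) + norm (U (a n)))" .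
  qed
 qed
 have "(\<lambda>n. LINT r|lborel. indicator {a n..b n} r *\<^sub>R \<phi> r) \<longlonglongrightarrow> (LINT r|lborel. \<phi> r)"
 proof (rule integral_dominated_convergence[OF _ _ integrable_norm[OF i]])
  show "AE r in lborel. (\<lambda>n. indicator {a n..b n} r *\<^sub>R \<phi> r) \<longlonglongrightarrow> \<phi> r"
  proof (rule AE_I2)
   fix r :: real
   show "(\<lambda>n. indicator {a n..b n} r *\<^sub>R \<phi> r) \<longlonglongrightarrow> \<phi> r"
   proof (cases "0 < r")
    case True
    have 1: "\<forall>\<^sub>F n in sequentially. a n < r" using alim True by (rule order_tendstoD)
    have 2: "\<forall>\<^sub>F n in sequentially. r < b n"
    proof -
     obtain n0 where "r < real n0" using reals_Archimedean2 by blast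
     then have "r < b n" if "n0 \<le> n" for n using b(1)[of n] that by (smt (verit) of_nat_le_iff)
     then show ?thesis by (rule eventually_sequentiallyI)
    qed
    have "\<forall>\<^sub>F n in sequentially. indicator {a n..b n} r *\<^sub>R \<phi> r = \<phi> r"
     using 1 2 by eventually_elim simp
    then show ?thesis by (rule tendsto_eventually)
   next
    case False
    then have "\<phi> r = 0" by (simp add: \<phi>_def)
    then show ?thesis by simp
   qed
  qed
  show "AE r in lborel. norm (indicator {a n..b n} r *\<^sub>R \<phi> r) \<le> norm (\<phi> r)" for n by (auto simp: indicator_def)
 qed measurable
 moreover have "(\<lambda>n. LINT r|lborel. indicator {a n..b n} r *\<^sub>R \<phi> r) \<longlonglongrightarrow> 0"
 proof -
  have "(LINT r|lborel. indicator {a n..b n} r *\<^sub>R \<phi> r) = B (b n) - B (a n)" for n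
   using a[of n] b(1)[of n] by (intro Beq) (auto intro: order_trans)
  then show ?thesis using tendsto_diff[OF blim Alim] by simp
 qed
 ultimately have "(LINT r|lborel. \<phi> r) = 0" by (rule LIMSEQ_unique)
 then show ?thesis unfolding \<phi>_def dirichlet_semigroup_def by (subst (asm) Bochner_Integration.integral_diff[OF i1 i2]) simp
qed

text \<open>The fundamental theorem of calculus in the time variable together with Fubini's theorem
  in time and space, after \<open>T \<tau> f\<close> has been rewritten with the time derivative of
  the kernel. A positive s provides one majorant for all times in the interval.\<close>

lemma T_difference:
 assumes s: "0 < s" and st: "s \<le> t" and y: "0 < y"
 shows "integrable lborel (\<lambda>\<tau>. indicator {s..t} \<tau> *\<^sub>R T \<tau> f y)"
  and "T t U y - T s U y = (LINT \<tau>|lborel. indicator {s..t} \<tau> *\<^sub>R T \<tau> f y)"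
proof -
 let ?J = "(LINT \<tau>|lborel. indicator {s..t} \<tau> *\<^sub>R T \<tau> f y)"
 note [measurable] = Lpm_ext0[OF UL]
 obtain C where C: "0 < C" "\<And>\<sigma> r. s \<le> \<sigma> \<Longrightarrow> \<sigma> \<le> t \<Longrightarrow> 0 < r \<Longrightarrow>
  \<bar>dkernel \<nu> \<sigma> y r\<bar> \<le> C * (r * exp (- r)) \<and> \<bar>kernel_flux \<nu> \<sigma> y r\<bar> \<le> C * exp (- r) \<and> \<bar>kernel_dt \<nu> \<sigma> y r\<bar> \<le> C * (r * exp (- r))"
  using kernel_bounds[OF m_bounds(5) s y, of t] by blast
 define H where "H \<tau> r = indicator {s..t} \<tau> *\<^sub>R (of_real (indicator {0<..} r * kernel_dt \<nu> \<tau> y r) * ext0 U r)" for \<tau> r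
 define w where "w r = C * (indicator {0<..} r * (r * exp (- r) * norm (ext0 U r)))" for r :: real
 have w: "integrable lborel w"
 proof -
  have "w = (\<lambda>r. C * (indicator {0<..} r * (r * exp (- r) * norm (U r))))"
   by (auto simp: w_def ext0_def indicator_def)
  then show ?thesis using weighted_integrable[OF UL] by simp
 qed
 have Hw: "norm (H \<tau> r) \<le> norm (indicator {s..t} \<tau> * w r)" for \<tau> r
 proof (cases "\<tau> \<in> {s..t} \<and> 0 < r")
  case True
  have "\<bar>kernel_dt \<nu> \<tau> y r\<bar> * norm (U r) \<le> C * (r * exp (- r)) * norm (U r)"
   using C(2)[of \<tau> r] True by (intro mult_right_mono) auto
  then show ?thesis using True C(1) by (simp add: H_def w_def ext0_def norm_mult mult.assoc)
 next
  case False
  then show ?thesis by (auto simp: H_def)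
 qed
 have iw: "integrable (lborel \<Otimes>\<^sub>M lborel) (\<lambda>(\<tau>, r). indicator {s..t} \<tau> * w r)"
 proof (rule lborel_pair.Fubini_integrable)
  note [measurable] = w[THEN borel_measurable_integrable]
  show "(\<lambda>(\<tau>, r). indicator {s..t} \<tau> * w r) \<in> borel_measurable (lborel \<Otimes>\<^sub>M lborel)" by measurable
  have "integrable lborel (\<lambda>\<tau>. indicator {s..t} \<tau> * (LINT r|lborel. norm (w r)))"
   using st by (intro integrable_mult_left integrable_real_indicator) auto
  then show "integrable lborel (\<lambda>\<tau>. LINT r|lborel. norm (case (\<tau>, r) of (\<tau>, r) \<Rightarrow> indicator {s..t} \<tau> * w r))"
   by (simp add: abs_mult)
  show "AE \<tau> in lborel. integrable lborel (\<lambda>r. case (\<tau>, r) of (\<tau>, r) \<Rightarrow> indicator {s..t} \<tau> * w r)"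
   using w by simp
 qed
 have iH: "integrable (lborel \<Otimes>\<^sub>M lborel) (\<lambda>(\<tau>, r). H \<tau> r)"
 proof (rule Bochner_Integration.integrable_bound[OF iw])
  show "(\<lambda>(\<tau>, r). H \<tau> r) \<in> borel_measurable (lborel \<Otimes>\<^sub>M lborel)" unfolding H_def by measurable
  show "AE z in lborel \<Otimes>\<^sub>M lborel. norm (case z of (\<tau>, r) \<Rightarrow> H \<tau> r) \<le> norm (case z of (\<tau>, r) \<Rightarrow> indicator {s..t} \<tau> * w r)"
   using Hw by auto
 qed
 have 1: "(LINT r|lborel. H \<tau> r) = indicator {s..t} \<tau> *\<^sub>R T \<tau> f y" for \<tau>
 proof (cases "\<tau> \<in> {s..t}")
  case True
  then have "0 < \<tau>" using s by auto
  have "(LINT r|lborel. H \<tau> r) = (LINT r|lborel. of_real (indicator {0<..} r * kernel_dt \<nu> \<tau> y r) * U r)"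
   using True by (intro Bochner_Integration.integral_cong) (auto simp: H_def ext0_def indicator_def)
  also have "\<dots> = T \<tau> f y" by (rule T_eq_kernel_dt[OF \<open>0 < \<tau>\<close> y, symmetric])
  finally show ?thesis using True by simp
 qed (simp add: H_def)
 have 2: "(LINT \<tau>|lborel. H \<tau> r) = of_real (indicator {0<..} r * (dkernel \<nu> t y r - dkernel \<nu> s y r)) * U r" for r
 proof (cases "0 < r")
  case True
  have FTC: "(LINT \<tau>|lborel. indicator {s..t} \<tau> *\<^sub>R kernel_dt \<nu> \<tau> y r) = dkernel \<nu> t y r - dkernel \<nu> s y r"
  proof (rule integral_FTC_atLeastAtMost[OF st])
   fix \<tau> assume "s \<le> \<tau>" "\<tau> \<le> t"
   then have "0 < \<tau>" using s by simp
   from dkernel_deriv_t[OF m_bounds(5) this]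
   show "((\<lambda>\<tau>. dkernel \<nu> \<tau> y r) has_vector_derivative kernel_dt \<nu> \<tau> y r) (at \<tau> within {s..t})"
    unfolding has_real_derivative_iff_has_vector_derivative .
  next
   have "continuous_on {s..t} (\<lambda>\<tau>. bkernel \<mu> \<tau> y r)" if "0 \<le> \<mu>" for \<mu>
    using s that by (intro continuous_at_imp_continuous_on ballI DERIV_isCont[OF bkernel_deriv_t]) auto
   then show "continuous_on {s..t} (\<lambda>\<tau>. kernel_dt \<nu> \<tau> y r)"
    unfolding kernel_dt_def using s m_bounds(5) by (intro continuous_intros) auto
  qed
  have "(LINT \<tau>|lborel. H \<tau> r) = (LINT \<tau>|lborel. of_real (indicator {s..t} \<tau> *\<^sub>R kernel_dt \<nu> \<tau> y r) * U r)"
   using True by (intro Bochner_Integration.integral_cong) (auto simp: H_def ext0_def indicator_def)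
  also have "\<dots> = (LINT \<tau>|lborel. of_real (indicator {s..t} \<tau> *\<^sub>R kernel_dt \<nu> \<tau> y r)) * U r"
   by (rule integral_mult_left_zero)
  also have "(LINT \<tau>|lborel. complex_of_real (indicator {s..t} \<tau> *\<^sub>R kernel_dt \<nu> \<tau> y r)) = of_real (dkernel \<nu> t y r - dkernel \<nu> s y r)"
   unfolding integral_complex_of_real FTC ..
  finally show ?thesis using True by simp
 qed (simp add: H_def)
 show "integrable lborel (\<lambda>\<tau>. indicator {s..t} \<tau> *\<^sub>R T \<tau> f y)"
  using lborel_pair.integrable_fst'[OF iH] by (simp add: 1)
 have "?J = (LINT r|lborel. of_real (indicator {0<..} r * (dkernel \<nu> t y r - dkernel \<nu> s y r)) * U r)"
  using lborel_pair.Fubini_integral[OF iH] by (simp add: 1 2)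
 also have "\<dots> = (LINT r|lborel. of_real (indicator {0<..} r * dkernel \<nu> t y r) * U r - of_real (indicator {0<..} r * dkernel \<nu> s y r) * U r)"
  by (intro Bochner_Integration.integral_cong) (auto simp: algebra_simps)
 also have "\<dots> = T t U y - T s U y"
  unfolding dirichlet_semigroup_def using s st by (intro Bochner_Integration.integral_diff T_integrable[OF UL] y) auto
 finally show "T t U y - T s U y = ?J" by simp
qed

text \<open>A substitute for Minkowski's integral inequality: Hoelder's inequality in the time
  variable bounds the power p of the time integral by (t - s)^(p - 1) times the integral of the
  power, and Fubini's theorem then brings in the norm at each time.\<close>

lemma average_bound:
 assumes s: "0 < s" and st: "s < t" and e: "0 \<le> e"
  and small: "\<And>\<tau>. 0 < \<tau> \<Longrightarrow> \<tau> \<le> t \<Longrightarrow> N (\<lambda>y. T \<tau> f y - f y) \<le> ennreal e"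
 shows "N (\<lambda>y. T t U y - T s U y - of_real (t - s) * f y) \<le> ennreal (t powr p * e)"
proof -
 note fm = fL[unfolded Lpm_iff, THEN conjunct1]
 note [measurable] = fm[unfolded hl_measurable_iff]
 have [measurable]: "(\<lambda>\<tau>. T \<tau> f y) \<in> borel_measurable borel" for y
  by (rule T_measurable[OF fm]) auto
 have [measurable]: "(\<lambda>z. T (snd z) f (fst z)) \<in> borel_measurable (lborel \<Otimes>\<^sub>M lborel)"
  by (rule T_measurable[OF fm]) auto
 let ?J = "\<lambda>\<tau>::real. indicator {s..t} \<tau> :: real"
 let ?I = "\<lambda>y::real. indicator {0<..} y :: real"
 let ?D = "\<lambda>y. T t U y - T s U y - of_real (t - s) * f y"
 let ?V = "\<lambda>y \<tau>. ?J \<tau> * norm (T \<tau> f y - f y) powr p"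
 let ?W = "\<lambda>y \<tau>. ?I y * (y powr m * (?J \<tau> * norm (T \<tau> f y - ext0 f y) powr p))"
 have pw: "ennreal (norm (?D y) powr p) \<le>
   ennreal ((t - s) powr (p - 1)) * (nnint_R (\<lambda>\<tau>. ?V y \<tau>))" if y: "0 < y" for y
 proof -
  note iT = T_difference(1)[OF s less_imp_le[OF st] y]
  have ic: "integrable lborel (\<lambda>\<tau>. ?J \<tau> *\<^sub>R f y)" using st by (intro integrable_scaleR_left integrable_real_indicator) auto
  have "T t U y - T s U y - of_real (t - s) * f y = (LINT \<tau>|lborel. ?J \<tau> *\<^sub>R T \<tau> f y) - (LINT \<tau>|lborel. ?J \<tau> *\<^sub>R f y)"
   using T_difference(2)[OF s less_imp_le[OF st] y] st by (simp add: scaleR_conv_of_real)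
  also have "\<dots> = (LINT \<tau>|lborel. ?J \<tau> *\<^sub>R T \<tau> f y - ?J \<tau> *\<^sub>R f y)"
   by (rule Bochner_Integration.integral_diff[symmetric, OF iT ic])
  finally have eq: "T t U y - T s U y - of_real (t - s) * f y = (LINT \<tau>|lborel. ?J \<tau> *\<^sub>R T \<tau> f y - ?J \<tau> *\<^sub>R f y)" .
  have "ennreal (norm (?D y)) \<le> (\<integral>\<^sup>+\<tau>. norm (?J \<tau> *\<^sub>R T \<tau> f y - ?J \<tau> *\<^sub>R f y) \<partial>lborel)"
   unfolding eq by (rule integral_norm_bound_ennreal[OF Bochner_Integration.integrable_diff[OF iT ic]])
  also have "\<dots> = (nnint_R (\<lambda>\<tau>. ?J \<tau> * norm (T \<tau> f y - f y)))"
   by (intro nn_integral_cong) (auto simp: indicator_def)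
  finally have le: "ennreal (norm (?D y)) \<le> (nnint_R (\<lambda>\<tau>. ?J \<tau> * norm (T \<tau> f y - f y)))" .
  have "ennreal (norm (?D y) powr p) \<le>
   ennreal ((t - s) powr (p - 1)) * (nnint_R (\<lambda>\<tau>. ?J \<tau> * (norm (T \<tau> f y - f y) powr p * 1 powr (1 - p))))"
  proof (rule nn_integral_Hoelder[OF p _ _ le])
   show "(\<lambda>\<tau>. norm (T \<tau> f y - f y)) \<in> borel_measurable lborel"
    by measurable
   have "(nnint_R (\<lambda>\<tau>. ?J \<tau> * 1)) = (\<integral>\<^sup>+\<tau>. indicator {s..t} \<tau> \<partial>lborel)"
    by (intro nn_integral_cong) (auto simp: indicator_def)
   then show "(nnint_R (\<lambda>\<tau>. ?J \<tau> * 1)) \<le> ennreal (t - s)" using st by simp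
  qed (use st in auto)
  then show ?thesis by simp
 qed
 have m2: "(\<lambda>(y, \<tau>). ennreal (?W y \<tau>)) \<in> borel_measurable (lborel \<Otimes>\<^sub>M lborel)"
  unfolding case_prod_beta' by measurable
 have "N (\<lambda>y. T t U y - T s U y - of_real (t - s) * f y) \<le>
   (\<integral>\<^sup>+y. ennreal ((t - s) powr (p - 1)) * (nnint_R (\<lambda>\<tau>. ?W y \<tau>)) \<partial>lborel)"
  unfolding power_norm_def
 proof (rule nn_integral_mono)
  fix y :: real
  show "ennreal (y powr m * norm (?D y) powr p) * indicator {0<..} y \<le>
    ennreal ((t - s) powr (p - 1)) * (nnint_R (\<lambda>\<tau>. ?W y \<tau>))"
  proof (cases "0 < y")
   case True
   have mm: "(\<lambda>\<tau>. ennreal (?V y \<tau>)) \<in> borel_measurable lborel"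
    by measurable
   have "ennreal (y powr m * norm (?D y) powr p) =
     ennreal (y powr m) * ennreal (norm (?D y) powr p)" by (rule ennreal_mult') simp
   also have "\<dots> \<le> ennreal (y powr m) * (ennreal ((t - s) powr (p - 1)) * (nnint_R (\<lambda>\<tau>. ?V y \<tau>)))"
    by (intro mult_left_mono pw True) simp
   also have "\<dots> = ennreal ((t - s) powr (p - 1)) * (ennreal (y powr m) * (nnint_R (\<lambda>\<tau>. ?V y \<tau>)))"
    by (simp only: mult_ac)
   also have "ennreal (y powr m) * (nnint_R (\<lambda>\<tau>. ?V y \<tau>)) =
     (\<integral>\<^sup>+\<tau>. ennreal (y powr m) * ennreal (?V y \<tau>) \<partial>lborel)"
    by (rule nn_integral_cmult[symmetric, OF mm])
   also have "\<dots> = (nnint_R (\<lambda>\<tau>. ?W y \<tau>))"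
    using True by (intro nn_integral_cong) (simp add: ennreal_mult' ext0_def)
   finally show ?thesis using True by simp
  qed simp
 qed
 also have "\<dots> = ennreal ((t - s) powr (p - 1)) * (\<integral>\<^sup>+y. (nnint_R (\<lambda>\<tau>. ?W y \<tau>)) \<partial>lborel)"
  by (rule nn_integral_cmult[OF lborel.borel_measurable_nn_integral[OF m2]])
 also have "(\<integral>\<^sup>+y. (nnint_R (\<lambda>\<tau>. ?W y \<tau>)) \<partial>lborel) =
   (\<integral>\<^sup>+\<tau>. (nnint_R (\<lambda>y. ?W y \<tau>)) \<partial>lborel)"
  by (rule lborel_pair.Fubini'[OF m2, symmetric])
 also have "\<dots> \<le> (\<integral>\<^sup>+\<tau>. ennreal e * indicator {s..t} \<tau> \<partial>lborel)"
 proof (rule nn_integral_mono)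
  fix \<tau> :: real
  show "(nnint_R (\<lambda>y. ?W y \<tau>)) \<le> ennreal e * indicator {s..t} \<tau>"
  proof (cases "\<tau> \<in> {s..t}")
   case True
   have "(nnint_R (\<lambda>y. ?W y \<tau>)) = N (\<lambda>y. T \<tau> f y - f y)"
    unfolding power_norm_def using True by (intro nn_integral_cong) (auto simp: ext0_def indicator_def)
   then show ?thesis using small[of \<tau>] True s by simp
  qed simp
 qed
 also have "(\<integral>\<^sup>+\<tau>. ennreal e * indicator {s..t} \<tau> \<partial>lborel) = ennreal (e * (t - s))"
  using st e by (simp add: nn_integral_cmult_indicator ennreal_mult)
 also have "ennreal ((t - s) powr (p - 1)) * ennreal (e * (t - s)) = ennreal ((t - s) powr (p - 1) * (e * (t - s)))"
  by (rule ennreal_mult'[symmetric]) simp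
 also have "(t - s) powr (p - 1) * (e * (t - s)) = (t - s) powr p * e"
  using st powr_mult_base[of "t - s" "p - 1"] by (simp add: mult_ac)
 also have "ennreal ((t - s) powr p * e) \<le> ennreal (t powr p * e)"
  using s st e p by (intro ennreal_leI mult_right_mono powr_mono2) auto
 \<comment> \<open>The chain estimates a factor inside a product, so that monotonicity of the
   multiplication remains as a premise; it is discharged in the next line.\<close>
 finally have imp: "(\<And>x y :: ennreal. x \<le> y \<Longrightarrow> ennreal ((t - s) powr (p - 1)) * x \<le> ennreal ((t - s) powr (p - 1)) * y) \<Longrightarrow>
   N (\<lambda>y. T t U y - T s U y - of_real (t - s) * f y) \<le> ennreal (t powr p * e)" .
 show ?thesis by (rule imp) (rule mult_left_mono, simp_all)
qed

text \<open>The quotient minus f is split into (T s U - U) / t, the average over [s, t] of T \<tau>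
  f - f up to normalisation, and (s / t) f. The average is small for small t; the other two terms
  are made small for each fixed t by choosing s afterwards.\<close>

theorem generator_tendsto: "((\<lambda>t. N (\<lambda>y. (T t U y - U y) / of_real t - f y)) \<longlongrightarrow> 0) (at_right 0)"
proof (rule ennreal_tendsto_0I)
 let ?E = "\<lambda>t. \<lambda>y. (T t U y - U y) / of_real t - f y"
 fix e :: real assume e: "0 < e"
 note fm = fL[unfolded Lpm_iff, THEN conjunct1] and Um = UL[unfolded Lpm_iff, THEN conjunct1]
 \<comment> \<open>Three terms, each of size at most e', enter through two uses of the
   quasi-triangle inequality, and this is the factor that results.\<close>
 define A :: real where "A = 2 powr p * (1 + 2 powr p * 2)"
 have A: "0 < A" by (simp add: A_def add_pos_pos)
 define e' where "e' = e / A"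
 have e': "0 < e'" using e A by (simp add: e'_def)
 have "\<forall>\<^sub>F t in at_right 0. N (\<lambda>y. T t f y - f y) \<le> ennreal e'"
  using strongly_continuous[OF fL] e' unfolding SC_def by (rule ennreal_tendsto_0D)
 then obtain d where d: "0 < d" "\<And>t. 0 < t \<Longrightarrow> t < d \<Longrightarrow> N (\<lambda>y. T t f y - f y) \<le> ennreal e'"
  unfolding eventually_at_right_field by blast
 have "N (?E t) \<le> ennreal e" if t: "0 < t" "t < d" for t
 proof -
  have l1: "((\<lambda>s. ennreal (inverse t powr p) * N (\<lambda>y. T s U y - U y)) \<longlongrightarrow> ennreal (inverse t powr p) * 0) (at_right 0)"
   using strongly_continuous[OF UL] unfolding SC_def by (intro tendsto_intros) auto
  have "\<forall>\<^sub>F s in at_right 0. ennreal (inverse t powr p) * N (\<lambda>y. T s U y - U y) \<le> ennreal e'"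
   using l1 by (intro ennreal_tendsto_0D e') simp
  moreover have "\<forall>\<^sub>F s in at_right 0. ennreal ((s / t) powr p) * N f \<le> ennreal e'"
  proof -
   obtain n where n: "N f = ennreal n" "0 \<le> n" using fL by (cases "N f") (auto simp: Lpm_iff)
   have "((\<lambda>s. s / t) \<longlongrightarrow> 0 / t) (at_right 0)" using t by (intro tendsto_intros) auto
   then have "((\<lambda>s. (s / t) powr p * n) \<longlongrightarrow> 0 * n) (at_right 0)"
    using p t by (intro tendsto_mult tendsto_const tendsto_zero_powrI[where b = p])
     (auto simp: eventually_at_right_field intro!: exI[of _ 1])
   then have "\<forall>\<^sub>F s in at_right 0. (s / t) powr p * n < e'" using e' by (intro order_tendstoD) auto
   then show ?thesis
    by eventually_elim (simp add: n ennreal_mult'[symmetric] ennreal_leI)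
  qed
  moreover have "\<forall>\<^sub>F s in at_right 0. 0 < s \<and> s < t"
   using t by (auto simp: eventually_at_right_field intro!: exI[of _ t])
  ultimately have "\<forall>\<^sub>F s in at_right 0. ennreal (inverse t powr p) * N (\<lambda>y. T s U y - U y) \<le> ennreal e' \<and>
    ennreal ((s / t) powr p) * N f \<le> ennreal e' \<and> 0 < s \<and> s < t"
   by eventually_elim auto
  then obtain s where s: "ennreal (inverse t powr p) * N (\<lambda>y. T s U y - U y) \<le> ennreal e'"
   "ennreal ((s / t) powr p) * N f \<le> ennreal e'" "0 < s" "s < t"
   using eventually_happens'[of "at_right (0::real)"] by (auto simp: trivial_limit_at_right_real)
  define G where "G y = T t U y - T s U y - of_real (t - s) * f y" for y
  have Gm: "hl_measurable G"
   unfolding G_def by (intro hl_measurable_add T_hl_measurable Um hl_measurable_mult_left fm) measurable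
  have g1: "N (\<lambda>y. of_real (inverse t) * (T s U y - U y)) \<le> ennreal e'"
   using s(1) t power_norm_cmult[OF T_minus_id_measurable[OF Um, of s], of m p "of_real (inverse t)"]
   by (simp only: norm_of_real) simp
  have g2: "N (\<lambda>y. of_real (inverse t) * G y) \<le> ennreal e'"
  proof -
   have "N G \<le> ennreal (t powr p * e')"
    unfolding G_def using d t e' by (intro average_bound s) auto
   then have "N (\<lambda>y. of_real (inverse t) * G y) \<le> ennreal (inverse t powr p) * ennreal (t powr p * e')"
    using t unfolding power_norm_cmult[OF Gm] norm_of_real by (simp add: mult_left_mono)
   also have "\<dots> = ennreal (inverse t powr p * (t powr p * e'))" by (rule ennreal_mult'[symmetric]) simp
   also have "inverse t powr p * (t powr p * e') = (inverse t powr p * t powr p) * e'" by simp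
   also have "inverse t powr p * t powr p = 1" using t by (simp add: powr_mult[symmetric])
   finally show ?thesis by simp
  qed
  have g3: "N (\<lambda>y. of_real (s / t) * f y) \<le> ennreal e'"
   using s t power_norm_cmult[OF fm, of m p "of_real (s / t)"] by (simp only: norm_of_real) simp
  have Gfm: "hl_measurable (\<lambda>y. of_real (inverse t) * G y - of_real (s / t) * f y)"
   by (intro hl_measurable_add hl_measurable_mult_left Gm fm) measurable
  have "N (?E t) \<le> ennreal (2 powr p) * (N (\<lambda>y. of_real (inverse t) * (T s U y - U y))
    + N (\<lambda>y. of_real (inverse t) * G y - of_real (s / t) * f y))"
  proof (rule power_norm_add[OF _ Gfm m_bounds(4)])
   show "hl_measurable (\<lambda>y. of_real (inverse t) * (T s U y - U y))"
    by (intro hl_measurable_mult_left T_minus_id_measurable Um) measurable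
   fix y :: real
   have "(T t U y - U y) / of_real t - f y = of_real (inverse t) * (T s U y - U y) + (of_real (inverse t) * G y - of_real (s / t) * f y)"
    using t by (simp add: G_def field_simps)
   then show "norm ((T t U y - U y) / of_real t - f y) \<le> norm (of_real (inverse t) * (T s U y - U y)) + norm (of_real (inverse t) * G y - of_real (s / t) * f y)"
    by (metis norm_triangle_ineq)
  qed
  also have "\<dots> \<le> ennreal (2 powr p) * (ennreal e' + ennreal (2 powr p) * (ennreal e' + ennreal e'))"
  proof (intro mult_left_mono add_mono g1)
   have "N (\<lambda>y. of_real (inverse t) * G y - of_real (s / t) * f y) \<le> ennreal (2 powr p) * (N (\<lambda>y. of_real (inverse t) * G y) + N (\<lambda>y. of_real (s / t) * f y))"
    by (rule power_norm_add[OF hl_measurable_mult_left[OF Gm] hl_measurable_mult_left[OF fm] m_bounds(4) norm_triangle_ineq4]) simp_all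
   also have "\<dots> \<le> ennreal (2 powr p) * (ennreal e' + ennreal e')" by (intro mult_left_mono add_mono g2 g3) simp
   finally show "N (\<lambda>y. of_real (inverse t) * G y - of_real (s / t) * f y) \<le> ennreal (2 powr p) * (ennreal e' + ennreal e')" .
  qed simp
  also have "\<dots> = ennreal (2 powr p * (e' + 2 powr p * (e' + e')))"
  proof -
   have "0 \<le> e'" using e' by simp
   then show ?thesis by (simp only: ennreal_mult ennreal_plus mult_nonneg_nonneg add_nonneg_nonneg powr_ge_zero)
  qed
  also have "2 powr p * (e' + 2 powr p * (e' + e')) = A * e'" by (simp add: A_def algebra_simps)
  also have "\<dots> = e" using A by (simp add: e'_def)
  finally show ?thesis .
 qed
 then show "\<forall>\<^sub>F t in at_right 0. N (?E t) \<le> ennreal e"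
  unfolding eventually_at_right_field using d(1) by blast
qed

end

end

section \<open>Duality\<close>

context bessel_Lp
begin

definition q :: real where "q = p / (p - 1)"
text \<open>The weight for which the spaces with exponents p and q are in duality with respect to
  \<open>y powr (1 - 2 * \<nu>) dy\<close>: this density is \<open>y powr (m / p)\<close> times a
  power of y whose q-th power is \<open>y powr m_dual\<close>.\<close>

definition m_dual :: real where "m_dual = (1 - 2 * \<nu> - m / p) * q"

lemma q_bounds: "1 < q" "1 / p + 1 / q = 1" "0 < q"
 using p by (auto simp: q_def field_simps)

text \<open>Passing to the dual replaces M = (m + 1) / p by 2 - 2 \<nu> - M, a reflection that maps
  the interval from - 2 \<nu> to 2 onto itself.\<close>

lemma dual_bessel_Lp: "bessel_Lp q \<nu> m_dual"
proof
 have "1 / q = 1 - 1 / p" using q_bounds(2) by simp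
 then have "(m_dual + 1) / q = 1 - 2 * \<nu> - m / p + (1 - 1 / p)"
  using q_bounds(3) by (simp add: m_dual_def add_divide_distrib)
 also have "\<dots> = 2 - 2 * \<nu> - (m + 1) / p" by (simp add: add_divide_distrib)
 finally have eq: "(m_dual + 1) / q = 2 - 2 * \<nu> - (m + 1) / p" .
 have "- 2 * \<nu> < 2 - 2 * \<nu> - M" "2 - 2 * \<nu> - M < 2" if "- 2 * \<nu> < M" "M < 2" for M
  using that by auto
 then show "- 2 * \<nu> < (m_dual + 1) / q" "(m_dual + 1) / q < 2"
  unfolding eq using m_lower m_upper by blast+
qed (use q_bounds \<nu> in auto)

abbreviation "weight y \<equiv> indicator {0<..} y * y powr (1 - 2 * \<nu>)"

text \<open>Bilinear, without complex conjugation; the kernel being real and symmetric for this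
  weight, each \<open>T t\<close> is its own transpose.\<close>

definition pairing :: "(real \<Rightarrow> complex) \<Rightarrow> (real \<Rightarrow> complex) \<Rightarrow> complex" where
 "pairing f g = (LINT y|lborel. of_real (weight y) * (f y * g y))"

text \<open>Young's inequality with a free scale l in place of Hoelder's inequality: it stays within
  powers of the norms, and for limits l is chosen so that the term of the fixed function is
  small.\<close>

lemma pairing_le_scaled:
 assumes f: "hl_measurable f" and g: "hl_measurable g" and l: "0 < l"
 shows "(nnint_R (\<lambda>y. weight y * (norm (f y) * norm (g y)))) \<le>
  ennreal (l powr (- p)) * power_norm m p f + ennreal (l powr q) * power_norm m_dual q g"
proof -
 note [measurable] = f[unfolded hl_measurable_iff] g[unfolded hl_measurable_iff]
 have e: "power_norm m p f = (\<integral>\<^sup>+y. ennreal (y powr m * norm (ext0 f y) powr p) * indicator {0<..} y \<partial>lborel)" for m p and f :: "real \<Rightarrow> complex"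
  unfolding power_norm_def by (rule nn_integral_cong) (auto simp: ext0_def indicator_def)
 have "(nnint_R (\<lambda>y. weight y * (norm (f y) * norm (g y)))) \<le>
   (\<integral>\<^sup>+y. ennreal (l powr (- p)) * (ennreal (y powr m * norm (ext0 f y) powr p) * indicator {0<..} y) +
    ennreal (l powr q) * (ennreal (y powr m_dual * norm (ext0 g y) powr q) * indicator {0<..} y) \<partial>lborel)"
 proof (rule nn_integral_mono)
  fix y :: real
  show "ennreal (weight y * (norm (f y) * norm (g y))) \<le>
   ennreal (l powr (- p)) * (ennreal (y powr m * norm (ext0 f y) powr p) * indicator {0<..} y) +
   ennreal (l powr q) * (ennreal (y powr m_dual * norm (ext0 g y) powr q) * indicator {0<..} y)"
  proof (cases "0 < y")
   case True
   let ?a = "y powr (m / p) * norm (f y) / l"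
   let ?b = "l * (y powr (1 - 2 * \<nu> - m / p) * norm (g y))"
   have "?a * ?b \<le> ?a powr p / p + ?b powr q / q"
    using p q_bounds l by (intro Youngs_inequality) auto
   also have "\<dots> \<le> ?a powr p + ?b powr q"
   proof -
    have "x / r \<le> x" if "0 \<le> x" "1 < r" for x r :: real using that by (simp add: divide_le_eq mult_le_cancel_left1)
    then show ?thesis using p q_bounds by (intro add_mono) auto
   qed
   also have "?a powr p = l powr (- p) * (y powr m * norm (f y) powr p)"
    using True l p by (simp add: powr_divide powr_mult powr_powr powr_minus_divide)
   also have "?b powr q = l powr q * (y powr m_dual * norm (g y) powr q)"
    using True l by (simp add: powr_mult powr_powr m_dual_def)
   also have "?a * ?b = y powr (1 - 2 * \<nu>) * (norm (f y) * norm (g y))"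
   proof -
    have "y powr (m / p) * y powr (1 - 2 * \<nu> - m / p) = y powr (1 - 2 * \<nu>)" by (simp add: powr_add[symmetric])
    then have "y powr (m / p) * norm (f y) * (y powr (1 - 2 * \<nu> - m / p) * norm (g y)) = y powr (1 - 2 * \<nu>) * (norm (f y) * norm (g y))"
     by (metis (no_types, opaque_lifting) mult.assoc mult.left_commute)
    then show ?thesis using l by simp
   qed
   finally have "ennreal (y powr (1 - 2 * \<nu>) * (norm (f y) * norm (g y))) \<le>
    ennreal (l powr (- p) * (y powr m * norm (f y) powr p) + l powr q * (y powr m_dual * norm (g y) powr q))"
    by (rule ennreal_leI)
   also have "\<dots> = ennreal (l powr (- p) * (y powr m * norm (f y) powr p)) + ennreal (l powr q * (y powr m_dual * norm (g y) powr q))"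
    by (rule ennreal_plus) auto
   also have "\<dots> = ennreal (l powr (- p)) * ennreal (y powr m * norm (f y) powr p) + ennreal (l powr q) * ennreal (y powr m_dual * norm (g y) powr q)"
    by (intro arg_cong2[of _ _ _ _ "(+)"] ennreal_mult') auto
   finally show ?thesis using True by (simp add: ext0_def)
  qed simp
 qed
 also have "\<dots> = ennreal (l powr (- p)) * power_norm m p f + ennreal (l powr q) * power_norm m_dual q g"
  unfolding e by (simp add: nn_integral_add nn_integral_cmult)
 finally show ?thesis .
qed

lemma pairing_integrable:
 assumes f: "f \<in> L" and g: "g \<in> Lpm m_dual q"
 shows "integrable lborel (\<lambda>y. of_real (weight y) * (f y * g y))"
proof (rule integrableI_bounded)
 note [measurable] = Lpm_ext0[OF f] Lpm_ext0[OF g]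
 have "(\<lambda>y. of_real (weight y) * (f y * g y)) = (\<lambda>y. of_real (weight y) * (ext0 f y * ext0 g y))"
  by (auto simp: ext0_def indicator_def)
 then show "(\<lambda>y. of_real (weight y) * (f y * g y)) \<in> borel_measurable lborel" by simp
 have "(nnint_R (\<lambda>y. norm (of_real (weight y) * (f y * g y)))) = (nnint_R (\<lambda>y. weight y * (norm (f y) * norm (g y))))"
  by (intro nn_integral_cong) (auto simp: norm_mult indicator_def)
 also have "\<dots> \<le> ennreal (1 powr (- p)) * power_norm m p f + ennreal (1 powr q) * power_norm m_dual q g"
  using f g by (intro pairing_le_scaled) (auto simp: Lpm_iff)
 also have "\<dots> < \<infinity>" using f g by (simp add: Lpm_iff)
 finally show "(nnint_R (\<lambda>y. norm (of_real (weight y) * (f y * g y)))) < \<infinity>" .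
qed

lemma pairing_norm_le:
 assumes f: "f \<in> L" and g: "g \<in> Lpm m_dual q" and l: "0 < l"
 shows "ennreal (norm (pairing f g)) \<le> ennreal (l powr (- p)) * power_norm m p f + ennreal (l powr q) * power_norm m_dual q g"
proof -
 have "ennreal (norm (pairing f g)) \<le> (\<integral>\<^sup>+y. norm (of_real (weight y) * (f y * g y)) \<partial>lborel)"
  unfolding pairing_def by (rule integral_norm_bound_ennreal[OF pairing_integrable[OF f g]])
 also have "\<dots> = (nnint_R (\<lambda>y. weight y * (norm (f y) * norm (g y))))"
  by (intro nn_integral_cong) (auto simp: norm_mult indicator_def)
 finally show ?thesis using pairing_le_scaled[of f g l] f g l by (auto simp: Lpm_iff intro: order_trans)
qed

lemma ennreal_norm_tendsto_0I:
 fixes z :: "'a \<Rightarrow> complex"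
 assumes "\<And>e::real. 0 < e \<Longrightarrow> \<forall>\<^sub>F t in F. ennreal (norm (z t)) \<le> ennreal e"
 shows "(z \<longlongrightarrow> 0) F"
proof (rule tendstoI)
 fix e :: real assume e: "0 < e"
 then have "\<forall>\<^sub>F t in F. ennreal (norm (z t)) \<le> ennreal (e / 2)" by (intro assms) simp
 then show "\<forall>\<^sub>F t in F. dist (z t) 0 < e"
  by eventually_elim (use e in \<open>simp add: ennreal_le_iff\<close>)
qed

lemma scaled_le:
 assumes "x \<le> ennreal (e / (2 * a))" "0 < a" "0 < e"
 shows "ennreal a * x \<le> ennreal (e / 2)"
proof -
 have "ennreal a * x \<le> ennreal a * ennreal (e / (2 * a))" using assms by (intro mult_left_mono) auto
 also have "\<dots> = ennreal (a * (e / (2 * a)))" using assms by (intro ennreal_mult'[symmetric]) simp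
 finally show ?thesis using assms by simp
qed

lemma pairing_tendsto_left:
 assumes F: "\<forall>\<^sub>F t in F. f t \<in> L" and lim: "((\<lambda>t. N (f t)) \<longlongrightarrow> 0) F" and g: "g \<in> Lpm m_dual q"
 shows "((\<lambda>t. pairing (f t) g) \<longlongrightarrow> 0) F"
proof (rule ennreal_norm_tendsto_0I)
 fix e :: real assume e: "0 < e"
 obtain n where n: "power_norm m_dual q g = ennreal n" "0 \<le> n"
  using g by (cases "power_norm m_dual q g") (auto simp: Lpm_iff)
 \<comment> \<open>With this scale the term of the fixed function g is at most e / 2. The summand 1
   in the denominator covers the case in which g is 0.\<close>
 define l where "l = (e / (2 * (n + 1))) powr (1 / q)"
 have l: "0 < l" using e n by (simp add: l_def)
 have lq: "l powr q = e / (2 * (n + 1))" using e n q_bounds by (simp add: l_def powr_powr)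
 have "e / (2 * (n + 1)) * n \<le> e / 2" using e n by (simp add: field_simps)
 then have "ennreal (l powr q * n) \<le> ennreal (e / 2)" unfolding lq by (rule ennreal_leI)
 moreover have "ennreal (l powr q * n) = ennreal (l powr q) * ennreal n" by (rule ennreal_mult') simp
 ultimately have 1: "ennreal (l powr q) * power_norm m_dual q g \<le> ennreal (e / 2)" unfolding n by simp
 have "\<forall>\<^sub>F t in F. N (f t) \<le> ennreal (e / (2 * (l powr (- p))))"
  using e l by (intro ennreal_tendsto_0D lim) auto
 with F show "\<forall>\<^sub>F t in F. ennreal (norm (pairing (f t) g)) \<le> ennreal e"
 proof eventually_elim
  case (elim t)
  have "ennreal (l powr (- p)) * N (f t) \<le> ennreal (e / 2)" using elim l e by (intro scaled_le) auto
  then have "ennreal (norm (pairing (f t) g)) \<le> ennreal (e / 2) + ennreal (e / 2)"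
   using pairing_norm_le[OF elim(1) g l] 1 by (meson add_mono order_trans)
  also have "\<dots> = ennreal e" using e by (simp add: ennreal_plus[symmetric] del: ennreal_plus)
  finally show ?case .
 qed
qed

lemma pairing_tendsto_right:
 assumes F: "\<forall>\<^sub>F t in F. g t \<in> Lpm m_dual q" and lim: "((\<lambda>t. power_norm m_dual q (g t)) \<longlongrightarrow> 0) F" and f: "f \<in> L"
 shows "((\<lambda>t. pairing f (g t)) \<longlongrightarrow> 0) F"
proof (rule ennreal_norm_tendsto_0I)
 fix e :: real assume e: "0 < e"
 obtain n where n: "N f = ennreal n" "0 \<le> n"
  using f by (cases "N f") (auto simp: Lpm_iff)
 define l where "l = (e / (2 * (n + 1))) powr (- (1 / p))"
 have l: "0 < l" using e n by (simp add: l_def)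
 have lq: "l powr (- p) = e / (2 * (n + 1))" using e n p by (simp add: l_def powr_powr)
 have "e / (2 * (n + 1)) * n \<le> e / 2" using e n by (simp add: field_simps)
 then have "ennreal (l powr (- p) * n) \<le> ennreal (e / 2)" unfolding lq by (rule ennreal_leI)
 moreover have "ennreal (l powr (- p) * n) = ennreal (l powr (- p)) * ennreal n" by (rule ennreal_mult') simp
 ultimately have 1: "ennreal (l powr (- p)) * N f \<le> ennreal (e / 2)" unfolding n by simp
 have "\<forall>\<^sub>F t in F. power_norm m_dual q (g t) \<le> ennreal (e / (2 * (l powr q)))"
  using e l by (intro ennreal_tendsto_0D lim) auto
 with F show "\<forall>\<^sub>F t in F. ennreal (norm (pairing f (g t))) \<le> ennreal e"
 proof eventually_elim
  case (elim t)
  have "ennreal (l powr q) * power_norm m_dual q (g t) \<le> ennreal (e / 2)" using elim l e by (intro scaled_le) auto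
  then have "ennreal (norm (pairing f (g t))) \<le> ennreal (e / 2) + ennreal (e / 2)"
   using pairing_norm_le[OF f elim(1) l] 1 by (meson add_mono order_trans)
  also have "\<dots> = ennreal e" using e by (simp add: ennreal_plus[symmetric] del: ennreal_plus)
  finally show ?case .
 qed
qed

lemma pairing_linear:
 assumes "f \<in> L" "f' \<in> L" "g \<in> Lpm m_dual q" "g' \<in> Lpm m_dual q"
 shows "pairing (\<lambda>y. f y - f' y) g = pairing f g - pairing f' g" "pairing f (\<lambda>y. g y - g' y) = pairing f g - pairing f g'"
  and "pairing (\<lambda>y. f y / k) g = pairing f g / k" "pairing f (\<lambda>y. g y / k) = pairing f g / k"
proof -
 show "pairing (\<lambda>y. f y - f' y) g = pairing f g - pairing f' g"
  unfolding pairing_def left_diff_distrib right_diff_distrib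
  by (rule Bochner_Integration.integral_diff[OF pairing_integrable pairing_integrable]) (use assms in auto)
 show "pairing f (\<lambda>y. g y - g' y) = pairing f g - pairing f g'"
  unfolding pairing_def left_diff_distrib right_diff_distrib
  by (rule Bochner_Integration.integral_diff[OF pairing_integrable pairing_integrable]) (use assms in auto)
 show "pairing (\<lambda>y. f y / k) g = pairing f g / k" "pairing f (\<lambda>y. g y / k) = pairing f g / k"
  unfolding pairing_def by (simp_all add: mult.assoc)
qed

lemma norm_in_L: "f \<in> L \<Longrightarrow> (\<lambda>y. complex_of_real (norm (f y))) \<in> L"
proof (rule Lpm_bound)
 assume f: "f \<in> L"
 note [measurable] = Lpm_ext0[OF f]
 have "ext0 (\<lambda>y. complex_of_real (norm (f y))) = (\<lambda>y. complex_of_real (norm (ext0 f y)))"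
  by (auto simp: ext0_def)
 then show "hl_measurable (\<lambda>y. complex_of_real (norm (f y)))" by (simp add: hl_measurable_iff)
qed (use m_bounds in auto)

text \<open>Fubini's theorem and \<open>dkernel_swap\<close>. Absolute integrability of the double
  integral comes from the same pairing with the modulus of f, which lies in the space.\<close>

lemma pairing_symmetric:
 assumes f: "f \<in> L" and g: "g \<in> Lpm m_dual q" and t: "0 < t"
 shows "pairing (T t f) g = pairing f (T t g)"
proof -
 let ?I = "\<lambda>y. LINT r|lborel. indicator {0<..} r * dkernel \<nu> t y r * norm (f r)"
 note [measurable] = Lpm_ext0[OF f] Lpm_ext0[OF g]
 define H where "H y r = of_real (weight y * (indicator {0<..} r * dkernel \<nu> t y r)) * (ext0 f r * ext0 g y)" for y r
 have nf: "(\<lambda>y. complex_of_real (norm (f y))) \<in> L" by (rule norm_in_L[OF f])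
 have Tn: "norm (T t (\<lambda>y. of_real (norm (f y))) y) = (?I y)"
  if y: "0 < y" for y
 proof -
  have "T t (\<lambda>y. of_real (norm (f y))) y = of_real (?I y)"
   unfolding dirichlet_semigroup_def integral_complex_of_real[symmetric] by simp
  moreover have "0 \<le> (?I y)"
   using less_imp_le[OF dkernel_pos[OF m_bounds(5) t y]]
   by (intro Bochner_Integration.integral_nonneg) (auto simp: indicator_def)
  ultimately show ?thesis by simp
 qed
 have iH: "integrable (lborel \<Otimes>\<^sub>M lborel) (\<lambda>(y, r). H y r)"
 proof (rule lborel_pair.Fubini_integrable)
  show "(\<lambda>(y, r). H y r) \<in> borel_measurable (lborel \<Otimes>\<^sub>M lborel)" unfolding H_def by measurable
  have "integrable lborel (\<lambda>y. norm (of_real (weight y) * (T t (\<lambda>y. of_real (norm (f y))) y * g y)))"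
   by (intro integrable_norm pairing_integrable T_in_L nf t g)
  moreover have "norm (of_real (weight y) * (T t (\<lambda>y. of_real (norm (f y))) y * g y)) = (LINT r|lborel. norm (H y r))" for y
  proof (cases "0 < y")
   case True
   have "(LINT r|lborel. norm (H y r)) = (LINT r|lborel. (y powr (1 - 2 * \<nu>) * norm (g y)) * (indicator {0<..} r * dkernel \<nu> t y r * norm (f r)))"
    using True less_imp_le[OF dkernel_pos[OF m_bounds(5) t True]]
    by (intro Bochner_Integration.integral_cong) (auto simp: H_def norm_mult ext0_def indicator_def)
   also have "\<dots> = (y powr (1 - 2 * \<nu>) * norm (g y)) * (?I y)"
    by (rule integral_mult_right_zero)
   finally show ?thesis using True by (simp add: norm_mult Tn)
  qed (simp add: H_def)
  ultimately show "integrable lborel (\<lambda>y. LINT r|lborel. norm (case (y, r) of (y, r) \<Rightarrow> H y r))" by simp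
  show "AE y in lborel. integrable lborel (\<lambda>r. case (y, r) of (y, r) \<Rightarrow> H y r)"
  proof (rule AE_I2)
   fix y :: real
   show "integrable lborel (\<lambda>r. case (y, r) of (y, r) \<Rightarrow> H y r)"
   proof (cases "0 < y")
    case True
    have "integrable lborel (\<lambda>r. (of_real (y powr (1 - 2 * \<nu>)) * g y) * (of_real (indicator {0<..} r * dkernel \<nu> t y r) * f r))"
     by (intro integrable_mult_right T_integrable f t True)
    moreover have "(\<lambda>r. (of_real (y powr (1 - 2 * \<nu>)) * g y) * (of_real (indicator {0<..} r * dkernel \<nu> t y r) * f r)) = (\<lambda>r. H y r)"
     using True by (auto simp: H_def ext0_def indicator_def)
    ultimately show ?thesis by simp
   qed (simp add: H_def)
  qed
 qed
 have 1: "(LINT r|lborel. H y r) = of_real (weight y) * (T t f y * g y)" for y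
 proof (cases "0 < y")
  case True
  have "(LINT r|lborel. H y r) = (LINT r|lborel. (of_real (weight y) * g y) * (of_real (indicator {0<..} r * dkernel \<nu> t y r) * f r))"
   using True by (intro Bochner_Integration.integral_cong) (auto simp: H_def ext0_def indicator_def)
  also have "\<dots> = (of_real (weight y) * g y) * T t f y"
   unfolding dirichlet_semigroup_def by (rule integral_mult_right_zero)
  finally show ?thesis by simp
 qed (simp add: H_def)
 have 2: "(LINT y|lborel. H y r) = of_real (weight r) * (f r * T t g r)" for r
 proof (cases "0 < r")
  case True
  have "(LINT y|lborel. H y r) = (LINT y|lborel. (of_real (weight r) * f r) * (of_real (indicator {0<..} y * dkernel \<nu> t r y) * g y))"
  proof (rule Bochner_Integration.integral_cong[OF refl])
   fix y :: real
   show "H y r = (of_real (weight r) * f r) * (of_real (indicator {0<..} y * dkernel \<nu> t r y) * g y)"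
   proof (cases "0 < y")
    case y: True
    have "y powr (1 - 2 * \<nu>) * dkernel \<nu> t y r = r powr (1 - 2 * \<nu>) * dkernel \<nu> t r y * (y powr (2 * \<nu> - 1) * y powr (1 - 2 * \<nu>))"
     unfolding dkernel_swap[OF y True] by (simp only: mult_ac)
    also have "y powr (2 * \<nu> - 1) * y powr (1 - 2 * \<nu>) = 1" using y by (simp add: powr_add[symmetric])
    finally have "complex_of_real (y powr (1 - 2 * \<nu>) * dkernel \<nu> t y r) = of_real (r powr (1 - 2 * \<nu>) * dkernel \<nu> t r y)" by simp
    then have "complex_of_real (y powr (1 - 2 * \<nu>)) * of_real (dkernel \<nu> t y r) = of_real (r powr (1 - 2 * \<nu>)) * of_real (dkernel \<nu> t r y)" by simp
    then show ?thesis using y True by (simp add: H_def ext0_def)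
   qed (simp add: H_def)
  qed
  also have "\<dots> = (of_real (weight r) * f r) * T t g r"
   unfolding dirichlet_semigroup_def by (rule integral_mult_right_zero)
  finally show ?thesis by simp
 qed (simp add: H_def)
 show ?thesis unfolding pairing_def using lborel_pair.Fubini_integral[OF iH] by (simp add: 1 2)
qed

text \<open>By \<open>generator_tendsto\<close> in the dual space the difference quotients of \<psi>
  converge to \<eta>. By symmetry the two paired difference quotients agree up to a quantity that
  does not depend on t; it must therefore be 0.\<close>

lemma pairing_generator:
 assumes u: "u \<in> L" and v: "v \<in> L" and lim: "((\<lambda>t. N (\<lambda>y. (T t u y - u y) / of_real t - v y)) \<longlongrightarrow> 0) (at_right 0)"
  and sol: "bessel_solution (1 - 2 * \<nu>) \<psi> \<psi>1 \<eta>" and \<eta>: "\<eta> \<in> Lpm m_dual q" and \<psi>: "\<psi> \<in> Lpm m_dual q"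
  and \<psi>0: "(\<psi> \<longlongrightarrow> 0) (at_right 0)"
 shows "pairing v \<psi> = pairing u \<eta>"
proof -
 let ?Q = "\<lambda>t. \<lambda>y. (T t u y - u y) / of_real t - v y"
 let ?\<Psi> = "\<lambda>t. \<lambda>y. (T t \<psi> y - \<psi> y) / of_real t - \<eta> y"
 interpret dual: bessel_Lp q \<nu> m_dual by (rule dual_bessel_Lp)
 note lim' = dual.generator_tendsto[OF sol \<eta> \<psi> \<psi>0]
 have pos: "\<forall>\<^sub>F t in at_right (0::real). 0 < t" by (simp add: eventually_at_right_less)
 have uq: "(\<lambda>y. (T t u y - u y) / of_real t) \<in> L" if "0 < t" for t
  using Lpm_cmult[OF Lpm_diff[OF T_in_L[OF u that] u m_bounds(4)], of "inverse (of_real t)"] by (simp add: field_simps)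
 have \<psi>q: "(\<lambda>y. (T t \<psi> y - \<psi> y) / of_real t) \<in> Lpm m_dual q" if "0 < t" for t
  using Lpm_cmult[OF Lpm_diff[OF dual.T_in_L[OF \<psi> that] \<psi> dual.m_bounds(4)], of "inverse (of_real t)"] by (simp add: field_simps)
 have 1: "((\<lambda>t. pairing (?Q t) \<psi>) \<longlongrightarrow> 0) (at_right 0)"
  by (rule pairing_tendsto_left[OF _ lim \<psi>]) (use pos in \<open>auto elim!: eventually_mono intro!: Lpm_diff uq v m_bounds\<close>)
 have 2: "((\<lambda>t. pairing u (?\<Psi> t)) \<longlongrightarrow> 0) (at_right 0)"
  by (rule pairing_tendsto_right[OF _ lim' u]) (use pos in \<open>auto elim!: eventually_mono intro!: Lpm_diff \<psi>q \<eta> dual.m_bounds\<close>)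
 have eq: "pairing (?Q t) \<psi> - pairing u (?\<Psi> t) = pairing u \<eta> - pairing v \<psi>"
  if t: "0 < t" for t
 proof -
  note Tu = T_in_L[OF u t] and T\<psi> = dual.T_in_L[OF \<psi> t]
  note du = Lpm_diff[OF Tu u m_bounds(4)] and d\<psi> = Lpm_diff[OF T\<psi> \<psi> dual.m_bounds(4)]
  have "pairing (?Q t) \<psi> = (pairing (T t u) \<psi> - pairing u \<psi>) / of_real t - pairing v \<psi>"
   by (simp only: pairing_linear(1)[OF uq[OF t] v \<psi> \<psi>] pairing_linear(3)[OF du u \<psi> \<psi>] pairing_linear(1)[OF Tu u \<psi> \<psi>])
  moreover have "pairing u (?\<Psi> t) = (pairing u (T t \<psi>) - pairing u \<psi>) / of_real t - pairing u \<eta>"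
   by (simp only: pairing_linear(2)[OF u u \<psi>q[OF t] \<eta>] pairing_linear(4)[OF u u d\<psi> \<psi>] pairing_linear(2)[OF u u T\<psi> \<psi>])
  ultimately show ?thesis using pairing_symmetric[OF u \<psi> t] by simp
 qed
 have "((\<lambda>t. pairing (?Q t) \<psi> - pairing u (?\<Psi> t)) \<longlongrightarrow> 0 - 0) (at_right 0)"
  by (intro tendsto_diff 1 2)
 moreover have "\<forall>\<^sub>F t in at_right 0. pairing (?Q t) \<psi> - pairing u (?\<Psi> t) = pairing u \<eta> - pairing v \<psi>"
  using pos by eventually_elim (rule eq)
 ultimately have "((\<lambda>t. pairing u \<eta> - pairing v \<psi>) \<longlongrightarrow> 0) (at_right (0::real))"
  by (simp add: tendsto_cong)
 then have "pairing u \<eta> - pairing v \<psi> = 0" by (simp add: tendsto_const_iff trivial_limit_at_right_real)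
 then show ?thesis by simp
qed

end

section \<open>Construction of solutions and functions that vanish almost everywhere\<close>

lemma of_real_powr_cancel:
 fixes z :: complex
 assumes "0 < y"
 shows "of_real (y powr c) * (of_real (y powr (- c)) * z) = z" "of_real (y powr (- c)) * (of_real (y powr c) * z) = z"
proof -
 have "y powr c * y powr (- c) = 1" "y powr (- c) * y powr c = 1" using assms by (simp_all add: powr_add[symmetric])
 then show "of_real (y powr c) * (of_real (y powr (- c)) * z) = z" "of_real (y powr (- c)) * (of_real (y powr c) * z) = z"
  by (metis mult.assoc mult_1 of_real_1 of_real_mult)+
qed

lemma set_integrable_continuous_mult:
 fixes f g :: "real \<Rightarrow> complex"
 assumes f: "set_integrable lborel {a..b} f" and g: "continuous_on {a..b} g"
 shows "set_integrable lborel {a..b} (\<lambda>x. g x * f x)"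
proof -
 obtain B where B: "\<And>x. x \<in> {a..b} \<Longrightarrow> norm (g x) \<le> B"
  using compact_imp_bounded[OF compact_continuous_image[OF g compact_Icc]] unfolding bounded_iff by blast
 have g': "(\<lambda>x. indicator {a..b} x *\<^sub>R g x) \<in> borel_measurable borel"
  using borel_measurable_continuous_on_indicator[OF _ g] by simp
 have f': "integrable lborel (\<lambda>x. indicator {a..b} x *\<^sub>R f x)" using f by (simp add: set_integrable_def)
 have eq: "(\<lambda>x. indicator {a..b} x *\<^sub>R (g x * f x)) = (\<lambda>x. (indicator {a..b} x *\<^sub>R g x) * (indicator {a..b} x *\<^sub>R f x))"
  by (auto simp: indicator_def)
 show ?thesis
  unfolding set_integrable_def
 proof (rule Bochner_Integration.integrable_bound[OF integrable_mult_right[OF integrable_norm[OF f'], of B]])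
  show "(\<lambda>x. indicator {a..b} x *\<^sub>R (g x * f x)) \<in> borel_measurable lborel"
   unfolding eq using g' f'[THEN borel_measurable_integrable] by (intro borel_measurable_times) simp_all
  have "norm (g x) * norm (f x) \<le> \<bar>B * norm (f x)\<bar>" if "x \<in> {a..b}" for x
   using mult_right_mono[OF B[OF that] norm_ge_zero[of "f x"]] by linarith
  then show "AE x in lborel. norm (indicator {a..b} x *\<^sub>R (g x * f x)) \<le> norm (B * norm (indicator {a..b} x *\<^sub>R f x))"
   by (intro AE_I2) (auto simp: indicator_def norm_mult)
 qed
qed

lemma bessel_solution_add_const:
 "bessel_solution c U U1 f \<Longrightarrow> bessel_solution c (\<lambda>y. U y + k) U1 f"
 unfolding bessel_solution_def by (auto intro: primitive_add_const)

text \<open>The power \<open>y powr (2 * \<nu>)\<close> is a homogeneous solution: y^c times its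
  derivative is the constant 2 \<nu>.\<close>

lemma bessel_solution_add_powr:
 assumes s: "bessel_solution (1 - 2 * \<nu>) U U1 f"
 shows "bessel_solution (1 - 2 * \<nu>) (\<lambda>y. U y + k * of_real (y powr (2 * \<nu>)))
  (\<lambda>y. U1 y + k * of_real (2 * \<nu> * y powr (2 * \<nu> - 1))) f"
proof -
 let ?q = "\<lambda>y. 2 * \<nu> * y powr (2 * \<nu> - 1)"
 note P = s[unfolded bessel_solution_def]
 have c: "primitive (\<lambda>_. k) (\<lambda>_. 0)" by (simp add: primitive_def set_integrable_def set_lebesgue_integral_def)
 have 1: "primitive (\<lambda>y. k * of_real (y powr (2 * \<nu>))) (\<lambda>y. k * of_real (?q y))"
  by (rule primitive_cong[OF primitive_mult[OF c primitive_powr[of "2 * \<nu>"]]]) simp_all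
 have eq: "of_real (y powr (1 - 2 * \<nu>)) * (U1 y + k * of_real (?q y)) = of_real (y powr (1 - 2 * \<nu>)) * U1 y + k * of_real (2 * \<nu>)"
  if "0 < y" for y
 proof -
  have "y powr (1 - 2 * \<nu>) * (?q y) = 2 * \<nu>"
   using that by (simp add: powr_add[symmetric] mult.left_commute)
  then have "of_real (y powr (1 - 2 * \<nu>)) * (k * of_real (?q y)) = k * of_real (2 * \<nu>)"
   by (metis (no_types) mult.left_commute of_real_mult)
  then show ?thesis by (simp only: distrib_left)
 qed
 show ?thesis
  unfolding bessel_solution_def
 proof
  show "primitive (\<lambda>y. U y + k * of_real (y powr (2 * \<nu>))) (\<lambda>y. U1 y + k * of_real (?q y))"
   using P by (intro primitive_add 1) auto
  show "primitive (\<lambda>y. of_real (y powr (1 - 2 * \<nu>)) * (U1 y + k * of_real (?q y))) (\<lambda>y. of_real (y powr (1 - 2 * \<nu>)) * f y)"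
   by (rule primitive_cong[OF primitive_add_const[OF conjunct2[OF P], of "k * of_real (2 * \<nu>)"]]) (simp_all only: eq)
 qed
qed

lemma bessel_solution_exists:
 assumes f: "\<And>a b. 0 < a \<Longrightarrow> a \<le> b \<Longrightarrow> set_integrable lborel {a..b} f"
 obtains U U1 where "bessel_solution c U U1 f"
proof -
 have "set_integrable lborel {a..b} (\<lambda>y. of_real (y powr c) * f y)" if "0 < a" "a \<le> b" for a b
  using that by (intro set_integrable_continuous_mult f continuous_intros) auto
 then obtain P where P: "primitive P (\<lambda>y. of_real (y powr c) * f y)"
  by (rule primitive_exists) blast+
 define U1 where "U1 y = of_real (y powr (- c)) * P y" for y
 have "continuous_on {0<..} U1"
  unfolding U1_def by (intro continuous_intros primitive_continuous_on[OF P]) auto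
 then have "set_integrable lborel {a..b} U1" if "0 < a" "a \<le> b" for a b
  using that by (intro borel_integrable_atLeastAtMost') (auto elim: continuous_on_subset)
 then obtain U where U: "primitive U U1" by (rule primitive_exists) blast+
 have "bessel_solution c U U1 f"
  unfolding bessel_solution_def using U
  by (auto simp: U1_def of_real_powr_cancel intro: primitive_cong[OF P])
 then show ?thesis by (rule that)
qed

text \<open>The positive and the negative part of h are densities of two measures that are finite
  and equal on all half-lines, hence equal; so the densities agree almost everywhere, and both parts
  cannot be positive at the same point.\<close>

lemma AE_zero_of_tails:
 fixes h :: "real \<Rightarrow> real"
 assumes h: "integrable lborel h" and z: "\<And>x. (LINT y:{x<..}|lborel. h y) = 0"
 shows "AE y in lborel. h y = 0"
proof -
 note [measurable] = borel_measurable_integrable[OF h]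
 define f where "f y = ennreal (h y)" for y
 define g where "g y = ennreal (- h y)" for y
 let ?G = "\<lambda>x. \<integral>\<^sup>+y. g y * indicator {x<..} y \<partial>lborel"
 let ?F = "\<lambda>x. \<integral>\<^sup>+y. f y * indicator {x<..} y \<partial>lborel"
 have [measurable]: "f \<in> borel_measurable borel" "g \<in> borel_measurable borel" unfolding f_def g_def by measurable
 have F: "(?F x) < \<infinity>" "(?G x) < \<infinity>"
  and eq: "(?F x) = (?G x)" for x
 proof -
  let ?k = "\<lambda>y. indicator {x<..} y *\<^sub>R h y"
  have k: "integrable lborel ?k" by (intro integrable_mult_indicator h) simp
  have e: "(?F x) = (nnint_R (\<lambda>y. ?k y))"
   "(?G x) = (nnint_R (\<lambda>y. - ?k y))"
   by (auto simp: f_def g_def indicator_def intro!: nn_integral_cong)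
  have fin: "(nnint_R (\<lambda>y. ?k y)) \<noteq> \<infinity>" "(nnint_R (\<lambda>y. - ?k y)) \<noteq> \<infinity>"
   using k by (auto simp: real_integrable_def)
  then show "(?F x) < \<infinity>" "(?G x) < \<infinity>"
   unfolding e by (simp_all add: less_top)
  have "enn2real (nnint_R (\<lambda>y. ?k y)) = enn2real (nnint_R (\<lambda>y. - ?k y))"
   using z[of x] real_lebesgue_integral_def[OF k] by (simp add: set_lebesgue_integral_def)
  with fin show "(?F x) = (?G x)"
   unfolding e by (cases "\<integral>\<^sup>+y. ennreal (?k y) \<partial>lborel"; cases "\<integral>\<^sup>+y. ennreal (- ?k y) \<partial>lborel") auto
 qed
 have "density lborel f = density lborel g"
  by (rule measure_eqI_lessThan) (use F eq in \<open>auto simp: emeasure_density\<close>)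
 then have "AE y in lborel. f y = g y" by (intro sigma_finite_measure.density_unique[OF lborel.sigma_finite_measure_axioms]) simp_all
 then show ?thesis
 proof eventually_elim
  case (elim y)
  then show ?case
   by (cases "0 \<le> h y") (auto simp: f_def g_def ennreal_neg ennreal_eq_0_iff dest: sym)
 qed
qed

text \<open>Truncation to the interval from 1 / (n + 1) to n + 1 makes the function integrable, and
  its tails are integrals over intervals; \<open>AE_zero_of_tails\<close> then applies to the real
  and the imaginary part.\<close>

lemma AE_zero_of_intervals:
 fixes g :: "real \<Rightarrow> complex"
 assumes i: "\<And>a b. 0 < a \<Longrightarrow> a \<le> b \<Longrightarrow> set_integrable lborel {a..b} g"
  and z: "\<And>a b. 0 < a \<Longrightarrow> a \<le> b \<Longrightarrow> (LINT x:{a..b}|lborel. g x) = 0"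
 shows "AE y in lborel. 0 < y \<longrightarrow> g y = 0"
proof -
 have ae: "AE y in lborel. inverse (real (Suc n)) \<le> y \<and> y \<le> real (Suc n) \<longrightarrow> g y = 0" for n
 proof -
  let ?a = "inverse (real (Suc n))" and ?b = "real (Suc n)"
  have "?a \<le> 1" by (simp add: inverse_le_1_iff)
  also have "1 \<le> ?b" by simp
  finally have ab: "0 < ?a" "?a \<le> ?b" by auto
  define h where "h y = indicator {?a..?b} y *\<^sub>R g y" for y
  let ?k = "\<lambda>x. \<lambda>y. indicator {x<..} y *\<^sub>R h y"
  have h: "integrable lborel h" using i[OF ab] by (simp add: h_def[abs_def] set_integrable_def)
  have zero: "(LINT y:{x<..}|lborel. h y) = 0" for x
  proof (cases "x < ?b")
   case True
   have "(LINT y:{x<..}|lborel. h y) = (LINT y:{max x ?a..?b}|lborel. g y)"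
    unfolding set_lebesgue_integral_def
   proof (rule integral_cong_AE)
    have "AE y in lborel. y \<noteq> x" by (rule AE_lborel_singleton)
    then show "AE y in lborel. indicator {x<..} y *\<^sub>R h y = indicator {max x ?a..?b} y *\<^sub>R g y"
     by eventually_elim (auto simp: h_def indicator_def)
    show "(?k x) \<in> borel_measurable lborel" using h by simp
    have "set_integrable lborel {max x ?a..?b} g" using True ab by (intro i less_le_trans[OF ab(1)]) auto
    then show "(\<lambda>y. indicator {max x ?a..?b} y *\<^sub>R g y) \<in> borel_measurable lborel" by (simp add: set_integrable_def)
   qed
   also have "\<dots> = 0" using True ab by (intro z less_le_trans[OF ab(1)]) auto
   finally show ?thesis .
  next
   case False
   then have "(?k x) = (\<lambda>_. 0)" by (auto simp: h_def indicator_def)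
   then show ?thesis by (simp only: set_lebesgue_integral_def) simp
  qed
  have "AE y in lborel. Re (h y) = 0"
  proof (rule AE_zero_of_tails)
   fix x
   have "integrable lborel (?k x)" by (intro integrable_mult_indicator h) simp
   from integral_Re[OF this] have "Re (LINT y:{x<..}|lborel. h y) = (LINT y:{x<..}|lborel. Re (h y))"
    by (simp add: set_lebesgue_integral_def)
   then show "(LINT y:{x<..}|lborel. Re (h y)) = 0" by (simp add: zero)
  qed (use h in simp)
  moreover have "AE y in lborel. Im (h y) = 0"
  proof (rule AE_zero_of_tails)
   fix x
   have "integrable lborel (?k x)" by (intro integrable_mult_indicator h) simp
   from integral_Im[OF this] have "Im (LINT y:{x<..}|lborel. h y) = (LINT y:{x<..}|lborel. Im (h y))"
    by (simp add: set_lebesgue_integral_def)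
   then show "(LINT y:{x<..}|lborel. Im (h y)) = 0" by (simp add: zero)
  qed (use h in simp)
  ultimately show ?thesis
   by eventually_elim (auto simp: h_def indicator_def complex_eq_iff)
 qed
 have "AE y in lborel. \<forall>n. inverse (real (Suc n)) \<le> y \<and> y \<le> real (Suc n) \<longrightarrow> g y = 0"
  unfolding AE_all_countable using ae by blast
 then show ?thesis
 proof eventually_elim
  case (elim y)
  show ?case
  proof
   assume y: "0 < y"
   obtain n where n: "inverse (real (Suc n)) < y" using reals_Archimedean[OF y] by auto
   obtain k where k: "y \<le> real k" using real_arch_simple by blast
   have "inverse (real (Suc (max n k))) \<le> inverse (real (Suc n))" by (intro le_imp_inverse_le) auto
   also have "\<dots> \<le> y" using n by simp
   finally have "inverse (real (Suc (max n k))) \<le> y" "y \<le> real (Suc (max n k))" using k by simp_all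
   then show "g y = 0" using elim[THEN spec, of "max n k"] by blast
  qed
 qed
qed

section \<open>Test solutions and the identification of the domain of the generator\<close>

context bessel_Lp
begin

lemma L_interval_integrable:
 assumes f: "f \<in> L" and ab: "0 < a"
 shows "set_integrable lborel {a..b} f"
 unfolding set_integrable_def
proof (rule Bochner_Integration.integrable_bound[OF integrable_mult_right[OF weighted_integrable[OF f], of "exp b / a"]])
 note [measurable] = Lpm_ext0[OF f]
 have "(\<lambda>x. indicator {a..b} x *\<^sub>R f x) = (\<lambda>x. indicator {a..b} x *\<^sub>R ext0 f x)"
  using ab by (auto simp: indicator_def ext0_def)
 then show "(\<lambda>x. indicator {a..b} x *\<^sub>R f x) \<in> borel_measurable lborel" by simp
 show "AE x in lborel. norm (indicator {a..b} x *\<^sub>R f x) \<le> norm (exp b / a * (indicator {0<..} x * (x * exp (- x) * norm (f x))))"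
 proof (rule AE_I2)
  fix x
  show "norm (indicator {a..b} x *\<^sub>R f x) \<le> norm (exp b / a * (indicator {0<..} x * (x * exp (- x) * norm (f x))))"
  proof (cases "x \<in> {a..b}")
   case True
   have "1 * 1 \<le> (x / a) * exp (b - x)" using True ab by (intro mult_mono) auto
   then have "1 * norm (f x) \<le> (x / a) * exp (b - x) * norm (f x)" by (intro mult_right_mono) auto
   also have "\<dots> = exp b / a * (x * exp (- x) * norm (f x))" by (simp add: exp_diff exp_minus field_simps)
   finally show ?thesis using True ab by (simp add: abs_mult)
  qed simp
 qed
qed

text \<open>Constants solve the homogeneous equation, so the limit at 0 can be subtracted. Nothing
  is asserted about the size of the solution at infinity.\<close>

lemma solution_exists:
 assumes f: "f \<in> L"
 obtains U U1 where "bessel_solution (1 - 2 * \<nu>) U U1 f" "(U \<longlongrightarrow> 0) (at_right 0)"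
proof -
 obtain U U1 where s: "bessel_solution (1 - 2 * \<nu>) U U1 f"
  by (rule bessel_solution_exists[OF L_interval_integrable[OF f]])
 obtain l where l: "(U \<longlongrightarrow> l) (at_right 0)" using solution_limit[OF s f] by blast
 have "bessel_solution (1 - 2 * \<nu>) (\<lambda>y. U y + (- l)) U1 f"
  by (rule bessel_solution_add_const[OF s])
 moreover have "((\<lambda>y. U y + (- l)) \<longlongrightarrow> l + (- l)) (at_right 0)" by (intro tendsto_intros l)
 ultimately show ?thesis using that by simp
qed

text \<open>Two homogeneous solutions are available to make the solution and its derivative vanish
  at \<beta>, hence beyond it. Below \<alpha> it is a constant plus a multiple of r^(2 \<nu>), and
  the condition on the mean of \<eta> removes the constant.\<close>

lemma compactly_supported_solution:
 assumes \<eta>: "hl_measurable \<eta>" and \<alpha>: "0 < \<alpha>" "\<alpha> \<le> 1" "\<alpha> \<le> \<beta>"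
  and supp: "\<And>r. 0 < r \<Longrightarrow> norm (\<eta> r) \<le> K * indicator {\<alpha>..\<beta>} r" and K: "0 \<le> K"
  and mean: "(LINT r:{\<alpha>..\<beta>}|lborel. of_real r * \<eta> r) = 0"
 obtains \<psi> \<psi>1 k where "bessel_solution (1 - 2 * \<nu>) \<psi> \<psi>1 \<eta>" "\<psi> \<in> L" "(\<psi> \<longlongrightarrow> 0) (at_right 0)"
  "\<And>r. 0 < r \<Longrightarrow> r \<le> \<alpha> \<Longrightarrow> \<psi> r = k * of_real (r powr (2 * \<nu>))"
  "\<And>r. 0 < r \<Longrightarrow> r \<le> \<alpha> \<Longrightarrow> of_real (r powr (1 - 2 * \<nu>)) * \<psi>1 r = 2 * of_real \<nu> * k"
  "\<And>r. \<beta> \<le> r \<Longrightarrow> \<psi> r = 0 \<and> \<psi>1 r = 0"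
proof -
 let ?c = "1 - 2 * \<nu>"
 have \<eta>L: "\<eta> \<in> L" by (rule compact_support_in_L[OF \<eta> \<alpha>(1) supp K])
 have \<eta>0: "\<eta> r = 0" if "0 < r" "r < \<alpha> \<or> \<beta> < r" for r using supp[OF that(1)] that(2) by auto
 obtain P P1 where PP: "bessel_solution ?c P P1 \<eta>"
  by (rule bessel_solution_exists[OF L_interval_integrable[OF \<eta>L]])
 then have P: "primitive P P1" "primitive (\<lambda>y. of_real (y powr ?c) * P1 y) (\<lambda>y. of_real (y powr ?c) * \<eta> y)"
  by (auto simp: bessel_solution_def)
 \<comment> \<open>Subtracting j y^(2 \<nu>) makes the derivative vanish at \<beta>; the constant l
   then does the same for the function.\<close>
 define j where "j = of_real (\<beta> powr ?c) * P1 \<beta> / of_real (2 * \<nu>)"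
 define l where "l = P \<beta> - j * of_real (\<beta> powr (2 * \<nu>))"
 define \<psi> where "\<psi> y = (P y + (- j) * of_real (y powr (2 * \<nu>))) + (- l)" for y
 define \<psi>1 where "\<psi>1 y = P1 y + (- j) * of_real (2 * \<nu> * y powr (2 * \<nu> - 1))" for y
 have sol: "bessel_solution ?c \<psi> \<psi>1 \<eta>"
  unfolding \<psi>_def[abs_def] \<psi>1_def[abs_def] by (intro bessel_solution_add_const bessel_solution_add_powr PP)
 then have prim: "primitive \<psi> \<psi>1" "primitive (\<lambda>y. of_real (y powr ?c) * \<psi>1 y) (\<lambda>y. of_real (y powr ?c) * \<eta> y)"
  by (auto simp: bessel_solution_def)
 define \<Phi> where "\<Phi> y = of_real (y powr ?c) * \<psi>1 y" for y
 have \<beta>: "0 < \<beta>" using \<alpha> by simp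
 have \<psi>\<beta>: "\<psi> \<beta> = 0" by (simp add: \<psi>_def l_def)
 have \<Phi>\<beta>: "\<Phi> \<beta> = 0"
 proof -
  have "\<beta> powr ?c * (2 * \<nu> * \<beta> powr (2 * \<nu> - 1)) = 2 * \<nu>" using \<beta> by (simp add: powr_add[symmetric] mult.left_commute)
  then have "of_real (\<beta> powr ?c) * (j * of_real (2 * \<nu> * \<beta> powr (2 * \<nu> - 1))) = j * of_real (2 * \<nu>)"
   by (metis (no_types) mult.left_commute of_real_mult)
  then have "\<Phi> \<beta> = of_real (\<beta> powr ?c) * P1 \<beta> - j * of_real (2 * \<nu>)"
   unfolding \<Phi>_def \<psi>1_def by (simp only: distrib_left mult_minus_left mult_minus_right) simp
  then show ?thesis using \<nu> by (simp add: j_def)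
 qed
 \<comment> \<open>The support bound allows \<eta> to be nonzero at the endpoints \<alpha> and
   \<beta> themselves, which are null sets; measurability is shown by writing out the values at
   these two points.\<close>
 have zero_int: "(LINT x:{a..b}|lborel. g x * \<eta> x) = 0" if "\<beta> \<le> a \<or> b \<le> \<alpha>" "0 < a" for a b and g :: "real \<Rightarrow> complex"
 proof -
  have "(LINT x:{a..b}|lborel. g x * \<eta> x) = (LINT x|(lborel :: real measure). (0::complex))"
   unfolding set_lebesgue_integral_def
  proof (rule integral_cong_AE)
   have z: "AE x in lborel. x \<noteq> \<beta>" "AE x in lborel. x \<noteq> \<alpha>" by (rule AE_lborel_singleton)+
   then show ae: "AE x in lborel. indicator {a..b} x *\<^sub>R (g x * \<eta> x) = 0"
    by eventually_elim (use that \<eta>0 in \<open>auto simp: indicator_def\<close>)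
   have "indicator {a..b} x *\<^sub>R (g x * \<eta> x) = 0" if "x \<notin> {\<alpha>, \<beta>}" for x
    using that \<open>\<beta> \<le> a \<or> b \<le> \<alpha>\<close> \<open>0 < a\<close> \<eta>0[of x] by (auto simp: indicator_def)
   then have "(\<lambda>x. indicator {a..b} x *\<^sub>R (g x * \<eta> x)) =
     (\<lambda>x. indicator {a..b} \<alpha> *\<^sub>R (g \<alpha> * \<eta> \<alpha>) * indicator {\<alpha>} x + (if \<alpha> = \<beta> then 0 else indicator {a..b} \<beta> *\<^sub>R (g \<beta> * \<eta> \<beta>) * indicator {\<beta>} x))"
    by (intro ext) (auto simp: indicator_def)
   then show "(\<lambda>x. indicator {a..b} x *\<^sub>R (g x * \<eta> x)) \<in> borel_measurable lborel"
    by (simp only:) measurable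
  qed simp
  then show ?thesis by simp
 qed
 have \<Phi>c: "\<Phi> r = \<Phi> \<alpha>" if "0 < r" "r \<le> \<alpha>" for r
  using primitiveD(2)[OF prim(2) that] zero_int[of r \<alpha>] that by (simp add: \<Phi>_def)
 have \<psi>1_eq: "\<psi>1 y = of_real (y powr (- ?c)) * \<Phi> y" if "0 < y" for y
  unfolding \<Phi>_def by (rule of_real_powr_cancel(2)[OF that, symmetric])
 have \<Phi>r: "\<Phi> r = 0" if "\<beta> \<le> r" for r
  using primitiveD(2)[OF prim(2) \<beta> that] zero_int[of \<beta> r] that \<beta> \<Phi>\<beta> by (simp add: \<Phi>_def)
 have \<psi>1r: "\<psi>1 r = 0" if "\<beta> \<le> r" for r
  using \<psi>1_eq[of r] \<Phi>r[OF that] that \<beta> by simp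
 have \<psi>r: "\<psi> r = 0" if "\<beta> \<le> r" for r
 proof -
  have "(LINT x:{\<beta>..r}|lborel. \<psi>1 x) = (LINT x:{\<beta>..r}|lborel. 0)"
   by (intro set_lebesgue_integral_cong) (auto simp: \<psi>1r)
  also have "\<dots> = 0" by (simp add: set_lebesgue_integral_def)
  finally show ?thesis using primitiveD(2)[OF prim(1) \<beta> that] \<psi>\<beta> by simp
 qed
 \<comment> \<open>This combination annihilates r^(2 \<nu>) and so isolates the constant part of
   \<psi> below \<alpha>. Its density is r \<eta>, and it vanishes at \<beta>, which is how the mean
   of \<eta> determines that constant.\<close>
 have ident: "primitive (\<lambda>y. of_real (y powr (2 * \<nu>)) * \<Phi> y - of_real (2 * \<nu>) * \<psi> y) (\<lambda>y. of_real y * \<eta> y)"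
 proof -
  have c: "primitive (\<lambda>_. k) (\<lambda>_. 0)" for k by (simp add: primitive_def set_integrable_def set_lebesgue_integral_def)
  show ?thesis
   unfolding \<Phi>_def
  proof (rule primitive_cong[OF primitive_diff[OF primitive_mult[OF primitive_powr[of "2 * \<nu>"] prim(2)]
      primitive_mult[OF c[of "of_real (2 * \<nu>)"] prim(1)]] refl])
   fix y :: real assume y: "0 < y"
   have 1: "of_real (y powr (2 * \<nu>)) * (of_real (y powr ?c) * \<eta> y) = of_real y * \<eta> y"
   proof -
    have "y powr (2 * \<nu>) * y powr ?c = y" using y by (simp add: powr_add[symmetric])
    then show ?thesis by (metis mult.assoc of_real_mult)
   qed
   have 2: "of_real (2 * \<nu> * y powr (2 * \<nu> - 1)) * (of_real (y powr ?c) * \<psi>1 y) = of_real (2 * \<nu>) * \<psi>1 y"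
    using of_real_powr_cancel(2)[OF y, of ?c "\<psi>1 y"] by (simp add: mult.assoc)
   show "of_real (y powr (2 * \<nu>)) * (of_real (y powr ?c) * \<eta> y) + of_real (2 * \<nu> * y powr (2 * \<nu> - 1)) * (of_real (y powr ?c) * \<psi>1 y)
     - (of_real (2 * \<nu>) * \<psi>1 y + 0 * \<psi> y) = of_real y * \<eta> y"
    unfolding 1 2 by simp
  qed
 qed
 define k where "k = \<Phi> \<alpha> / of_real (2 * \<nu>)"
 have at\<alpha>: "of_real (\<alpha> powr (2 * \<nu>)) * \<Phi> \<alpha> - of_real (2 * \<nu>) * \<psi> \<alpha> = 0"
  using primitiveD(2)[OF ident \<alpha>(1,3)] mean \<Phi>\<beta> \<psi>\<beta> by simp
 have \<psi>l: "\<psi> r = k * of_real (r powr (2 * \<nu>))" if r: "0 < r" "r \<le> \<alpha>" for r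
 proof -
  have "of_real (r powr (2 * \<nu>)) * \<Phi> r - of_real (2 * \<nu>) * \<psi> r = 0"
   using primitiveD(2)[OF ident r] at\<alpha> zero_int[of r \<alpha> of_real] r by simp
  then have "of_real (2 * \<nu>) * \<psi> r = of_real (r powr (2 * \<nu>)) * \<Phi> \<alpha>" using \<Phi>c[OF r] by simp
  then show ?thesis using \<nu> by (simp add: k_def field_simps)
 qed
 have lim: "(\<psi> \<longlongrightarrow> 0) (at_right 0)"
 proof -
  have "((\<lambda>r. r powr (2 * \<nu>)) \<longlongrightarrow> 0) (at_right (0::real))" using \<nu> by real_asymp
  then have "((\<lambda>r. k * of_real (r powr (2 * \<nu>))) \<longlongrightarrow> k * of_real 0) (at_right 0)" by (intro tendsto_intros)
  moreover have "\<forall>\<^sub>F r in at_right 0. k * of_real (r powr (2 * \<nu>)) = \<psi> r"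
   unfolding eventually_at_right_field by (intro exI[of _ \<alpha>]) (use \<alpha> \<psi>l in auto)
  ultimately show ?thesis by (simp add: tendsto_cong)
 qed
 have "continuous_on {\<alpha>..\<beta>} \<psi>"
  using \<alpha> by (intro continuous_on_subset[OF bessel_solution_continuous(1)[OF sol]]) auto
 from compact_imp_bounded[OF compact_continuous_image[OF this compact_Icc]]
 obtain B where B: "\<And>r. r \<in> {\<alpha>..\<beta>} \<Longrightarrow> norm (\<psi> r) \<le> B" unfolding bounded_iff by blast
 have \<psi>m: "hl_measurable \<psi>" by (rule bessel_solution_measurable[OF sol])
 have "\<psi> \<in> L"
 proof (rule Lpm_bound2)
  define a where "a = - (m + 2) / p"
  have a: "m + a * p < -1" using p by (simp add: a_def)
  show "(\<lambda>y. of_real (norm k * barrier a y)) \<in> L" by (rule barrier_in_L[OF a])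
  show "(\<lambda>y. of_real (indicator {\<alpha>..\<beta>} y) * \<psi> y) \<in> L"
  proof (rule compact_support_in_L[OF _ \<alpha>(1)])
   show "hl_measurable (\<lambda>y. of_real (indicator {\<alpha>..\<beta>} y) * \<psi> y)"
    by (rule hl_measurable_mult_left[OF \<psi>m]) measurable
   show "norm (of_real (indicator {\<alpha>..\<beta>} r) * \<psi> r) \<le> max 0 B * indicator {\<alpha>..\<beta>} r" for r
    using B[of r] by (auto simp: indicator_def)
  qed simp
  fix y :: real assume y: "0 < y"
  \<comment> \<open>The bound \<alpha> \<le> 1 places (0, \<alpha>) in the region where the barrier
    is the power \<open>y powr (2 * \<nu>)\<close>.\<close>
  show "norm (\<psi> y) \<le> norm (complex_of_real (norm k * barrier a y)) + norm (of_real (indicator {\<alpha>..\<beta>} y) * \<psi> y)"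
  proof (cases "y < \<alpha>")
   case True
   then show ?thesis using \<psi>l[of y] y \<alpha> by (auto simp: barrier_def norm_mult)
  next
   case False
   then show ?thesis using \<psi>r[of y] by (cases "y \<le> \<beta>") auto
  qed
 qed (use \<psi>m m_bounds in auto)
 moreover have "of_real (r powr ?c) * \<psi>1 r = 2 * of_real \<nu> * k" if "0 < r" "r \<le> \<alpha>" for r
  using \<Phi>c[OF that] \<nu> by (simp add: \<Phi>_def k_def)
 ultimately show ?thesis using that[OF sol _ lim \<psi>l] \<psi>r \<psi>1r by blast
qed


text \<open>For u the identity of \<open>pairing_generator\<close> trades \<eta> against v and
  \<psi>. For U the same trade is Green's identity on [e, \<beta>] with e tending to 0, where only
  boundary terms have to be checked since \<psi> vanishes beyond \<beta>. The difference gives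
  orthogonality without any bound for U at infinity.\<close>

lemma generator_difference_orthogonal:
 assumes u: "u \<in> L" and v: "v \<in> L" and gen: "((\<lambda>t. N (\<lambda>y. (T t u y - u y) / of_real t - v y)) \<longlongrightarrow> 0) (at_right 0)"
  and sol: "bessel_solution (1 - 2 * \<nu>) U U1 v" and U0: "(U \<longlongrightarrow> 0) (at_right 0)"
  and \<eta>: "hl_measurable \<eta>" and \<alpha>: "0 < \<alpha>" "\<alpha> \<le> 1" "\<alpha> \<le> \<beta>"
  and supp: "\<And>r. 0 < r \<Longrightarrow> norm (\<eta> r) \<le> K * indicator {\<alpha>..\<beta>} r" and K: "0 \<le> K"
  and mean: "(LINT r:{\<alpha>..\<beta>}|lborel. of_real r * \<eta> r) = 0"
 shows "(LINT r:{\<alpha>..\<beta>}|lborel. of_real (r powr (1 - 2 * \<nu>)) * (\<eta> r * (u r - U r))) = 0"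
proof -
 let ?c = "1 - 2 * \<nu>"
 interpret dual: bessel_Lp q \<nu> m_dual by (rule dual_bessel_Lp)
 have \<eta>L: "\<eta> \<in> dual.L" by (rule dual.compact_support_in_L[OF \<eta> \<alpha>(1) supp K])
 have \<eta>0: "\<eta> r = 0" if "0 < r" "r < \<alpha> \<or> \<beta> < r" for r using supp[OF that(1)] that(2) by auto
 obtain \<psi> \<psi>1 k where \<psi>: "bessel_solution ?c \<psi> \<psi>1 \<eta>" "\<psi> \<in> dual.L" "(\<psi> \<longlongrightarrow> 0) (at_right 0)"
  and \<psi>l: "\<And>r. 0 < r \<Longrightarrow> r \<le> \<alpha> \<Longrightarrow> \<psi> r = k * of_real (r powr (2 * \<nu>))"
  "\<And>r. 0 < r \<Longrightarrow> r \<le> \<alpha> \<Longrightarrow> of_real (r powr ?c) * \<psi>1 r = 2 * of_real \<nu> * k"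
  and \<psi>r: "\<And>r. \<beta> \<le> r \<Longrightarrow> \<psi> r = 0 \<and> \<psi>1 r = 0"
  using dual.compactly_supported_solution[OF \<eta> \<alpha> supp K mean] by blast
 define W where "W y = of_real (y powr ?c) * (\<psi> y * U1 y - U y * \<psi>1 y)" for y
 have W: "primitive W (\<lambda>y. of_real (y powr ?c) * (\<psi> y * v y - U y * \<eta> y))"
  unfolding W_def[abs_def] by (rule Green_identity[OF sol \<psi>(1)])
 have W\<beta>: "W \<beta> = 0" using \<psi>r[of \<beta>] by (simp add: W_def)
 \<comment> \<open>Near 0 the test solution is the exact power k y^(2 \<nu>), so that the Wronskian
   reduces to y U1 and U, both of which tend to 0.\<close>
 have Wl: "W y = k * (of_real y * U1 y) - 2 * of_real \<nu> * k * U y" if y: "0 < y" "y \<le> \<alpha>" for y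
 proof -
  have "W y = \<psi> y * of_real (y powr ?c) * U1 y - of_real (y powr ?c) * \<psi>1 y * U y"
   by (simp add: W_def algebra_simps)
  also have "\<psi> y * of_real (y powr ?c) = k * of_real y"
  proof -
   have "y powr (2 * \<nu>) * y powr ?c = y" using y by (simp add: powr_add[symmetric])
   then show ?thesis unfolding \<psi>l(1)[OF y] by (metis mult.assoc of_real_mult)
  qed
  finally show ?thesis unfolding \<psi>l(2)[OF y] by (simp add: mult.assoc)
 qed
 have W0: "(W \<longlongrightarrow> 0) (at_right 0)"
 proof -
  have "((\<lambda>y. k * (of_real y * U1 y) - 2 * of_real \<nu> * k * U y) \<longlongrightarrow> k * 0 - 2 * of_real \<nu> * k * 0) (at_right 0)"
   by (intro tendsto_intros solution_derivative_limit[OF sol v] U0)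
  moreover have "\<forall>\<^sub>F y in at_right 0. k * (of_real y * U1 y) - 2 * of_real \<nu> * k * U y = W y"
   unfolding eventually_at_right_field by (intro exI[of _ \<alpha>]) (use \<alpha> Wl in auto)
  ultimately show ?thesis by (simp add: tendsto_cong)
 qed
 define V where "V = (LINT y:{\<alpha>..\<beta>}|lborel. of_real (y powr ?c) * (\<eta> y * U y))"
 define H where "H y = of_real (weight y) * (v y * \<psi> y)" for y
 have H: "integrable lborel H" unfolding H_def[abs_def] by (rule pairing_integrable[OF v \<psi>(2)])
 have i\<eta>: "set_integrable lborel {a..b} \<eta>" if "0 < a" for a b by (rule dual.L_interval_integrable[OF \<eta>L that])
 have iU: "set_integrable lborel {a..b} (\<lambda>y. of_real (y powr ?c) * (\<eta> y * U y))" if "0 < a" "a \<le> b" for a b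
 proof -
  have "set_integrable lborel {a..b} (\<lambda>y. (of_real (y powr ?c) * U y) * \<eta> y)"
   using that by (intro set_integrable_continuous_mult i\<eta> continuous_intros continuous_on_subset[OF bessel_solution_continuous(1)[OF sol]]) auto
  then show ?thesis by (simp add: mult_ac)
 qed
 have IH: "(LINT y:{e..\<beta>}|lborel. H y) = V - W e" if e: "0 < e" "e \<le> \<alpha>" for e
 proof -
  have iH: "set_integrable lborel {e..\<beta>} H" unfolding set_integrable_def by (intro integrable_mult_indicator H) simp
  have VU: "(LINT y:{e..\<beta>}|lborel. of_real (y powr ?c) * (\<eta> y * U y)) = V"
   unfolding V_def set_lebesgue_integral_def
   by (rule Bochner_Integration.integral_cong) (use e \<eta>0 in \<open>auto simp: indicator_def\<close>)
  have "0 - W e = (LINT y:{e..\<beta>}|lborel. of_real (y powr ?c) * (\<psi> y * v y - U y * \<eta> y))"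
   using primitiveD(2)[OF W, of e \<beta>] e \<alpha> W\<beta> by simp
  also have "\<dots> = (LINT y:{e..\<beta>}|lborel. H y - of_real (y powr ?c) * (\<eta> y * U y))"
   by (rule set_lebesgue_integral_cong) (use e in \<open>auto simp: H_def algebra_simps\<close>)
  also have "\<dots> = (LINT y:{e..\<beta>}|lborel. H y) - V"
   unfolding VU[symmetric] using e \<alpha> by (intro set_integral_diff iH iU) auto
  finally show ?thesis by (simp add: algebra_simps)
 qed
 have pv: "pairing v \<psi> = V"
 proof -
  let ?X = "\<lambda>n. \<alpha> * inverse (real (Suc n))"
  have X: "?X \<longlonglongrightarrow> 0" using tendsto_mult_right_zero[OF LIMSEQ_inverse_real_of_nat] by simp
  have Xb: "0 < ?X n" "?X n \<le> \<alpha>" for n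
   using \<alpha> inverse_le_1_iff[of "real (Suc n)"] by (auto simp: mult_le_cancel_left2)
  have "(\<lambda>n. LINT y|lborel. indicator {?X n..\<beta>} y *\<^sub>R H y) \<longlonglongrightarrow> (LINT y|lborel. H y)"
  proof (rule integral_dominated_convergence[OF _ _ integrable_norm[OF H]])
   show "AE y in lborel. (\<lambda>n. indicator {?X n..\<beta>} y *\<^sub>R H y) \<longlonglongrightarrow> H y"
   proof (rule AE_I2)
    fix y
    show "(\<lambda>n. indicator {?X n..\<beta>} y *\<^sub>R H y) \<longlonglongrightarrow> H y"
    proof (cases "0 < y \<and> y \<le> \<beta>")
     case True
     have "\<forall>\<^sub>F n in sequentially. ?X n < y" using True by (intro order_tendstoD(2)[OF X]) auto
     then have "\<forall>\<^sub>F n in sequentially. indicator {?X n..\<beta>} y *\<^sub>R H y = H y"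
      by eventually_elim (use True in \<open>auto simp: indicator_def\<close>)
     then show ?thesis by (rule tendsto_eventually)
    next
     case False
     then have "H y = 0" using \<psi>r[of y] by (auto simp: H_def indicator_def)
     then show ?thesis by simp
    qed
   qed
  qed (use H in \<open>auto simp: indicator_def\<close>)
  moreover have "(\<lambda>n. LINT y|lborel. indicator {?X n..\<beta>} y *\<^sub>R H y) \<longlonglongrightarrow> V - 0"
  proof -
   have "(\<lambda>n. V - W (?X n)) \<longlonglongrightarrow> V - 0"
    by (intro tendsto_intros W0[unfolded tendsto_at_right_0_sequentially, rule_format]) (use X Xb in auto)
   then show ?thesis using IH[OF Xb] by (simp only: set_lebesgue_integral_def)
  qed
  ultimately have "(LINT y|lborel. H y) = V - 0" by (rule LIMSEQ_unique)
  then show ?thesis by (simp add: pairing_def H_def[abs_def])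
 qed
 have pu: "pairing u \<eta> = (LINT y:{\<alpha>..\<beta>}|lborel. of_real (y powr ?c) * (\<eta> y * u y))"
  unfolding pairing_def set_lebesgue_integral_def
  by (rule Bochner_Integration.integral_cong) (use \<alpha> \<eta>0 in \<open>auto simp: indicator_def not_le\<close>)
 have iu: "set_integrable lborel {\<alpha>..\<beta>} (\<lambda>y. of_real (y powr ?c) * (\<eta> y * u y))"
 proof -
  have "set_integrable lborel {\<alpha>..\<beta>} (\<lambda>y. of_real (weight y) * (u y * \<eta> y))"
   unfolding set_integrable_def by (intro integrable_mult_indicator pairing_integrable u \<eta>L) simp
  then show ?thesis
   by (rule set_integrable_cong[THEN iffD1, rotated -1]) (use \<alpha> in \<open>auto simp: mult_ac\<close>)
 qed
 have "(LINT r:{\<alpha>..\<beta>}|lborel. of_real (r powr ?c) * (\<eta> r * (u r - U r))) =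
   (LINT r:{\<alpha>..\<beta>}|lborel. of_real (r powr ?c) * (\<eta> r * u r) - of_real (r powr ?c) * (\<eta> r * U r))"
  by (simp only: right_diff_distrib)
 also have "\<dots> = pairing u \<eta> - V"
  unfolding pu V_def using \<alpha> by (intro set_integral_diff iu iU) auto
 also have "\<dots> = 0" using pairing_generator[OF u v gen \<psi>(1) \<eta>L \<psi>(2,3)] pv by simp
 finally show ?thesis .
qed

text \<open>The quotient w of u - U by y^(2 \<nu>) is shown to have the same mean over every
  interval as over [1, 2], hence to be constant. The constant multiple of y^(2 \<nu>) is then added
  to U, which preserves both the equation and the limit 0.\<close>

theorem generator_solution:
 assumes u: "u \<in> L" and v: "v \<in> L" and gen: "((\<lambda>t. N (\<lambda>y. (T t u y - u y) / of_real t - v y)) \<longlongrightarrow> 0) (at_right 0)"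
 obtains U U1 where "bessel_solution (1 - 2 * \<nu>) U U1 v" "(U \<longlongrightarrow> 0) (at_right 0)" "eq_AE u U"
proof -
 let ?c = "1 - 2 * \<nu>"
 obtain U U1 where sol: "bessel_solution ?c U U1 v" and U0: "(U \<longlongrightarrow> 0) (at_right 0)"
  using solution_exists[OF v] .
 define w where "w y = of_real (y powr (- (2 * \<nu>))) * (u y - U y)" for y
 have iw: "set_integrable lborel {a..b} w" if "0 < a" for a b
  unfolding w_def using that
  by (intro set_integrable_continuous_mult set_integral_diff L_interval_integrable u continuous_intros
    borel_integrable_atLeastAtMost' continuous_on_subset[OF bessel_solution_continuous(1)[OF sol]]) auto
 define k where "k = (LINT y:{1..2}|lborel. w y)"
 have mean: "(LINT y:{a..b}|lborel. w y) = of_real (b - a) * k" if ab: "0 < a" "a \<le> b" for a b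
 proof -
  \<comment> \<open>One interval that contains both [a, b] and [1, 2], with \<alpha> \<le> 1 as the
    construction of the test solution requires.\<close>
  define \<alpha> where "\<alpha> = min a 1" define \<beta> where "\<beta> = max b 2"
  have \<alpha>: "0 < \<alpha>" "\<alpha> \<le> 1" "\<alpha> \<le> \<beta>" using ab by (auto simp: \<alpha>_def \<beta>_def)
  have sub: "{a..b} \<subseteq> {\<alpha>..\<beta>}" "{1..2} \<subseteq> {\<alpha>..\<beta>}" by (auto simp: \<alpha>_def \<beta>_def)
  \<comment> \<open>A difference of indicators with integral 0. Dividing by r turns this into the
    required mean condition on \<eta>, and r^c \<eta> (u - U) becomes \<zeta> w.\<close>
  define \<zeta> where "\<zeta> r = indicator {a..b} r - (b - a) * indicator {1..2} r" for r :: real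
  define \<eta> where "\<eta> r = complex_of_real (\<zeta> r / r)" for r
  have \<zeta>: "\<bar>\<zeta> r\<bar> \<le> (1 + (b - a)) * indicator {\<alpha>..\<beta>} r" for r
   using sub ab by (auto simp: \<zeta>_def indicator_def)
  have \<zeta>int: "(LINT r:{\<alpha>..\<beta>}|lborel. \<zeta> r *\<^sub>R f r) = (LINT r:{a..b}|lborel. f r) - of_real (b - a) * (LINT r:{1..2}|lborel. f r)"
   if "set_integrable lborel {a..b} f" "set_integrable lborel {1..2} f" for f :: "real \<Rightarrow> complex"
  proof -
   have "(LINT r:{\<alpha>..\<beta>}|lborel. \<zeta> r *\<^sub>R f r) =
     (LINT r|lborel. indicator {a..b} r *\<^sub>R f r - of_real (b - a) * (indicator {1..2} r *\<^sub>R f r))"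
    unfolding set_lebesgue_integral_def
   proof (rule Bochner_Integration.integral_cong[OF refl])
    fix r
    have "indicator {\<alpha>..\<beta>} r * \<zeta> r = \<zeta> r" using sub by (auto simp: \<zeta>_def indicator_def)
    then have "indicator {\<alpha>..\<beta>} r *\<^sub>R \<zeta> r *\<^sub>R f r = \<zeta> r *\<^sub>R f r" by simp
    then show "indicator {\<alpha>..\<beta>} r *\<^sub>R \<zeta> r *\<^sub>R f r = indicator {a..b} r *\<^sub>R f r - of_real (b - a) * (indicator {1..2} r *\<^sub>R f r)"
     by (simp add: \<zeta>_def scaleR_conv_of_real algebra_simps)
   qed
   also have "\<dots> = (LINT r|lborel. indicator {a..b} r *\<^sub>R f r) - (LINT r|lborel. of_real (b - a) * (indicator {1..2} r *\<^sub>R f r))"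
    using that by (intro Bochner_Integration.integral_diff integrable_mult_right) (auto simp: set_integrable_def)
   finally show ?thesis unfolding set_lebesgue_integral_def by (simp only: integral_mult_right_zero)
  qed
  have "(LINT r:{\<alpha>..\<beta>}|lborel. of_real (r powr ?c) * (\<eta> r * (u r - U r))) = 0"
  proof (rule generator_difference_orthogonal[OF u v gen sol U0 _ \<alpha>])
   show "hl_measurable \<eta>"
    unfolding \<eta>_def \<zeta>_def by (rule hl_measurableI) measurable
   show "norm (\<eta> r) \<le> ((1 + (b - a)) / \<alpha>) * indicator {\<alpha>..\<beta>} r" if "0 < r" for r
   proof (cases "r \<in> {\<alpha>..\<beta>}")
    case True
    then show ?thesis using \<zeta>[of r] \<alpha> that ab by (auto simp: \<eta>_def norm_divide intro!: frac_le)
   next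
    case False
    then show ?thesis using \<zeta>[of r] by (simp add: \<eta>_def)
   qed
   show "0 \<le> (1 + (b - a)) / \<alpha>" using ab \<alpha> by simp
   have "(LINT r:{\<alpha>..\<beta>}|lborel. of_real r * \<eta> r) = (LINT r:{\<alpha>..\<beta>}|lborel. \<zeta> r *\<^sub>R 1)"
    by (rule set_lebesgue_integral_cong) (use \<alpha> in \<open>auto simp: \<eta>_def scaleR_conv_of_real\<close>)
   also have "\<dots> = (LINT r:{a..b}|lborel. (1::complex)) - of_real (b - a) * (LINT r:{1..2::real}|lborel. 1)"
    by (rule \<zeta>int) (intro borel_integrable_atLeastAtMost' continuous_intros)+
   also have "\<dots> = 0"
    using ab by (simp add: set_lebesgue_integral_def scaleR_conv_of_real)
   finally show "(LINT r:{\<alpha>..\<beta>}|lborel. of_real r * \<eta> r) = 0" .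
  qed
  moreover have "(LINT r:{\<alpha>..\<beta>}|lborel. of_real (r powr ?c) * (\<eta> r * (u r - U r))) = (LINT r:{\<alpha>..\<beta>}|lborel. \<zeta> r *\<^sub>R w r)"
  proof (rule set_lebesgue_integral_cong)
   show "\<forall>r. r \<in> {\<alpha>..\<beta>} \<longrightarrow> of_real (r powr ?c) * (\<eta> r * (u r - U r)) = \<zeta> r *\<^sub>R w r"
   proof (intro allI impI)
    fix r assume "r \<in> {\<alpha>..\<beta>}"
    then have r: "0 < r" using \<alpha> by simp
    have "r powr ?c * (\<zeta> r / r) = \<zeta> r * r powr (- (2 * \<nu>))" using r by (simp add: powr_diff powr_minus_divide)
    then show "of_real (r powr ?c) * (\<eta> r * (u r - U r)) = \<zeta> r *\<^sub>R w r"
     unfolding \<eta>_def w_def scaleR_conv_of_real by (metis mult.assoc of_real_mult)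
   qed
  qed simp
  ultimately have "(LINT r:{a..b}|lborel. w r) - of_real (b - a) * k = 0"
   unfolding k_def using \<zeta>int[OF iw iw] ab by simp
  then show ?thesis by simp
 qed
 have ik: "set_integrable lborel {a..b} (\<lambda>_. k)" "(LINT y:{a..b}|lborel. k) = of_real (b - a) * k" if "a \<le> b" for a b
  using that by (auto simp: set_integrable_def set_lebesgue_integral_def scaleR_conv_of_real)
 have "AE y in lborel. 0 < y \<longrightarrow> w y - k = 0"
 proof (rule AE_zero_of_intervals)
  fix a b :: real assume ab: "0 < a" "a \<le> b"
  show "set_integrable lborel {a..b} (\<lambda>y. w y - k)" by (intro set_integral_diff iw ik ab)
  show "(LINT y:{a..b}|lborel. w y - k) = 0"
   using set_integral_diff(2)[OF iw[OF ab(1)] ik(1)[OF ab(2)]] mean[OF ab] ik(2)[OF ab(2)] by simp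
 qed
 then have ae: "AE y in lborel. 0 < y \<longrightarrow> u y = U y + k * of_real (y powr (2 * \<nu>))"
 proof eventually_elim
  case (elim y)
  show ?case
  proof
   assume y: "0 < y"
   have "u y - U y = of_real (y powr (2 * \<nu>)) * w y"
    unfolding w_def by (rule of_real_powr_cancel(1)[OF y, symmetric])
   then show "u y = U y + k * of_real (y powr (2 * \<nu>))" using elim y by (simp add: algebra_simps)
  qed
 qed
 have "((\<lambda>r. r powr (2 * \<nu>)) \<longlongrightarrow> 0) (at_right (0::real))" using \<nu> by real_asymp
 then have "((\<lambda>y. U y + k * of_real (y powr (2 * \<nu>))) \<longlongrightarrow> 0 + k * of_real 0) (at_right 0)"
  by (intro tendsto_intros U0)
 then show ?thesis using that[OF bessel_solution_add_powr[OF sol] _ ae] by simp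
qed

end

section \<open>Weak derivatives\<close>

text \<open>The classical flat function exp (- s / x); the negative powers of x are those that its
  derivatives produce.\<close>

definition cutoff :: "real \<Rightarrow> nat \<Rightarrow> real \<Rightarrow> real" where
 "cutoff s n x = (if 0 < x then exp (- s / x) / x ^ n else 0)"

text \<open>Away from 0 this is a computation. At 0 the exponential outweighs every negative power,
  so that the difference quotient tends to 0 from the right and is 0 on the left.\<close>

lemma cutoff_derivative:
 assumes s: "0 < s"
 shows "(cutoff s n has_real_derivative s * cutoff s (n + 2) x - real n * cutoff s (n + 1) x) (at x)"
proof -
 consider "0 < x" | "x < 0" | "x = 0" by linarith
 then show ?thesis
 proof cases
  case 1
  have "((\<lambda>x. exp (- s / x) / x ^ n) has_real_derivative s * cutoff s (n + 2) x - real n * cutoff s (n + 1) x) (at x)"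
  proof -
   have e: "((\<lambda>x. exp (- s / x)) has_real_derivative exp (- s / x) * (s / x\<^sup>2)) (at x)"
    using 1 by (auto intro!: derivative_eq_intros simp: power2_eq_square)
   show ?thesis
   proof (cases n)
    case 0
    then show ?thesis using e 1 by (simp add: cutoff_def power2_eq_square mult.commute)
   next
    case (Suc k)
    have "((\<lambda>x. x ^ Suc k) has_real_derivative (1 + real k) * (1 * x ^ k)) (at x)"
     by (rule DERIV_power_Suc[OF DERIV_ident])
    from DERIV_divide[OF e this] show ?thesis
     unfolding Suc by (rule DERIV_cong) (use 1 in \<open>auto simp: cutoff_def field_simps power2_eq_square\<close>)
   qed
  qed
  moreover have "\<forall>\<^sub>F y in nhds x. exp (- s / y) / y ^ n = cutoff s n y"
   using eventually_nhds_in_open[of "{0<..}" x] 1 by (auto elim!: eventually_mono simp: cutoff_def)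
  ultimately show ?thesis by (subst (asm) DERIV_cong_ev[OF refl _ refl])
 next
  case 2
  have "\<forall>\<^sub>F y in nhds x. cutoff s n y = 0"
   using eventually_nhds_in_open[of "{..<0}" x] 2 by (auto elim!: eventually_mono simp: cutoff_def)
  then show ?thesis using 2 by (subst DERIV_cong_ev[OF refl _ refl]) (auto simp: cutoff_def)
 next
  case 3
  \<comment> \<open>In the variable s / h the difference quotient at 0 is a power divided by an
    exponential, up to a power of s.\<close>
  have "filterlim (\<lambda>h. s / h) at_top (at_right (0::real))" using s by real_asymp
  from filterlim_compose[OF tendsto_power_div_exp_0 this, of "n + 1"]
  have "((\<lambda>h. (s / h) ^ (n + 1) / exp (s / h) / s ^ (n + 1)) \<longlongrightarrow> 0 / s ^ (n + 1)) (at_right 0)"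
   using s by (intro tendsto_divide tendsto_const) auto
  moreover have "\<forall>\<^sub>F h in at_right 0. (s / h) ^ (n + 1) / exp (s / h) / s ^ (n + 1) = cutoff s n h / h"
   using eventually_at_right_less[of "0::real"] s
   by (auto elim!: eventually_mono simp: cutoff_def power_divide exp_minus field_simps)
  ultimately have r: "((\<lambda>h. cutoff s n h / h) \<longlongrightarrow> 0) (at_right 0)" by (simp add: tendsto_cong)
  have l: "((\<lambda>h. cutoff s n h / h) \<longlongrightarrow> 0) (at_left 0)"
   by (rule tendsto_eventually) (use eventually_at_left_real[of "-1" 0] in \<open>auto elim!: eventually_mono simp: cutoff_def\<close>)
  show ?thesis using filterlim_split_at[OF l r] 3 by (simp add: has_field_derivative_iff cutoff_def)
 qed
qed

text \<open>
 The span of the products \<open>cutoff s m (x - a) * cutoff s n (b - x)\<close> is closed under differentiation,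
 so that its members are smooth; for \<open>m = n = 0\<close> and \<open>s \<rightarrow> 0\<close> they tend to the indicator of \<open>(a, b)\<close>.
\<close>

inductive bump_span :: "(real \<Rightarrow> real) \<Rightarrow> bool" where
 bump: "0 < s \<Longrightarrow> 0 < a \<Longrightarrow> a < b \<Longrightarrow> bump_span (\<lambda>x. cutoff s m (x - a) * cutoff s n (b - x))"
| add: "bump_span F \<Longrightarrow> bump_span G \<Longrightarrow> bump_span (\<lambda>x. F x + G x)"
| scale: "bump_span F \<Longrightarrow> bump_span (\<lambda>x. k * F x)"

lemma bump_span_derivative: "bump_span F \<Longrightarrow> \<exists>F'. bump_span F' \<and> (\<forall>x. (F has_real_derivative F' x) (at x))"
proof (induction rule: bump_span.induct)
 case (bump s a b m n)
 let ?c = "\<lambda>i j x. cutoff s i (x - a) * cutoff s j (b - x)"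
 let ?F = "\<lambda>x. (s * ?c (m + 2) n x + (- real m) * ?c (m + 1) n x) + ((- s) * ?c m (n + 2) x + real n * ?c m (n + 1) x)"
 have "bump_span ?F" using bump by (intro bump_span.intros)
 moreover have "(?c m n has_real_derivative ?F x) (at x)" for x
 proof -
  have "((\<lambda>x. cutoff s m (x - a)) has_real_derivative (s * cutoff s (m + 2) (x - a) - real m * cutoff s (m + 1) (x - a)) * 1) (at x)"
   "((\<lambda>x. cutoff s n (b - x)) has_real_derivative (s * cutoff s (n + 2) (b - x) - real n * cutoff s (n + 1) (b - x)) * (-1)) (at x)"
   by (rule DERIV_chain2[OF cutoff_derivative[OF bump(1)]]; auto intro!: derivative_eq_intros)+
  from DERIV_mult[OF this] show ?thesis by (rule DERIV_cong) (simp add: algebra_simps)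
 qed
 ultimately show ?case by blast
next
 case (add F G)
 then obtain F' G' where "bump_span F'" "bump_span G'" "\<And>x. (F has_real_derivative F' x) (at x)"
  "\<And>x. (G has_real_derivative G' x) (at x)" by blast
 then show ?case by (intro exI[of _ "\<lambda>x. F' x + G' x"]) (auto intro: bump_span.add DERIV_add)
next
 case (scale F k)
 then obtain F' where "bump_span F'" "\<And>x. (F has_real_derivative F' x) (at x)" by blast
 then show ?case by (intro exI[of _ "\<lambda>x. k * F' x"]) (auto intro: bump_span.scale DERIV_cmult)
qed

lemma bump_span_smooth:
 assumes "bump_span F" shows "bump_span ((deriv ^^ k) F)" "(deriv ^^ k) F differentiable (at x)"
proof -
 show b: "bump_span ((deriv ^^ k) F)" for k
 proof (induction k)
  case (Suc k)
  then obtain F' where "bump_span F'" "\<And>x. ((deriv ^^ k) F has_real_derivative F' x) (at x)"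
   using bump_span_derivative by blast
  then have "(deriv ^^ Suc k) F = F'" by (auto intro: DERIV_imp_deriv)
  then show ?case using \<open>bump_span F'\<close> by simp
 qed (simp add: assms)
 show "(deriv ^^ k) F differentiable (at x)"
  using bump_span_derivative[OF b[of k]] real_differentiable_def by blast
qed

lemma bump_span_continuous: "bump_span F \<Longrightarrow> continuous_on S F"
 using bump_span_derivative[of F] by (meson DERIV_isCont continuous_at_imp_continuous_on)

lemma bump_span_support: "bump_span F \<Longrightarrow> \<exists>a b. 0 < a \<and> a < b \<and> (\<forall>x. x \<notin> {a..b} \<longrightarrow> F x = 0)"
proof (induction rule: bump_span.induct)
 case (bump s a b m n)
 then show ?case by (intro exI[of _ a] exI[of _ b]) (auto simp: cutoff_def)
next
 case (add F G)
 then obtain a b a' b' where ab: "0 < a" "a < b" "0 < a'" "a' < b'"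
  and z: "\<And>x. x \<notin> {a..b} \<Longrightarrow> F x = 0" "\<And>x. x \<notin> {a'..b'} \<Longrightarrow> G x = 0" by blast
 have "F x + G x = 0" if "x \<notin> {min a a'..max b b'}" for x using z[of x] that by (auto simp: min_le_iff_disj le_max_iff_disj)
 then show ?case using ab by (intro exI[of _ "min a a'"] exI[of _ "max b b'"]) auto
qed auto

lemma test_fun_bump_span: "bump_span F \<Longrightarrow> test_fun F"
proof -
 assume F: "bump_span F"
 then obtain a b where "0 < a" "a < b" "\<forall>x. x \<notin> {a..b} \<longrightarrow> F x = 0" using bump_span_support by blast
 then show ?thesis unfolding test_fun_def using bump_span_smooth(2)[OF F] by (intro conjI allI exI[of _ "{a..b}"]) auto
qed

text \<open>Integral 0 is exactly what makes the antiderivative vanish to the right of the support.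
  The antiderivative may leave the span, but all its derivatives from the first on belong to
  it.\<close>

lemma bump_span_antiderivative:
 assumes h: "bump_span h" and z: "(LINT x|lborel. h x) = 0"
 obtains \<phi> where "test_fun \<phi>" "deriv \<phi> = h"
proof -
 obtain a b where ab: "0 < a" "a < b" "\<And>x. x \<notin> {a..b} \<Longrightarrow> h x = 0" using bump_span_support[OF h] by blast
 have supp: "a \<le> x \<and> x \<le> b" if "h x \<noteq> 0" for x using ab(3)[of x] that by fastforce
 \<comment> \<open>The base point lies in the half-line strictly to the left of the support of h, so
   that every x \<ge> a is an interior point of the interval of integration.\<close>
 define \<phi> where "\<phi> x = integral {a / 2..x} h" for x
 have cont: "continuous_on {c..d} h" for c d by (rule bump_span_continuous[OF h])
 have hi: "integral {c..d} h = (LINT x:{c..d}|lborel. h x)" for c d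
  by (rule set_borel_integral_eq_integral(2)[symmetric, OF borel_integrable_atLeastAtMost'[OF cont]])
 have out: "\<phi> x = 0" if "x \<notin> {a..b}" for x
 proof (cases "x < a")
  case True
  then have "integral {a / 2..x} h = integral {a / 2..x} (\<lambda>_. 0)" by (intro integral_cong ab(3)) auto
  then show ?thesis by (simp add: \<phi>_def)
 next
  case False
  have "(LINT x:{a / 2..x}|lborel. h x) = (LINT x|lborel. h x)"
   unfolding set_lebesgue_integral_def
  proof (rule Bochner_Integration.integral_cong[OF refl])
   show "indicator {a / 2..x} y *\<^sub>R h y = h y" for y
    using supp[of y] False that ab by (cases "h y = 0") (auto simp: indicator_def)
  qed
  then show ?thesis using z by (simp add: \<phi>_def hi)
 qed
 have der: "(\<phi> has_real_derivative h x) (at x)" for x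
 proof (cases "x < a")
  case True
  have "\<forall>\<^sub>F y in nhds x. \<phi> y = 0"
   using eventually_nhds_in_open[of "{..<a}" x] True by (auto elim!: eventually_mono intro: out)
  then show ?thesis using True ab(3)[of x] by (subst DERIV_cong_ev[OF refl _ refl]) auto
 next
  case False
  have "(\<phi> has_real_derivative h x) (at x within {a / 2..x + 1})"
   unfolding \<phi>_def[abs_def] by (rule integral_has_real_derivative[OF cont]) (use False ab in auto)
  then show ?thesis using False ab at_within_interior[of x "{a / 2..x + 1}"] by simp
 qed
 then have dh: "deriv \<phi> = h" by (auto intro: DERIV_imp_deriv)
 have "(deriv ^^ k) \<phi> differentiable (at x)" for k x
 proof (cases k)
  case 0
  then show ?thesis using der real_differentiable_def by auto
 next
  case (Suc j)
  then show ?thesis using bump_span_smooth(2)[OF h, of j] by (simp add: funpow_Suc_right dh del: funpow.simps)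
 qed
 then have "test_fun \<phi>"
  unfolding test_fun_def using out ab by (intro conjI allI exI[of _ "{a..b}"]) auto
 then show ?thesis using dh that by blast
qed

lemma Lp_loc_1_iff: "u \<in> Lp_loc 1 \<longleftrightarrow> (\<forall>a b. 0 < a \<longrightarrow> a \<le> b \<longrightarrow> set_integrable lborel {a..b} u)"
proof
 assume u: "u \<in> Lp_loc 1"
 show "\<forall>a b. 0 < a \<longrightarrow> a \<le> b \<longrightarrow> set_integrable lborel {a..b} u"
 proof (intro allI impI)
  fix a b :: real assume ab: "0 < a" "a \<le> b"
  have [measurable]: "ext0 u \<in> borel_measurable borel" using u by (simp add: Lp_loc_def hl_measurable_iff)
  have e: "(\<lambda>x. indicator {a..b} x *\<^sub>R u x) = (\<lambda>x. indicator {a..b} x *\<^sub>R ext0 u x)"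
   using ab by (auto simp: indicator_def ext0_def)
  have "set_integrable lborel {a..b} (\<lambda>x. norm (u x) powr 1)"
   using u ab unfolding Lp_loc_def by (auto elim!: allE[of _ "{a..b}"])
  then have "set_integrable lborel {a..b} (\<lambda>x. norm (u x))" by simp
  then show "set_integrable lborel {a..b} u"
   unfolding set_integrable_def by (rule Bochner_Integration.integrable_bound) (auto simp: e)
 qed
next
 assume i: "\<forall>a b. 0 < a \<longrightarrow> a \<le> b \<longrightarrow> set_integrable lborel {a..b} u"
 have "set_integrable lborel K u" if K: "compact K" "K \<subseteq> {0<..}" for K
 proof (cases "K = {}")
  case False
  obtain a b where "a \<in> K" "b \<in> K" "\<And>x. x \<in> K \<Longrightarrow> a \<le> x \<and> x \<le> b"
   using compact_attains_inf[OF K(1) False] compact_attains_sup[OF K(1) False] by metis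
  then have "0 < a" "a \<le> b" "K \<subseteq> {a..b}" using K by auto
  then show ?thesis using i set_integrable_subset[of lborel "{a..b}" u K] compact_imp_closed[OF K(1)] by auto
 qed simp
 then show "u \<in> Lp_loc 1"
  using i by (auto simp: Lp_loc_def intro!: hl_measurable_of_intervals set_integrable_norm)
qed

lemma test_integral:
 fixes h :: "real \<Rightarrow> real" and u :: "real \<Rightarrow> complex"
 assumes h: "continuous_on UNIV h" "\<And>x. x \<notin> {a..b} \<Longrightarrow> h x = 0" and ab: "0 < a" and u: "set_integrable lborel {a..b} u"
 shows "set_integrable lborel {0<..} (\<lambda>x. h x *\<^sub>R u x)" "(LINT x:{0<..}|lborel. h x *\<^sub>R u x) = (LINT x:{a..b}|lborel. of_real (h x) * u x)"
proof -
 have e: "(\<lambda>x. indicator {0<..} x *\<^sub>R h x *\<^sub>R u x) = (\<lambda>x. indicator {a..b} x *\<^sub>R (of_real (h x) * u x))"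
  using h(2) ab by (auto simp: indicator_def scaleR_conv_of_real)
 have "set_integrable lborel {a..b} (\<lambda>x. of_real (h x) * u x)"
  by (intro set_integrable_continuous_mult u continuous_intros continuous_on_subset[OF h(1)]) simp
 then show "set_integrable lborel {0<..} (\<lambda>x. h x *\<^sub>R u x)" unfolding set_integrable_def e .
 show "(LINT x:{0<..}|lborel. h x *\<^sub>R u x) = (LINT x:{a..b}|lborel. of_real (h x) * u x)"
  unfolding set_lebesgue_integral_def e ..
qed

lemma bump_span_integrable:
 assumes "bump_span h" "u \<in> Lp_loc 1" shows "set_integrable lborel {0<..} (\<lambda>x. h x *\<^sub>R u x)"
proof -
 obtain a b where "0 < a" "a < b" "\<And>x. x \<notin> {a..b} \<Longrightarrow> h x = 0" using bump_span_support[OF assms(1)] by blast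
 then show ?thesis using test_integral(1)[OF bump_span_continuous[OF assms(1)], of a b u] assms(2) by (auto simp: Lp_loc_1_iff)
qed

text \<open>The fundamental lemma of the calculus of variations: by dominated convergence the bumps
  over (a, b) with s = 1 / (n + 1) recover the integral of v over every interval.\<close>

lemma AE_zero_of_bumps:
 assumes v: "v \<in> Lp_loc 1" and z: "\<And>h. bump_span h \<Longrightarrow> (LINT y:{0<..}|lborel. h y *\<^sub>R v y) = 0"
 shows "AE y in lborel. 0 < y \<longrightarrow> v y = 0"
proof (rule AE_zero_of_intervals)
 fix a b :: real assume ab: "0 < a" "a \<le> b"
 show i: "set_integrable lborel {a..b} v" using v ab by (auto simp: Lp_loc_1_iff)
 note [measurable] = i[unfolded set_integrable_def, THEN borel_measurable_integrable]
 let ?h = "\<lambda>n y. cutoff (inverse (real (Suc n))) 0 (y - a) * cutoff (inverse (real (Suc n))) 0 (b - y)"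
 let ?w = "\<lambda>y. indicator {a..b} y *\<^sub>R v y"
 have hb: "0 \<le> ?h n y" "?h n y \<le> 1" "y \<notin> {a..b} \<Longrightarrow> ?h n y = 0" for n y
 proof -
  have "0 \<le> cutoff s 0 x" "cutoff s 0 x \<le> 1" if "0 \<le> s" for s x using that by (auto simp: cutoff_def)
  then show "0 \<le> ?h n y" "?h n y \<le> 1" by (auto intro!: mult_le_one)
 qed (auto simp: cutoff_def)
 show "(LINT y:{a..b}|lborel. v y) = 0"
 proof (cases "a = b")
  case True
  have "(LINT y:{a..b}|lborel. v y) = (LINT y|(lborel :: real measure). 0)"
   unfolding set_lebesgue_integral_def
  proof (rule integral_cong_AE)
   have "AE y in lborel. y \<noteq> a" by (rule AE_lborel_singleton)
   then show "AE y in lborel. indicator {a..b} y *\<^sub>R v y = 0" by eventually_elim (use True in auto)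
  qed simp_all
  then show ?thesis by simp
 next
  case False
  have bs: "bump_span (?h n)" for n using ab False by (intro bump_span.bump) auto
  have hz: "(LINT y|lborel. of_real (?h n y) * (?w y)) = 0" for n
  proof -
   have "(\<lambda>y. indicator {0<..} y *\<^sub>R ?h n y *\<^sub>R v y) = (\<lambda>y. of_real (?h n y) * (?w y))"
   proof
    fix y
    show "indicator {0<..} y *\<^sub>R ?h n y *\<^sub>R v y = of_real (?h n y) * (?w y)"
     using hb(3)[of y n] ab by (cases "y \<in> {a..b}") (simp_all add: scaleR_conv_of_real)
   qed
   then show ?thesis using z[OF bs[of n]] by (simp only: set_lebesgue_integral_def)
  qed
  have "(\<lambda>n. LINT y|lborel. of_real (?h n y) * (?w y)) \<longlonglongrightarrow> (LINT y|lborel. indicator {a..b} y *\<^sub>R v y)"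
  proof (rule integral_dominated_convergence[OF _ _ i[unfolded set_integrable_def, THEN integrable_norm]])
   show "AE y in lborel. (\<lambda>n. of_real (?h n y) * (?w y)) \<longlonglongrightarrow> indicator {a..b} y *\<^sub>R v y"
    using AE_lborel_singleton[of a] AE_lborel_singleton[of b]
   proof eventually_elim
    case (elim y)
    show ?case
    proof (cases "y \<in> {a..b}")
     case True
     have "(\<lambda>n. exp (- inverse (real (Suc n)) / x)) \<longlonglongrightarrow> exp (- 0 / x)" if "0 < x" for x :: real
      using that by (intro tendsto_intros LIMSEQ_inverse_real_of_nat) auto
     from tendsto_mult[OF this this, of "y - a" "b - y"] have "(\<lambda>n. ?h n y) \<longlonglongrightarrow> 1"
      using True elim by (simp add: cutoff_def)
     then have "(\<lambda>n. of_real (?h n y) * (?w y)) \<longlonglongrightarrow> of_real 1 * (?w y)"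
      by (intro tendsto_intros)
     then show ?thesis by simp
    qed simp
   qed
   show "AE y in lborel. norm (of_real (?h n y) * (?w y)) \<le> norm (?w y)" for n
    unfolding norm_mult norm_of_real abs_of_nonneg[OF hb(1)]
    by (intro AE_I2 mult_left_le_one_le norm_ge_zero hb)
   show "(\<lambda>y. of_real (?h n y) * (?w y)) \<in> borel_measurable lborel" for n
   proof -
    have "?h n \<in> borel_measurable lborel"
     using borel_measurable_continuous_onI[OF bump_span_continuous[OF bs]] by simp
    from borel_measurable_times[OF measurable_compose[OF this borel_measurable_of_real]
      borel_measurable_integrable[OF i[unfolded set_integrable_def]]] show ?thesis .
   qed
  qed simp
  then show ?thesis unfolding hz by (simp add: set_lebesgue_integral_def LIMSEQ_const_iff)
 qed
qed

section \<open>Primitives and weak derivatives\<close>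

lemma primitive_Lp_loc:
 assumes "primitive U v" shows "U \<in> Lp_loc 1" "v \<in> Lp_loc 1"
 unfolding Lp_loc_1_iff
 by (intro allI impI borel_integrable_atLeastAtMost' continuous_on_subset[OF primitive_continuous_on[OF assms]]; auto)
  (intro allI impI primitiveD(1)[OF assms])

lemma Lp_loc_cong_AE:
 assumes "u \<in> Lp_loc p" "hl_measurable v" "eq_AE u v"
 shows "v \<in> Lp_loc p"
 unfolding Lp_loc_def
proof (intro CollectI conjI allI impI assms(2))
 fix K :: "real set" assume K: "compact K \<and> K \<subseteq> {0<..}"
 have i: "integrable lborel (\<lambda>y. indicator K y *\<^sub>R norm (u y) powr p)" using assms(1) K by (auto simp: Lp_loc_def set_integrable_def)
 show "set_integrable lborel K (\<lambda>y. norm (v y) powr p)"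
  unfolding set_integrable_def
 proof (rule integrable_cong_AE_imp[OF i])
  show "AE y in lborel. indicator K y *\<^sub>R norm (u y) powr p = indicator K y *\<^sub>R norm (v y) powr p"
   using assms(3) by eventually_elim (use K in \<open>auto simp: indicator_def\<close>)
  note [measurable] = hl_measurable_norm_powr[OF assms(2), of p, unfolded hl_measurable_iff]
  have [measurable]: "K \<in> sets borel" using K by (simp add: borel_compact)
  have "(\<lambda>y. indicator K y *\<^sub>R norm (v y) powr p) = (\<lambda>y. indicator K y *\<^sub>R ext0 (\<lambda>y. norm (v y) powr p) y)"
   using K by (intro ext) (auto simp: indicator_def ext0_def subset_iff)
  then show "(\<lambda>y. indicator K y *\<^sub>R norm (v y) powr p) \<in> borel_measurable lborel" by simp
 qed
qed

lemma test_fun_deriv: "test_fun \<phi> \<Longrightarrow> test_fun (deriv \<phi>)"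
proof -
 assume t: "test_fun \<phi>"
 then obtain K where K: "compact K" "K \<subseteq> {0<..}" "\<And>x. x \<notin> K \<Longrightarrow> \<phi> x = 0" by (auto simp: test_fun_def)
 have "deriv \<phi> x = 0" if "x \<notin> K" for x
 proof -
  have "\<forall>\<^sub>F y in nhds x. y \<in> - K"
   using compact_imp_closed[OF K(1)] that by (intro eventually_nhds_in_open) auto
  then have "\<forall>\<^sub>F y in nhds x. \<phi> y = 0" by eventually_elim (use K in auto)
  then have "deriv \<phi> x = deriv (\<lambda>_. 0) x" by (intro deriv_cong_ev) auto
  then show ?thesis by simp
 qed
 moreover have "(deriv ^^ k) (deriv \<phi>) differentiable (at x)" for k x
  using t unfolding test_fun_def by (metis comp_apply funpow_Suc_right)
 ultimately show ?thesis unfolding test_fun_def using K by blast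
qed

text \<open>The product rule for primitives on an interval at whose endpoints the test function
  vanishes.\<close>

lemma integration_by_parts:
 assumes P: "primitive U v" and t: "test_fun \<phi>"
 shows "(LINT y:{0<..}|lborel. deriv \<phi> y *\<^sub>R U y) = - (LINT y:{0<..}|lborel. \<phi> y *\<^sub>R v y)"
proof -
 obtain K where K: "compact K" "K \<subseteq> {0<..}" "\<And>x. x \<notin> K \<Longrightarrow> \<phi> x = 0 \<and> deriv \<phi> x = 0"
 proof -
  obtain K L where "compact K" "K \<subseteq> {0<..}" "\<And>x. x \<notin> K \<Longrightarrow> \<phi> x = 0" "compact L" "L \<subseteq> {0<..}" "\<And>x. x \<notin> L \<Longrightarrow> deriv \<phi> x = 0"
   using t test_fun_deriv[OF t] unfolding test_fun_def by blast
  then show ?thesis by (intro that[of "K \<union> L"]) auto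
 qed
 \<comment> \<open>The support may be empty; the point 1 is added so that the extrema exist.\<close>
 have "compact (insert 1 K)" "insert 1 K \<noteq> {}" using K by auto
 then obtain a b where "a \<in> insert 1 K" "b \<in> insert 1 K" and ab: "\<And>x. x \<in> insert 1 K \<Longrightarrow> a \<le> x \<and> x \<le> b"
  using compact_attains_inf[of "insert 1 K"] compact_attains_sup[of "insert 1 K"] by metis
 then have a: "0 < a" "a \<le> b" using K by auto
 \<comment> \<open>The interval is enlarged strictly, because the test function is known to vanish
   only outside [a, b].\<close>
 define a' b' where "a' = a / 2" and "b' = b + 1"
 have a': "0 < a'" "a' \<le> b'" using a by (auto simp: a'_def b'_def)
 have out: "\<phi> x = 0" "deriv \<phi> x = 0" if "x \<notin> {a..b}" for x using K(3) ab that by fastforce+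
 have out': "\<phi> x = 0" "deriv \<phi> x = 0" if "x \<notin> {a'..b'}" for x using out[of x] that a by (auto simp: a'_def b'_def)
 have end0: "\<phi> a' = 0" "\<phi> b' = 0" using out[of a'] out[of b'] a by (auto simp: a'_def b'_def)
 have d: "(\<phi> has_real_derivative deriv \<phi> x) (at x)" "(deriv \<phi> has_real_derivative deriv (deriv \<phi>) x) (at x)" for x
  using t[unfolded test_fun_def, THEN conjunct1, rule_format, of 0 x] t[unfolded test_fun_def, THEN conjunct1, rule_format, of 1 x]
  by (auto simp: DERIV_deriv_iff_real_differentiable)
 have c: "continuous_on S \<phi>" "continuous_on S (deriv \<phi>)" for S using d by (meson DERIV_isCont continuous_at_imp_continuous_on)+
 have "primitive (\<lambda>x. of_real (\<phi> x)) (\<lambda>x. of_real (deriv \<phi> x))"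
 proof (rule primitive_of_derivative)
  show "((\<lambda>x. complex_of_real (\<phi> x)) has_vector_derivative of_real (deriv \<phi> y)) (at y)" for y
   using d(1)[of y] unfolding has_real_derivative_iff_has_vector_derivative
   by (rule bounded_linear.has_vector_derivative[OF bounded_linear_of_real])
 qed (intro continuous_intros c)
 note PI = primitiveD[OF primitive_mult[OF this P] a']
 have Ui: "set_integrable lborel {a'..b'} U" "set_integrable lborel {a'..b'} v"
  using primitive_Lp_loc[OF P] a' by (auto simp: Lp_loc_1_iff)
 have i: "set_integrable lborel {a'..b'} (\<lambda>x. of_real (\<phi> x) * v x)" "set_integrable lborel {a'..b'} (\<lambda>x. of_real (deriv \<phi> x) * U x)"
  by (intro set_integrable_continuous_mult Ui continuous_intros c)+
 have "(LINT x:{a'..b'}|lborel. of_real (\<phi> x) * v x) + (LINT x:{a'..b'}|lborel. of_real (deriv \<phi> x) * U x) = 0"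
  using PI(2) end0 set_integral_add(2)[OF i] by simp
 then show ?thesis
  using test_integral(2)[OF c(1) out'(1) a'(1) Ui(2)] test_integral(2)[OF c(2) out'(2) a'(1) Ui(1)]
  by (simp add: add_eq_0_iff)
qed

lemma set_integral_cong_AE_half_line:
 fixes u v :: "real \<Rightarrow> complex" and \<phi> :: "real \<Rightarrow> real"
 assumes ae: "eq_AE u v" and m: "hl_measurable u" "hl_measurable v" "\<phi> \<in> borel_measurable borel"
 shows "(LINT y:{0<..}|lborel. \<phi> y *\<^sub>R u y) = (LINT y:{0<..}|lborel. \<phi> y *\<^sub>R v y)"
proof -
 note [measurable] = m(3) m(1,2)[unfolded hl_measurable_iff]
 have e: "(\<lambda>y. indicator {0<..} y *\<^sub>R \<phi> y *\<^sub>R u y) = (\<lambda>y. \<phi> y *\<^sub>R ext0 u y)" for u :: "real \<Rightarrow> complex"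
  by (auto simp: indicator_def ext0_def)
 show ?thesis
  unfolding set_lebesgue_integral_def e
 proof (rule integral_cong_AE)
  show "AE y in lborel. \<phi> y *\<^sub>R ext0 u y = \<phi> y *\<^sub>R ext0 v y" using ae by eventually_elim (simp add: ext0_def)
 qed simp_all
qed

lemma test_fun_measurable: "test_fun \<phi> \<Longrightarrow> (deriv ^^ k) \<phi> \<in> borel_measurable borel"
 unfolding test_fun_def
 by (intro borel_measurable_continuous_onI continuous_at_imp_continuous_on ballI differentiable_imp_continuous_within) blast

lemma has_weak_derivI:
 assumes u: "hl_measurable u" "eq_AE u U" and P: "primitive U U1"
 shows "has_weak_deriv 1 u U1" "primitive U1 U2 \<Longrightarrow> has_weak_deriv 2 u U2"
proof -
 have uL: "u \<in> Lp_loc 1" using u(2) by (intro Lp_loc_cong_AE[OF primitive_Lp_loc(1)[OF P] u(1)]) (auto elim: eventually_mono)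
 have e: "(LINT y:{0<..}|lborel. (deriv ^^ k) \<phi> y *\<^sub>R u y) = (LINT y:{0<..}|lborel. (deriv ^^ k) \<phi> y *\<^sub>R U y)" if "test_fun \<phi>" for \<phi> k
  by (intro set_integral_cong_AE_half_line u primitive_measurable[OF P] test_fun_measurable that)
 show "has_weak_deriv 1 u U1"
  unfolding has_weak_deriv_def
 proof (intro conjI allI impI uL primitive_Lp_loc(2)[OF P])
  fix \<phi> assume t: "test_fun \<phi>"
  show "(LINT y:{0<..}|lborel. (deriv ^^ 1) \<phi> y *\<^sub>R u y) = (-1) ^ 1 * (LINT y:{0<..}|lborel. \<phi> y *\<^sub>R U1 y)"
   unfolding e[OF t] using integration_by_parts[OF P t] by simp
 qed
 assume P2: "primitive U1 U2"
 show "has_weak_deriv 2 u U2"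
  unfolding has_weak_deriv_def
 proof (intro conjI allI impI uL primitive_Lp_loc(2)[OF P2])
  fix \<phi> assume t: "test_fun \<phi>"
  have "(deriv ^^ 2) \<phi> = deriv (deriv \<phi>)" by (simp add: numeral_2_eq_2)
  then show "(LINT y:{0<..}|lborel. (deriv ^^ 2) \<phi> y *\<^sub>R u y) = (-1) ^ 2 * (LINT y:{0<..}|lborel. \<phi> y *\<^sub>R U2 y)"
   unfolding e[OF t] using integration_by_parts[OF P test_fun_deriv[OF t]] integration_by_parts[OF P2 t] by simp
 qed
qed

text \<open>\<open>weak_D\<close> is an arbitrary choice among the weak derivatives. Any two of them
  have the same integrals against all bumps, so the choice is identified almost everywhere.\<close>

lemma weak_D_AE:
 assumes "has_weak_deriv k u v"
 shows "has_weak_deriv k u (weak_D k u)" "AE y in lborel. 0 < y \<longrightarrow> weak_D k u y = v y"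
proof -
 show w: "has_weak_deriv k u (weak_D k u)" unfolding weak_D_def by (rule someI[where P = "has_weak_deriv k u", OF assms])
 have L: "v \<in> Lp_loc 1" "weak_D k u \<in> Lp_loc 1" using assms w by (auto simp: has_weak_deriv_def)
 have "AE y in lborel. 0 < y \<longrightarrow> weak_D k u y - v y = 0"
 proof (rule AE_zero_of_bumps)
  show "(\<lambda>y. weak_D k u y - v y) \<in> Lp_loc 1" using L by (auto simp: Lp_loc_1_iff)
  fix h assume h: "bump_span h"
  have "(-1) ^ k * (LINT y:{0<..}|lborel. h y *\<^sub>R weak_D k u y) = (-1) ^ k * (LINT y:{0<..}|lborel. h y *\<^sub>R v y)"
   using assms[unfolded has_weak_deriv_def, THEN conjunct2, THEN conjunct2, rule_format, OF test_fun_bump_span[OF h]]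
    w[unfolded has_weak_deriv_def, THEN conjunct2, THEN conjunct2, rule_format, OF test_fun_bump_span[OF h]] by (simp only:)
  then show "(LINT y:{0<..}|lborel. h y *\<^sub>R (weak_D k u y - v y)) = 0"
   using set_integral_diff(2)[OF bump_span_integrable[OF h L(2)] bump_span_integrable[OF h L(1)]]
   by (simp add: scaleR_diff_right)
 qed
 then show "AE y in lborel. 0 < y \<longrightarrow> weak_D k u y = v y" by simp
qed

text \<open>The lemma of du Bois-Reymond: u minus a primitive of v annihilates derivatives of test
  functions, in particular every bump with integral 0. Every bump differs from such a one by a
  multiple of a fixed bump, whence the difference is constant.\<close>

lemma primitive_of_weak_deriv:
 assumes "has_weak_deriv 1 u v"
 obtains U where "primitive U v" "eq_AE u U"
proof -
 have L: "u \<in> Lp_loc 1" "v \<in> Lp_loc 1"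
  and w: "\<And>\<phi>. test_fun \<phi> \<Longrightarrow> (LINT y:{0<..}|lborel. deriv \<phi> y *\<^sub>R u y) = - (LINT y:{0<..}|lborel. \<phi> y *\<^sub>R v y)"
  using assms by (auto simp: has_weak_deriv_def)
 obtain V where V: "primitive V v" by (rule primitive_exists[of v]) (use L(2) in \<open>auto simp: Lp_loc_1_iff\<close>)
 define d where "d y = u y - V y" for y
 have dL: "d \<in> Lp_loc 1" using L(1) primitive_Lp_loc(1)[OF V] by (auto simp: Lp_loc_1_iff d_def[abs_def])
 define I where "I h = (LINT y:{0<..}|lborel. h y *\<^sub>R d y)" for h :: "real \<Rightarrow> real"
 note bi = bump_span_integrable[OF _ dL]
 have zero: "I h = 0" if h: "bump_span h" "(LINT x|lborel. h x) = 0" for h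
 proof -
  obtain \<phi> where \<phi>: "test_fun \<phi>" "deriv \<phi> = h" using bump_span_antiderivative[OF h] .
  have "I h = (LINT y:{0<..}|lborel. h y *\<^sub>R u y) - (LINT y:{0<..}|lborel. h y *\<^sub>R V y)"
   unfolding I_def d_def scaleR_diff_right
   by (intro set_integral_diff bump_span_integrable h L primitive_Lp_loc(1)[OF V])
  then show ?thesis using w[OF \<phi>(1)] integration_by_parts[OF V \<phi>(1)] \<phi>(2) by simp
 qed
 \<comment> \<open>A fixed bump over (1, 2), positive there and therefore with nonzero integral, by
   which other bumps are normalised to integral 0.\<close>
 define \<rho> where "\<rho> x = cutoff 1 0 (x - 1) * cutoff 1 0 (2 - x)" for x
 have \<rho>: "bump_span \<rho>" unfolding \<rho>_def by (intro bump_span.bump) auto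
 have hi: "integrable lborel h" if h: "bump_span h" for h
 proof -
  obtain a b where ab: "\<And>x. x \<notin> {a..b} \<Longrightarrow> h x = 0" using bump_span_support[OF h] by blast
  have "integrable lborel (\<lambda>x. indicator {a..b} x *\<^sub>R h x)"
   using borel_integrable_atLeastAtMost'[OF bump_span_continuous[OF h]] by (simp add: set_integrable_def)
  also have "(\<lambda>x. indicator {a..b} x *\<^sub>R h x) = h"
  proof
   show "indicator {a..b} x *\<^sub>R h x = h x" for x using ab[of x] by (cases "x \<in> {a..b}") auto
  qed
  finally show ?thesis .
 qed
 define R where "R = (LINT x|lborel. \<rho> x)"
 have R: "R \<noteq> 0"
 proof
  assume "R = 0"
  moreover have \<rho>0: "0 \<le> \<rho> x" for x by (simp add: \<rho>_def cutoff_def)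
  ultimately have "AE x in lborel. \<rho> x = 0" using integral_nonneg_eq_0_iff_AE[OF hi[OF \<rho>]] by (simp add: R_def)
  then have "AE x in lborel. x \<notin> {1<..<2::real}" 
  proof eventually_elim
   case (elim x)
   have "0 < \<rho> x" if "1 < x" "x < 2" using that by (simp add: \<rho>_def cutoff_def)
   then show ?case using elim by auto
  qed
  then have "{1<..<2::real} \<in> null_sets lborel" by (subst AE_iff_null_sets) auto
  then show False by (auto dest: null_setsD1)
 qed
 define k where "k = I \<rho> / of_real R"
 have "AE y in lborel. 0 < y \<longrightarrow> d y - k = 0"
 proof (rule AE_zero_of_bumps)
  have kL: "(\<lambda>_. k) \<in> Lp_loc 1" 
   unfolding Lp_loc_1_iff by (intro allI impI borel_integrable_atLeastAtMost' continuous_on_const)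
  show "(\<lambda>y. d y - k) \<in> Lp_loc 1" using dL kL by (simp add: Lp_loc_1_iff set_integral_diff)
  fix h assume h: "bump_span h"
  define c where "c = (LINT x|lborel. h x) / R"
  have s: "bump_span (\<lambda>x. h x + (- c) * \<rho> x)" by (intro bump_span.add bump_span.scale h \<rho>)
  have "(LINT x|lborel. h x + (- c) * \<rho> x) = 0"
   using Bochner_Integration.integral_add[OF hi[OF h] integrable_mult_right[OF hi[OF \<rho>], of "- c"]] R
   by (simp add: c_def R_def)
  from zero[OF s this] have "0 = I h + (LINT y:{0<..}|lborel. of_real (- c) * (\<rho> y *\<^sub>R d y))"
   unfolding I_def using set_integral_add(2)[OF bi[OF h] set_integrable_mult_right[of "of_real (- c)", OF bi[OF \<rho>]]]
   by (simp add: scaleR_conv_of_real algebra_simps)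
  also have "(LINT y:{0<..}|lborel. of_real (- c) * (\<rho> y *\<^sub>R d y)) = of_real (- c) * I \<rho>"
   unfolding I_def by (rule set_integral_mult_right)
  finally have "I h = of_real (LINT x|lborel. h x) * k" using R by (simp add: c_def k_def)
  also have "of_real (LINT x|lborel. h x) * k = (LINT y:{0<..}|lborel. h y *\<^sub>R k)"
  proof -
   obtain a b where ab: "0 < a" "\<And>x. x \<notin> {a..b} \<Longrightarrow> h x = 0" using bump_span_support[OF h] by blast
   have "(\<lambda>y. indicator {0<..} y *\<^sub>R h y *\<^sub>R k) = (\<lambda>y. of_real (h y) * k)"
   proof
    show "indicator {0<..} y *\<^sub>R h y *\<^sub>R k = of_real (h y) * k" for y
     using ab(1) ab(2)[of y] by (cases "0 < y") (auto simp: scaleR_conv_of_real)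
   qed
   then show ?thesis by (simp add: set_lebesgue_integral_def)
  qed
  finally show "(LINT y:{0<..}|lborel. h y *\<^sub>R (d y - k)) = 0"
   unfolding I_def scaleR_diff_right using set_integral_diff(2)[OF bi[OF h] bump_span_integrable[OF h kL]] by simp
 qed
 then have "AE y in lborel. 0 < y \<longrightarrow> u y = V y + k" by eventually_elim (simp add: d_def algebra_simps)
 then show ?thesis using that[OF primitive_add_const[OF V]] by blast
qed

text \<open>Derivatives of test functions are test functions, so the first weak derivative can be
  tested with them. This allows the second derivative, which is defined directly from u, to be
  integrated one order at a time.\<close>

lemma has_weak_deriv_second:
 assumes "has_weak_deriv 1 u v" "has_weak_deriv 2 u w" shows "has_weak_deriv 1 v w"
proof -
 have "(LINT y:{0<..}|lborel. deriv \<phi> y *\<^sub>R v y) = - (LINT y:{0<..}|lborel. \<phi> y *\<^sub>R w y)" if t: "test_fun \<phi>" for \<phi>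
 proof -
  have "(LINT y:{0<..}|lborel. deriv (deriv \<phi>) y *\<^sub>R u y) = - (LINT y:{0<..}|lborel. deriv \<phi> y *\<^sub>R v y)"
   using assms(1) test_fun_deriv[OF t] unfolding has_weak_deriv_def by simp
  moreover have "(LINT y:{0<..}|lborel. deriv (deriv \<phi>) y *\<^sub>R u y) = (LINT y:{0<..}|lborel. \<phi> y *\<^sub>R w y)"
   using assms(2) t unfolding has_weak_deriv_def by (simp add: numeral_2_eq_2)
  ultimately show ?thesis by simp
 qed
 then show ?thesis using assms unfolding has_weak_deriv_def by simp
qed

section \<open>The two domains\<close>

text \<open>A positive continuous weight is bounded below on compact subsets of the
  half-line.\<close>

lemma Lp_loc_of_weighted:
 assumes w: "continuous_on {0<..} w" "\<And>y. 0 < y \<Longrightarrow> 0 < w y" and p: "0 < p"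
  and g: "hl_measurable g" and wg: "(\<lambda>y. of_real (w y) * g y) \<in> Lpm m p"
 shows "g \<in> Lp_loc p"
 unfolding Lp_loc_def
proof (intro CollectI conjI allI impI g)
 let ?h = "(\<lambda>y. y powr m * norm (of_real (w y) * g y) powr p)"
 fix K :: "real set" assume K: "compact K \<and> K \<subseteq> {0<..}"
 have K0: "0 < y" if "y \<in> K" for y using K that by auto
 define h where "h y = y powr m * w y powr p" for y
 have h: "0 < h y" if "0 < y" for y using that w(2)[OF that] by (simp add: h_def)
 obtain e where e: "0 < e" "\<And>y. y \<in> K \<Longrightarrow> e \<le> h y"
 proof (cases "K = {}")
  case False
  have "w y \<noteq> 0" if "y \<in> K" for y using w(2)[OF K0[OF that]] by simp
  then have "continuous_on K h" unfolding h_def using K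
   by (intro continuous_intros continuous_on_subset[OF w(1)]) auto
  then obtain z where "z \<in> K" "\<And>y. y \<in> K \<Longrightarrow> h z \<le> h y"
   using continuous_attains_inf[of K h] K False by blast
  then show ?thesis using that[of "h z"] h[OF K0] by blast
 qed (use that[of 1] in auto)
 have [measurable]: "ext0 (\<lambda>y. norm (g y) powr p) \<in> borel_measurable borel"
  using hl_measurable_norm_powr[OF g] by (simp add: hl_measurable_iff)
 have [measurable]: "K \<in> sets borel" using K by (simp add: borel_compact)
 have eq: "(\<lambda>y. indicator K y *\<^sub>R norm (g y) powr p) = (\<lambda>y. indicator K y * ext0 (\<lambda>y. norm (g y) powr p) y)"
  using K0 by (intro ext) (auto simp: indicator_def ext0_def)
 have mK: "(\<lambda>y. indicator K y *\<^sub>R norm (g y) powr p) \<in> borel_measurable lborel" unfolding eq by simp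
 have "(nnint_R (\<lambda>y. norm (indicator K y *\<^sub>R norm (g y) powr p))) \<le>
   (\<integral>\<^sup>+y. ennreal (1 / e) * ennreal (ext0 ?h y) \<partial>lborel)"
 proof (rule nn_integral_mono)
  fix y
  have "norm (g y) powr p \<le> 1 / e * (y powr m * norm (of_real (w y) * g y) powr p)" if y: "y \<in> K"
  proof -
   have "e * norm (g y) powr p \<le> h y * norm (g y) powr p" by (intro mult_right_mono e y) simp
   also have "\<dots> = y powr m * norm (of_real (w y) * g y) powr p"
    using w(2)[OF K0[OF y]] by (simp add: h_def norm_mult powr_mult)
   finally show ?thesis using e(1) by (simp add: field_simps)
  qed
  then show "ennreal (norm (indicator K y *\<^sub>R norm (g y) powr p)) \<le>
    ennreal (1 / e) * ennreal (ext0 ?h y)"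
   using K0 e(1) by (cases "y \<in> K") (auto simp: ennreal_mult'[symmetric] ext0_def intro!: ennreal_leI)
 qed
 also have "\<dots> = ennreal (1 / e) * power_norm m p (\<lambda>y. of_real (w y) * g y)"
 proof -
  have "hl_measurable ?h"
  proof -
   note [measurable] = hl_measurable_norm_powr[OF wg[unfolded Lpm_iff, THEN conjunct1], unfolded hl_measurable_iff]
   have "ext0 ?h = (\<lambda>y. y powr m * ext0 (\<lambda>y. norm (of_real (w y) * g y) powr p) y)"
    by (auto simp: ext0_def)
   then show ?thesis by (simp add: hl_measurable_iff)
  qed
  moreover have "power_norm m p (\<lambda>y. of_real (w y) * g y) = (nnint_R (\<lambda>y. ext0 ?h y))"
   unfolding power_norm_def by (rule nn_integral_cong) (auto simp: ext0_def indicator_def)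
  ultimately show ?thesis by (simp add: hl_measurable_iff nn_integral_cmult)
 qed
 also have "\<dots> < \<infinity>" using wg by (simp add: Lpm_iff ennreal_mult_less_top)
 finally show "set_integrable lborel K (\<lambda>y. norm (g y) powr p)"
  unfolding set_integrable_def by (intro integrableI_bounded mK)
qed

lemma Lp_loc_measurable: "u \<in> Lp_loc p \<Longrightarrow> hl_measurable u"
 by (simp add: Lp_loc_def)

lemma has_weak_deriv_measurable: "has_weak_deriv k u v \<Longrightarrow> hl_measurable v"
 unfolding has_weak_deriv_def by (blast intro: Lp_loc_measurable)

context bessel_Lp
begin

lemma solution_weak_derivs:
 assumes sol: "bessel_solution (1 - 2 * \<nu>) U U1 f" and u: "hl_measurable u" "eq_AE u U"
 defines "U2 \<equiv> \<lambda>y. f y - of_real ((1 - 2 * \<nu>) / y) * U1 y"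
 shows "has_weak_deriv 1 u U1" "has_weak_deriv 2 u U2"
  and "AE y in lborel. 0 < y \<longrightarrow> weak_D 1 u y = U1 y" "AE y in lborel. 0 < y \<longrightarrow> weak_D 2 u y = U2 y"
  and "hl_measurable (weak_D 1 u)" "hl_measurable (weak_D 2 u)"
proof -
 have P: "primitive U U1" "primitive U1 U2" using sol by (auto simp: bessel_solution_iff U2_def)
 show w: "has_weak_deriv 1 u U1" "has_weak_deriv 2 u U2" by (rule has_weak_derivI(1)[OF u P(1)], rule has_weak_derivI(2)[OF u P])
 show "AE y in lborel. 0 < y \<longrightarrow> weak_D 1 u y = U1 y" "AE y in lborel. 0 < y \<longrightarrow> weak_D 2 u y = U2 y"
  "hl_measurable (weak_D 1 u)" "hl_measurable (weak_D 2 u)"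
  using weak_D_AE[OF w(1)] weak_D_AE[OF w(2)] by (auto intro: has_weak_deriv_measurable)
qed

lemma opB_measurable:
 assumes "hl_measurable (weak_D 1 u)" "hl_measurable (weak_D 2 u)"
 shows "hl_measurable (opB c u)"
 unfolding opB_def by (intro hl_measurable_add assms hl_measurable_mult_left) measurable

text \<open>Weak derivatives are replaced by primitives in two steps, which turns the operator into
  the Bessel equation. In the converse direction the local regularity of the derivatives comes from
  the weighted estimates at \<theta> = 0.\<close>

lemma dom_B_max_iff:
 "u \<in> dom_B_max (1 - 2 * \<nu>) m p \<longleftrightarrow> u \<in> L \<and> (\<exists>U U1 f. bessel_solution (1 - 2 * \<nu>) U U1 f \<and> f \<in> L \<and>
   (eq_AE u U))"
proof (intro iffI conjI)
 let ?c = "1 - 2 * \<nu>"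
 assume u: "u \<in> dom_B_max ?c m p"
 then show "u \<in> L" by (simp add: dom_B_max_def)
 define g1 g2 where "g1 = weak_D 1 u" and "g2 = weak_D 2 u"
 obtain v1 v2 where "has_weak_deriv 1 u v1" "has_weak_deriv 2 u v2"
  using u unfolding dom_B_max_def W2p_loc_def by blast
 then have g: "has_weak_deriv 1 u g1" "has_weak_deriv 2 u g2" unfolding g1_def g2_def by (auto intro: weak_D_AE)
 obtain U where U: "primitive U g1" "eq_AE u U" using primitive_of_weak_deriv[OF g(1)] .
 obtain V where V: "primitive V g2" "eq_AE g1 V"
  using primitive_of_weak_deriv[OF has_weak_deriv_second[OF g]] .
 have m: "hl_measurable (opB ?c u)"
  using has_weak_deriv_measurable[OF g(1)] has_weak_deriv_measurable[OF g(2)] unfolding g1_def g2_def by (rule opB_measurable)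
 have Vm: "hl_measurable V" by (rule primitive_measurable[OF V(1)])
 have "primitive U V" by (rule primitive_cong_AE[OF U(1) Vm V(2)])
 moreover have "primitive V (\<lambda>y. opB ?c u y - of_real (?c / y) * V y)"
 proof (rule primitive_cong_AE[OF V(1)])
  show "hl_measurable (\<lambda>y. opB ?c u y - of_real (?c / y) * V y)"
   by (intro hl_measurable_add m hl_measurable_mult_left Vm) measurable
  show "AE y in lborel. 0 < y \<longrightarrow> g2 y = opB ?c u y - of_real (?c / y) * V y"
   using V(2) by eventually_elim (simp add: opB_def g1_def g2_def)
 qed
 ultimately have "bessel_solution ?c U V (opB ?c u)" by (simp add: bessel_solution_iff)
 moreover have "opB ?c u \<in> L" using u by (simp add: dom_B_max_def)
 ultimately show "\<exists>U U1 f. bessel_solution ?c U U1 f \<and> f \<in> L \<and> (eq_AE u U)"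
  using U(2) by blast
next
 let ?c = "1 - 2 * \<nu>"
 assume "u \<in> L \<and> (\<exists>U U1 f. bessel_solution ?c U U1 f \<and> f \<in> L \<and> (eq_AE u U))"
 then obtain U U1 f where u: "u \<in> L" and sol: "bessel_solution ?c U U1 f" and f: "f \<in> L"
  and ae: "eq_AE u U" by blast
 have um: "hl_measurable u" using u by (simp add: Lpm_iff)
 have UL: "U \<in> L" by (rule Lpm_cong_AE[OF u bessel_solution_measurable(1)[OF sol] ae])
 note wd = solution_weak_derivs[OF sol um ae]
 note sw = solution_weighted(1,2)[OF sol f UL admissible_0]
 have mn: "continuous_on {0<..} (\<lambda>y. min 1 y powr a)" for a :: real by (intro continuous_intros) auto
 have uloc: "u \<in> Lp_loc p" by (rule Lp_loc_of_weighted[of "\<lambda>_. 1", OF _ _ m_bounds(3) um]) (use u in auto)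
 have l1: "U1 \<in> Lp_loc p"
  by (rule Lp_loc_of_weighted[OF mn _ m_bounds(3) has_weak_deriv_measurable[OF wd(1)] sw(1)]) auto
 have l2: "(\<lambda>y. f y - of_real (?c / y) * U1 y) \<in> Lp_loc p"
  by (rule Lp_loc_of_weighted[OF mn _ m_bounds(3) has_weak_deriv_measurable[OF wd(2)] sw(2)]) auto
 have "u \<in> W2p_loc p" unfolding W2p_loc_def using uloc l1 l2 wd(1,2) by blast
 moreover have "opB ?c u \<in> L"
 proof (rule Lpm_cong_AE[OF f opB_measurable[OF wd(5,6)]])
  show "AE y in lborel. 0 < y \<longrightarrow> f y = opB ?c u y"
   using wd(3,4) by eventually_elim (simp add: opB_def)
 qed
 ultimately show "u \<in> dom_B_max ?c m p" using u by (simp add: dom_B_max_def)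
qed

lemma Lpm_cong:
 assumes "\<And>y. 0 < y \<Longrightarrow> f y = g y" shows "f \<in> L \<longleftrightarrow> g \<in> L"
 using hl_measurable_cong[of f g] power_norm_cong[of f g m p] assms by (simp add: Lpm_iff)

text \<open>Compared with \<open>dom_B_max_iff\<close> only the limit at 0 is added, so that the
  theorem reduces to expressing this limit by weights. The inclusion of solutions is
  \<open>generator_tendsto\<close>, the reverse one \<open>generator_solution\<close>.\<close>

lemma dom_Bd_iff:
 "u \<in> dom_Bd (1 - 2 * \<nu>) m p \<longleftrightarrow> u \<in> L \<and> (\<exists>U U1 f. bessel_solution (1 - 2 * \<nu>) U U1 f \<and> f \<in> L \<and>
   (eq_AE u U) \<and> (U \<longlongrightarrow> 0) (at_right 0))"
proof -
 let ?c = "1 - 2 * \<nu>"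
 let ?S = "\<lambda>v t y. (semigroup_Bd ?c (of_real t) u y - u y) / of_real t - v y"
 let ?Q = "\<lambda>v t y. (T t u y - u y) / of_real t - v y"
 have pos: "\<forall>\<^sub>F t in at_right (0::real). 0 < t" by (simp add: eventually_at_right_less)
 have SQ: "?S v t y = ?Q v t y" if "0 < t" "0 < y" for v t y using that m_bounds(5) by (simp add: semigroup_Bd_of_real)
 have dom: "u \<in> dom_Bd ?c m p \<longleftrightarrow> u \<in> L \<and> (\<exists>v\<in>L. ((\<lambda>t. N (?Q v t)) \<longlongrightarrow> 0) (at_right 0))"
 proof (cases "u \<in> L")
  case u: True
  have "semigroup_Bd ?c (of_real t) u \<in> L" if "0 < t" for t
   using T_in_L[OF u that] Lpm_cong[of "semigroup_Bd ?c (of_real t) u" "T t u"] that m_bounds(5) by (simp add: semigroup_Bd_of_real)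
  then have 1: "\<forall>\<^sub>F t in at_right (0::real). semigroup_Bd ?c (of_real t) u \<in> L" using pos by (rule eventually_mono[rotated])
  have 2: "((\<lambda>t. Lpm_norm m p (?S v t)) \<longlongrightarrow> 0) (at_right 0) \<longleftrightarrow> ((\<lambda>t. N (?Q v t)) \<longlongrightarrow> 0) (at_right 0)" if v: "v \<in> L" for v
  proof -
   have "?S v t \<in> L" if "semigroup_Bd ?c (of_real t) u \<in> L" for t
    using Lpm_diff[OF Lpm_cmult[OF Lpm_diff[OF that u m_bounds(4)], of "inverse (of_real t)"] v m_bounds(4)]
    by (simp add: field_simps)
   then have "\<forall>\<^sub>F t in at_right 0. ?S v t \<in> L" using 1 by (rule eventually_mono[rotated])
   then have "((\<lambda>t. Lpm_norm m p (?S v t)) \<longlongrightarrow> 0) (at_right 0) \<longleftrightarrow> ((\<lambda>t. N (?S v t)) \<longlongrightarrow> 0) (at_right 0)"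
    by (rule Lpm_norm_tendsto_iff[OF m_bounds(3)])
   also have "\<dots> \<longleftrightarrow> ((\<lambda>t. N (?Q v t)) \<longlongrightarrow> 0) (at_right 0)"
    using pos by (intro tendsto_cong) (auto elim!: eventually_mono intro!: power_norm_cong SQ)
   finally show ?thesis .
  qed
  show ?thesis unfolding dom_Bd_def generator_dom_def using u 1 2 by auto
 qed (auto simp: dom_Bd_def generator_dom_def)
 show ?thesis
  unfolding dom
 proof (intro conj_cong refl iffI)
  assume u: "u \<in> L"
  { assume "\<exists>v\<in>L. ((\<lambda>t. N (?Q v t)) \<longlongrightarrow> 0) (at_right 0)"
   then obtain v where v: "v \<in> L" "((\<lambda>t. N (?Q v t)) \<longlongrightarrow> 0) (at_right 0)" by blast
   show "\<exists>U U1 f. bessel_solution ?c U U1 f \<and> f \<in> L \<and> (eq_AE u U) \<and> (U \<longlongrightarrow> 0) (at_right 0)"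
    using generator_solution[OF u v] v(1) by metis }
  assume "\<exists>U U1 f. bessel_solution ?c U U1 f \<and> f \<in> L \<and> (eq_AE u U) \<and> (U \<longlongrightarrow> 0) (at_right 0)"
  then obtain U U1 f where sol: "bessel_solution ?c U U1 f" and f: "f \<in> L"
   and ae: "eq_AE u U" and U0: "(U \<longlongrightarrow> 0) (at_right 0)" by blast
  have UL: "U \<in> L" by (rule Lpm_cong_AE[OF u bessel_solution_measurable(1)[OF sol] ae])
  have "T t u y = T t U y" for t y by (rule T_cong_AE) (use u UL ae in \<open>auto simp: Lpm_iff\<close>)
  then have "N (?Q f t) = N (\<lambda>y. (T t U y - U y) / of_real t - f y)" for t
   using ae by (intro power_norm_cong_AE) (auto elim: eventually_mono)
  then show "\<exists>v\<in>L. ((\<lambda>t. N (?Q v t)) \<longlongrightarrow> 0) (at_right 0)"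
   using generator_tendsto[OF sol f UL U0] by (intro bexI[OF _ f]) simp
 qed
qed

end

theorem proposition3p5:
 fixes p c m :: real
 assumes "1 < p" and "c < 1" and "c - 1 < (m + 1) / p" and "(m + 1) / p < 2"
 shows "dom_Bd c m p =
   {u \<in> dom_B_max c m p. \<forall>\<theta>::real. 0 \<le> \<theta> \<and> \<theta> \<le> 1 \<and> c - 1 + 2 * \<theta> < (m + 1) / p \<and> (m + 1) / p < 2 \<longrightarrow>
     (\<lambda>y. of_real (y powr (- 2 * \<theta>)) * u y) \<in> Lpm m p} \<and>
  (\<forall>u \<in> dom_Bd c m p. \<forall>\<theta>::real. 0 \<le> \<theta> \<and> \<theta> \<le> 1 \<and> c - 1 + 2 * \<theta> < (m + 1) / p \<and> (m + 1) / p < 2 \<longrightarrow>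
     (\<lambda>y. of_real ((min 1 y) powr (2 - 2 * \<theta>)) * weak_D 2 u y) \<in> Lpm m p \<and>
     (\<lambda>y. of_real ((min 1 y) powr (1 - 2 * \<theta>)) * weak_D 1 u y) \<in> Lpm m p) \<and>
  (\<forall>u \<in> dom_Bd c m p. set_integrable lborel {0<..<1} (weak_D 1 u) \<and> limit_at_0 u 0)"
proof -
 define \<nu> where "\<nu> = (1 - c) / 2"
 have c: "c = 1 - 2 * \<nu>" by (simp add: \<nu>_def field_simps)
 interpret bessel_Lp p \<nu> m
  by unfold_locales (use assms in \<open>auto simp: c\<close>)
 have adm: "admissible \<theta> \<longleftrightarrow> 0 \<le> \<theta> \<and> \<theta> \<le> 1 \<and> c - 1 + 2 * \<theta> < (m + 1) / p \<and> (m + 1) / p < 2" for \<theta>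
  using assms(4) by (auto simp: admissible_def c)
 have wm: "hl_measurable (\<lambda>y. of_real (w y) * u y)" if "hl_measurable u" "w \<in> borel_measurable borel"
  for u :: "real \<Rightarrow> complex" and w :: "real \<Rightarrow> real"
  using that by (intro hl_measurable_mult_left) auto
 have dom: "u \<in> dom_B_max c m p \<and> (\<forall>\<theta>. admissible \<theta> \<longrightarrow> (\<lambda>y. of_real (y powr (- 2 * \<theta>)) * u y) \<in> L \<and>
   (\<lambda>y. of_real ((min 1 y) powr (2 - 2 * \<theta>)) * weak_D 2 u y) \<in> L \<and>
   (\<lambda>y. of_real ((min 1 y) powr (1 - 2 * \<theta>)) * weak_D 1 u y) \<in> L) \<and>
   set_integrable lborel {0<..<1} (weak_D 1 u) \<and> limit_at_0 u 0" if dom_u: "u \<in> dom_Bd c m p" for u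
 proof -
  obtain U U1 f where u: "u \<in> L" and sol: "bessel_solution (1 - 2 * \<nu>) U U1 f" and f: "f \<in> L"
   and ae: "eq_AE u U" and U0: "(U \<longlongrightarrow> 0) (at_right 0)"
   using dom_u unfolding c dom_Bd_iff by blast
  have um: "hl_measurable u" using u by (simp add: Lpm_iff)
  have UL: "U \<in> L" by (rule Lpm_cong_AE[OF u bessel_solution_measurable(1)[OF sol] ae])
  note wd = solution_weak_derivs[OF sol um ae]
  have "u \<in> dom_B_max c m p" using u sol f ae unfolding c dom_B_max_iff by blast
  moreover have "(\<lambda>y. of_real (y powr (- 2 * \<theta>)) * u y) \<in> L \<and>
   (\<lambda>y. of_real ((min 1 y) powr (2 - 2 * \<theta>)) * weak_D 2 u y) \<in> L \<and>
   (\<lambda>y. of_real ((min 1 y) powr (1 - 2 * \<theta>)) * weak_D 1 u y) \<in> L" if \<theta>: "admissible \<theta>" for \<theta>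
  proof -
   note s = solution_weighted[OF sol f UL \<theta>]
   have "(\<lambda>y. of_real (y powr (- 2 * \<theta>)) * u y) \<in> L"
    by (rule Lpm_cong_AE[OF s(3)[OF U0] wm[OF um]]) (use ae in \<open>auto elim: eventually_mono\<close>)
   moreover have "(\<lambda>y. of_real ((min 1 y) powr (2 - 2 * \<theta>)) * weak_D 2 u y) \<in> L"
    by (rule Lpm_cong_AE[OF s(2) wm[OF wd(6)]]) (use wd(4) in \<open>auto elim: eventually_mono\<close>)
   moreover have "(\<lambda>y. of_real ((min 1 y) powr (1 - 2 * \<theta>)) * weak_D 1 u y) \<in> L"
    by (rule Lpm_cong_AE[OF s(1) wm[OF wd(5)]]) (use wd(3) in \<open>auto elim: eventually_mono\<close>)
   ultimately show ?thesis by blast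
  qed
  moreover have "set_integrable lborel {0<..<1} (weak_D 1 u)"
   unfolding set_integrable_def
  proof (rule integrable_cong_AE_imp[OF U1_integrable_near_zero[OF sol f]])
   have "(\<lambda>y. indicator {0<..<1} y *\<^sub>R weak_D 1 u y) = (\<lambda>y. indicator {0<..<1} y *\<^sub>R ext0 (weak_D 1 u) y)"
    by (auto simp: indicator_def ext0_def)
   then show "(\<lambda>y. indicator {0<..<1} y *\<^sub>R weak_D 1 u y) \<in> borel_measurable lborel"
    using wd(5) by (simp add: hl_measurable_iff)
   show "AE y in lborel. indicator {0<..<1} y *\<^sub>R U1 y = indicator {0<..<1} y *\<^sub>R weak_D 1 u y"
    using wd(3) by eventually_elim (simp add: indicator_def)
  qed
  moreover have "limit_at_0 u 0"
   unfolding limit_at_0_def using bessel_solution_continuous(1)[OF sol] ae U0 by blast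
  ultimately show ?thesis by blast
 qed
 have "u \<in> dom_Bd c m p" if u: "u \<in> dom_B_max c m p" and w: "\<And>\<theta>. admissible \<theta> \<Longrightarrow> (\<lambda>y. of_real (y powr (- 2 * \<theta>)) * u y) \<in> L" for u
 proof -
  obtain U U1 f where uL: "u \<in> L" and sol: "bessel_solution (1 - 2 * \<nu>) U U1 f" and f: "f \<in> L"
   and ae: "eq_AE u U"
   using u unfolding c dom_B_max_iff by blast
  have Um: "hl_measurable U" by (rule bessel_solution_measurable[OF sol])
  have UL: "U \<in> L" by (rule Lpm_cong_AE[OF uL Um ae])
  obtain l where l: "(U \<longlongrightarrow> l) (at_right 0)" using solution_limit[OF sol f] by blast
  \<comment> \<open>For this inclusion the weighted condition is used at a single critical exponent,
    which already forces the limit to be 0.\<close>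
  obtain \<theta> where \<theta>: "critical \<theta>" using critical_exists[OF admissible_0] by blast
  have "(\<lambda>y. of_real (y powr (- 2 * \<theta>)) * U y) \<in> L"
   by (rule Lpm_cong_AE[OF w wm[OF Um]]) (use \<theta> ae in \<open>auto simp: critical_def elim: eventually_mono\<close>)
  then have "l = 0" by (rule limit_zero_of_weighted[OF sol f UL \<theta> _ l])
  then show ?thesis using uL sol f ae l unfolding c dom_Bd_iff by blast
 qed
 then show ?thesis using dom unfolding adm[symmetric] by blast
qed
end
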